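(* $Sym^*$ is a left $\mathcal{D}^*$-module Hopf algebra, and $Sym_*$ is a right $\mathcal{D}^*$-module Hopf algebra. Moreover, $Sym_*$ is a left $\mathcal{D}_*$-comodule Hopf algebra.
   Context: All algebras are graded over $\mathbb{Z}$ and products commute without signs. The algebra $\mathcal{D}^*$. Let $x_1,x_2,\ldots$ be variables, $\partial_i=\partial/\partial x_i$, and for $k\ge 1$ let $D_k:=\sum_{i\ge 1}x_i^{k+1}\partial_i$; $D_0$ is the identity operator. For (possibly infinite) sums of operators written in standard form (polynomial part on the left, derivatives on the right), the product $\vee$ is the bilinear product with $(x_\lambda\partial_\mu)\vee(x_\nu\partial_\pi):=x_\lambda x_\nu\partial_\mu\partial_\pi$ (where $x_\lambda=x_{\lambda_1}x_{\lambda_2}\cdots$, $\partial_\mu=\partial_{\mu_1}\partial_{\mu_2}\cdots$). For a partition $\lambda=(1^{m_1}2^{m_2}\ldots k^{m_k})$ put $D_\lambda:=\frac{D_1^{\vee m_1}}{m_1!}\vee\cdots\vee\frac{D_k^{\vee m_k}}{m_k!}$, with $D_\emptyset=D_0$. $\mathcal{D}^*$ is the $\mathbb{Z}$-span of all $D_\lambda$. It is known that $\mathcal{D}^*$ is closed under composition, and with composition as multiplication it is a graded cocommutative Hopf algebra with comultiplication $\varDelta(D_\lambda)=\sum_{\mu\cup\nu=\lambda}D_\mu\otimes D_\nu$ (where $\mu\cup\nu$ is the partition obtained by concatenating and reordering the parts) and counit $\varepsilon(D_\lambda)=1$ if $\lambda=\emptyset$ and $0$ otherwise. The Hopf algebra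 $\mathcal{D}_*$ is the graded dual of $\mathcal{D}^*$: as an algebra it is $\mathbb{Z}[b_1,b_2,\ldots]$ with $b_i$ of degree $i$, where the monomial basis $b_\lambda=b_{\lambda_1}b_{\lambda_2}\cdots$ is dual to the basis $D_\lambda$, and its comultiplication (dual to composition) is $\varDelta(b_k)=\sum_{i=0}^k (b)^{i+1}_{k-i}\otimes b_i$, where $b_0:=1$, $b:=b_0+b_1+b_2+\cdots$ and $(b)^{i+1}_{k-i}$ is the part of degree $k-i$ of $b^{i+1}$. Symmetric functions. $Sym_*$ is the Hopf algebra of symmetric functions with integer coefficients, with comultiplication $\delta(h_n)=\sum_{k=0}^n h_k\otimes h_{n-k}$ on complete homogeneous symmetric functions (equivalently, power sums are primitive). $Sym^*$ is its graded dual; it is isomorphic as a Hopf algebra to $Sym_*$ via the standard pairing $\langle m_\lambda\,|\,h_\mu\rangle=\delta_{\lambda\mu}$ ($m_\lambda$ the monomial symmetric functions), so $Sym^*$ is regarded as the ring of symmetric functions in $x_1,x_2,\ldots$. Actions. $\mathcal{D}^*$ acts on $Sym^*$ on the left by applying differential operators to symmetric functions in $x_1,x_2,\ldots$. $\mathcal{D}^*$ acts on $Sym_*$ on the right by the adjoint operators $D^\perp$, $\langle f\,|\,D^\perp g\rangle=\langle D f\,|\,g\rangle$. The left coaction $\widetilde{\varDelta}\colon Sym_*\to\mathcal{D}_*\otimes Sym_*$ is defined by $\langle D\otimes f\,|\,\widetilde{\varDelta}(g)\rangle=\langle D f\,|\,g\rangle$ for $D\in\mathcal{D}^*$, $f\in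 Sym^*$, $g\in Sym_*$. "Module Hopf algebra" means a module algebra (the multiplication and the unit are module maps, with $\mathcal{D}^*$ acting on tensor products through $\varDelta$ and on $\mathbb{Z}$ through $\varepsilon$) such that in addition the comultiplication and the antipode are module maps. "Comodule Hopf algebra" is the analogous notion with comodule maps. *)

theory Defs
  imports
    "HOL-Library.Multiset"
    "HOL-Library.Function_Algebras"
    "HOL-Library.Poly_Mapping"
    "HOL-Computational_Algebra.Formal_Power_Series"
begin

section \<open>Abelian groups as modules over the integers\<close>

definition zmul :: "int \<Rightarrow> 'a::ab_group_add \<Rightarrow> 'a" where
  "zmul n x = (if 0 \<le> n then ((+) x ^^ nat n) 0 else - ((+) x ^^ nat (- n)) 0)"

lemma zmul_0_left [simp]: "zmul 0 x = 0"
  by (simp add: zmul_def)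

lemma zmul_add1: "zmul (n + 1) x = x + zmul n x"
proof (cases "0 \<le> n")
  case True
  then have "nat (n + 1) = Suc (nat n)" by simp
  with True show ?thesis by (simp add: zmul_def)
next
  case False
  define k where "k = nat (- n - 1)"
  have n: "n = - int (Suc k)" using False by (simp add: k_def)
  have "nat (- n) = Suc k" "n + 1 = - int k" by (simp_all add: n)
  with False show ?thesis by (cases "k = 0") (simp_all add: zmul_def)
qed

lemma zmul_sub1: "zmul (n - 1) x = zmul n x - x"
  using zmul_add1[of "n - 1" x] by simp

lemma zmul_add: "zmul (a + b) x = zmul a x + zmul b x"
proof (induction a rule: int_induct[where k = 0])
  case (step1 i)
  have "i + 1 + b = (i + b) + 1" by simp
  then have "zmul (i + 1 + b) x = x + zmul (i + b) x" by (simp only: zmul_add1)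
  also have "\<dots> = zmul (i + 1) x + zmul b x"
    unfolding step1 zmul_add1 by (simp only: add.assoc)
  finally show ?case .
next
  case (step2 i)
  have "zmul (i - 1 + b) x = zmul (i + b - 1) x" by (simp add: algebra_simps)
  then show ?case using step2 by (simp add: zmul_sub1)
qed simp

global_interpretation zmod: module "zmul :: int \<Rightarrow> 'a::ab_group_add \<Rightarrow> 'a"
proof
  fix a b :: int and x y :: 'a
  show "zmul (a + b) x = zmul a x + zmul b x"
    by (rule zmul_add)
  show "zmul a (x + y) = zmul a x + zmul a y"
    by (induction a rule: int_induct[where k = 0]) (simp_all add: zmul_add1 zmul_sub1)
  have neg: "zmul (- b) x = - zmul b x"
    using zmul_add[of b "- b" x] by (simp add: eq_neg_iff_add_eq_0 add.commute)
  show "zmul a (zmul b x) = zmul (a * b) x"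
  proof (induction a rule: int_induct[where k = 0])
    case (step1 i)
    have "zmul ((i + 1) * b) x = zmul (i * b) x + zmul b x"
      by (simp only: distrib_right zmul_add mult_1_left)
    then show ?case using step1 by (simp add: zmul_add1)
  next
    case (step2 i)
    have "zmul ((i - 1) * b) x = zmul (i * b + - b) x" by (simp add: left_diff_distrib)
    also have "\<dots> = zmul (i * b) x - zmul b x" by (simp only: zmul_add neg) simp
    finally show ?case using step2 by (simp add: zmul_sub1)
  qed simp
  show "zmul 1 x = x"
    by (simp add: zmul_def)
qed

definition biadditive :: "('a::ab_group_add \<Rightarrow> 'b::ab_group_add \<Rightarrow> 'c::ab_group_add) \<Rightarrow> bool" where
  "biadditive f \<longleftrightarrow> (\<forall>a. additive (f a)) \<and> (\<forall>b. additive (\<lambda>a. f a b))"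


section \<open>Tensor products over the integers\<close>

definition tensor_relators :: "('a::ab_group_add \<times> 'b::ab_group_add \<Rightarrow>\<^sub>0 int) set" where
  "tensor_relators =
     {frag_of (a + a', b) - frag_of (a, b) - frag_of (a', b) |a a' b. True} \<union>
     {frag_of (a, b + b') - frag_of (a, b) - frag_of (a, b') |a b b'. True}"

definition tensor_rel ::
  "('a::ab_group_add \<times> 'b::ab_group_add \<Rightarrow>\<^sub>0 int) \<Rightarrow> ('a \<times> 'b \<Rightarrow>\<^sub>0 int) \<Rightarrow> bool" where
  "tensor_rel p q \<longleftrightarrow> p - q \<in> zmod.span tensor_relators"

quotient_type (overloaded) ('a, 'b) tensor =
  "'a::ab_group_add \<times> 'b::ab_group_add \<Rightarrow>\<^sub>0 int" / tensor_rel
proof (rule equivpI)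
  show "reflp (tensor_rel :: ('a \<times> 'b \<Rightarrow>\<^sub>0 int) \<Rightarrow> _)"
    by (intro reflpI) (simp add: tensor_rel_def zmod.span_zero)
  show "symp (tensor_rel :: ('a \<times> 'b \<Rightarrow>\<^sub>0 int) \<Rightarrow> _)"
  proof (intro sympI)
    fix p q :: "'a \<times> 'b \<Rightarrow>\<^sub>0 int"
    assume "tensor_rel p q"
    then have "- (p - q) \<in> zmod.span tensor_relators"
      unfolding tensor_rel_def by (rule zmod.span_neg)
    then show "tensor_rel q p" by (simp add: tensor_rel_def)
  qed
  show "transp (tensor_rel :: ('a \<times> 'b \<Rightarrow>\<^sub>0 int) \<Rightarrow> _)"
  proof (intro transpI)
    fix p q r :: "'a \<times> 'b \<Rightarrow>\<^sub>0 int"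
    assume "tensor_rel p q" "tensor_rel q r"
    then have "(p - q) + (q - r) \<in> zmod.span tensor_relators"
      unfolding tensor_rel_def by (rule zmod.span_add)
    then show "tensor_rel p r" by (simp add: tensor_rel_def)
  qed
qed

instantiation tensor :: (ab_group_add, ab_group_add) ab_group_add
begin

lift_definition zero_tensor :: "('a, 'b) tensor" is 0 .

lift_definition plus_tensor :: "('a, 'b) tensor \<Rightarrow> ('a, 'b) tensor \<Rightarrow> ('a, 'b) tensor" is "(+)"
proof -
  fix p p' q q' :: "'a \<times> 'b \<Rightarrow>\<^sub>0 int"
  assume "tensor_rel p p'" "tensor_rel q q'"
  then have "(p - p') + (q - q') \<in> zmod.span tensor_relators"
    unfolding tensor_rel_def by (rule zmod.span_add)
  then show "tensor_rel (p + q) (p' + q')" by (simp add: tensor_rel_def algebra_simps)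
qed

lift_definition uminus_tensor :: "('a, 'b) tensor \<Rightarrow> ('a, 'b) tensor" is uminus
proof -
  fix p p' :: "'a \<times> 'b \<Rightarrow>\<^sub>0 int"
  assume "tensor_rel p p'"
  then have "- (p - p') \<in> zmod.span tensor_relators"
    unfolding tensor_rel_def by (rule zmod.span_neg)
  then show "tensor_rel (- p) (- p')" by (simp add: tensor_rel_def)
qed

definition minus_tensor :: "('a, 'b) tensor \<Rightarrow> ('a, 'b) tensor \<Rightarrow> ('a, 'b) tensor" where
  "minus_tensor s t = s + - t"

instance
proof
  fix s t u :: "('a, 'b) tensor"
  show "s + t + u = s + (t + u)" "s + t = t + s" "0 + s = s" "- s + s = 0"
    by (transfer; simp add: tensor_rel_def zmod.span_zero ac_simps)+
  show "s - t = s + - t"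
    by (rule minus_tensor_def)
qed

end

lift_definition tens :: "'a::ab_group_add \<Rightarrow> 'b::ab_group_add \<Rightarrow> ('a, 'b) tensor" (infixr \<open>\<otimes>\<close> 75)
  is "\<lambda>a b. frag_of (a, b)" .

definition tlift :: "('a::ab_group_add \<Rightarrow> 'b::ab_group_add \<Rightarrow> 'c::ab_group_add) \<Rightarrow> ('a, 'b) tensor \<Rightarrow> 'c" where
  "tlift f = (THE \<phi>. additive \<phi> \<and> (\<forall>a b. \<phi> (a \<otimes> b) = f a b))"

lemma zmul_hom: "additive f \<Longrightarrow> f (zmul n x) = zmul n (f x)"
proof -
  assume "additive f"
  then interpret additive f .
  show ?thesis
    by (induction n rule: int_induct[where k = 0]) (simp_all add: zmul_add1 zmul_sub1 add diff zero)
qed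

lemma tens_biadditive: "biadditive (\<otimes>)"
proof -
  have "(a + a') \<otimes> b = a \<otimes> b + a' \<otimes> b" for a a' :: 'a and b :: 'b
  proof transfer
    fix a a' :: 'a and b :: 'b
    have "frag_of (a + a', b) - frag_of (a, b) - frag_of (a', b) \<in> zmod.span tensor_relators"
      by (rule zmod.span_base) (unfold tensor_relators_def, blast)
    then show "tensor_rel (frag_of (a + a', b)) (frag_of (a, b) + frag_of (a', b))"
      by (simp add: tensor_rel_def diff_diff_eq)
  qed
  moreover have "a \<otimes> (b + b') = a \<otimes> b + a \<otimes> b'" for a :: 'a and b b' :: 'b
  proof transfer
    fix a :: 'a and b b' :: 'b
    have "frag_of (a, b + b') - frag_of (a, b) - frag_of (a, b') \<in> zmod.span tensor_relators"
      by (rule zmod.span_base) (unfold tensor_relators_def, blast)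
    then show "tensor_rel (frag_of (a, b + b')) (frag_of (a, b) + frag_of (a, b'))"
      by (simp add: tensor_rel_def diff_diff_eq)
  qed
  ultimately show ?thesis
    by (auto simp: biadditive_def additive_def)
qed

lemma tensor_induct [case_names zero tens diff]:
  assumes "P 0" "\<And>a b. P (a \<otimes> b)" "\<And>s t. P s \<Longrightarrow> P t \<Longrightarrow> P (s - t)"
  shows "P t"
proof -
  have "P (abs_tensor p)" for p :: "'a \<times> 'b \<Rightarrow>\<^sub>0 int"
    using subset_UNIV
  proof (induction p rule: frag_induction[where S = UNIV])
    case zero
    then show ?case using assms(1) by (simp add: zero_tensor_def)
  next
    case (one x)
    then show ?case using assms(2)[of "fst x" "snd x"] by (simp add: tens.abs_eq)
  next
    case (diff a b)
    moreover have "abs_tensor (a - b) = abs_tensor a - abs_tensor b"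
      by (simp add: minus_tensor_def plus_tensor.abs_eq uminus_tensor.abs_eq)
    ultimately show ?case using assms(3) diff by simp
  qed
  then show ?thesis using Quotient_abs_rep[OF Quotient_tensor, of t] by metis
qed

lemma additive_tensor_eqI:
  assumes "additive \<phi>" "additive \<psi>" "\<And>a b. \<phi> (a \<otimes> b) = \<psi> (a \<otimes> b)"
  shows "\<phi> = \<psi>"
proof
  fix t
  interpret f: additive \<phi> by fact
  interpret g: additive \<psi> by fact
  show "\<phi> t = \<psi> t"
    by (induction t rule: tensor_induct) (simp_all add: assms f.diff g.diff f.zero g.zero)
qed

lemma tlift_universal:
  assumes "biadditive f"
  shows "additive (tlift f) \<and> (\<forall>a b. tlift f (a \<otimes> b) = f a b)"
proof -
  define F where "F p = (\<Sum>k\<in>Poly_Mapping.keys p. zmul (Poly_Mapping.lookup p k) (case_prod f k))"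
    for p :: "'a \<times> 'b \<Rightarrow>\<^sub>0 int"
  have F_sup: "F p = (\<Sum>k\<in>A. zmul (Poly_Mapping.lookup p k) (case_prod f k))"
    if "finite A" "Poly_Mapping.keys p \<subseteq> A" for p A
    unfolding F_def using that by (intro sum.mono_neutral_left) (auto simp: in_keys_iff)
  have F_add: "F (p + q) = F p + F q" for p q
  proof -
    let ?A = "Poly_Mapping.keys p \<union> Poly_Mapping.keys q"
    show ?thesis
      using Poly_Mapping.keys_add[of p q]
      by (simp add: F_sup[of ?A] lookup_add zmod.scale_left_distrib sum.distrib)
  qed
  interpret F: additive F by standard (rule F_add)
  have F_of: "F (frag_of (a, b)) = f a b" for a b
    by (simp add: F_def)
  have F_null: "F p = 0" if "p \<in> zmod.span tensor_relators" for p
    using that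
  proof (induction rule: zmod.span_induct_alt)
    case base
    then show ?case by (rule F.zero)
  next
    case (step c x y)
    have "F x = 0"
      using step(1) assms
      by (auto simp: tensor_relators_def F.diff F_of biadditive_def additive_def)
    then show ?case
      by (simp add: F.add zmul_hom[OF F.additive_axioms] step)
  qed
  define \<phi> where "\<phi> t = F (rep_tensor t)" for t
  have \<phi>_abs: "\<phi> (abs_tensor p) = F p" for p
  proof -
    have "tensor_rel (rep_tensor (abs_tensor p)) p"
      by (metis Quotient_tensor Quotient_rep_abs_eq Quotient_rep_abs tensor.abs_eq_iff Quotient_abs_rep)
    then show ?thesis
      using F_null F.diff by (fastforce simp: tensor_rel_def \<phi>_def)
  qed
  have "\<phi> (s + t) = \<phi> s + \<phi> t" for s t
  proof -
    obtain p q where "s = abs_tensor p" "t = abs_tensor q"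
      using Quotient_abs_rep[OF Quotient_tensor] by metis
    then show ?thesis by (simp add: \<phi>_abs plus_tensor.abs_eq F_add)
  qed
  then have \<phi>: "additive \<phi> \<and> (\<forall>a b. \<phi> (a \<otimes> b) = f a b)"
    by (auto simp: additive_def tens.abs_eq \<phi>_abs F_of)
  show ?thesis
    unfolding tlift_def
    by (rule theI[of _ \<phi>]) (use \<phi> in \<open>auto intro: additive_tensor_eqI\<close>)
qed

definition tmap ::
  "('a::ab_group_add \<Rightarrow> 'c::ab_group_add) \<Rightarrow> ('b::ab_group_add \<Rightarrow> 'd::ab_group_add) \<Rightarrow>
   ('a, 'b) tensor \<Rightarrow> ('c, 'd) tensor" where
  "tmap f g = tlift (\<lambda>a b. f a \<otimes> g b)"

definition tassoc ::
  "(('a::ab_group_add, 'b::ab_group_add) tensor, 'c::ab_group_add) tensor \<Rightarrow> ('a, ('b, 'c) tensor) tensor" where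
  "tassoc = tlift (\<lambda>t c. tlift (\<lambda>a b. a \<otimes> b \<otimes> c) t)"

definition tensor_mult ::
  "('a::ab_group_add \<Rightarrow> 'a \<Rightarrow> 'a) \<Rightarrow> ('b::ab_group_add \<Rightarrow> 'b \<Rightarrow> 'b) \<Rightarrow>
   ('a, 'b) tensor \<Rightarrow> ('a, 'b) tensor \<Rightarrow> ('a, 'b) tensor" where
  "tensor_mult m n s t = tlift (\<lambda>a b. tlift (\<lambda>a' b'. m a a' \<otimes> n b b') t) s"

definition tensor_grade ::
  "(int \<Rightarrow> 'a::ab_group_add set) \<Rightarrow> (int \<Rightarrow> 'b::ab_group_add set) \<Rightarrow> int \<Rightarrow> ('a, 'b) tensor set" where
  "tensor_grade G G' n = zmod.span {a \<otimes> b |a b i j. a \<in> G i \<and> b \<in> G' j \<and> i + j = n}"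


section \<open>Graded Hopf algebras, module and comodule Hopf algebras\<close>

text \<open>
  Gradings are over the integers and the degree is always the homological (lower) one. An object
  with an upper grading is graded by the convention that its part of upper degree \<open>n\<close> is its part of
  (lower) degree \<open>-n\<close>, so that a right action of such an algebra lowers homological degrees.
  No signs are introduced in products of tensors.
\<close>

record (overloaded) 'a hopf_data =
  hgrade :: "int \<Rightarrow> 'a set"
  hmult :: "'a \<Rightarrow> 'a \<Rightarrow> 'a"
  hone :: 'a
  hcomult :: "'a \<Rightarrow> ('a, 'a) tensor"
  hcounit :: "'a \<Rightarrow> int"

definition grading :: "(int \<Rightarrow> 'a::ab_group_add set) \<Rightarrow> bool" where
  "grading G \<longleftrightarrow> (\<forall>n. zmod.subspace (G n)) \<and>
     (\<forall>x. \<exists>!c :: int \<Rightarrow>\<^sub>0 'a. (\<forall>n. Poly_Mapping.lookup c n \<in> G n) \<and>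
        x = (\<Sum>n\<in>Poly_Mapping.keys c. Poly_Mapping.lookup c n))"

definition graded_algebra :: "'a::ab_group_add hopf_data \<Rightarrow> bool" where
  "graded_algebra A \<longleftrightarrow> grading (hgrade A) \<and> biadditive (hmult A) \<and>
     (\<forall>x y z. hmult A (hmult A x y) z = hmult A x (hmult A y z)) \<and>
     (\<forall>x. hmult A (hone A) x = x \<and> hmult A x (hone A) = x) \<and>
     (\<forall>i j. \<forall>x\<in>hgrade A i. \<forall>y\<in>hgrade A j. hmult A x y \<in> hgrade A (i + j)) \<and>
     hone A \<in> hgrade A 0"

definition graded_coalgebra :: "'a::ab_group_add hopf_data \<Rightarrow> bool" where
  "graded_coalgebra A \<longleftrightarrow> grading (hgrade A) \<and> additive (hcomult A) \<and> additive (hcounit A) \<and>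
     (\<forall>x. tassoc (tmap (hcomult A) id (hcomult A x)) = tmap id (hcomult A) (hcomult A x)) \<and>
     (\<forall>x. tlift (\<lambda>a b. zmul (hcounit A a) b) (hcomult A x) = x) \<and>
     (\<forall>x. tlift (\<lambda>a b. zmul (hcounit A b) a) (hcomult A x) = x) \<and>
     (\<forall>n. \<forall>x\<in>hgrade A n. hcomult A x \<in> tensor_grade (hgrade A) (hgrade A) n) \<and>
     (\<forall>n. \<forall>x\<in>hgrade A n. n \<noteq> 0 \<longrightarrow> hcounit A x = 0)"

definition graded_bialgebra :: "'a::ab_group_add hopf_data \<Rightarrow> bool" where
  "graded_bialgebra A \<longleftrightarrow> graded_algebra A \<and> graded_coalgebra A \<and>
     (\<forall>x y. hcomult A (hmult A x y) = tensor_mult (hmult A) (hmult A) (hcomult A x) (hcomult A y)) \<and>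
     hcomult A (hone A) = hone A \<otimes> hone A \<and>
     (\<forall>x y. hcounit A (hmult A x y) = hcounit A x * hcounit A y) \<and>
     hcounit A (hone A) = 1"

definition is_antipode :: "'a::ab_group_add hopf_data \<Rightarrow> ('a \<Rightarrow> 'a) \<Rightarrow> bool" where
  "is_antipode A S \<longleftrightarrow> additive S \<and> (\<forall>n. S ` hgrade A n \<subseteq> hgrade A n) \<and>
     (\<forall>x. tlift (\<lambda>a b. hmult A (S a) b) (hcomult A x) = zmul (hcounit A x) (hone A)) \<and>
     (\<forall>x. tlift (\<lambda>a b. hmult A a (S b)) (hcomult A x) = zmul (hcounit A x) (hone A))"

definition hopf_algebra :: "'a::ab_group_add hopf_data \<Rightarrow> bool" where
  "hopf_algebra A \<longleftrightarrow> graded_bialgebra A \<and> (\<exists>S. is_antipode A S)"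

definition antipode :: "'a::ab_group_add hopf_data \<Rightarrow> 'a \<Rightarrow> 'a" where
  "antipode A = (THE S. is_antipode A S)"

text \<open>
  An action of \<open>H\<close>, left or right, is given below by the operators \<open>act h\<close>. Left and right modules
  differ only in the order in which the operators of a product are applied.
\<close>

definition left_module ::
  "'h::ab_group_add hopf_data \<Rightarrow> 'a::ab_group_add hopf_data \<Rightarrow> ('h \<Rightarrow> 'a \<Rightarrow> 'a) \<Rightarrow> bool" where
  "left_module H A act \<longleftrightarrow> biadditive act \<and> (\<forall>a. act (hone H) a = a) \<and>
     (\<forall>h k a. act (hmult H h k) a = act h (act k a)) \<and>
     (\<forall>i j. \<forall>h\<in>hgrade H i. \<forall>a\<in>hgrade A j. act h a \<in> hgrade A (i + j))"

definition right_module ::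
  "'h::ab_group_add hopf_data \<Rightarrow> 'a::ab_group_add hopf_data \<Rightarrow> ('h \<Rightarrow> 'a \<Rightarrow> 'a) \<Rightarrow> bool" where
  "right_module H A act \<longleftrightarrow> biadditive act \<and> (\<forall>a. act (hone H) a = a) \<and>
     (\<forall>h k a. act (hmult H h k) a = act k (act h a)) \<and>
     (\<forall>i j. \<forall>h\<in>hgrade H i. \<forall>a\<in>hgrade A j. act h a \<in> hgrade A (i + j))"

definition tensor_act ::
  "'h::ab_group_add hopf_data \<Rightarrow> ('h \<Rightarrow> 'a::ab_group_add \<Rightarrow> 'a) \<Rightarrow> ('h \<Rightarrow> 'b::ab_group_add \<Rightarrow> 'b) \<Rightarrow>
   'h \<Rightarrow> ('a, 'b) tensor \<Rightarrow> ('a, 'b) tensor" where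
  "tensor_act H act act' h t = tlift (\<lambda>h1 h2. tmap (act h1) (act' h2) t) (hcomult H h)"

definition trivial_act :: "'h::ab_group_add hopf_data \<Rightarrow> 'h \<Rightarrow> int \<Rightarrow> int" where
  "trivial_act H h n = hcounit H h * n"

definition module_map ::
  "('h \<Rightarrow> 'a::ab_group_add \<Rightarrow> 'a) \<Rightarrow> ('h \<Rightarrow> 'b::ab_group_add \<Rightarrow> 'b) \<Rightarrow> ('a \<Rightarrow> 'b) \<Rightarrow> bool" where
  "module_map act act' \<phi> \<longleftrightarrow> additive \<phi> \<and> (\<forall>h a. \<phi> (act h a) = act' h (\<phi> a))"

definition module_algebra_maps ::
  "'h::ab_group_add hopf_data \<Rightarrow> 'a::ab_group_add hopf_data \<Rightarrow> ('h \<Rightarrow> 'a \<Rightarrow> 'a) \<Rightarrow> bool" where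
  "module_algebra_maps H A act \<longleftrightarrow>
     module_map (tensor_act H act act) act (tlift (hmult A)) \<and>
     module_map (trivial_act H) act (\<lambda>n. zmul n (hone A))"

definition module_hopf_maps ::
  "'h::ab_group_add hopf_data \<Rightarrow> 'a::ab_group_add hopf_data \<Rightarrow> ('h \<Rightarrow> 'a \<Rightarrow> 'a) \<Rightarrow> bool" where
  "module_hopf_maps H A act \<longleftrightarrow> module_algebra_maps H A act \<and>
     module_map act (tensor_act H act act) (hcomult A) \<and>
     module_map act act (antipode A)"

definition left_module_hopf_algebra ::
  "'h::ab_group_add hopf_data \<Rightarrow> 'a::ab_group_add hopf_data \<Rightarrow> ('h \<Rightarrow> 'a \<Rightarrow> 'a) \<Rightarrow> bool" where
  "left_module_hopf_algebra H A act \<longleftrightarrow>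
     hopf_algebra H \<and> hopf_algebra A \<and> left_module H A act \<and> module_hopf_maps H A act"

definition right_module_hopf_algebra ::
  "'h::ab_group_add hopf_data \<Rightarrow> 'a::ab_group_add hopf_data \<Rightarrow> ('h \<Rightarrow> 'a \<Rightarrow> 'a) \<Rightarrow> bool" where
  "right_module_hopf_algebra H A act \<longleftrightarrow>
     hopf_algebra H \<and> hopf_algebra A \<and> right_module H A act \<and> module_hopf_maps H A act"

definition left_comodule ::
  "'h::ab_group_add hopf_data \<Rightarrow> 'a::ab_group_add hopf_data \<Rightarrow> ('a \<Rightarrow> ('h, 'a) tensor) \<Rightarrow> bool" where
  "left_comodule H A \<rho> \<longleftrightarrow> additive \<rho> \<and>
     (\<forall>a. tassoc (tmap (hcomult H) id (\<rho> a)) = tmap id \<rho> (\<rho> a)) \<and>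
     (\<forall>a. tlift (\<lambda>h b. zmul (hcounit H h) b) (\<rho> a) = a) \<and>
     (\<forall>n. \<forall>a\<in>hgrade A n. \<rho> a \<in> tensor_grade (hgrade H) (hgrade A) n)"

definition tensor_coact ::
  "'h::ab_group_add hopf_data \<Rightarrow> ('a::ab_group_add \<Rightarrow> ('h, 'a) tensor) \<Rightarrow>
   ('b::ab_group_add \<Rightarrow> ('h, 'b) tensor) \<Rightarrow> ('a, 'b) tensor \<Rightarrow> ('h, ('a, 'b) tensor) tensor" where
  "tensor_coact H \<rho> \<rho>' =
     tlift (\<lambda>a b. tlift (\<lambda>h a'. tlift (\<lambda>k b'. hmult H h k \<otimes> a' \<otimes> b') (\<rho>' b)) (\<rho> a))"

definition trivial_coact :: "'h::ab_group_add hopf_data \<Rightarrow> int \<Rightarrow> ('h, int) tensor" where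
  "trivial_coact H n = hone H \<otimes> n"

definition comodule_map ::
  "('a::ab_group_add \<Rightarrow> ('h::ab_group_add, 'a) tensor) \<Rightarrow> ('b::ab_group_add \<Rightarrow> ('h, 'b) tensor) \<Rightarrow>
   ('a \<Rightarrow> 'b) \<Rightarrow> bool" where
  "comodule_map \<rho> \<rho>' \<phi> \<longleftrightarrow> additive \<phi> \<and> (\<forall>a. \<rho>' (\<phi> a) = tmap id \<phi> (\<rho> a))"

definition left_comodule_hopf_algebra ::
  "'h::ab_group_add hopf_data \<Rightarrow> 'a::ab_group_add hopf_data \<Rightarrow> ('a \<Rightarrow> ('h, 'a) tensor) \<Rightarrow> bool" where
  "left_comodule_hopf_algebra H A \<rho> \<longleftrightarrow>
     hopf_algebra H \<and> hopf_algebra A \<and> left_comodule H A \<rho> \<and>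
     comodule_map (tensor_coact H \<rho> \<rho>) \<rho> (tlift (hmult A)) \<and>
     comodule_map (trivial_coact H) \<rho> (\<lambda>n. zmul n (hone A)) \<and>
     comodule_map \<rho> (tensor_coact H \<rho> \<rho>) (hcomult A) \<and>
     comodule_map \<rho> \<rho> (antipode A)"


section \<open>Partitions\<close>

typedef partition = "{p :: nat multiset. 0 \<notin># p}"
  morphisms parts Abs_partition
  by (rule exI[of _ "{#}"]) simp

setup_lifting type_definition_partition

text \<open>Addition of partitions is the union of their parts.\<close>

instantiation partition :: comm_monoid_add
begin

lift_definition zero_partition :: partition is "{#}" by simp

lift_definition plus_partition :: "partition \<Rightarrow> partition \<Rightarrow> partition" is "(+)" by simp

instance
  by standard (transfer; simp)+

end

definition weight :: "partition \<Rightarrow> nat" where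
  "weight p = sum_mset (parts p)"


section \<open>Differential operators and the algebra \<open>D\<^sup>*\<close>\<close>

text \<open>
  A multiset of natural numbers stands for a monomial in countably many variables, a number \<open>i\<close>
  occurring \<open>e\<close> times for the factor \<open>x\<^sub>i\<^sup>e\<close> (the variables are indexed from 0). A formal power
  series is the function giving its coefficients. An operator in standard form
  is the function giving the coefficient of \<open>x\<^sub>\<alpha> \<partial>\<^sub>\<beta>\<close> for all monomials \<open>\<alpha>\<close>, \<open>\<beta>\<close>.
\<close>

type_synonym mono = "nat multiset"
type_synonym 'a series = "mono \<Rightarrow> 'a"
type_synonym diffop = "mono \<Rightarrow> mono \<Rightarrow> rat"

definition partial_deriv :: "nat \<Rightarrow> rat series \<Rightarrow> rat series" where
  "partial_deriv i f = (\<lambda>\<gamma>. of_nat (count \<gamma> i + 1) * f (add_mset i \<gamma>))"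

definition partial_derivs :: "mono \<Rightarrow> rat series \<Rightarrow> rat series" where
  "partial_derivs \<beta> f = fold_mset partial_deriv f \<beta>"

text \<open>
  The inner sum is taken over finitely many \<open>\<beta>\<close> for the operators in question, because in each of
  their terms \<open>\<beta>\<close> divides \<open>\<alpha>\<close>.
\<close>

definition diffop_apply :: "diffop \<Rightarrow> rat series \<Rightarrow> rat series" where
  "diffop_apply P f = (\<lambda>\<gamma>. \<Sum>\<alpha> | \<alpha> \<subseteq># \<gamma>. \<Sum>\<beta> | P \<alpha> \<beta> \<noteq> 0. P \<alpha> \<beta> * partial_derivs \<beta> f (\<gamma> - \<alpha>))"

definition diffop_id :: diffop where
  "diffop_id = (\<lambda>\<alpha> \<beta>. if \<alpha> = {#} \<and> \<beta> = {#} then 1 else 0)"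

definition vee :: "diffop \<Rightarrow> diffop \<Rightarrow> diffop" (infixl \<open>\<^bold>\<or>\<close> 70) where
  "P \<^bold>\<or> Q = (\<lambda>\<alpha> \<beta>. \<Sum>\<alpha>' | \<alpha>' \<subseteq># \<alpha>. \<Sum>\<beta>' | \<beta>' \<subseteq># \<beta>. P \<alpha>' \<beta>' * Q (\<alpha> - \<alpha>') (\<beta> - \<beta>'))"

definition D_gen :: "nat \<Rightarrow> diffop" where
  "D_gen k = (\<lambda>\<alpha> \<beta>. if \<exists>i. \<alpha> = replicate_mset (k + 1) i \<and> \<beta> = {#i#} then 1 else 0)"

definition D_form :: "partition \<Rightarrow> diffop" where
  "D_form l = (\<lambda>\<alpha> \<beta>. fold_mset (\<lambda>k P. D_gen k \<^bold>\<or> P) diffop_id (parts l) \<alpha> \<beta> /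
     (\<Prod>k\<in>set_mset (parts l). fact (count (parts l) k)))"

typedef Dupper = "zmod.span (range (\<lambda>l. diffop_apply (D_form l)))"
  morphisms operator Abs_Dupper
  using zmod.span_zero by blast

setup_lifting type_definition_Dupper

instantiation Dupper :: ab_group_add
begin

lift_definition zero_Dupper :: Dupper is 0 by (rule zmod.span_zero)
lift_definition plus_Dupper :: "Dupper \<Rightarrow> Dupper \<Rightarrow> Dupper" is "(+)" by (rule zmod.span_add)
lift_definition minus_Dupper :: "Dupper \<Rightarrow> Dupper \<Rightarrow> Dupper" is "(-)" by (rule zmod.span_diff)
lift_definition uminus_Dupper :: "Dupper \<Rightarrow> Dupper" is uminus by (rule zmod.span_neg)

instance
  by standard (transfer; simp)+

end

lift_definition D_basis :: "partition \<Rightarrow> Dupper" is "\<lambda>l. diffop_apply (D_form l)"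
  by (rule zmod.span_base) simp

text \<open>
  The span is closed under composition and the \<open>D_basis l\<close> are linearly independent, so the
  definite descriptions below denote.
\<close>

definition Dupper_comp :: "Dupper \<Rightarrow> Dupper \<Rightarrow> Dupper" where
  "Dupper_comp P Q = (THE R. operator R = operator P \<circ> operator Q)"

definition Dupper_comult :: "Dupper \<Rightarrow> (Dupper, Dupper) tensor" where
  "Dupper_comult = (THE \<Delta>. additive \<Delta> \<and>
     (\<forall>l. \<Delta> (D_basis l) = (\<Sum>(m, n) | m + n = l. D_basis m \<otimes> D_basis n)))"

definition Dupper_counit :: "Dupper \<Rightarrow> int" where
  "Dupper_counit = (THE \<epsilon>. additive \<epsilon> \<and> (\<forall>l. \<epsilon> (D_basis l) = (if l = 0 then 1 else 0)))"

definition Dupper_hopf :: "Dupper hopf_data" where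
  "Dupper_hopf =
     \<lparr>hgrade = (\<lambda>n. zmod.span {D_basis l |l. - int (weight l) = n}),
      hmult = Dupper_comp, hone = D_basis 0, hcomult = Dupper_comult, hcounit = Dupper_counit\<rparr>"


section \<open>The dual algebra \<open>D\<^sub>*\<close>\<close>

text \<open>The polynomial ring in \<open>b\<^sub>1, b\<^sub>2, \<dots>\<close>, a partition standing for the product of the \<open>b\<^sub>k\<close> over its parts.\<close>

type_synonym Dlower = "partition \<Rightarrow>\<^sub>0 int"

definition b_mono :: "partition \<Rightarrow> Dlower" where
  "b_mono l = Poly_Mapping.single l 1"

definition b_gen :: "nat \<Rightarrow> Dlower" where
  "b_gen k = (if k = 0 then 1 else b_mono (Abs_partition {#k#}))"

text \<open>
  The part of degree \<open>d\<close> of the \<open>n\<close>-th power of \<open>b = b\<^sub>0 + b\<^sub>1 + b\<^sub>2 + \<dots>\<close>. As \<open>b\<^sub>k\<close> has degree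
  \<open>k\<close>, the degree is recorded by the exponent of the variable of a power series.
\<close>

definition b_power_part :: "nat \<Rightarrow> nat \<Rightarrow> Dlower" where
  "b_power_part n d = fps_nth (Abs_fps b_gen ^ n) d"

definition Dlower_comult :: "Dlower \<Rightarrow> (Dlower, Dlower) tensor" where
  "Dlower_comult = (THE \<Delta>. additive \<Delta> \<and> \<Delta> 1 = 1 \<otimes> 1 \<and>
     (\<forall>p q. \<Delta> (p * q) = tensor_mult (*) (*) (\<Delta> p) (\<Delta> q)) \<and>
     (\<forall>k\<ge>1. \<Delta> (b_gen k) = (\<Sum>i\<le>k. b_power_part (i + 1) (k - i) \<otimes> b_gen i)))"

definition Dlower_hopf :: "Dlower hopf_data" where
  "Dlower_hopf =
     \<lparr>hgrade = (\<lambda>n. {p. \<forall>l\<in>Poly_Mapping.keys p. int (weight l) = n}),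
      hmult = (*), hone = 1, hcomult = Dlower_comult, hcounit = (\<lambda>p. Poly_Mapping.lookup p 0)\<rparr>"

definition D_pairing :: "Dupper \<Rightarrow> Dlower \<Rightarrow> int" where
  "D_pairing = (THE B. biadditive B \<and>
     (\<forall>l m. B (D_basis l) (b_mono m) = (if l = m then 1 else 0)))"


section \<open>Symmetric functions\<close>

definition symmetric_series :: "int series set" where
  "symmetric_series = {f. (\<forall>\<pi> \<gamma>. bij \<pi> \<longrightarrow> f (image_mset \<pi> \<gamma>) = f \<gamma>) \<and>
     (\<exists>d. \<forall>\<gamma>. f \<gamma> \<noteq> 0 \<longrightarrow> size \<gamma> \<le> d)}"

typedef sym = symmetric_series
  morphisms sym_coeff Abs_sym
  by (rule exI[of _ "\<lambda>_. 0"]) (simp add: symmetric_series_def)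

setup_lifting type_definition_sym

definition series_mult :: "int series \<Rightarrow> int series \<Rightarrow> int series" where
  "series_mult f g = (\<lambda>\<gamma>. \<Sum>\<alpha> | \<alpha> \<subseteq># \<gamma>. f \<alpha> * g (\<gamma> - \<alpha>))"


lemma finite_submsets [simp]: "finite {\<alpha>. \<alpha> \<subseteq># (\<gamma> :: 'a multiset)}"
proof (rule finite_subset)
  show "{\<alpha>. \<alpha> \<subseteq># \<gamma>} \<subseteq> (\<Union>n\<le>size \<gamma>. multisets_of_size (set_mset \<gamma>) n)"
  proof
    fix \<alpha> assume "\<alpha> \<in> {\<alpha>. \<alpha> \<subseteq># \<gamma>}"
    then have "size \<alpha> \<le> size \<gamma>" "set_mset \<alpha> \<subseteq> set_mset \<gamma>"
      using size_mset_mono set_mset_mono by blast+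
    then show "\<alpha> \<in> (\<Union>n\<le>size \<gamma>. multisets_of_size (set_mset \<gamma>) n)"
      by (simp add: multisets_of_size_def)
  qed
  show "finite (\<Union>n\<le>size \<gamma>. multisets_of_size (set_mset \<gamma>) n)"
    by (intro finite_UN_I finite_multisets_of_size) simp_all
qed

lemma image_mset_submsets:
  assumes "bij \<pi>"
  shows "bij_betw (image_mset \<pi>) {\<alpha>. \<alpha> \<subseteq># \<gamma>} {\<alpha>. \<alpha> \<subseteq># image_mset \<pi> \<gamma>}"
proof (rule bij_betwI[where g = "image_mset (inv \<pi>)"])
  have 1: "inv \<pi> \<circ> \<pi> = id" and 2: "\<pi> \<circ> inv \<pi> = id"
    using assms surj_iff[of \<pi>] by (auto simp: bij_is_inj dest: bij_is_surj)
  have 3: "image_mset (inv \<pi>) (image_mset \<pi> \<alpha>) = \<alpha>" for \<alpha>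
    by (simp only: multiset.map_comp 1 multiset.map_id)
  show "image_mset \<pi> \<in> {\<alpha>. \<alpha> \<subseteq># \<gamma>} \<rightarrow> {\<alpha>. \<alpha> \<subseteq># image_mset \<pi> \<gamma>}"
    by (blast intro: image_mset_subseteq_mono)
  show "image_mset (inv \<pi>) \<in> {\<alpha>. \<alpha> \<subseteq># image_mset \<pi> \<gamma>} \<rightarrow> {\<alpha>. \<alpha> \<subseteq># \<gamma>}"
  proof
    fix \<alpha> assume "\<alpha> \<in> {\<alpha>. \<alpha> \<subseteq># image_mset \<pi> \<gamma>}"
    then have "image_mset (inv \<pi>) \<alpha> \<subseteq># image_mset (inv \<pi>) (image_mset \<pi> \<gamma>)"
      by (blast intro: image_mset_subseteq_mono)
    then show "image_mset (inv \<pi>) \<alpha> \<in> {\<alpha>. \<alpha> \<subseteq># \<gamma>}" by (simp only: 3 mem_Collect_eq)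
  qed
  show "image_mset (inv \<pi>) (image_mset \<pi> \<alpha>) = \<alpha>" for \<alpha>
    by (rule 3)
  show "image_mset \<pi> (image_mset (inv \<pi>) \<alpha>) = \<alpha>" for \<alpha>
    by (simp only: multiset.map_comp 2 multiset.map_id)
qed

lemma series_mult_symmetric:
  assumes f: "f \<in> symmetric_series" and g: "g \<in> symmetric_series"
  shows "series_mult f g \<in> symmetric_series"
proof -
  have fs: "f (image_mset \<pi> \<gamma>) = f \<gamma>" and gs: "g (image_mset \<pi> \<gamma>) = g \<gamma>" if "bij \<pi>" for \<pi> \<gamma>
    using f g that unfolding symmetric_series_def by blast+
  have "series_mult f g (image_mset \<pi> \<gamma>) = series_mult f g \<gamma>" if \<pi>: "bij \<pi>" for \<pi> :: "nat \<Rightarrow> nat" and \<gamma>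
  proof -
    have "series_mult f g (image_mset \<pi> \<gamma>) =
        (\<Sum>\<alpha> | \<alpha> \<subseteq># \<gamma>. f (image_mset \<pi> \<alpha>) * g (image_mset \<pi> \<gamma> - image_mset \<pi> \<alpha>))"
      unfolding series_mult_def
      by (rule sum.reindex_bij_betw[OF image_mset_submsets[OF \<pi>], symmetric])
    also have "\<dots> = (\<Sum>\<alpha> | \<alpha> \<subseteq># \<gamma>. f \<alpha> * g (\<gamma> - \<alpha>))"
    proof (rule sum.cong[OF refl])
      fix \<alpha> assume "\<alpha> \<in> {\<alpha>. \<alpha> \<subseteq># \<gamma>}"
      then have "image_mset \<pi> \<gamma> - image_mset \<pi> \<alpha> = image_mset \<pi> (\<gamma> - \<alpha>)"
        by (metis image_mset_Diff mem_Collect_eq)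
      then show "f (image_mset \<pi> \<alpha>) * g (image_mset \<pi> \<gamma> - image_mset \<pi> \<alpha>) = f \<alpha> * g (\<gamma> - \<alpha>)"
        by (simp only: fs[OF \<pi>] gs[OF \<pi>])
    qed
    finally show ?thesis by (simp only: series_mult_def)
  qed
  moreover obtain d where d: "\<And>\<gamma>. f \<gamma> \<noteq> 0 \<Longrightarrow> size \<gamma> \<le> d"
    using f unfolding symmetric_series_def by blast
  moreover obtain e where e: "\<And>\<gamma>. g \<gamma> \<noteq> 0 \<Longrightarrow> size \<gamma> \<le> e"
    using g unfolding symmetric_series_def by blast
  have "size \<gamma> \<le> d + e" if "series_mult f g \<gamma> \<noteq> 0" for \<gamma>
  proof -
    have "\<exists>\<alpha>\<in>{\<alpha>. \<alpha> \<subseteq># \<gamma>}. f \<alpha> * g (\<gamma> - \<alpha>) \<noteq> 0"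
      using that unfolding series_mult_def by (meson sum.neutral)
    then obtain \<alpha> where \<alpha>: "\<alpha> \<subseteq># \<gamma>" "f \<alpha> * g (\<gamma> - \<alpha>) \<noteq> 0" by blast
    then have "size \<alpha> \<le> d" "size (\<gamma> - \<alpha>) \<le> e" using d e by auto
    moreover have "size \<gamma> = size \<alpha> + size (\<gamma> - \<alpha>)"
      using \<alpha>(1) by (metis size_union subset_mset.add_diff_inverse)
    ultimately show ?thesis by linarith
  qed
  ultimately show ?thesis
    unfolding symmetric_series_def by blast
qed

instantiation sym :: comm_ring_1
begin

lift_definition zero_sym :: sym is "\<lambda>_. 0"
  by (simp add: symmetric_series_def)

lift_definition one_sym :: sym is "\<lambda>\<gamma>. if \<gamma> = {#} then 1 else 0"
  by (auto simp: symmetric_series_def)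

lift_definition plus_sym :: "sym \<Rightarrow> sym \<Rightarrow> sym" is "\<lambda>f g \<gamma>. f \<gamma> + g \<gamma>"
proof -
  fix f g assume f: "f \<in> symmetric_series" and g: "g \<in> symmetric_series"
  obtain d e where "\<And>\<gamma>. f \<gamma> \<noteq> 0 \<Longrightarrow> size \<gamma> \<le> d" "\<And>\<gamma>. g \<gamma> \<noteq> 0 \<Longrightarrow> size \<gamma> \<le> e"
    using f g by (auto simp: symmetric_series_def)
  then have "\<forall>\<gamma>. f \<gamma> + g \<gamma> \<noteq> 0 \<longrightarrow> size \<gamma> \<le> max d e"
    by (metis add.right_neutral max.coboundedI1 max.coboundedI2)
  then show "(\<lambda>\<gamma>. f \<gamma> + g \<gamma>) \<in> symmetric_series"
    using f g by (auto simp: symmetric_series_def)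
qed

lift_definition uminus_sym :: "sym \<Rightarrow> sym" is "\<lambda>f \<gamma>. - f \<gamma>"
  by (simp add: symmetric_series_def)

definition minus_sym :: "sym \<Rightarrow> sym \<Rightarrow> sym" where
  "minus_sym f g = f + - g"

lift_definition times_sym :: "sym \<Rightarrow> sym \<Rightarrow> sym" is series_mult
  by (rule series_mult_symmetric)

instance
proof
  fix f g h :: sym
  show "f + g + h = f + (g + h)" "f + g = g + f" "0 + f = f" "- f + f = 0"
    by (transfer; simp add: fun_eq_iff)+
  show "f - g = f + - g"
    by (rule minus_sym_def)
  show "(f + g) * h = f * h + g * h"
    by transfer (simp add: series_mult_def distrib_right sum.distrib)
  show "f * g = g * f"
  proof transfer
    fix f g :: "int series"
    have "series_mult f g \<gamma> = series_mult g f \<gamma>" for \<gamma>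
      unfolding series_mult_def
      by (rule sum.reindex_bij_witness[where i = "\<lambda>\<alpha>. \<gamma> - \<alpha>" and j = "\<lambda>\<alpha>. \<gamma> - \<alpha>"])
        (auto simp: subset_mset.diff_diff_right mult.commute)
    then show "series_mult f g = series_mult g f" ..
  qed
  show "f * g * h = f * (g * h)"
  proof transfer
    fix f g h :: "int series"
    have "series_mult (series_mult f g) h \<gamma> = series_mult f (series_mult g h) \<gamma>" for \<gamma>
    proof -
      have "series_mult (series_mult f g) h \<gamma> =
          (\<Sum>(\<alpha>, \<beta>)\<in>(SIGMA \<alpha>:{\<alpha>. \<alpha> \<subseteq># \<gamma>}. {\<beta>. \<beta> \<subseteq># \<alpha>}). f \<beta> * g (\<alpha> - \<beta>) * h (\<gamma> - \<alpha>))"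
        unfolding series_mult_def sum_distrib_right by (simp add: sum.Sigma)
      also have "\<dots> = (\<Sum>(\<alpha>, \<beta>)\<in>(SIGMA \<alpha>:{\<alpha>. \<alpha> \<subseteq># \<gamma>}. {\<beta>. \<beta> \<subseteq># \<gamma> - \<alpha>}).
          f \<alpha> * (g \<beta> * h (\<gamma> - \<alpha> - \<beta>)))"
      proof (rule sum.reindex_bij_witness[where
            i = "\<lambda>(\<alpha>, \<beta>). (\<alpha> + \<beta>, \<alpha>)" and j = "\<lambda>(\<alpha>, \<beta>). (\<beta>, \<alpha> - \<beta>)"], goal_cases)
        case (2 a)
        then obtain \<alpha> \<beta> where a: "a = (\<alpha>, \<beta>)" "\<alpha> \<subseteq># \<gamma>" "\<beta> \<subseteq># \<alpha>" by auto
        have "\<beta> \<subseteq># \<gamma>" using a by (metis subset_mset.order_trans)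
        moreover have "\<alpha> - \<beta> \<subseteq># \<gamma> - \<beta>"
          using a(2) by (simp add: subseteq_mset_def diff_le_mono)
        ultimately show ?case by (simp add: a(1))
      next
        case (4 b)
        then obtain \<alpha> \<beta> where b: "b = (\<alpha>, \<beta>)" "\<alpha> \<subseteq># \<gamma>" "\<beta> \<subseteq># \<gamma> - \<alpha>" by auto
        then have "\<alpha> + \<beta> \<subseteq># \<gamma>"
          by (metis add.commute subset_mset.le_diff_conv2)
        then show ?case by (simp add: b(1))
      qed (auto simp: mult.assoc)
      also have "\<dots> = series_mult f (series_mult g h) \<gamma>"
        unfolding series_mult_def sum_distrib_left by (simp add: sum.Sigma)
      finally show ?thesis .
    qed
    then show "series_mult (series_mult f g) h = series_mult f (series_mult g h)" ..
  qed
  show "1 * f = f"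
  proof transfer
    fix f :: "int series"
    have "series_mult (\<lambda>\<gamma>. if \<gamma> = {#} then 1 else 0) f \<gamma> = f \<gamma>" for \<gamma>
    proof -
      have "series_mult (\<lambda>\<gamma>. if \<gamma> = {#} then 1 else 0) f \<gamma> =
          (\<Sum>\<alpha> | \<alpha> \<subseteq># \<gamma>. if {#} = \<alpha> then f (\<gamma> - \<alpha>) else 0)"
        unfolding series_mult_def by (intro sum.cong) auto
      then show ?thesis by (simp add: sum.delta)
    qed
    then show "series_mult (\<lambda>\<gamma>. if \<gamma> = {#} then 1 else 0) f = f" ..
  qed
  show "(0::sym) \<noteq> 1"
    by transfer (auto simp: fun_eq_iff)
qed

end

lift_definition h_sym :: "nat \<Rightarrow> sym" is "\<lambda>n \<gamma>. if size \<gamma> = n then 1 else 0"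
  by (auto simp: symmetric_series_def)

definition h_prod :: "partition \<Rightarrow> sym" where
  "h_prod l = (\<Prod>k\<in>#parts l. h_sym k)"

definition exponents :: "mono \<Rightarrow> nat multiset" where
  "exponents \<gamma> = image_mset (count \<gamma>) (mset_set (set_mset \<gamma>))"

lemma exponents_image:
  assumes "bij \<pi>"
  shows "exponents (image_mset \<pi> \<gamma>) = exponents \<gamma>"
proof -
  have inj: "inj \<pi>" using assms by (rule bij_is_inj)
  have "mset_set (\<pi> ` set_mset \<gamma>) = image_mset \<pi> (mset_set (set_mset \<gamma>))"
    using inj by (simp add: image_mset_mset_set inj_on_def)
  moreover have "count (image_mset \<pi> \<gamma>) (\<pi> i) = count \<gamma> i" for i
    using inj by (induction \<gamma>) (auto simp: inj_eq)
  ultimately show ?thesis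
    by (simp add: exponents_def image_mset.compositionality comp_def)
qed

lemma sum_exponents: "sum_mset (exponents \<gamma>) = size \<gamma>"
  by (simp add: exponents_def size_multiset_overloaded_eq sum_unfold_sum_mset)

lift_definition m_sym :: "partition \<Rightarrow> sym" is "\<lambda>l \<gamma>. if exponents \<gamma> = parts l then 1 else 0"
  by (auto simp: symmetric_series_def exponents_image sum_exponents[symmetric] simp del: sum_mset.neutral)

definition sym_comult :: "sym \<Rightarrow> (sym, sym) tensor" where
  "sym_comult = (THE \<delta>. additive \<delta> \<and> \<delta> 1 = 1 \<otimes> 1 \<and>
     (\<forall>f g. \<delta> (f * g) = tensor_mult (*) (*) (\<delta> f) (\<delta> g)) \<and>
     (\<forall>n. \<delta> (h_sym n) = (\<Sum>k\<le>n. h_sym k \<otimes> h_sym (n - k))))"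

definition sym_counit :: "sym \<Rightarrow> int" where
  "sym_counit f = sym_coeff f {#}"

definition homogeneous :: "int \<Rightarrow> sym set" where
  "homogeneous n = {f. \<forall>\<gamma>. sym_coeff f \<gamma> \<noteq> 0 \<longrightarrow> int (size \<gamma>) = n}"

text \<open>
  The graded dual \<open>Sym\<^sup>*\<close> is identified with the Hopf algebra \<open>Sym\<^sub>*\<close> by the standard pairing, so
  that the two differ only in their grading.
\<close>

definition Sym_lower :: "sym hopf_data" where
  "Sym_lower =
     \<lparr>hgrade = homogeneous, hmult = (*), hone = 1, hcomult = sym_comult, hcounit = sym_counit\<rparr>"

definition Sym_upper :: "sym hopf_data" where
  "Sym_upper = Sym_lower\<lparr>hgrade := \<lambda>n. homogeneous (- n)\<rparr>"

definition sym_pairing :: "sym \<Rightarrow> sym \<Rightarrow> int" where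
  "sym_pairing = (THE B. biadditive B \<and>
     (\<forall>l m. B (m_sym l) (h_prod m) = (if l = m then 1 else 0)))"


section \<open>The actions and the coaction\<close>

definition D_act :: "Dupper \<Rightarrow> sym \<Rightarrow> sym" where
  "D_act P f = (THE g. (\<lambda>\<gamma>. of_int (sym_coeff g \<gamma>)) = operator P (\<lambda>\<gamma>. of_int (sym_coeff f \<gamma>)))"

definition D_perp :: "Dupper \<Rightarrow> sym \<Rightarrow> sym" where
  "D_perp P g = (THE g'. \<forall>f. sym_pairing f g' = sym_pairing (D_act P f) g)"

definition D_coact :: "sym \<Rightarrow> (Dlower, sym) tensor" where
  "D_coact g = (THE t. \<forall>P f.
     tlift (\<lambda>b g'. D_pairing P b * sym_pairing f g') t = sym_pairing (D_act P f) g)"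

end

(*
  Let M n m be the coefficient of x^n in (x + b_1 x^2 + b_2 x^3 + ...)^m. The sum of all b_l D_l is the
  substitution x_i |-> x_i + b_1 x_i^2 + ..., so D_l maps a series f to the series whose coefficient at
  x^g is the sum over d of f(d) times the coefficient of b_l in K g d = prod_i M (g_i) (d_i). The
  comultiplication of D_* satisfies Delta (M n m) = sum_e M n e (x) M e m, hence it is dual to
  composition, and the adjoint of the action on Sym is contraction with the ring homomorphism
  rho : Sym -> D_* (x) Sym, rho h_n = sum_m M n m (x) h_m.

  All identities for rho are identities between ring homomorphisms, checked on the generators h_n.
  Contracting them with elements of D^* gives the right module, and adjointness with respect to the
  pairing of Sym with itself gives the left module. That Sym is the polynomial ring in the h_n follows
  from two facts: the monomial functions occur as leading terms of products with elementary
  functions, and the form <h_l, h_m> is symmetric because it is multiplicative in both arguments.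
*)

theory Submission
  imports Defs 
begin

text \<open>That the D_l are coefficients of a substitution is Taylor's formula: \<open>vee\<close>
  keeps all derivatives to the right of the x_i, so the divided powers in D_l are the terms in the
  expansion of f(x + b_1 x^2 + ...). Instead of expanding, the proof inducts on the parts of l:
  \<partial>/\<partial>b_k acts on K as one further factor D_k acts on operators, and the
  multiplicity it brings out is the one divided out by the factorials. As K has entries in
  \<int>[b], integrality costs nothing. Two obstacles shape the rest. The comultiplications,
  pairings, actions and the coaction are definite descriptions, so existence and uniqueness have to
  be shown for each; bases given with coordinate functionals (\<open>free_on\<close>) provide both,
  and tensors are compared through pairs of such functionals. Moreover an additive map on Sym need
  not have an adjoint, because Sym is self-dual only degree by degree; bounds on degrees supply it.
  Compatibility with antipodes rests on the uniqueness of convolution inverses.\<close>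

section \<open>Tensor products of rings\<close>

lemma additive_add: "additive f \<Longrightarrow> f (x + y) = f x + f y"
  by (rule additive.add)

lemma additive_0: "additive f \<Longrightarrow> f 0 = 0"
  by (rule additive.zero)

lemma additive_diff: "additive f \<Longrightarrow> f (x - y) = f x - f y"
  by (rule additive.diff)

lemma additive_sum: "additive f \<Longrightarrow> f (sum g A) = (\<Sum>x\<in>A. f (g x))"
  by (rule additive.sum)

lemma additive_zmul: "additive f \<Longrightarrow> f (zmul n x) = zmul n (f x)"
  by (rule zmul_hom)

lemma additive_ident: "additive (\<lambda>x. x)"
  by (simp add: additive_def)

lemma additive_id: "additive id"
  by (simp add: additive_def)

lemma additive_const0: "additive (\<lambda>x. 0)"
  by (simp add: additive_def)

lemma additive_comp: "additive f \<Longrightarrow> additive g \<Longrightarrow> additive (\<lambda>x. f (g x))"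
  by (simp add: additive_def)

lemma additive_plus: "additive f \<Longrightarrow> additive g \<Longrightarrow> additive (\<lambda>x. f x + g x)"
  by (simp add: additive_def)

lemma additive_Sum: "(\<And>i. i \<in> I \<Longrightarrow> additive (f i)) \<Longrightarrow> additive (\<lambda>x. \<Sum>i\<in>I. f i x)"
  by (simp add: additive_def sum.distrib)

lemma additive_zmul_left: "additive f \<Longrightarrow> additive (\<lambda>x. zmul (f x) y)"
  by (simp add: additive_def zmod.scale_left_distrib)

lemma additive_zmul_right: "additive f \<Longrightarrow> additive (\<lambda>x. zmul n (f x))"
  by (simp add: additive_def zmod.scale_right_distrib)

lemma additive_mult_left: "additive f \<Longrightarrow> additive (\<lambda>x. f x * (y :: 'a::ring))"
  by (simp add: additive_def distrib_right)

lemma additive_mult_right: "additive f \<Longrightarrow> additive (\<lambda>x. (y :: 'a::ring) * f x)"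
  by (simp add: additive_def distrib_left)

lemma biadditiveI: "(\<And>a. additive (f a)) \<Longrightarrow> (\<And>b. additive (\<lambda>a. f a b)) \<Longrightarrow> biadditive f"
  by (simp add: biadditive_def)

lemma biadditive_right: "biadditive f \<Longrightarrow> additive (f a)"
  by (simp add: biadditive_def)

lemma biadditive_left: "biadditive f \<Longrightarrow> additive (\<lambda>a. f a b)"
  by (simp add: biadditive_def)

lemma tens_right: "additive f \<Longrightarrow> additive (\<lambda>x. a \<otimes> f x)"
  by (rule additive_comp[OF biadditive_right[OF tens_biadditive]])

lemma tens_left: "additive f \<Longrightarrow> additive (\<lambda>x. f x \<otimes> b)"
  by (rule additive_comp[OF biadditive_left[OF tens_biadditive]])

lemma additive_tlift: "biadditive f \<Longrightarrow> additive (tlift f)"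
  using tlift_universal by blast

lemma tlift_tens: "biadditive f \<Longrightarrow> tlift f (a \<otimes> b) = f a b"
  using tlift_universal by blast

lemma additive_tlift_comp: "biadditive f \<Longrightarrow> additive g \<Longrightarrow> additive (\<lambda>x. tlift f (g x))"
  by (rule additive_comp[OF additive_tlift])

lemma additive_eqI_tensor:
  assumes "additive f" "additive g" "\<And>a b. f (a \<otimes> b) = g (a \<otimes> b)"
  shows "f t = g t"
  using additive_tensor_eqI[OF assms] by simp

text \<open>In nested liftings the outer variable sits inside the bilinear map of the inner one.
  Agreement on pure tensors reduces additivity in it to additivity of the values.\<close>

lemma additive_tlift_param:
  assumes "\<And>x. biadditive (f x)" "\<And>a b. additive (\<lambda>x. f x a b)"
  shows "additive (\<lambda>x. tlift (f x) t)"
proof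
  fix x y
  show "tlift (f (x + y)) t = tlift (f x) t + tlift (f y) t"
  proof (rule additive_eqI_tensor[of "tlift (f (x + y))" "\<lambda>t. tlift (f x) t + tlift (f y) t"])
    show "tlift (f (x + y)) (a \<otimes> b) = tlift (f x) (a \<otimes> b) + tlift (f y) (a \<otimes> b)" for a b
      unfolding tlift_tens[OF assms(1)] by (rule additive_add[OF assms(2)])
  qed (intro additive_plus additive_tlift assms(1))+
qed

lemmas additive_intros =
  additive_ident additive_id additive_const0 additive_plus additive_Sum additive_zmul_left
  additive_zmul_right additive_mult_left additive_mult_right tens_right tens_left
  additive_tlift_comp additive_tlift_param biadditiveI

lemma biadditive_mult: "biadditive ((*) :: 'a::ring \<Rightarrow> _)"
  by (intro additive_intros)

lemma zmul_tens_left: "zmul n a \<otimes> b = zmul n (a \<otimes> b)"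
  by (rule additive_zmul[of "\<lambda>a. a \<otimes> b"]) (intro additive_intros)

lemma zmul_tens_right: "a \<otimes> zmul n b = zmul n (a \<otimes> b)"
  by (rule additive_zmul[of "\<lambda>b. a \<otimes> b"]) (intro additive_intros)

lemma sum_tens: "sum f A \<otimes> b = (\<Sum>i\<in>A. f i \<otimes> b)"
  by (rule additive_sum[of "\<lambda>a. a \<otimes> b"]) (intro additive_intros)

lemma tens_sum: "a \<otimes> sum f A = (\<Sum>i\<in>A. a \<otimes> f i)"
  by (rule additive_sum[of "\<lambda>b. a \<otimes> b"]) (intro additive_intros)

lemma tens_0_left [simp]: "0 \<otimes> b = 0"
  by (rule additive_0[of "\<lambda>a. a \<otimes> b"]) (intro additive_intros)

lemma tens_0_right [simp]: "a \<otimes> 0 = 0"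
  by (rule additive_0[of "\<lambda>b. a \<otimes> b"]) (intro additive_intros)

lemma zmul_of_int: "zmul n (x :: 'a::ring_1) = of_int n * x"
  by (induction n rule: int_induct[where k = 0]) (simp_all add: zmul_add1 zmul_sub1 algebra_simps)

lemma zmul_int [simp]: "zmul n (m :: int) = n * m"
  by (simp add: zmul_of_int)

lemma biadditive_tmap: "additive f \<Longrightarrow> additive g \<Longrightarrow> biadditive (\<lambda>a b. f a \<otimes> g b)"
  by (intro additive_intros)

lemma tmap_tens: "additive f \<Longrightarrow> additive g \<Longrightarrow> tmap f g (a \<otimes> b) = f a \<otimes> g b"
  by (simp add: tmap_def tlift_tens biadditive_tmap)

lemma additive_tmap: "additive f \<Longrightarrow> additive g \<Longrightarrow> additive (tmap f g)"
  unfolding tmap_def by (intro additive_tlift biadditive_tmap)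

lemma additive_tmap_comp:
  "additive f \<Longrightarrow> additive g \<Longrightarrow> additive h \<Longrightarrow> additive (\<lambda>x. tmap f g (h x))"
  by (rule additive_comp[OF additive_tmap])

lemma biadditive_assoc1: "biadditive (\<lambda>a b. a \<otimes> b \<otimes> c)"
  by (intro additive_intros)

lemma biadditive_assoc2: "biadditive (\<lambda>t c. tlift (\<lambda>a b. a \<otimes> b \<otimes> c) t)"
  by (intro additive_intros)

lemma tassoc_tens: "tassoc ((a \<otimes> b) \<otimes> c) = a \<otimes> b \<otimes> c"
  by (simp add: tassoc_def tlift_tens biadditive_assoc1 biadditive_assoc2)

lemma additive_tassoc: "additive tassoc"
  unfolding tassoc_def by (intro additive_intros)

lemma biadditive_tensor_mult1:
  assumes "biadditive m" "biadditive n"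
  shows "biadditive (\<lambda>a' b'. m a a' \<otimes> n b b')"
  by (intro biadditiveI tens_left tens_right biadditive_right[OF assms(1)] biadditive_right[OF assms(2)])

lemma biadditive_tensor_mult2:
  assumes "biadditive m" "biadditive n"
  shows "biadditive (\<lambda>a b. tlift (\<lambda>a' b'. m a a' \<otimes> n b b') t)"
  by (intro additive_intros tens_left tens_right biadditive_right[OF assms(1)] biadditive_right[OF assms(2)]
      biadditive_left[OF assms(1)] biadditive_left[OF assms(2)])

lemma tensor_mult_tens:
  assumes "biadditive m" "biadditive n"
  shows "tensor_mult m n (a \<otimes> b) (a' \<otimes> b') = m a a' \<otimes> n b b'"
  unfolding tensor_mult_def
  by (subst tlift_tens[OF biadditive_tensor_mult2[OF assms, of "a' \<otimes> b'"]])
    (rule tlift_tens[OF biadditive_tensor_mult1[OF assms]])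

lemma biadditive_tensor_mult:
  assumes "biadditive m" "biadditive n"
  shows "biadditive (tensor_mult m n)"
  unfolding tensor_mult_def
  by (rule biadditiveI; intro additive_tlift_param additive_tlift_comp additive_tlift biadditive_tensor_mult1
      biadditive_tensor_mult2 additive_ident assms tens_left tens_right additive_tlift_param biadditive_right[OF assms(1)] biadditive_right[OF assms(2)]
      biadditive_left[OF assms(1)] biadditive_left[OF assms(2)])

text \<open>An augmentation to \<open>\<int>\<close> ensures that a tensor product of rings is a nonzero ring.\<close>

class aug_ring = comm_ring_1 +
  assumes ex_augmentation:
    "\<exists>e :: 'a \<Rightarrow> int. (\<forall>x y. e (x + y) = e x + e y) \<and> (\<forall>x y. e (x * y) = e x * e y) \<and> e 1 = 1"

instance int :: aug_ring
  by standard (rule exI[of _ id], simp)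

lemma aug_ring_additive: "\<exists>e :: 'a::aug_ring \<Rightarrow> int. additive e \<and> (\<forall>x y. e (x * y) = e x * e y) \<and> e 1 = 1"
  using ex_augmentation by (simp add: additive_def)

text \<open>Additive maps that agree on pure tensors agree; this is applied to one variable at a
  time and serves to prove associativity.\<close>

lemma tensor_times_induct3:
  fixes P :: "('a::comm_ring_1, 'b::comm_ring_1) tensor \<Rightarrow> _ \<Rightarrow> _ \<Rightarrow> 'c::ab_group_add"
  assumes "\<And>t u. additive (\<lambda>s. P s t u)" "\<And>s u. additive (\<lambda>t. P s t u)" "\<And>s t. additive (P s t)"
    and "\<And>s u. additive (\<lambda>t. Q s t u)" "\<And>t u. additive (\<lambda>s. Q s t u)" "\<And>s t. additive (Q s t)"
    and eq: "\<And>a b c d e f. P (a \<otimes> b) (c \<otimes> d) (e \<otimes> f) = Q (a \<otimes> b) (c \<otimes> d) (e \<otimes> f)"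
  shows "P s t u = Q s t u"
proof -
  have 1: "P (a \<otimes> b) (c \<otimes> d) u = Q (a \<otimes> b) (c \<otimes> d) u" for a b c d u
    by (rule additive_eqI_tensor[of "P (a \<otimes> b) (c \<otimes> d)" "Q (a \<otimes> b) (c \<otimes> d)"]) (simp_all add: assms)
  have 2: "P (a \<otimes> b) t u = Q (a \<otimes> b) t u" for a b t u
    by (rule additive_eqI_tensor[of "\<lambda>t. P (a \<otimes> b) t u" "\<lambda>t. Q (a \<otimes> b) t u"]) (simp_all add: assms 1)
  show ?thesis
    by (rule additive_eqI_tensor[of "\<lambda>s. P s t u" "\<lambda>s. Q s t u"]) (simp_all add: assms 2)
qed

instantiation tensor :: (aug_ring, aug_ring) aug_ring
begin

definition times_tensor :: "('a, 'b) tensor \<Rightarrow> ('a, 'b) tensor \<Rightarrow> ('a, 'b) tensor" where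
  "times_tensor = tensor_mult (*) (*)"

definition one_tensor :: "('a, 'b) tensor" where
  "one_tensor = 1 \<otimes> 1"

instance
proof
  have bi: "biadditive ((*) :: ('a, 'b) tensor \<Rightarrow> _)"
    unfolding times_tensor_def by (intro biadditive_tensor_mult biadditive_mult)
  have l: "additive (\<lambda>s. f s * t)" if "additive f" for f :: "('a, 'b) tensor \<Rightarrow> _" and t :: "('a, 'b) tensor"
    by (rule additive_comp[OF biadditive_left[OF bi] that])
  have r: "additive (\<lambda>s. t * f s)" if "additive f" for f :: "('a, 'b) tensor \<Rightarrow> _" and t :: "('a, 'b) tensor"
    by (rule additive_comp[OF biadditive_right[OF bi] that])
  have t: "(a \<otimes> b) * (a' \<otimes> b') = (a * a') \<otimes> (b * b')" for a a' :: 'a and b b' :: 'b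
    by (simp add: times_tensor_def tensor_mult_tens biadditive_mult)
  fix s u v :: "('a, 'b) tensor"
  show "s * u * v = s * (u * v)"
    by (rule tensor_times_induct3[of "\<lambda>s u v. s * u * v" "\<lambda>s u v. s * (u * v)"])
      (intro l r additive_ident | simp add: t mult.assoc)+
  show "s * u = u * s"
  proof (rule additive_eqI_tensor[of "\<lambda>s. s * u" "\<lambda>s. u * s"])
    show "(a \<otimes> b) * u = u * (a \<otimes> b)" for a b
      by (rule additive_eqI_tensor[of "\<lambda>u. (a \<otimes> b) * u" "\<lambda>u. u * (a \<otimes> b)"])
        (intro l r additive_ident | simp add: t mult.commute)+
  qed (intro l r additive_ident)+
  show "(s + u) * v = s * v + u * v"
    by (rule additive_add[OF l[OF additive_ident]])
  show "1 * s = s"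
    by (rule additive_eqI_tensor[of "\<lambda>s. 1 * s"]) (intro r additive_ident | simp add: t one_tensor_def)+
  obtain e :: "'a \<Rightarrow> int" where e: "additive e" "\<And>x y. e (x * y) = e x * e y" "e 1 = 1"
    using aug_ring_additive by blast
  obtain e' :: "'b \<Rightarrow> int" where e': "additive e'" "\<And>x y. e' (x * y) = e' x * e' y" "e' 1 = 1"
    using aug_ring_additive by blast
  \<comment> \<open>The product of the two augmentations. It sends 1 to 1, which separates 1 from 0,
    and it is the augmentation that the instance needs.\<close>
  let ?E = "tlift (\<lambda>a b. e a * e' b)"
  have be: "biadditive (\<lambda>a b. e a * e' b)"
    by (intro additive_intros e e')
  have E1: "?E 1 = 1"
    by (simp add: one_tensor_def tlift_tens be e e')
  then show "(0 :: ('a, 'b) tensor) \<noteq> 1"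
    using additive_0[OF additive_tlift[OF be]] by auto
  have E: "?E (a \<otimes> b) = e a * e' b" for a b
    by (simp add: tlift_tens be)
  have aE: "additive (\<lambda>x. ?E (f x))" if "additive f" for f :: "('a, 'b) tensor \<Rightarrow> _"
    by (rule additive_tlift_comp[OF be that])
  have "?E (s * t) = ?E s * ?E t" for s t
  proof (rule additive_eqI_tensor[of "\<lambda>s. ?E (s * t)" "\<lambda>s. ?E s * ?E t"])
    fix a b
    have *: "?E ((a \<otimes> b) * (c \<otimes> d)) = ?E (a \<otimes> b) * ?E (c \<otimes> d)" for c d
      unfolding t E e(2) e'(2) by (simp only: mult_ac)
    show "?E (a \<otimes> b * t) = ?E (a \<otimes> b) * ?E t"
      by (rule additive_eqI_tensor[of "\<lambda>t. ?E (a \<otimes> b * t)" "\<lambda>t. ?E (a \<otimes> b) * ?E t"])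
        (intro aE additive_mult_right r additive_ident | simp only: *)+
  qed (intro aE l additive_mult_left additive_ident)+
  then show "\<exists>e :: ('a, 'b) tensor \<Rightarrow> int.
      (\<forall>x y. e (x + y) = e x + e y) \<and> (\<forall>x y. e (x * y) = e x * e y) \<and> e 1 = 1"
    using E1 additive_add[OF additive_tlift[OF be]] by (intro exI[of _ ?E]) simp
qed

end

lemma tens_times: "(a \<otimes> b) * (a' \<otimes> b') = (a * a') \<otimes> (b * b')"
  by (simp add: times_tensor_def tensor_mult_tens biadditive_mult)

lemma tens_1: "1 \<otimes> 1 = 1"
  by (simp add: one_tensor_def)

lemma tensor_mult_times: "tensor_mult (*) (*) s t = s * t"
  by (simp add: times_tensor_def)

lemma prod_tens: "(\<Prod>i\<in>I. a i \<otimes> b i) = (\<Prod>i\<in>I. a i) \<otimes> (\<Prod>i\<in>I. b i)"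
  by (induction I rule: infinite_finite_induct) (simp_all add: tens_1 tens_times)

section \<open>Ring homomorphisms and tensor products\<close>

definition rhom :: "('a::comm_ring_1 \<Rightarrow> 'b::comm_ring_1) \<Rightarrow> bool" where
  "rhom f \<longleftrightarrow> additive f \<and> f 1 = 1 \<and> (\<forall>x y. f (x * y) = f x * f y)"

lemma rhom_additive: "rhom f \<Longrightarrow> additive f"
  and rhom_1: "rhom f \<Longrightarrow> f 1 = 1"
  and rhom_mult: "rhom f \<Longrightarrow> f (x * y) = f x * f y"
  by (simp_all add: rhom_def)

lemma rhom_0: "rhom f \<Longrightarrow> f 0 = 0"
  by (rule additive_0[OF rhom_additive])

lemma rhom_sum: "rhom f \<Longrightarrow> f (sum g A) = (\<Sum>x\<in>A. f (g x))"
  by (rule additive_sum[OF rhom_additive])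

lemma rhom_prod: "rhom f \<Longrightarrow> f (prod g A) = (\<Prod>x\<in>A. f (g x))"
  by (induction A rule: infinite_finite_induct) (simp_all add: rhom_1 rhom_mult)

lemma rhom_prod_mset: "rhom f \<Longrightarrow> f (\<Prod>x\<in>#A. g x) = (\<Prod>x\<in>#A. f (g x))"
  by (induction A) (simp_all add: rhom_1 rhom_mult)

lemma rhom_of_int: "rhom f \<Longrightarrow> f (of_int n) = of_int n"
  using additive_zmul[OF rhom_additive, of f n 1] by (simp add: zmul_of_int rhom_1)

lemma rhom_id: "rhom id"
  by (simp add: rhom_def additive_id)

lemma rhom_ident: "rhom (\<lambda>x. x)"
  by (simp add: rhom_def additive_ident)

lemma rhom_of_int': "rhom of_int"
  by (simp add: rhom_def additive_def)

lemma rhom_comp: "rhom f \<Longrightarrow> rhom g \<Longrightarrow> rhom (\<lambda>x. f (g x))"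
  by (simp add: rhom_def additive_comp)

text \<open>Multiplicativity on pure tensors spreads by additivity, first to an arbitrary left
  factor, then to an arbitrary right one.\<close>

lemma rhom_tensorI:
  fixes f :: "('a::aug_ring, 'b::aug_ring) tensor \<Rightarrow> 'c::comm_ring_1"
  assumes "additive f" "f (1 \<otimes> 1) = 1"
    "\<And>a b a' b'. f ((a * a') \<otimes> (b * b')) = f (a \<otimes> b) * f (a' \<otimes> b')"
  shows "rhom f"
proof -
  have 1: "f (s * (a \<otimes> b)) = f s * f (a \<otimes> b)" for s a b
    by (rule additive_eqI_tensor[of "\<lambda>s. f (s * (a \<otimes> b))" "\<lambda>s. f s * f (a \<otimes> b)"])
      (intro additive_intros additive_comp[OF assms(1)] assms(1) | simp add: tens_times assms)+
  have "f (s * t) = f s * f t" for s t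
    by (rule additive_eqI_tensor[of "\<lambda>t. f (s * t)" "\<lambda>t. f s * f t"])
      (intro additive_intros additive_comp[OF assms(1)] assms(1) | simp add: 1)+
  with assms show ?thesis by (simp add: rhom_def tens_1)
qed

lemma rhom_tlift:
  fixes f :: "'a::aug_ring \<Rightarrow> 'c::comm_ring_1" and g :: "'b::aug_ring \<Rightarrow> 'c"
  assumes "rhom f" "rhom g"
  shows "rhom (tlift (\<lambda>a b. f a * g b))"
proof -
  have b: "biadditive (\<lambda>a b. f a * g b)"
    by (intro additive_intros rhom_additive assms)
  have t: "tlift (\<lambda>a b. f a * g b) (x \<otimes> y) = f x * g y" for x y
    by (rule tlift_tens[OF b])
  show ?thesis
  proof (rule rhom_tensorI)
    show "tlift (\<lambda>a b. f a * g b) ((a * a') \<otimes> (b * b')) =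
        tlift (\<lambda>a b. f a * g b) (a \<otimes> b) * tlift (\<lambda>a b. f a * g b) (a' \<otimes> b')" for a b a' b'
      unfolding t rhom_mult[OF assms(1)] rhom_mult[OF assms(2)] by (simp only: mult_ac)
  qed (simp_all add: additive_tlift b t rhom_1 assms)
qed

lemma rhom_tmap:
  fixes f :: "'a::aug_ring \<Rightarrow> 'c::aug_ring" and g :: "'b::aug_ring \<Rightarrow> 'd::aug_ring"
  assumes "rhom f" "rhom g"
  shows "rhom (tmap f g)"
  by (rule rhom_tensorI)
    (simp_all add: additive_tmap tmap_tens rhom_additive assms rhom_1 rhom_mult tens_1[symmetric] tens_times)

lemma rhom_tassoc: "rhom (tassoc :: (('a::aug_ring, 'b::aug_ring) tensor, 'c::aug_ring) tensor \<Rightarrow> _)"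
proof (rule rhom_tensorI)
  have a: "additive (\<lambda>x. tassoc (f x \<otimes> c))" if "additive f"
    for f :: "('a, 'b) tensor \<Rightarrow> ('a, 'b) tensor" and c :: 'c
    by (intro additive_comp[OF additive_tassoc] additive_intros that)
  have 1: "tassoc ((s * (x \<otimes> y)) \<otimes> (c * c')) = tassoc (s \<otimes> c) * tassoc ((x \<otimes> y) \<otimes> c')"
    for s :: "('a, 'b) tensor" and x y and c c' :: 'c
    by (rule additive_eqI_tensor[of "\<lambda>s. tassoc ((s * (x \<otimes> y)) \<otimes> (c * c'))"])
      (intro a additive_intros | simp add: tens_times tassoc_tens)+
  show "tassoc ((s * t) \<otimes> (c * c')) = tassoc (s \<otimes> c) * tassoc (t \<otimes> c')"
    for s t :: "('a, 'b) tensor" and c c' :: 'c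
    by (rule additive_eqI_tensor[of "\<lambda>t. tassoc ((s * t) \<otimes> (c * c'))"])
      (intro a additive_intros | simp add: 1)+
qed (simp_all add: additive_tassoc tassoc_tens tens_1[symmetric])

section \<open>Free abelian groups, gradings and antipodes\<close>

lemma additive_eq_on_span:
  assumes "additive f" "additive g" "\<And>x. x \<in> S \<Longrightarrow> f x = g x" "x \<in> zmod.span S"
  shows "f x = g x"
  using assms(4)
  by (induction rule: zmod.span_induct_alt) (simp_all add: additive_0 additive_add additive_zmul assms)

lemma ex1_eq: "\<exists>!x. P x \<Longrightarrow> P a \<Longrightarrow> P b \<Longrightarrow> a = b"
  by blast

lemma zmul_cong0: "(n \<noteq> 0 \<Longrightarrow> x = y) \<Longrightarrow> zmul n x = zmul n y"
  by (cases "n = 0") simp_all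

text \<open>A basis presented by its coordinate functionals: duality gives independence, the span
  gives generation. It yields existence (\<open>ext\<close>) and uniqueness
  (\<open>additive_eqI\<close>) of additive maps with prescribed values, as the definite
  descriptions require.\<close>

locale free_on =
  fixes B :: "'i \<Rightarrow> 'a::ab_group_add" and c :: "'i \<Rightarrow> 'a \<Rightarrow> int"
  assumes additive_coord: "additive (c i)"
    and coord_basis: "c i (B j) = (if i = j then 1 else 0)"
    and span_range: "zmod.span (range B) = UNIV"
begin

lemma in_span: "x \<in> zmod.span (range B)"
  by (simp add: span_range)

lemma additive_coord_comp: "additive g \<Longrightarrow> additive (\<lambda>x. c i (g x))"
  by (rule additive_comp[OF additive_coord])

lemma coord_simps: "c i 0 = 0" "c i (x + y) = c i x + c i y" "c i (zmul n x) = n * c i x"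
  "c i (sum f A) = (\<Sum>a\<in>A. c i (f a))" "c i (x - y) = c i x - c i y"
  by (simp_all add: additive_0[OF additive_coord] additive_add[OF additive_coord]
      additive_zmul[OF additive_coord] additive_sum[OF additive_coord] additive_diff[OF additive_coord])

lemma finite_coords: "finite {i. c i x \<noteq> 0}"
  using in_span[of x]
proof (induction rule: zmod.span_induct_alt)
  case (step n b y)
  then obtain j where "b = B j" by blast
  then have "{i. c i (zmul n b + y) \<noteq> 0} \<subseteq> insert j {i. c i y \<noteq> 0}"
    by (auto simp: coord_simps coord_basis split: if_splits)
  then show ?case using step(2) by (meson finite_insert finite_subset)
qed (simp add: coord_simps)

definition ext :: "('i \<Rightarrow> 'b::ab_group_add) \<Rightarrow> 'a \<Rightarrow> 'b" where
  "ext v x = (\<Sum>i | c i x \<noteq> 0. zmul (c i x) (v i))"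

lemma ext_sum:
  assumes "finite I" "{i. c i x \<noteq> 0} \<subseteq> I"
  shows "ext v x = (\<Sum>i\<in>I. zmul (c i x) (v i))"
  unfolding ext_def using assms by (intro sum.mono_neutral_left) auto

lemma additive_ext: "additive (ext v)"
proof
  fix x y
  let ?I = "{i. c i x \<noteq> 0} \<union> {i. c i y \<noteq> 0}"
  have I: "finite ?I" by (simp add: finite_coords)
  have "ext v (x + y) = (\<Sum>i\<in>?I. zmul (c i (x + y)) (v i))"
    by (rule ext_sum[OF I]) (auto simp: coord_simps)
  moreover have "ext v x = (\<Sum>i\<in>?I. zmul (c i x) (v i))"
    by (rule ext_sum[OF I]) auto
  moreover have "ext v y = (\<Sum>i\<in>?I. zmul (c i y) (v i))"
    by (rule ext_sum[OF I]) auto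
  ultimately show "ext v (x + y) = ext v x + ext v y"
    by (simp add: coord_simps zmod.scale_left_distrib sum.distrib)
qed

lemma ext_basis: "ext v (B j) = v j"
  by (subst ext_sum[of "{j}"]) (auto simp: coord_basis)

lemma additive_eqI: "additive f \<Longrightarrow> additive g \<Longrightarrow> (\<And>i. f (B i) = g (B i)) \<Longrightarrow> f x = g x"
  by (rule additive_eq_on_span[OF _ _ _ in_span]) auto

lemma expand: "ext B x = x"
  by (rule additive_eqI[of "ext B" "\<lambda>x. x"]) (simp_all add: additive_ext additive_ident ext_basis)

lemma coord_eqI: "(\<And>i. c i x = c i y) \<Longrightarrow> x = y"
  using expand[of x] expand[of y] by (simp add: ext_def)

lemma coord_ext_sum: "finite I \<Longrightarrow> c j (\<Sum>i\<in>I. zmul (n i) (B i)) = (if j \<in> I then n j else 0)"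
  by (simp add: coord_simps coord_basis if_distrib sum.delta cong: if_cong)

lemma graded_part_iff: "x \<in> zmod.span {B i |i. d i = n} \<longleftrightarrow> (\<forall>i. c i x \<noteq> 0 \<longrightarrow> d i = n)"
proof
  assume "x \<in> zmod.span {B i |i. d i = n}"
  then show "\<forall>i. c i x \<noteq> 0 \<longrightarrow> d i = n"
    by (induction rule: zmod.span_induct_alt) (auto simp: coord_simps coord_basis split: if_splits)
next
  assume "\<forall>i. c i x \<noteq> 0 \<longrightarrow> d i = n"
  then have "ext B x \<in> zmod.span {B i |i. d i = n}"
    unfolding ext_def by (intro zmod.span_sum zmod.span_scale zmod.span_base) auto
  then show "x \<in> zmod.span {B i |i. d i = n}" by (simp only: expand)
qed

text \<open>The component of degree n of an element keeps the coordinates at basis elements of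
  degree n and sets the others to 0.\<close>

lemma grading_span:
  fixes d :: "'i \<Rightarrow> int"
  shows "grading (\<lambda>n. zmod.span {B i |i. d i = n})"
  unfolding grading_def
proof (intro conjI allI)
  fix x
  define part where "part n = (\<Sum>i | c i x \<noteq> 0 \<and> d i = n. zmul (c i x) (B i))" for n
  have fin: "finite {i. c i x \<noteq> 0 \<and> d i = n}" for n
    by (rule finite_subset[OF _ finite_coords[of x]]) auto
  have c_part: "c i (part n) = (if d i = n then c i x else 0)" for i n
    unfolding part_def by (subst coord_ext_sum[OF fin]) auto
  have "{n. part n \<noteq> 0} \<subseteq> d ` {i. c i x \<noteq> 0}"
  proof
    fix n assume "n \<in> {n. part n \<noteq> 0}"
    then have "\<exists>i. c i (part n) \<noteq> 0" using coord_eqI[of "part n" 0] by (auto simp: coord_simps)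
    then show "n \<in> d ` {i. c i x \<noteq> 0}" by (auto simp: c_part split: if_splits)
  qed
  then have "finite {n. part n \<noteq> 0}" using finite_coords by (meson finite_imageI finite_subset)
  then obtain p where p: "Poly_Mapping.lookup p = part"
    by (metis Abs_poly_mapping_inverse mem_Collect_eq)
  \<comment> \<open>Coordinate i sees only the component of degree \<open>d i\<close>. Hence the
    coordinates of x determine every decomposition, which settles existence and uniqueness
    alike.\<close>
  have sum_c: "c i (\<Sum>n\<in>Poly_Mapping.keys q. Poly_Mapping.lookup q n) = c i (Poly_Mapping.lookup q (d i))"
    if q: "\<forall>n. Poly_Mapping.lookup q n \<in> zmod.span {B i |i. d i = n}" for q i
  proof -
    have "c i (\<Sum>n\<in>Poly_Mapping.keys q. Poly_Mapping.lookup q n) =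
        (\<Sum>n\<in>Poly_Mapping.keys q. if d i = n then c i (Poly_Mapping.lookup q (d i)) else 0)"
      unfolding coord_simps using q[unfolded graded_part_iff] by (intro sum.cong) auto
    also have "\<dots> = c i (Poly_Mapping.lookup q (d i))"
      by (simp add: sum.delta in_keys_iff coord_simps)
    finally show ?thesis .
  qed
  show "\<exists>!q. (\<forall>n. Poly_Mapping.lookup q n \<in> zmod.span {B i |i. d i = n}) \<and>
      x = (\<Sum>n\<in>Poly_Mapping.keys q. Poly_Mapping.lookup q n)"
  proof (rule ex1I[of _ p])
    have *: "\<forall>n. Poly_Mapping.lookup p n \<in> zmod.span {B i |i. d i = n}"
      unfolding graded_part_iff p by (auto simp: c_part)
    moreover have "x = (\<Sum>n\<in>Poly_Mapping.keys p. Poly_Mapping.lookup p n)"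
      by (rule coord_eqI, simp only: sum_c[OF *]) (simp add: p c_part)
    ultimately show "(\<forall>n. Poly_Mapping.lookup p n \<in> zmod.span {B i |i. d i = n}) \<and>
      x = (\<Sum>n\<in>Poly_Mapping.keys p. Poly_Mapping.lookup p n)" by blast
  next
    fix q assume q: "(\<forall>n. Poly_Mapping.lookup q n \<in> zmod.span {B i |i. d i = n}) \<and>
      x = (\<Sum>n\<in>Poly_Mapping.keys q. Poly_Mapping.lookup q n)"
    have cq: "c i (Poly_Mapping.lookup q (d i)) = c i x" for i
      using sum_c[of q i] q by simp
    have "c i (Poly_Mapping.lookup q n) = c i (part n)" for i n
      using q[unfolded graded_part_iff] cq[of i] by (cases "d i = n") (auto simp: c_part)
    then show "q = p"
      by (intro poly_mapping_eqI coord_eqI) (simp add: p)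
  qed
qed (rule zmod.subspace_span)

text \<open>If one grading lies inside another in each degree, uniqueness of decompositions in the
  larger one makes them equal. It shows that homogeneous symmetric functions are spanned by products
  of h_n as well as by the m_l.\<close>

lemma grading_eq_span:
  fixes d :: "'i \<Rightarrow> int"
  assumes G: "grading G" and B: "\<And>i. B i \<in> G (d i)"
  shows "G n = zmod.span {B i |i. d i = n}"
proof
  have sub: "zmod.subspace (G m)" for m using G by (simp add: grading_def)
  have le: "zmod.span {B i |i. d i = m} \<subseteq> G m" for m
    by (rule zmod.span_minimal[OF _ sub]) (use B in auto)
  then show "zmod.span {B i |i. d i = n} \<subseteq> G n" .
  show "G n \<subseteq> zmod.span {B i |i. d i = n}"
  proof
    fix x assume x: "x \<in> G n"
    have "\<exists>!q. (\<forall>m. Poly_Mapping.lookup q m \<in> zmod.span {B i |i. d i = m}) \<and>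
        x = (\<Sum>m\<in>Poly_Mapping.keys q. Poly_Mapping.lookup q m)"
      using grading_span[of d] unfolding grading_def by blast
    then obtain q where q: "\<forall>m. Poly_Mapping.lookup q m \<in> zmod.span {B i |i. d i = m}"
        "x = (\<Sum>m\<in>Poly_Mapping.keys q. Poly_Mapping.lookup q m)"
      by blast
    have 1: "\<exists>!q. (\<forall>n. Poly_Mapping.lookup q n \<in> G n) \<and>
        x = (\<Sum>n\<in>Poly_Mapping.keys q. Poly_Mapping.lookup q n)"
      using G by (simp add: grading_def)
    have 2: "(\<forall>m. Poly_Mapping.lookup q m \<in> G m) \<and>
        x = (\<Sum>m\<in>Poly_Mapping.keys q. Poly_Mapping.lookup q m)" using q le by blast
    \<comment> \<open>A homogeneous x is its own decomposition; comparing with q puts x into the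
      smaller span.\<close>
    have 3: "(\<forall>m. Poly_Mapping.lookup (Poly_Mapping.single n x) m \<in> G m) \<and>
        x = (\<Sum>m\<in>Poly_Mapping.keys (Poly_Mapping.single n x). Poly_Mapping.lookup (Poly_Mapping.single n x) m)"
      using x zmod.subspace_0[OF sub] by (simp add: lookup_single when_def)
    have "q = Poly_Mapping.single n x" by (rule ex1_eq[OF 1 2 3])
    then have "Poly_Mapping.lookup q n = x" by simp
    then show "x \<in> zmod.span {B i |i. d i = n}" using spec[OF q(1), of n] by (simp only:)
  qed
qed

end

text \<open>With \<open>coord_eqI\<close> this says that pairs of coordinate functionals separate
  tensors, the way in which equations in tensor products without ring structure are checked.\<close>

lemma free_on_tensor:
  assumes "free_on B c" "free_on B' c'"
  shows "free_on (\<lambda>(i, j). B i \<otimes> B' j) (\<lambda>(i, j). tlift (\<lambda>a b. c i a * c' j b))"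
proof -
  interpret F: free_on B c by fact
  interpret F': free_on B' c' by fact
  have bi: "biadditive (\<lambda>a b. c i a * c' j b)" for i j
    by (intro additive_intros F.additive_coord F'.additive_coord)
  let ?S = "zmod.span (range (\<lambda>(i, j). B i \<otimes> B' j))"
  have "t \<in> ?S" for t
  proof (induction t rule: tensor_induct)
    case (tens a b)
    have "F.ext B a \<otimes> F'.ext B' b \<in> ?S"
      unfolding F.ext_def F'.ext_def sum_tens tens_sum zmul_tens_left zmul_tens_right
      by (intro zmod.span_sum zmod.span_scale zmod.span_base) auto
    then show ?case by (simp only: F.expand F'.expand)
  qed (auto intro: zmod.span_zero zmod.span_diff)
  then show ?thesis
    by (intro free_on.intro)
      (auto simp: additive_tlift bi tlift_tens F.coord_basis F'.coord_basis split: prod.splits)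
qed

lemma additive_eqI_tensor3:
  assumes "additive f" "additive g" "\<And>a b c. f ((a \<otimes> b) \<otimes> c) = g ((a \<otimes> b) \<otimes> c)"
  shows "f t = g t"
proof (rule additive_eqI_tensor[OF assms(1,2)])
  fix s c
  show "f (s \<otimes> c) = g (s \<otimes> c)"
    by (rule additive_eqI_tensor[of "\<lambda>s. f (s \<otimes> c)" "\<lambda>s. g (s \<otimes> c)"])
      (intro additive_comp[OF assms(1)] additive_comp[OF assms(2)] additive_intros | simp add: assms(3))+
qed

lemma tens_in_tensor_grade: "a \<in> G i \<Longrightarrow> b \<in> G' j \<Longrightarrow> n = i + j \<Longrightarrow> a \<otimes> b \<in> tensor_grade G G' n"
  unfolding tensor_grade_def by (rule zmod.span_base) auto

lemma tensor_grade_sum: "(\<And>i. i \<in> I \<Longrightarrow> f i \<in> tensor_grade G G' n) \<Longrightarrow> sum f I \<in> tensor_grade G G' n"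
  unfolding tensor_grade_def by (rule zmod.span_sum)

lemma additive_span_image:
  assumes "additive f" "\<And>x. x \<in> S \<Longrightarrow> f x \<in> V" "zmod.subspace V" "x \<in> zmod.span S"
  shows "f x \<in> V"
  using assms(4)
  by (induction rule: zmod.span_induct_alt)
    (auto simp: additive_0[OF assms(1)] additive_add[OF assms(1)] additive_zmul[OF assms(1)] 
      intro!: zmod.subspace_0[OF assms(3)] zmod.subspace_add[OF assms(3)] zmod.subspace_scale[OF assms(3)]
        assms(2))

lemma subspace_tensor_grade: "zmod.subspace (tensor_grade G G' n)"
  unfolding tensor_grade_def by (rule zmod.subspace_span)

lemma additive_tensor_grade:
  assumes "additive f" "zmod.subspace V" "t \<in> tensor_grade G G' n"
    "\<And>a b i j. a \<in> G i \<Longrightarrow> b \<in> G' j \<Longrightarrow> i + j = n \<Longrightarrow> f (a \<otimes> b) \<in> V"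
  shows "f t \<in> V"
  by (rule additive_span_image[OF assms(1) _ assms(2) assms(3)[unfolded tensor_grade_def]])
    (use assms(4) in blast)

lemma tensor_mult_grade:
  assumes "biadditive m" "biadditive m'"
    and "\<And>i j x y. x \<in> G i \<Longrightarrow> y \<in> G j \<Longrightarrow> m x y \<in> G (i + j)"
    and "\<And>i j x y. x \<in> G' i \<Longrightarrow> y \<in> G' j \<Longrightarrow> m' x y \<in> G' (i + j)"
    and s: "s \<in> tensor_grade G G' p" and t: "t \<in> tensor_grade G G' q"
  shows "tensor_mult m m' s t \<in> tensor_grade G G' (p + q)"
proof -
  note bi = biadditive_tensor_mult[OF assms(1,2)]
  show ?thesis
  proof (rule additive_tensor_grade[OF biadditive_left[OF bi] subspace_tensor_grade s])
    fix a b i j assume 1: "a \<in> G i" "b \<in> G' j" "i + j = p"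
    show "tensor_mult m m' (a \<otimes> b) t \<in> tensor_grade G G' (p + q)"
    proof (rule additive_tensor_grade[OF biadditive_right[OF bi] subspace_tensor_grade t])
      fix a' b' i' j' assume 2: "a' \<in> G i'" "b' \<in> G' j'" "i' + j' = q"
      show "tensor_mult m m' (a \<otimes> b) (a' \<otimes> b') \<in> tensor_grade G G' (p + q)"
        unfolding tensor_mult_tens[OF assms(1,2)]
        by (rule tens_in_tensor_grade[of _ G "i + i'" _ G' "j + j'"])
          (use 1 2 in \<open>simp_all add: assms(3,4)\<close>)
    qed
  qed
qed

section \<open>Convolution of endomorphisms and uniqueness of antipodes\<close>

definition conv :: "'a::ab_group_add hopf_data \<Rightarrow> ('a \<Rightarrow> 'a) \<Rightarrow> ('a \<Rightarrow> 'a) \<Rightarrow> 'a \<Rightarrow> 'a" where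
  "conv A f g x = tlift (\<lambda>a b. hmult A (f a) (g b)) (hcomult A x)"

abbreviation conv_unit :: "'a::ab_group_add hopf_data \<Rightarrow> 'a \<Rightarrow> 'a" where
  "conv_unit A \<equiv> \<lambda>x. zmul (hcounit A x) (hone A)"

context
  fixes A :: "'a::ab_group_add hopf_data"
  assumes A: "graded_bialgebra A"
begin

lemma biadditive_hmult: "biadditive (hmult A)"
  and additive_hcomult: "additive (hcomult A)"
  and additive_hcounit: "additive (hcounit A)"
  using A by (simp_all add: graded_bialgebra_def graded_algebra_def graded_coalgebra_def)

lemma biadditive_hmult_comp: "additive f \<Longrightarrow> additive g \<Longrightarrow> biadditive (\<lambda>a b. hmult A (f a) (g b))"
  by (intro biadditiveI additive_comp[OF biadditive_left[OF biadditive_hmult]]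
      additive_comp[OF biadditive_right[OF biadditive_hmult]])

text \<open>Both sides are maps \<open>\<Phi>\<close> and \<open>\<Psi>\<close> applied to the two
  iterated comultiplications of x. Associativity of the product identifies \<open>\<Phi>\<close>
  with \<open>\<Psi>\<close> after \<open>tassoc\<close>, and coassociativity does the rest.\<close>

lemma conv_assoc:
  assumes f: "additive f" and g: "additive g" and h: "additive h"
  shows "conv A (conv A f g) h x = conv A f (conv A g h) x"
proof -
  note bl = additive_comp[OF biadditive_left[OF biadditive_hmult]]
  note br = additive_comp[OF biadditive_right[OF biadditive_hmult]]
  define F where "F = tlift (\<lambda>a b. hmult A (f a) (g b))"
  define G where "G = tlift (\<lambda>a b. hmult A (g a) (h b))"
  have aF: "additive F" and aG: "additive G"
    unfolding F_def G_def by (intro additive_tlift biadditive_hmult_comp f g h)+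
  have F: "F (a \<otimes> b) = hmult A (f a) (g b)" and G: "G (a \<otimes> b) = hmult A (g a) (h b)" for a b
    unfolding F_def G_def by (simp_all add: tlift_tens biadditive_hmult_comp f g h)
  define \<Phi> where "\<Phi> = tlift (\<lambda>t c. hmult A (F t) (h c))"
  define \<Psi> where "\<Psi> = tlift (\<lambda>a t. hmult A (f a) (G t))"
  have a\<Phi>: "additive \<Phi>" and a\<Psi>: "additive \<Psi>"
    unfolding \<Phi>_def \<Psi>_def by (intro additive_tlift biadditive_hmult_comp f h aF aG)+
  have \<Phi>: "\<Phi> (t \<otimes> c) = hmult A (F t) (h c)" and \<Psi>: "\<Psi> (a \<otimes> t) = hmult A (f a) (G t)" for a c t
    unfolding \<Phi>_def \<Psi>_def by (simp_all add: tlift_tens biadditive_hmult_comp f h aF aG)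
  have 1: "conv A (conv A f g) h x = \<Phi> (tmap (hcomult A) id (hcomult A x))"
  proof -
    have aC: "additive (conv A f g)"
      using additive_comp[OF aF additive_hcomult] by (simp add: conv_def[abs_def] F_def)
    have b: "biadditive (\<lambda>a b. hmult A (conv A f g a) (h b))"
      by (rule biadditive_hmult_comp[OF aC h])
    show ?thesis
      unfolding conv_def[of A "conv A f g" h]
      by (rule additive_eqI_tensor[OF additive_tlift[OF b] additive_comp[OF a\<Phi> additive_tmap[OF additive_hcomult additive_id]]])
        (simp add: tlift_tens[OF b] tmap_tens additive_hcomult additive_id \<Phi>, simp add: F_def conv_def)
  qed
  have 2: "conv A f (conv A g h) x = \<Psi> (tmap id (hcomult A) (hcomult A x))"
  proof -
    have aC: "additive (conv A g h)"
      using additive_comp[OF aG additive_hcomult] by (simp add: conv_def[abs_def] G_def)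
    have b: "biadditive (\<lambda>a b. hmult A (f a) (conv A g h b))"
      by (rule biadditive_hmult_comp[OF f aC])
    show ?thesis
      unfolding conv_def[of A f "conv A g h"]
      by (rule additive_eqI_tensor[OF additive_tlift[OF b] additive_comp[OF a\<Psi> additive_tmap[OF additive_id additive_hcomult]]])
        (simp add: tlift_tens[OF b] tmap_tens additive_hcomult additive_id \<Psi>, simp add: G_def conv_def)
  qed
  have "\<Phi> t = \<Psi> (tassoc t)" for t
    by (rule additive_eqI_tensor3[OF a\<Phi> additive_comp[OF a\<Psi> additive_tassoc]])
      (use A in \<open>simp add: \<Phi> \<Psi> F G tassoc_tens graded_bialgebra_def graded_algebra_def\<close>)
  then show ?thesis
    using A by (simp add: 1 2 graded_bialgebra_def graded_coalgebra_def)
qed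

lemma hmult_zmul_one: "hmult A a (zmul n (hone A)) = zmul n a" "hmult A (zmul n (hone A)) a = zmul n a"
proof -
  have "hmult A a (zmul n (hone A)) = zmul n (hmult A a (hone A))"
    by (rule additive_zmul[OF biadditive_right[OF biadditive_hmult]])
  moreover have "hmult A (zmul n (hone A)) a = zmul n (hmult A (hone A) a)"
    by (rule additive_zmul[OF biadditive_left[OF biadditive_hmult]])
  ultimately show "hmult A a (zmul n (hone A)) = zmul n a" "hmult A (zmul n (hone A)) a = zmul n a"
    using A by (simp_all add: graded_bialgebra_def graded_algebra_def)
qed

lemma conv_unit_right:
  assumes "additive f"
  shows "conv A f (conv_unit A) x = f x"
proof -
  have b: "biadditive (\<lambda>a b. zmul (hcounit A b) (f a))" "biadditive (\<lambda>a b. zmul (hcounit A b) a)"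
    by (intro additive_intros additive_hcounit assms)+
  have "tlift (\<lambda>a b. zmul (hcounit A b) (f a)) (hcomult A x) = f (tlift (\<lambda>a b. zmul (hcounit A b) a) (hcomult A x))"
    by (rule additive_eqI_tensor[OF additive_tlift[OF b(1)] additive_comp[OF assms additive_tlift[OF b(2)]]])
      (simp add: tlift_tens b additive_zmul[OF assms])
  then show ?thesis
    using A by (simp add: conv_def hmult_zmul_one graded_bialgebra_def graded_coalgebra_def)
qed

lemma conv_unit_left:
  assumes "additive f"
  shows "conv A (conv_unit A) f x = f x"
proof -
  have b: "biadditive (\<lambda>a b. zmul (hcounit A a) (f b))" "biadditive (\<lambda>a b. zmul (hcounit A a) b)"
    by (intro additive_intros additive_hcounit assms)+
  have "tlift (\<lambda>a b. zmul (hcounit A a) (f b)) (hcomult A x) = f (tlift (\<lambda>a b. zmul (hcounit A a) b) (hcomult A x))"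
    by (rule additive_eqI_tensor[OF additive_tlift[OF b(1)] additive_comp[OF assms additive_tlift[OF b(2)]]])
      (simp add: tlift_tens b additive_zmul[OF assms])
  then show ?thesis
    using A by (simp add: conv_def hmult_zmul_one graded_bialgebra_def graded_coalgebra_def)
qed

text \<open>A left inverse equals a right inverse. This serves three times: for uniqueness of
  antipodes, for the antipode of D_* and for the self-adjointness of \<open>sym_S\<close>.\<close>

lemma conv_inverse_unique:
  assumes "additive f" "additive g" "additive h" "conv A f g = conv_unit A" "conv A g h = conv_unit A"
  shows "f = h"
proof
  fix x
  have "f x = conv A f (conv A g h) x" using assms by (simp only: conv_unit_right)
  also have "\<dots> = conv A (conv A f g) h x" by (rule conv_assoc[symmetric]) fact+
  also have "\<dots> = h x" using assms by (simp only: conv_unit_left)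
  finally show "f x = h x" .
qed

lemma is_antipode_iff: "is_antipode A S \<longleftrightarrow> additive S \<and> (\<forall>n. S ` hgrade A n \<subseteq> hgrade A n) \<and>
     conv A S id = conv_unit A \<and> conv A id S = conv_unit A"
  unfolding is_antipode_def conv_def fun_eq_iff by simp

lemma antipode_eq:
  assumes "is_antipode A S"
  shows "antipode A = S"
  unfolding antipode_def
proof (rule the_equality[of _ S])
  show "T = S" if "is_antipode A T" for T
    using that assms conv_inverse_unique[of T id S] by (simp add: is_antipode_iff additive_id)
qed fact

end

section \<open>The Hopf algebra \<open>D\<^sub>*\<close>\<close>

lemma parts_0 [simp]: "parts 0 = {#}"
  by (rule zero_partition.rep_eq)

lemma parts_plus [simp]: "parts (l + m) = parts l + parts m"
  by (rule plus_partition.rep_eq)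

lemma zero_notin_parts [simp]: "0 \<notin># parts l"
  using parts by auto

lemma parts_Abs: "0 \<notin># p \<Longrightarrow> parts (Abs_partition p) = p"
  by (simp add: Abs_partition_inverse)

lemma partition_eqI: "parts l = parts m \<Longrightarrow> l = m"
  by (simp add: parts_inject)

definition part1 :: "nat \<Rightarrow> partition" where
  "part1 k = Abs_partition {#k#}"

lemma parts_part1: "0 < k \<Longrightarrow> parts (part1 k) = {#k#}"
  by (simp add: part1_def parts_Abs)

lemma partition_induct [case_names 0 add]:
  assumes "P 0" "\<And>k l. 0 < k \<Longrightarrow> P l \<Longrightarrow> P (part1 k + l)"
  shows "P l"
proof -
  have "P (Abs_partition p)" if "0 \<notin># p" for p
    using that
  proof (induction p)
    case empty
    then show ?case using assms(1) by (simp add: zero_partition_def)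
  next
    case (add k p)
    have "Abs_partition (add_mset k p) = part1 k + Abs_partition p"
      using add.prems by (intro partition_eqI) (simp add: parts_Abs parts_part1)
    then show ?case using add assms(2)[of k "Abs_partition p"] by auto
  qed
  from this[of "parts l"] show ?thesis by (simp add: parts_inverse)
qed

lemma partition_plus_eq_0: "l + m = 0 \<longleftrightarrow> l = 0 \<and> (m :: partition) = 0"
proof -
  have "l = 0 \<longleftrightarrow> parts l = {#}" for l by (metis parts_0 partition_eqI)
  then show ?thesis by simp
qed

lemma weight_0 [simp]: "weight 0 = 0"
  by (simp add: weight_def)

lemma weight_plus [simp]: "weight (l + m) = weight l + weight m"
  by (simp add: weight_def)

lemma weight_part1: "0 < k \<Longrightarrow> weight (part1 k) = k"
  by (simp add: weight_def parts_part1)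

lemma part1_neq_0: "0 < k \<Longrightarrow> part1 k \<noteq> 0"
  using weight_part1[of k] by auto

lemma weight_eq_0: "weight l = 0 \<longleftrightarrow> l = 0"
  by (induction l rule: partition_induct) (auto simp: weight_part1 partition_plus_eq_0 part1_neq_0)

lemma size_le_weight: "size (parts l) \<le> weight l"
  by (induction l rule: partition_induct) (auto simp: weight_part1 parts_part1)

text \<open>Parts are positive, so the weight bounds both their number and their size.\<close>

lemma finite_weight: "finite {l. weight l \<le> n}"
proof (rule finite_imageD)
  show "finite (parts ` {l. weight l \<le> n})"
  proof (rule finite_subset)
    show "parts ` {l. weight l \<le> n} \<subseteq> (\<Union>k\<le>n. multisets_of_size {..n} k)"
    proof
      fix p assume "p \<in> parts ` {l. weight l \<le> n}"
      then obtain l where l: "p = parts l" "weight l \<le> n" by blast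
      have "size p \<le> n" using size_le_weight[of l] l by simp
      moreover have "k \<le> n" if "k \<in># p" for k
        using that l sum_mset.remove[of k "parts l"] by (simp add: weight_def)
      ultimately show "p \<in> (\<Union>k\<le>n. multisets_of_size {..n} k)"
        by (auto simp: multisets_of_size_def)
    qed
  qed (intro finite_UN_I finite_multisets_of_size finite_atMost)
qed (auto intro: inj_onI partition_eqI)

lemma finite_partition_pairs: "finite {(m, n). m + n = (l :: partition)}"
  by (rule finite_subset[of _ "{m. weight m \<le> weight l} \<times> {m. weight m \<le> weight l}"])
    (auto simp: finite_weight)

lemma poly_mapping_add_induct [case_names 0 single add]:
  fixes p :: "'a \<Rightarrow>\<^sub>0 'b::comm_monoid_add"
  assumes "P 0" "\<And>k v. P (Poly_Mapping.single k v)" "\<And>p q. P p \<Longrightarrow> P q \<Longrightarrow> P (p + q)"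
  shows "P p"
proof (induction p rule: update_induct)
  case (update f a b)
  then have "Poly_Mapping.update a b f = Poly_Mapping.single a b + f"
    by (intro poly_mapping_eqI) (auto simp: lookup_update lookup_add lookup_single when_def in_keys_iff)
  then show ?case using assms update by simp
qed (rule assms)

text \<open>The augmentation sums the augmented coefficients, that is, it evaluates every monomial
  at 1.\<close>

instance poly_mapping :: (comm_monoid_add, aug_ring) aug_ring
proof
  obtain e :: "'b \<Rightarrow> int" where e: "additive e" "\<And>x y. e (x * y) = e x * e y" "e 1 = 1"
    using aug_ring_additive by blast
  define E where "E p = (\<Sum>k\<in>Poly_Mapping.keys p. e (Poly_Mapping.lookup p k))" for p :: "'a \<Rightarrow>\<^sub>0 'b"
  have E_sup: "E p = (\<Sum>k\<in>A. e (Poly_Mapping.lookup p k))"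
    if "finite A" "Poly_Mapping.keys p \<subseteq> A" for p A
    unfolding E_def using that by (intro sum.mono_neutral_left) (auto simp: in_keys_iff additive_0[OF e(1)])
  have E_add: "E (p + q) = E p + E q" for p q
    using Poly_Mapping.keys_add[of p q]
    by (simp add: E_sup[of "Poly_Mapping.keys p \<union> Poly_Mapping.keys q"] lookup_add
        additive_add[OF e(1)] sum.distrib)
  have E_single: "E (Poly_Mapping.single k a) = e a" for k a
    by (simp add: E_def additive_0[OF e(1)])
  have E_0: "E 0 = 0" by (simp add: E_def)
  have "E (p * q) = E p * E q" for p q
  proof (induction p rule: poly_mapping_add_induct)
    case (single k v)
    show ?case
      by (induction q rule: poly_mapping_add_induct)
        (simp_all add: mult_single E_single e distrib_left E_add E_0)
  qed (simp_all add: distrib_right E_add E_0)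
  moreover have "E 1 = 1" using E_single[of 0 1] e by simp
  ultimately show "\<exists>e :: ('a \<Rightarrow>\<^sub>0 'b) \<Rightarrow> int.
      (\<forall>x y. e (x + y) = e x + e y) \<and> (\<forall>x y. e (x * y) = e x * e y) \<and> e 1 = 1"
    using E_add by (intro exI[of _ E]) simp
qed

lemma b_mono_0: "b_mono 0 = 1"
  by (simp add: b_mono_def)

lemma b_mono_plus: "b_mono (l + m) = b_mono l * b_mono m"
  by (simp add: b_mono_def mult_single)

lemma b_gen_0 [simp]: "b_gen 0 = 1"
  by (simp add: b_gen_def)

lemma b_gen_part1: "0 < k \<Longrightarrow> b_gen k = b_mono (part1 k)"
  by (simp add: b_gen_def part1_def)

lemma b_mono_prod: "b_mono l = (\<Prod>k\<in>#parts l. b_gen k)"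
  by (induction l rule: partition_induct) (simp_all add: b_mono_0 b_mono_plus b_gen_part1 parts_part1)

interpretation Db: free_on b_mono "\<lambda>l p. Poly_Mapping.lookup p l"
proof (rule free_on.intro)
  show "additive (\<lambda>p. Poly_Mapping.lookup p l)" for l :: partition
    by (simp add: additive_def lookup_add)
  show "Poly_Mapping.lookup (b_mono m) l = (if l = m then 1 else 0)" for l m
    by (simp add: b_mono_def lookup_single when_def)
  have "p \<in> zmod.span (range b_mono)" for p :: Dlower
    by (rule frag_induction[of p UNIV])
      (auto simp: b_mono_def[abs_def] intro: zmod.span_zero zmod.span_diff zmod.span_base)
  then show "zmod.span (range b_mono) = UNIV" by blast
qed

text \<open>The evaluation homomorphism at b_k = \<beta> k for k > 0. As b_0 is 1 it always goes to
  1, which is why \<open>ev_b_gen\<close> asks for a positive index.\<close>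

definition ev :: "(nat \<Rightarrow> 'b::comm_ring_1) \<Rightarrow> Dlower \<Rightarrow> 'b" where
  "ev \<beta> = Db.ext (\<lambda>l. \<Prod>k\<in>#parts l. \<beta> k)"

lemma additive_ev: "additive (ev \<beta>)"
  unfolding ev_def by (rule Db.additive_ext)

lemma ev_b_mono: "ev \<beta> (b_mono l) = (\<Prod>k\<in>#parts l. \<beta> k)"
  unfolding ev_def by (rule Db.ext_basis)

lemma rhom_DlowerI:
  assumes "additive f" "f 1 = 1" "\<And>l m. f (b_mono (l + m)) = f (b_mono l) * f (b_mono m)"
  shows "rhom f"
proof -
  have 1: "f (p * b_mono m) = f p * f (b_mono m)" for p m
    by (rule Db.additive_eqI[of "\<lambda>p. f (p * b_mono m)" "\<lambda>p. f p * f (b_mono m)"])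
      (intro additive_intros additive_comp[OF assms(1)] assms(1) | simp add: assms(3) flip: b_mono_plus)+
  have "f (p * q) = f p * f q" for p q
    by (rule Db.additive_eqI[of "\<lambda>q. f (p * q)" "\<lambda>q. f p * f q"])
      (intro additive_intros additive_comp[OF assms(1)] assms(1) | simp add: 1)+
  then show ?thesis using assms by (simp add: rhom_def)
qed

lemma rhom_ev: "rhom (ev \<beta>)"
  by (rule rhom_DlowerI) (simp_all add: additive_ev ev_b_mono b_mono_0[symmetric])

lemma ev_b_gen: "0 < k \<Longrightarrow> ev \<beta> (b_gen k) = \<beta> k"
  by (simp add: b_gen_part1 ev_b_mono parts_part1)

lemma rhom_Dlower_b_mono: "rhom f \<Longrightarrow> f (b_mono l) = (\<Prod>k\<in>#parts l. f (b_gen k))"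
  by (simp add: b_mono_prod rhom_prod_mset)

lemma rhom_Dlower_eqI:
  assumes "rhom f" "rhom g" "\<And>k. 0 < k \<Longrightarrow> f (b_gen k) = g (b_gen k)"
  shows "f p = g p"
proof (rule Db.additive_eqI[OF rhom_additive[OF assms(1)] rhom_additive[OF assms(2)]])
  have "f (b_gen k) = g (b_gen k)" for k
    using assms by (cases "k = 0") (simp_all add: rhom_1)
  then show "f (b_mono l) = g (b_mono l)" for l
    by (simp add: rhom_Dlower_b_mono assms)
qed

definition Dlower_grade :: "int \<Rightarrow> Dlower set" where
  "Dlower_grade n = {p. \<forall>l\<in>Poly_Mapping.keys p. int (weight l) = n}"

lemma Dlower_grade_eq: "Dlower_grade n = zmod.span {b_mono l |l. int (weight l) = n}"
  unfolding Dlower_grade_def Db.graded_part_iff[abs_def] set_eq_iff by (auto simp: in_keys_iff Db.graded_part_iff)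

lemma grading_Dlower: "grading Dlower_grade"
  unfolding Dlower_grade_eq[abs_def] by (rule Db.grading_span)

lemma subspace_Dlower_grade: "zmod.subspace (Dlower_grade n)"
  unfolding Dlower_grade_eq by (rule zmod.subspace_span)

text \<open>The target carries just a family of subgroups compatible with products, so that the
  lemma applies to tensor products and to Sym as well.\<close>

lemma rhom_Dlower_graded:
  fixes f :: "Dlower \<Rightarrow> 'b::comm_ring_1"
  assumes f: "rhom f" and G: "\<And>n. zmod.subspace (G n)" "1 \<in> G 0"
    "\<And>i j x y. x \<in> G i \<Longrightarrow> y \<in> G j \<Longrightarrow> x * y \<in> G (i + j)"
    and gen: "\<And>k. 0 < k \<Longrightarrow> f (b_gen k) \<in> G (int k)"
    and p: "p \<in> Dlower_grade n"
  shows "f p \<in> G n"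
proof (rule additive_span_image[OF rhom_additive[OF f] _ G(1) p[unfolded Dlower_grade_eq]])
  have "f (b_mono l) \<in> G (int (weight l))" for l
  proof (induction l rule: partition_induct)
    case 0
    then show ?case by (simp add: b_mono_0 rhom_1 f G)
  next
    case (add k l)
    then show ?case
      using G(3)[OF gen[of k] add.IH] by (simp add: b_mono_plus rhom_mult f b_gen_part1 weight_part1)
  qed
  then show "f x \<in> G n" if "x \<in> {b_mono l |l. int (weight l) = n}" for x
    using that by auto
qed

lemma b_mono_grade: "b_mono l \<in> Dlower_grade (int (weight l))"
  unfolding Dlower_grade_eq by (rule zmod.span_base) blast

lemma b_gen_grade: "b_gen k \<in> Dlower_grade (int k)"
  using b_mono_grade[of 0] b_mono_grade[of "part1 k"]
  by (cases "k = 0") (simp_all add: b_mono_0 b_gen_part1 weight_part1)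

lemma one_Dlower_grade: "1 \<in> Dlower_grade 0"
  using b_mono_grade[of 0] by (simp add: b_mono_0)

lemma Dlower_grade_mult:
  assumes "p \<in> Dlower_grade i" "q \<in> Dlower_grade j"
  shows "p * q \<in> Dlower_grade (i + j)"
proof (rule additive_span_image[of "\<lambda>p. p * q", OF _ _ subspace_Dlower_grade assms(1)[unfolded Dlower_grade_eq]])
  fix x assume "x \<in> {b_mono l |l. int (weight l) = i}"
  then obtain l where l: "x = b_mono l" "int (weight l) = i" by blast
  show "x * q \<in> Dlower_grade (i + j)"
  proof (rule additive_span_image[of "\<lambda>q. x * q", OF _ _ subspace_Dlower_grade assms(2)[unfolded Dlower_grade_eq]])
    fix y assume "y \<in> {b_mono l |l. int (weight l) = j}"
    then obtain m where m: "y = b_mono m" "int (weight m) = j" by blast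
    show "x * y \<in> Dlower_grade (i + j)"
      using b_mono_grade[of "l + m"] l m by (simp add: b_mono_plus)
  qed (intro additive_intros)
qed (intro additive_intros)

section \<open>Powers of b and the matrix M\<close>

lemma b_power_part_0: "b_power_part 0 d = (if d = 0 then 1 else 0)"
  by (simp add: b_power_part_def)

lemma b_power_part_Suc: "b_power_part (Suc m) d = (\<Sum>i\<le>d. b_gen i * b_power_part m (d - i))"
  by (simp add: b_power_part_def fps_mult_nth atLeast0AtMost)

lemma b_power_part_add:
  "b_power_part (a + b) d = (\<Sum>i\<le>d. b_power_part a i * b_power_part b (d - i))"
  by (simp add: b_power_part_def fps_mult_nth power_add atLeast0AtMost)

lemma b_power_part_deg_0: "b_power_part m 0 = 1"
  by (induction m) (simp_all add: b_power_part_0 b_power_part_Suc)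

lemma b_power_part_1: "b_power_part (Suc 0) d = b_gen d"
  by (simp add: b_power_part_def)

lemma b_power_part_grade: "b_power_part m d \<in> Dlower_grade (int d)"
proof (induction m arbitrary: d)
  case 0
  then show ?case
    using one_Dlower_grade zmod.subspace_0[OF subspace_Dlower_grade] by (simp add: b_power_part_0)
next
  case (Suc m)
  show ?case
    unfolding b_power_part_Suc
  proof (rule zmod.subspace_sum[OF subspace_Dlower_grade])
    fix i assume "i \<in> {..d}"
    then show "b_gen i * b_power_part m (d - i) \<in> Dlower_grade (int d)"
      using Dlower_grade_mult[OF b_gen_grade[of i] Suc[of "d - i"]] by simp
  qed
qed

text \<open>
  \<open>M n m\<close> is the coefficient of \<open>x\<^sup>n\<close> in \<open>(x + b\<^sub>1 x\<^sup>2 + b\<^sub>2 x\<^sup>3 + \<dots>)\<^sup>m\<close>. Composition of such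
  substitutions becomes multiplication of the matrices \<open>M\<close>.
\<close>

definition M :: "nat \<Rightarrow> nat \<Rightarrow> Dlower" where
  "M n m = (if m \<le> n then b_power_part m (n - m) else 0)"

lemma M_less: "n < m \<Longrightarrow> M n m = 0"
  by (simp add: M_def)

lemma M_refl [simp]: "M n n = 1"
  by (simp add: M_def b_power_part_deg_0)

lemma M_0_right: "M n 0 = (if n = 0 then 1 else 0)"
  by (simp add: M_def b_power_part_0)

lemma M_1: "M (Suc k) (Suc 0) = b_gen k"
  by (simp add: M_def b_power_part_1)

lemma M_grade: "M n m \<in> Dlower_grade (int n - int m)"
proof (cases "m \<le> n")
  case True
  then show ?thesis using b_power_part_grade[of m "n - m"] by (simp add: M_def of_nat_diff)
next
  case False
  then show ?thesis using zmod.subspace_0[OF subspace_Dlower_grade] by (simp add: M_def)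
qed

text \<open>The (a + b)-th power of x + b_1 x^2 + ... is a product of two powers. The index i starts
  effectively at a, since the a-th power is divisible by x^a; this explains the shift by a in the
  proof.\<close>

lemma M_add: "M n (a + b) = (\<Sum>i\<le>n. M i a * M (n - i) b)"
proof (cases "a + b \<le> n")
  case True
  have "(\<Sum>i\<le>n. M i a * M (n - i) b) = (\<Sum>i\<in>{a..n - b}. M i a * M (n - i) b)"
    by (rule sum.mono_neutral_right) (auto simp: M_def)
  also have "\<dots> = (\<Sum>j\<le>n - (a + b). b_power_part a j * b_power_part b (n - (a + b) - j))"
    by (rule sum.reindex_bij_witness[of _ "\<lambda>j. j + a" "\<lambda>i. i - a"])
      (use True in \<open>auto simp: M_def diff_diff_add add.commute add.left_commute\<close>)
  finally show ?thesis using True by (simp add: M_def b_power_part_add)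
next
  case False
  then have "M i a * M (n - i) b = 0" if "i \<le> n" for i
    using that by (auto simp: M_def)
  with False show ?thesis by (simp add: M_def)
qed

text \<open>Column 1 of M consists of 0 and all the b_k, with row k + 1 containing b_k.\<close>

lemma rhom_Dlower_eqI_M:
  assumes "rhom f" "rhom g" "\<And>n. f (M n 1) = g (M n 1)"
  shows "f p = g p"
proof (rule rhom_Dlower_eqI[OF assms(1,2)])
  show "f (b_gen k) = g (b_gen k)" for k
    using assms(3)[of "Suc k"] by (simp add: M_1)
qed

lemma Dlower_comult_universal:
  "rhom Dlower_comult \<and> (\<forall>k\<ge>1. Dlower_comult (b_gen k) = (\<Sum>i\<le>k. b_power_part (i + 1) (k - i) \<otimes> b_gen i))"
proof -
  let ?\<beta> = "\<lambda>k. \<Sum>i\<le>k. b_power_part (i + 1) (k - i) \<otimes> b_gen i"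
  have *: "Dlower_comult = ev ?\<beta>"
    unfolding Dlower_comult_def
  proof (rule the_equality)
    show "additive (ev ?\<beta>) \<and> ev ?\<beta> 1 = 1 \<otimes> 1 \<and>
        (\<forall>p q. ev ?\<beta> (p * q) = tensor_mult (*) (*) (ev ?\<beta> p) (ev ?\<beta> q)) \<and>
        (\<forall>k\<ge>1. ev ?\<beta> (b_gen k) = ?\<beta> k)"
      using rhom_ev[of ?\<beta>] by (simp add: rhom_def tens_1 tensor_mult_times ev_b_gen)
  next
    fix D assume D: "additive D \<and> D 1 = 1 \<otimes> 1 \<and>
        (\<forall>p q. D (p * q) = tensor_mult (*) (*) (D p) (D q)) \<and> (\<forall>k\<ge>1. D (b_gen k) = ?\<beta> k)"
    then have "rhom D" by (simp add: rhom_def tens_1 tensor_mult_times)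
    then show "D = ev ?\<beta>"
      by (intro ext) (rule rhom_Dlower_eqI[OF _ rhom_ev], use D in \<open>simp_all add: ev_b_gen\<close>)
  qed
  show ?thesis unfolding * by (simp add: rhom_ev ev_b_gen)
qed

lemma rhom_Dlower_comult: "rhom Dlower_comult"
  using Dlower_comult_universal by blast

text \<open>For n = k + 1 this is the prescribed formula with e = i + 1, since
  \<open>(b)^{i+1}_{k-i}\<close> is \<open>M (k + 1) (i + 1)\<close> and b_i is
  \<open>M (i + 1) 1\<close>. The additional term e = 0 vanishes.\<close>

lemma Dlower_comult_M1: "Dlower_comult (M n 1) = (\<Sum>e\<le>n. M n e \<otimes> M e 1)"
proof (cases n)
  case 0
  then show ?thesis by (simp add: M_less rhom_0[OF rhom_Dlower_comult])
next
  case (Suc k)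
  have "Dlower_comult (b_gen k) = (\<Sum>i\<le>k. b_power_part (i + 1) (k - i) \<otimes> b_gen i)"
    using Dlower_comult_universal
    by (cases "k = 0") (simp_all add: rhom_1 b_power_part_deg_0 tens_1)
  also have "\<dots> = (\<Sum>i\<le>k. M (Suc k) (Suc i) \<otimes> M (Suc i) 1)"
    by (rule sum.cong) (simp_all add: M_def b_power_part_1)
  also have "\<dots> = (\<Sum>e\<le>n. M n e \<otimes> M e 1)"
    unfolding Suc sum.atMost_Suc_shift by (simp add: M_0_right)
  finally show ?thesis by (simp add: Suc M_1)
qed

text \<open>Columns of M come from powers of a single series, so summing over k contracts
  \<open>M k a * M (n - k) c\<close> to \<open>M n (a + c)\<close>; then e = a + c. Thus Cauchy
  products pass through M, which is used for the comultiplication of D_*, and for the coaction on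
  h_n and on the antipode.\<close>

lemma M_convolution:
  fixes X Y :: "nat \<Rightarrow> 'a::aug_ring"
  shows "(\<Sum>k\<le>n. (\<Sum>a\<le>k. M k a \<otimes> X a) * (\<Sum>c\<le>n - k. M (n - k) c \<otimes> Y c)) =
    (\<Sum>e\<le>n. M n e \<otimes> (\<Sum>a\<le>e. X a * Y (e - a)))"
proof -
  \<comment> \<open>M is lower triangular, so all inner sums can run up to n; independent ranges
    make the sums exchangeable.\<close>
  have ext: "(\<Sum>e\<le>i. M i e \<otimes> Z e) = (\<Sum>e\<le>n. M i e \<otimes> Z e)" if "i \<le> n" for i and Z :: "nat \<Rightarrow> 'a"
    using that by (intro sum.mono_neutral_left) (auto simp: M_less)
  have "(\<Sum>k\<le>n. (\<Sum>a\<le>k. M k a \<otimes> X a) * (\<Sum>c\<le>n - k. M (n - k) c \<otimes> Y c)) =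
      (\<Sum>k\<le>n. (\<Sum>a\<le>n. M k a \<otimes> X a) * (\<Sum>c\<le>n. M (n - k) c \<otimes> Y c))"
    by (intro sum.cong refl arg_cong2[of _ _ _ _ "(*)"] ext) auto
  also have "\<dots> = (\<Sum>k\<le>n. \<Sum>a\<le>n. \<Sum>c\<le>n. (M k a * M (n - k) c) \<otimes> (X a * Y c))"
    by (simp only: sum_product tens_times)
  also have "\<dots> = (\<Sum>a\<le>n. \<Sum>c\<le>n. \<Sum>k\<le>n. (M k a * M (n - k) c) \<otimes> (X a * Y c))"
    by (subst sum.swap, rule sum.cong[OF refl], rule sum.swap)
  also have "\<dots> = (\<Sum>a\<le>n. \<Sum>c\<le>n. M n (a + c) \<otimes> (X a * Y c))"
    by (simp only: M_add sum_tens)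
  also have "\<dots> = (\<Sum>a\<le>n. \<Sum>e\<le>n. if a \<le> e then M n e \<otimes> (X a * Y (e - a)) else 0)"
  proof (rule sum.cong[OF refl])
    fix a assume "a \<in> {..n}"
    have "(\<Sum>c\<le>n. M n (a + c) \<otimes> (X a * Y c)) = (\<Sum>c\<in>{..n - a}. M n (a + c) \<otimes> (X a * Y c))"
      by (rule sum.mono_neutral_right) (auto simp: M_def)
    also have "\<dots> = (\<Sum>e\<in>{a..n}. M n e \<otimes> (X a * Y (e - a)))"
      by (rule sum.reindex_bij_witness[of _ "\<lambda>e. e - a" "\<lambda>c. a + c"]) (use \<open>a \<in> {..n}\<close> in auto)
    also have "\<dots> = (\<Sum>e\<le>n. if a \<le> e then M n e \<otimes> (X a * Y (e - a)) else 0)"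
      by (rule sum.mono_neutral_cong_left) auto
    finally show "(\<Sum>c\<le>n. M n (a + c) \<otimes> (X a * Y c)) = \<dots>" .
  qed
  also have "\<dots> = (\<Sum>e\<le>n. \<Sum>a\<le>n. if a \<le> e then M n e \<otimes> (X a * Y (e - a)) else 0)"
    by (rule sum.swap)
  also have "\<dots> = (\<Sum>e\<le>n. M n e \<otimes> (\<Sum>a\<le>e. X a * Y (e - a)))"
  proof (rule sum.cong[OF refl])
    fix e assume "e \<in> {..n}"
    then have "(\<Sum>a\<le>n. if a \<le> e then M n e \<otimes> (X a * Y (e - a)) else 0) =
        (\<Sum>a\<le>e. M n e \<otimes> (X a * Y (e - a)))"
      by (intro sum.mono_neutral_cong_right) auto
    then show "(\<Sum>a\<le>n. if a \<le> e then M n e \<otimes> (X a * Y (e - a)) else 0) = M n e \<otimes> (\<Sum>a\<le>e. X a * Y (e - a))"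
      by (simp add: tens_sum)
  qed
  finally show ?thesis .
qed

text \<open>Induction on the exponent: \<open>M_add\<close> splits off a first power, and
  \<open>M_convolution\<close> with X = column m and Y = column 1 reassembles the power.\<close>

lemma Dlower_comult_M: "Dlower_comult (M n m) = (\<Sum>e\<le>n. M n e \<otimes> M e m)"
proof (induction m arbitrary: n)
  case 0
  have "(\<Sum>e\<le>n. M n e \<otimes> M e 0) = (\<Sum>e\<le>n. if e = 0 then M n 0 \<otimes> 1 else 0)"
    by (rule sum.cong) (auto simp: M_0_right)
  then show ?case
    by (simp add: M_0_right rhom_0 rhom_1 rhom_Dlower_comult tens_1)
next
  case (Suc m)
  have "Dlower_comult (M n (Suc m)) = Dlower_comult (\<Sum>k\<le>n. M k m * M (n - k) 1)"
    using M_add[of n m 1] by simp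
  then show ?case
    using M_add[of _ m 1]
    by (simp add: rhom_sum[OF rhom_Dlower_comult] rhom_mult[OF rhom_Dlower_comult] Suc
        Dlower_comult_M1[simplified] M_convolution)
qed

definition Dlower_counit :: "Dlower \<Rightarrow> int" where
  "Dlower_counit p = Poly_Mapping.lookup p 0"

lemma rhom_Dlower_counit: "rhom Dlower_counit"
proof (rule rhom_DlowerI)
  show "additive Dlower_counit"
    unfolding Dlower_counit_def by (rule Db.additive_coord)
  show "Dlower_counit (b_mono (l + m)) = Dlower_counit (b_mono l) * Dlower_counit (b_mono m)" for l m
    unfolding Dlower_counit_def Db.coord_basis using partition_plus_eq_0[of l m] by (metis mult_1 mult_zero_left mult_zero_right)
qed (simp add: Dlower_counit_def lookup_one)

lemma Dlower_counit_graded: "p \<in> Dlower_grade n \<Longrightarrow> n \<noteq> 0 \<Longrightarrow> Dlower_counit p = 0"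
  unfolding Dlower_grade_def Dlower_counit_def by (force simp: in_keys_iff)

lemma Dlower_counit_M: "Dlower_counit (M n m) = (if n = m then 1 else 0)"
  using Dlower_counit_graded[OF M_grade] rhom_1[OF rhom_Dlower_counit] by auto

lemma Dlower_coassoc:
  "tassoc (tmap Dlower_comult id (Dlower_comult p)) = tmap id Dlower_comult (Dlower_comult p)"
proof (rule rhom_Dlower_eqI_M[of "\<lambda>p. tassoc (tmap Dlower_comult id (Dlower_comult p))"])
  note \<Delta> = rhom_Dlower_comult
  show "rhom (\<lambda>p. tassoc (tmap Dlower_comult id (Dlower_comult p)))"
    by (intro rhom_comp[OF rhom_tassoc] rhom_comp[OF rhom_tmap[OF \<Delta> rhom_id]] \<Delta>)
  show "rhom (\<lambda>p. tmap id Dlower_comult (Dlower_comult p))"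
    by (intro rhom_comp[OF rhom_tmap[OF rhom_id \<Delta>]] \<Delta>)
  note a = rhom_additive[OF \<Delta>]
  fix n
  have "tassoc (tmap Dlower_comult id (Dlower_comult (M n 1))) = (\<Sum>e\<le>n. \<Sum>f\<le>n. M n f \<otimes> M f e \<otimes> M e 1)"
    by (simp only: Dlower_comult_M additive_sum[OF additive_tmap[OF a additive_id]] tmap_tens[OF a additive_id]
        sum_tens id_apply additive_sum[OF additive_tassoc] tassoc_tens)
  also have "\<dots> = (\<Sum>f\<le>n. \<Sum>e\<le>n. M n f \<otimes> M f e \<otimes> M e 1)"
    by (rule sum.swap)
  \<comment> \<open>Terms with e > f vanish by triangularity; the inner range becomes that of the
    comultiplication of \<open>M f 1\<close>.\<close>
  also have "\<dots> = (\<Sum>f\<le>n. \<Sum>e\<le>f. M n f \<otimes> M f e \<otimes> M e 1)"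
    by (intro sum.cong refl sum.mono_neutral_right) (auto simp: M_less)
  also have "\<dots> = tmap id Dlower_comult (Dlower_comult (M n 1))"
    by (simp only: Dlower_comult_M additive_sum[OF additive_tmap[OF additive_id a]] tmap_tens[OF additive_id a]
        tens_sum id_apply)
  finally show "tassoc (tmap Dlower_comult id (Dlower_comult (M n 1))) = tmap id Dlower_comult (Dlower_comult (M n 1))" .
qed

lemma rhom_of_int_comp: "rhom f \<Longrightarrow> rhom (\<lambda>x. of_int (f x))"
  by (rule rhom_comp[OF rhom_of_int'])

lemma Dlower_counit_left: "tlift (\<lambda>a b. zmul (Dlower_counit a) b) (Dlower_comult p) = p"
proof -
  have r: "rhom (tlift (\<lambda>a b. of_int (Dlower_counit a) * b) :: (Dlower, Dlower) tensor \<Rightarrow> Dlower)"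
    by (intro rhom_tlift rhom_of_int_comp rhom_Dlower_counit rhom_ident)
  have b: "biadditive (\<lambda>a (b :: Dlower). of_int (Dlower_counit a) * b)"
    unfolding zmul_of_int[symmetric] by (intro additive_intros rhom_additive[OF rhom_Dlower_counit])
  show ?thesis
    unfolding zmul_of_int
  proof (rule rhom_Dlower_eqI_M[OF rhom_comp[OF r rhom_Dlower_comult] rhom_ident])
    fix n
    have "tlift (\<lambda>a b. of_int (Dlower_counit a) * b) (Dlower_comult (M n 1)) =
        (\<Sum>e\<le>n. if n = e then M n 1 else 0)"
      unfolding Dlower_comult_M rhom_sum[OF r] tlift_tens[OF b]
      by (intro sum.cong) (auto simp: Dlower_counit_M)
    then show "tlift (\<lambda>a b. of_int (Dlower_counit a) * b) (Dlower_comult (M n 1)) = M n 1" by simp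
  qed
qed

lemma Dlower_counit_right: "tlift (\<lambda>a b. zmul (Dlower_counit b) a) (Dlower_comult p) = p"
proof -
  have r: "rhom (tlift (\<lambda>a b. a * of_int (Dlower_counit b)) :: (Dlower, Dlower) tensor \<Rightarrow> Dlower)"
    by (intro rhom_tlift rhom_of_int_comp rhom_Dlower_counit rhom_ident)
  have b: "biadditive (\<lambda>(a :: Dlower) b. a * of_int (Dlower_counit b))"
    unfolding mult.commute[of _ "of_int _"] zmul_of_int[symmetric]
    by (intro additive_intros rhom_additive[OF rhom_Dlower_counit])
  show ?thesis
    unfolding zmul_of_int mult.commute[of "of_int _"]
  proof (rule rhom_Dlower_eqI_M[OF rhom_comp[OF r rhom_Dlower_comult] rhom_ident])
    fix n
    have "tlift (\<lambda>a b. a * of_int (Dlower_counit b)) (Dlower_comult (M n 1)) =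
        (\<Sum>e\<le>n. if e = 1 then M n 1 else 0)"
      unfolding Dlower_comult_M rhom_sum[OF r] tlift_tens[OF b]
      by (intro sum.cong) (auto simp: Dlower_counit_M)
    then show "tlift (\<lambda>a b. a * of_int (Dlower_counit b)) (Dlower_comult (M n 1)) = M n 1"
      by (simp add: M_less)
  qed
qed

lemma Dlower_comult_graded: "p \<in> Dlower_grade n \<Longrightarrow> Dlower_comult p \<in> tensor_grade Dlower_grade Dlower_grade n"
proof (rule rhom_Dlower_graded[OF rhom_Dlower_comult, of "tensor_grade Dlower_grade Dlower_grade"])
  show "1 \<in> tensor_grade Dlower_grade Dlower_grade 0"
    unfolding tens_1[symmetric] by (rule tens_in_tensor_grade[of _ _ 0 _ _ 0]) (simp_all add: one_Dlower_grade)
  show "x * y \<in> tensor_grade Dlower_grade Dlower_grade (i + j)"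
    if "x \<in> tensor_grade Dlower_grade Dlower_grade i" "y \<in> tensor_grade Dlower_grade Dlower_grade j" for i j x y
    unfolding tensor_mult_times[symmetric]
    by (rule tensor_mult_grade[OF biadditive_mult biadditive_mult _ _ that]) (rule Dlower_grade_mult, assumption+)+
  fix k :: nat
  have "Dlower_comult (M (Suc k) 1) \<in> tensor_grade Dlower_grade Dlower_grade (int k)"
    unfolding Dlower_comult_M
    by (intro tensor_grade_sum tens_in_tensor_grade[where G = Dlower_grade and G' = Dlower_grade, OF M_grade M_grade]) simp
  then show "Dlower_comult (b_gen k) \<in> tensor_grade Dlower_grade Dlower_grade (int k)"
    by (simp add: M_1)
qed (rule subspace_tensor_grade)

lemma Dlower_hopf_simps [simp]:
  "hgrade Dlower_hopf = Dlower_grade" "hmult Dlower_hopf = (*)" "hone Dlower_hopf = 1"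
  "hcomult Dlower_hopf = Dlower_comult" "hcounit Dlower_hopf = Dlower_counit"
  by (simp_all add: Dlower_hopf_def Dlower_grade_def Dlower_counit_def fun_eq_iff)

lemma graded_bialgebra_Dlower: "graded_bialgebra Dlower_hopf"
  unfolding graded_bialgebra_def graded_algebra_def graded_coalgebra_def Dlower_hopf_simps
  by (intro conjI allI ballI impI grading_Dlower biadditive_mult Dlower_grade_mult one_Dlower_grade
      rhom_additive[OF rhom_Dlower_comult] rhom_additive[OF rhom_Dlower_counit] Dlower_coassoc
      Dlower_counit_left Dlower_counit_right Dlower_comult_graded Dlower_counit_graded)
    (simp_all add: mult.assoc tensor_mult_times rhom_mult rhom_1 rhom_Dlower_comult rhom_Dlower_counit tens_1)

fun right_inverse_gen :: "(Dlower \<Rightarrow> Dlower) \<Rightarrow> nat \<Rightarrow> Dlower" where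
  "right_inverse_gen f k =
     (if k = 0 then 1 else - (\<Sum>i<k. f (b_power_part (Suc i) (k - i)) * right_inverse_gen f i))"

declare right_inverse_gen.simps [simp del]

lemma right_inverse_gen_0: "right_inverse_gen f 0 = 1"
  by (simp add: right_inverse_gen.simps)

lemma rhom_conv_Dlower: "rhom f \<Longrightarrow> rhom g \<Longrightarrow> rhom (conv Dlower_hopf f g)"
  unfolding conv_def[abs_def] by (simp add: rhom_comp[OF rhom_tlift rhom_Dlower_comult])

text \<open>D_* is commutative, so the convolution of two ring homomorphisms is one again and the
  identity need only be checked on generators, where it is the recursion.\<close>

lemma right_inverse_Dlower:
  assumes f: "rhom f"
  shows "conv Dlower_hopf f (ev (right_inverse_gen f)) = conv_unit Dlower_hopf"
proof
  fix p
  let ?r = "right_inverse_gen f" and ?g = "ev (right_inverse_gen f)"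
  have g: "?g (b_gen k) = ?r k" for k
    by (cases "k = 0") (simp_all add: ev_b_gen rhom_1[OF rhom_ev] right_inverse_gen.simps[of f 0])
  have b: "biadditive (\<lambda>a b. f a * ?g b)"
    by (intro additive_intros rhom_additive f rhom_ev)
  show "conv Dlower_hopf f ?g p = conv_unit Dlower_hopf p"
  proof (rule rhom_Dlower_eqI[OF rhom_conv_Dlower[OF f rhom_ev]])
    show "rhom (conv_unit Dlower_hopf)"
      by (simp add: zmul_of_int rhom_of_int_comp rhom_Dlower_counit)
    fix k :: nat assume k: "0 < k"
    have "conv Dlower_hopf f ?g (b_gen k) = (\<Sum>i\<le>k. f (b_power_part (Suc i) (k - i)) * ?g (b_gen i))"
      using Dlower_comult_universal k
      by (simp add: conv_def additive_sum[OF additive_tlift[OF b]] tlift_tens[OF b])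
    also have "\<dots> = 0"
      using k unfolding g
      by (simp add: right_inverse_gen.simps[of f k] lessThan_Suc_atMost[symmetric] b_power_part_deg_0 rhom_1[OF f])
    also have "\<dots> = conv_unit Dlower_hopf (b_gen k)"
      using Dlower_counit_graded[OF b_gen_grade, of k] k by simp
    finally show "conv Dlower_hopf f ?g (b_gen k) = conv_unit Dlower_hopf (b_gen k)" .
  qed
qed

definition Dlower_S :: "Dlower \<Rightarrow> Dlower" where
  "Dlower_S = ev (right_inverse_gen id)"

lemma rhom_Dlower_S: "rhom Dlower_S"
  unfolding Dlower_S_def by (rule rhom_ev)

lemma Dlower_S_grade: "p \<in> Dlower_grade n \<Longrightarrow> Dlower_S p \<in> Dlower_grade n"
proof (rule rhom_Dlower_graded[OF rhom_Dlower_S subspace_Dlower_grade one_Dlower_grade Dlower_grade_mult])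
  have "right_inverse_gen id k \<in> Dlower_grade (int k)" for k
  proof (induction k rule: less_induct)
    case (less k)
    show ?case
    proof (cases "k = 0")
      case True
      then show ?thesis by (simp only: right_inverse_gen_0 one_Dlower_grade of_nat_0)
    next
      case False
      have "b_power_part (Suc i) (k - i) * right_inverse_gen id i \<in> Dlower_grade (int k)" if "i < k" for i
      proof -
        have "int (k - i) + int i = int k" using that by simp
        then show ?thesis
          using Dlower_grade_mult[OF b_power_part_grade[of "Suc i" "k - i"] less[OF that]] by (simp only:)
      qed
      then have "- (\<Sum>i<k. b_power_part (Suc i) (k - i) * right_inverse_gen id i) \<in> Dlower_grade (int k)"
        by (intro zmod.subspace_neg zmod.subspace_sum subspace_Dlower_grade) simp
      moreover have "right_inverse_gen id k = - (\<Sum>i<k. b_power_part (Suc i) (k - i) * right_inverse_gen id i)"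
        using False by (subst right_inverse_gen.simps) (simp only: if_False id_apply)
      ultimately show ?thesis by (simp only:)
    qed
  qed
  then show "Dlower_S (b_gen k) \<in> Dlower_grade (int k)" if "0 < k" for k
    using that by (simp add: Dlower_S_def ev_b_gen)
qed

text \<open>A right inverse with a right inverse of its own is a two-sided inverse.\<close>

lemma is_antipode_Dlower_S: "is_antipode Dlower_hopf Dlower_S"
proof -
  have 1: "conv Dlower_hopf id Dlower_S = conv_unit Dlower_hopf"
    unfolding Dlower_S_def by (rule right_inverse_Dlower[OF rhom_id])
  have 2: "conv Dlower_hopf Dlower_S (ev (right_inverse_gen Dlower_S)) = conv_unit Dlower_hopf"
    by (rule right_inverse_Dlower[OF rhom_Dlower_S])
  have "id = ev (right_inverse_gen Dlower_S)"
    by (rule conv_inverse_unique[OF graded_bialgebra_Dlower additive_id rhom_additive[OF rhom_Dlower_S] additive_ev 1 2])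
  with 1 2 show ?thesis
    unfolding is_antipode_iff[OF graded_bialgebra_Dlower]
    by (auto simp: rhom_additive[OF rhom_Dlower_S] Dlower_S_grade)
qed

lemma hopf_algebra_Dlower: "hopf_algebra Dlower_hopf"
  unfolding hopf_algebra_def using graded_bialgebra_Dlower is_antipode_Dlower_S by blast

section \<open>Symmetric functions\<close>

text \<open>The distributive law, a divisor of a monomial being a choice of exponent in each
  variable. It passes from one variable to monomials in all later computations with
  \<open>e_sym\<close>, \<open>\<delta>b\<close>, \<open>\<rho>\<close> and
  \<open>K\<close>.\<close>

lemma sum_submsets_prod:
  fixes F :: "'a \<Rightarrow> nat \<Rightarrow> 'b::comm_ring_1"
  shows "(\<Sum>\<delta> | \<delta> \<subseteq># \<gamma>. \<Prod>i\<in>set_mset \<gamma>. F i (count \<delta> i)) = (\<Prod>i\<in>set_mset \<gamma>. \<Sum>d\<le>count \<gamma> i. F i d)"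
proof -
  let ?S = "set_mset \<gamma>"
  \<comment> \<open>Elements of \<open>PiE\<close> are undefined off the support, while
    multiplicities are 0 there; \<open>restrict\<close> and the conditional in its inverse translate
    between the two conventions.\<close>
  let ?f = "\<lambda>\<delta>. restrict (count \<delta>) ?S"
  have "(\<Prod>i\<in>?S. \<Sum>d\<le>count \<gamma> i. F i d) = (\<Sum>g\<in>PiE ?S (\<lambda>i. {..count \<gamma> i}). \<Prod>i\<in>?S. F i (g i))"
    by (rule prod_sum_PiE) auto
  also have "\<dots> = (\<Sum>\<delta> | \<delta> \<subseteq># \<gamma>. \<Prod>i\<in>?S. F i (count \<delta> i))"
  proof (rule sum.reindex_bij_witness[of _ ?f "\<lambda>g. Abs_multiset (\<lambda>i. if i \<in> ?S then g i else 0)"])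
    fix g assume g: "g \<in> PiE ?S (\<lambda>i. {..count \<gamma> i})"
    have "{i. 0 < (if i \<in> ?S then g i else 0)} \<subseteq> ?S" by auto
    then have c: "count (Abs_multiset (\<lambda>i. if i \<in> ?S then g i else 0)) = (\<lambda>i. if i \<in> ?S then g i else 0)"
      by (intro count_Abs_multiset) (metis finite_set_mset finite_subset)
    show "?f (Abs_multiset (\<lambda>i. if i \<in> ?S then g i else 0)) = g"
      using g by (auto simp: c fun_eq_iff PiE_def extensional_def)
    show "Abs_multiset (\<lambda>i. if i \<in> ?S then g i else 0) \<in> {\<delta>. \<delta> \<subseteq># \<gamma>}"
      using g by (auto simp: c subseteq_mset_def PiE_def Pi_def)
    show "(\<Prod>i\<in>?S. F i (count (Abs_multiset (\<lambda>i. if i \<in> ?S then g i else 0)) i)) = (\<Prod>i\<in>?S. F i (g i))"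
      by (rule prod.cong) (simp_all add: c)
  next
    fix \<delta> assume \<delta>: "\<delta> \<in> {\<delta>. \<delta> \<subseteq># \<gamma>}"
    then show "?f \<delta> \<in> PiE ?S (\<lambda>i. {..count \<gamma> i})"
      by (auto simp: subseteq_mset_def)
    have "(\<lambda>i. if i \<in> ?S then ?f \<delta> i else 0) = count \<delta>"
      using \<delta> by (auto simp: fun_eq_iff dest: mset_subset_eqD)
    then show "Abs_multiset (\<lambda>i. if i \<in> ?S then ?f \<delta> i else 0) = \<delta>"
      by (simp only: count_inverse)
  qed
  finally show ?thesis ..
qed

lemma additive_sym_coeff: "additive (\<lambda>f. sym_coeff f \<gamma>)"
  by (simp add: additive_def plus_sym.rep_eq)

lemmas sym_coeff_simps = additive_0[OF additive_sym_coeff] additive_add[OF additive_sym_coeff]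
  additive_diff[OF additive_sym_coeff] additive_sum[OF additive_sym_coeff] additive_zmul[OF additive_sym_coeff]

lemma sym_coeff_mult: "sym_coeff (f * g) \<gamma> = (\<Sum>\<alpha> | \<alpha> \<subseteq># \<gamma>. sym_coeff f \<alpha> * sym_coeff g (\<gamma> - \<alpha>))"
  by (simp add: times_sym.rep_eq series_mult_def)

lemma sym_eqI: "(\<And>\<gamma>. sym_coeff f \<gamma> = sym_coeff g \<gamma>) \<Longrightarrow> f = g"
  by (simp add: sym_coeff_inject[symmetric] fun_eq_iff)

lemma rhom_sym_counit: "rhom sym_counit"
  unfolding rhom_def sym_counit_def
proof (intro conjI allI)
  fix f g :: sym
  have "{\<alpha>. \<alpha> \<subseteq># {#}} = {{#} :: mono}" by auto
  then show "sym_coeff (f * g) {#} = sym_coeff f {#} * sym_coeff g {#}"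
    by (simp add: sym_coeff_mult)
qed (simp_all add: additive_sym_coeff one_sym.rep_eq)

instance sym :: aug_ring
  by standard (rule exI[of _ sym_counit],
    simp add: additive_add[OF rhom_additive] rhom_mult rhom_1 rhom_sym_counit)

lemma zero_notin_exponents [simp]: "0 \<notin># exponents \<gamma>"
  by (force simp: exponents_def count_eq_zero_iff)

definition mtype :: "mono \<Rightarrow> partition" where
  "mtype \<gamma> = Abs_partition (exponents \<gamma>)"

lemma parts_mtype: "parts (mtype \<gamma>) = exponents \<gamma>"
  by (simp add: mtype_def parts_Abs)

lemma weight_mtype: "weight (mtype \<gamma>) = size \<gamma>"
  by (simp add: weight_def parts_mtype sum_exponents)

lemma exponents_add_block:
  assumes "i \<notin># \<gamma>" "0 < k"
  shows "exponents (\<gamma> + replicate_mset k i) = add_mset k (exponents \<gamma>)"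
proof -
  have "set_mset (\<gamma> + replicate_mset k i) = insert i (set_mset \<gamma>)" using assms by auto
  moreover have "image_mset (count (\<gamma> + replicate_mset k i)) (mset_set (set_mset \<gamma>)) =
      image_mset (count \<gamma>) (mset_set (set_mset \<gamma>))"
    by (rule image_mset_cong) (use assms in auto)
  ultimately show ?thesis
    using assms by (simp add: exponents_def not_in_iff)
qed

lemma ex_mono_of_type: "\<exists>\<gamma>. mtype \<gamma> = l"
proof (induction l rule: partition_induct)
  case 0
  show ?case by (rule exI[of _ "{#}"], rule partition_eqI) (simp add: parts_mtype exponents_def)
next
  case (add k l)
  then obtain \<gamma> where \<gamma>: "mtype \<gamma> = l" by blast
  obtain i where i: "i \<notin># \<gamma>"
    using ex_new_if_finite[OF infinite_UNIV_nat, of "set_mset \<gamma>"] by auto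
  have "mtype (\<gamma> + replicate_mset k i) = part1 k + l"
    by (rule partition_eqI)
      (simp add: parts_mtype exponents_add_block[OF i add(1)] parts_part1[OF add(1)] \<gamma>[symmetric])
  then show ?case by blast
qed

text \<open>One monomial for each orbit under permutation of the variables; the coefficient there is
  the coordinate at \<open>m_sym l\<close>.\<close>

definition gam :: "partition \<Rightarrow> mono" where
  "gam l = (SOME \<gamma>. mtype \<gamma> = l)"

lemma mtype_gam [simp]: "mtype (gam l) = l"
  unfolding gam_def by (rule someI_ex[OF ex_mono_of_type])

lemma exponents_gam [simp]: "exponents (gam l) = parts l"
  using parts_mtype[of "gam l"] by simp

lemma size_gam [simp]: "size (gam l) = weight l"
  using weight_mtype[of "gam l"] by simp

text \<open>Induction on the number of variables: remove a variable i of one monomial and a variable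
  j with the same exponent from the other, then correct the bijection so that it sends i to
  j.\<close>

lemma exponents_eq_imp_permuted:
  assumes "exponents \<gamma> = exponents \<gamma>'"
  shows "\<exists>\<pi>. bij \<pi> \<and> image_mset \<pi> \<gamma> = \<gamma>'"
  using assms
proof (induction "card (set_mset \<gamma>)" arbitrary: \<gamma> \<gamma>')
  case 0
  then have "\<gamma> = {#}" by simp
  moreover have "\<gamma>' = {#}"
  proof -
    have "size (exponents \<gamma>') = 0" using 0(2) \<open>\<gamma> = {#}\<close> by (simp add: exponents_def flip: 0(2))
    then show ?thesis by (simp add: exponents_def)
  qed
  ultimately show ?case by (intro exI[of _ id] conjI bij_id) simp
next
  case (Suc n)
  then obtain i where i: "i \<in># \<gamma>" by (metis card_eq_0_iff nat.distinct(1) set_mset_eq_empty_iff multiset_nonemptyE)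
  define k where "k = count \<gamma> i"
  have k: "0 < k" using i by (simp add: k_def)
  have "k \<in># exponents \<gamma>" using i by (auto simp: exponents_def k_def)
  then have "k \<in># exponents \<gamma>'" using Suc.prems by simp
  then obtain j where j: "j \<in># \<gamma>'" "count \<gamma>' j = k" by (auto simp: exponents_def)
  define \<gamma>1 where "\<gamma>1 = filter_mset (\<lambda>a. a \<noteq> i) \<gamma>"
  define \<gamma>2 where "\<gamma>2 = filter_mset (\<lambda>a. a \<noteq> j) \<gamma>'"
  have 1: "\<gamma> = \<gamma>1 + replicate_mset k i" and 2: "\<gamma>' = \<gamma>2 + replicate_mset k j"
    by (auto simp: multiset_eq_iff \<gamma>1_def \<gamma>2_def k_def j(2))
  have i1: "i \<notin># \<gamma>1" and j2: "j \<notin># \<gamma>2" by (simp_all add: \<gamma>1_def \<gamma>2_def)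
  have "exponents \<gamma>1 = exponents \<gamma>2"
    using Suc.prems exponents_add_block[OF i1 k] exponents_add_block[OF j2 k] by (simp flip: 1 2)
  moreover have "n = card (set_mset \<gamma>1)"
  proof -
    have "set_mset \<gamma> = insert i (set_mset \<gamma>1)" using 1 k by auto
    then show ?thesis using Suc(2) i1 by simp
  qed
  ultimately obtain \<pi> where \<pi>: "bij \<pi>" "image_mset \<pi> \<gamma>1 = \<gamma>2" using Suc.hyps(1) by blast
  \<comment> \<open>The transposition of \<pi> i and j. Neither occurs in \<gamma>2, so what the
    induction achieved is kept.\<close>
  let ?\<tau> = "\<lambda>a. if a = \<pi> i then j else if a = j then \<pi> i else a"
  have \<tau>: "bij ?\<tau>"
    by (rule bij_betw_byWitness[of _ ?\<tau>]) auto
  have "\<pi> i \<notin># \<gamma>2" using i1 \<pi> by (auto simp: bij_def inj_eq)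
  then have "image_mset ?\<tau> \<gamma>2 = image_mset id \<gamma>2"
    using j2 by (intro image_mset_cong) auto
  then have "image_mset (?\<tau> \<circ> \<pi>) \<gamma> = \<gamma>'"
    by (simp add: 1 2 \<pi>(2) flip: multiset.map_comp)
  then show ?case using bij_comp[OF \<pi>(1) \<tau>] by blast
qed

lemma sym_coeff_permute: "bij \<pi> \<Longrightarrow> sym_coeff f (image_mset \<pi> \<gamma>) = sym_coeff f \<gamma>"
  using sym_coeff[of f] by (simp add: symmetric_series_def)

lemma sym_coeff_mtype: "mtype \<gamma> = mtype \<gamma>' \<Longrightarrow> sym_coeff f \<gamma> = sym_coeff f \<gamma>'"
  using exponents_eq_imp_permuted[of \<gamma> \<gamma>'] sym_coeff_permute by (metis parts_mtype)

lemma sym_coeff_gam: "sym_coeff f (gam (mtype \<gamma>)) = sym_coeff f \<gamma>"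
  by (rule sym_coeff_mtype) simp

lemma sym_coeff_bounded: "\<exists>d. \<forall>\<gamma>. sym_coeff f \<gamma> \<noteq> 0 \<longrightarrow> size \<gamma> \<le> d"
  using sym_coeff[of f] by (simp add: symmetric_series_def)

lemma sym_coeff_m_sym: "sym_coeff (m_sym l) \<gamma> = (if mtype \<gamma> = l then 1 else 0)"
  by (simp add: m_sym.rep_eq parts_mtype[symmetric] parts_inject)

interpretation Sm: free_on m_sym "\<lambda>l f. sym_coeff f (gam l)"
proof (rule free_on.intro)
  have "f \<in> zmod.span (range m_sym)" for f
  proof -
    obtain d where d: "\<And>\<gamma>. sym_coeff f \<gamma> \<noteq> 0 \<Longrightarrow> size \<gamma> \<le> d" using sym_coeff_bounded by blast
    \<comment> \<open>The degree bound in the definition of symmetric series is what makes this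
      expansion finite.\<close>
    have "f = (\<Sum>l | weight l \<le> d. zmul (sym_coeff f (gam l)) (m_sym l))"
    proof (rule sym_eqI)
      fix \<gamma>
      have "sym_coeff (\<Sum>l | weight l \<le> d. zmul (sym_coeff f (gam l)) (m_sym l)) \<gamma> =
          (\<Sum>l | weight l \<le> d. if mtype \<gamma> = l then sym_coeff f \<gamma> else 0)"
        unfolding sym_coeff_simps by (intro sum.cong) (auto simp: sym_coeff_m_sym sym_coeff_gam)
      also have "\<dots> = sym_coeff f \<gamma>"
        using d[of \<gamma>] finite_weight[of d] by (auto simp: sum.delta weight_mtype)
      finally show "sym_coeff f \<gamma> = sym_coeff (\<Sum>l | weight l \<le> d. zmul (sym_coeff f (gam l)) (m_sym l)) \<gamma>" ..
    qed
    moreover have "\<dots> \<in> zmod.span (range m_sym)"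
      by (intro zmod.span_sum zmod.span_scale zmod.span_base) auto
    ultimately show ?thesis by (simp only:)
  qed
  then show "zmod.span (range m_sym) = UNIV" by blast
qed (auto simp: additive_sym_coeff sym_coeff_m_sym)

lemma homogeneous_eq: "homogeneous n = zmod.span {m_sym l |l. int (weight l) = n}"
proof -
  have "(\<forall>\<gamma>. sym_coeff f \<gamma> \<noteq> 0 \<longrightarrow> int (size \<gamma>) = n) \<longleftrightarrow> (\<forall>l. sym_coeff f (gam l) \<noteq> 0 \<longrightarrow> int (weight l) = n)" for f
    by (metis size_gam sym_coeff_gam weight_mtype)
  then show ?thesis by (auto simp: homogeneous_def Sm.graded_part_iff)
qed

lemma grading_homogeneous: "grading homogeneous"
  unfolding homogeneous_eq[abs_def] by (rule Sm.grading_span)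

lemma subspace_homogeneous: "zmod.subspace (homogeneous n)"
  unfolding homogeneous_eq by (rule zmod.subspace_span)

lemma homogeneous_mult:
  assumes "f \<in> homogeneous i" "g \<in> homogeneous j"
  shows "f * g \<in> homogeneous (i + j)"
  unfolding homogeneous_def
proof (intro CollectI allI impI)
  fix \<gamma> assume "sym_coeff (f * g) \<gamma> \<noteq> 0"
  then obtain \<alpha> where "\<alpha> \<subseteq># \<gamma>" "sym_coeff f \<alpha> * sym_coeff g (\<gamma> - \<alpha>) \<noteq> 0"
    unfolding sym_coeff_mult by (metis (no_types, lifting) mem_Collect_eq sum.neutral)
  moreover have "size \<gamma> = size \<alpha> + size (\<gamma> - \<alpha>)"
    using \<open>\<alpha> \<subseteq># \<gamma>\<close> by (metis size_union subset_mset.add_diff_inverse)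
  ultimately show "int (size \<gamma>) = i + j"
    using assms by (auto simp: homogeneous_def)
qed

lemma one_homogeneous: "1 \<in> homogeneous 0"
  by (simp add: homogeneous_def one_sym.rep_eq)

lemma h_sym_homogeneous: "h_sym n \<in> homogeneous (int n)"
  by (simp add: homogeneous_def h_sym.rep_eq)

lemma h_sym_0 [simp]: "h_sym 0 = 1"
  by (rule sym_eqI) (simp add: h_sym.rep_eq one_sym.rep_eq)

text \<open>The elementary symmetric functions have two purposes: they give the leading-term
  argument for surjectivity of \<theta> and the antipode of Sym.\<close>

lift_definition e_sym :: "nat \<Rightarrow> sym" is "\<lambda>n \<gamma>. if size \<gamma> = n \<and> (\<forall>i. count \<gamma> i \<le> 1) then 1 else 0"
proof -
  fix n
  have "(\<forall>i. count (image_mset \<pi> \<gamma>) i \<le> 1) \<longleftrightarrow> (\<forall>i. count \<gamma> i \<le> 1)" if \<pi>: "bij \<pi>" for \<pi> :: "nat \<Rightarrow> nat" and \<gamma>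
  proof -
    have "(\<forall>i. count \<gamma> i \<le> 1) \<longleftrightarrow> (\<forall>k\<in>#exponents \<gamma>. k \<le> 1)" for \<gamma> :: mono
      by (auto simp: exponents_def) (metis count_inI le0)
    then show ?thesis by (simp add: exponents_image[OF \<pi>])
  qed
  then show "(\<lambda>\<gamma>. if size \<gamma> = n \<and> (\<forall>i. count \<gamma> i \<le> 1) then 1 else 0) \<in> symmetric_series"
    by (auto simp: symmetric_series_def)
qed

text \<open>E(-t) H(t) = 1. At a monomial of degree n the coefficient is the sum of signs over its
  squarefree divisors, which factors into 1 - 1 for each variable.\<close>

lemma e_h_convolution:
  assumes "0 < n"
  shows "(\<Sum>i\<le>n. (- 1) ^ i * e_sym i * h_sym (n - i)) = 0"
proof (rule sym_eqI)
  fix \<gamma>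
  let ?sq = "\<lambda>\<alpha> :: mono. \<forall>i. count \<alpha> i \<le> 1"
  have c: "sym_coeff ((- 1) ^ i * f) \<gamma> = (- 1) ^ i * sym_coeff f \<gamma>" for i f
    using zmul_of_int[of "(- 1) ^ i" f] additive_zmul[OF additive_sym_coeff[of \<gamma>], of "(- 1) ^ i" f] by simp
  have "sym_coeff (\<Sum>i\<le>n. (- 1) ^ i * e_sym i * h_sym (n - i)) \<gamma> =
      (\<Sum>i\<le>n. \<Sum>\<alpha> | \<alpha> \<subseteq># \<gamma>. if size \<alpha> = i \<and> ?sq \<alpha> \<and> size (\<gamma> - \<alpha>) = n - i then (- 1) ^ size \<alpha> else 0)"
    unfolding sym_coeff_simps mult.assoc c
    unfolding sym_coeff_mult e_sym.rep_eq h_sym.rep_eq sum_distrib_left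
    by (intro sum.cong refl) auto
  also have "\<dots> = (\<Sum>\<alpha> | \<alpha> \<subseteq># \<gamma>. \<Sum>i\<le>n. if i = size \<alpha> then (if ?sq \<alpha> \<and> size (\<gamma> - \<alpha>) = n - i then (- 1) ^ size \<alpha> else 0) else 0)"
    by (subst sum.swap) (intro sum.cong refl, auto)
  also have "\<dots> = (\<Sum>\<alpha> | \<alpha> \<subseteq># \<gamma>. if size \<gamma> = n \<and> ?sq \<alpha> then (- 1) ^ size \<alpha> else 0)"
  proof (rule sum.cong[OF refl])
    fix \<alpha> assume "\<alpha> \<in> {\<alpha>. \<alpha> \<subseteq># \<gamma>}"
    then have "size \<gamma> = size \<alpha> + size (\<gamma> - \<alpha>)"
      by (metis mem_Collect_eq size_union subset_mset.add_diff_inverse)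
    then show "(\<Sum>i\<le>n. if i = size \<alpha> then (if ?sq \<alpha> \<and> size (\<gamma> - \<alpha>) = n - i then (- 1) ^ size \<alpha> else 0) else 0) =
        (if size \<gamma> = n \<and> ?sq \<alpha> then (- 1) ^ size \<alpha> else (0 :: int))"
      by (auto simp: sum.delta)
  qed
  also have "\<dots> = 0"
  proof (cases "size \<gamma> = n")
    case True
    \<comment> \<open>The contribution of one variable with exponent d in the divisor; the value 0
      for d > 1 enforces squarefreeness.\<close>
    let ?F = "\<lambda>(i :: nat) (d :: nat). if d = 0 then 1 else if d = 1 then - 1 else (0 :: int)"
    have "(\<Sum>\<alpha> | \<alpha> \<subseteq># \<gamma>. if size \<gamma> = n \<and> ?sq \<alpha> then (- 1) ^ size \<alpha> else 0) =
        (\<Sum>\<alpha> | \<alpha> \<subseteq># \<gamma>. \<Prod>i\<in>set_mset \<gamma>. ?F i (count \<alpha> i))"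
    proof (rule sum.cong[OF refl])
      fix \<alpha> assume "\<alpha> \<in> {\<alpha>. \<alpha> \<subseteq># \<gamma>}"
      then have sub: "set_mset \<alpha> \<subseteq> set_mset \<gamma>" by (simp add: set_mset_mono)
      show "(if size \<gamma> = n \<and> ?sq \<alpha> then (- 1) ^ size \<alpha> else 0) = (\<Prod>i\<in>set_mset \<gamma>. ?F i (count \<alpha> i))"
      proof (cases "?sq \<alpha>")
        case sq: True
        have "size \<alpha> = (\<Sum>i\<in>set_mset \<gamma>. count \<alpha> i)"
          unfolding size_multiset_overloaded_eq using sub
          by (intro sum.mono_neutral_left) (auto simp: not_in_iff)
        then have "(- 1) ^ size \<alpha> = (\<Prod>i\<in>set_mset \<gamma>. (- 1 :: int) ^ count \<alpha> i)"
          by (simp add: power_sum)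
        also have "\<dots> = (\<Prod>i\<in>set_mset \<gamma>. ?F i (count \<alpha> i))"
        proof (rule prod.cong[OF refl])
          fix i
          have F: "(- 1) ^ c = ?F i c" if "c \<le> 1" for c using that by (cases c) auto
          show "(- 1) ^ count \<alpha> i = ?F i (count \<alpha> i)" by (rule F) (rule sq[rule_format])
        qed
        finally show ?thesis using sq True by simp
      next
        case False
        then obtain i where i: "count \<alpha> i > 1" using not_le by blast
        then have "i \<in> set_mset \<gamma>" using sub by (metis count_eq_zero_iff gr_implies_not0 subsetD)
        moreover have "?F i (count \<alpha> i) = 0" using i by simp
        ultimately have "(\<Prod>i\<in>set_mset \<gamma>. ?F i (count \<alpha> i)) = 0"
          by (intro prod_zero) blast+
        then show ?thesis using False by (simp only: if_False simp_thms)
      qed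
    qed
    also have "\<dots> = (\<Prod>i\<in>set_mset \<gamma>. \<Sum>d\<le>count \<gamma> i. ?F i d)"
      by (rule sum_submsets_prod)
    also have "\<dots> = 0"
    proof -
      obtain i where i: "i \<in># \<gamma>" using True assms by (metis multiset_nonemptyE size_empty less_numeral_extra(3))
      have "(\<Sum>d\<le>count \<gamma> i. ?F i d) = (\<Sum>d\<in>{0, 1}. ?F i d)"
        using i by (intro sum.mono_neutral_right) (auto simp: Suc_le_eq)
      then show ?thesis using i by (intro prod_zero) (auto intro!: bexI[of _ i])
    qed
    finally show ?thesis .
  qed simp
  finally show "sym_coeff (\<Sum>i\<le>n. (- 1) ^ i * e_sym i * h_sym (n - i)) \<gamma> = sym_coeff 0 \<gamma>"
    by (simp add: sym_coeff_simps)
qed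

section \<open>Surjectivity of the map from \<int>[b] to Sym with b_n going to h_n\<close>

definition \<theta> :: "Dlower \<Rightarrow> sym" where
  "\<theta> = ev h_sym"

lemma rhom_\<theta>: "rhom \<theta>"
  unfolding \<theta>_def by (rule rhom_ev)

lemma \<theta>_b_gen: "\<theta> (b_gen k) = h_sym k"
  by (cases "k = 0") (simp_all add: \<theta>_def ev_b_gen rhom_1[OF rhom_ev])

lemma \<theta>_b_mono: "\<theta> (b_mono l) = h_prod l"
  by (simp add: \<theta>_def ev_b_mono h_prod_def)

lemma range_\<theta>_diff: "f \<in> range \<theta> \<Longrightarrow> g \<in> range \<theta> \<Longrightarrow> f - g \<in> range \<theta>"
  by (auto simp flip: additive_diff[OF rhom_additive[OF rhom_\<theta>]])

lemma range_\<theta>_mult: "f \<in> range \<theta> \<Longrightarrow> g \<in> range \<theta> \<Longrightarrow> f * g \<in> range \<theta>"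
  by (auto simp flip: rhom_mult[OF rhom_\<theta>])

lemma range_\<theta>_of_int: "of_int n \<in> range \<theta>"
  by (metis rangeI rhom_of_int rhom_\<theta>)

lemma range_\<theta>_sum: "(\<And>i. i \<in> I \<Longrightarrow> f i \<in> range \<theta>) \<Longrightarrow> sum f I \<in> range \<theta>"
proof (induction I rule: infinite_finite_induct)
  case (insert i I)
  then have "f i - (of_int 0 - sum f I) \<in> range \<theta>"
    by (intro range_\<theta>_diff range_\<theta>_of_int) auto
  then show ?case using insert by simp
qed (use range_\<theta>_of_int[of 0] in simp_all)

lemma range_\<theta>_h_sym: "h_sym n \<in> range \<theta>"
  by (metis \<theta>_b_gen rangeI)

text \<open>The relation E(-t) H(t) = 1 expresses e_n recursively through the h_i. Its sign is
  removed by multiplying once more by (-1)^n, as the range is closed under products.\<close>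

lemma range_\<theta>_e_sym: "e_sym n \<in> range \<theta>"
proof (induction n rule: less_induct)
  case (less n)
  show ?case
  proof (cases "n = 0")
    case True
    have "e_sym 0 = 1"
      by (rule sym_eqI) (simp add: e_sym.rep_eq one_sym.rep_eq)
    then show ?thesis using True range_\<theta>_of_int[of 1] by simp
  next
    case False
    have "(- 1) ^ n * e_sym n = 0 - (\<Sum>i<n. (- 1) ^ i * e_sym i * h_sym (n - i))"
      using e_h_convolution[of n] False by (simp add: lessThan_Suc_atMost[symmetric] eq_neg_iff_add_eq_0 add.commute)
    also have "\<dots> \<in> range \<theta>"
    proof (intro range_\<theta>_diff range_\<theta>_sum range_\<theta>_mult range_\<theta>_h_sym)
      show "(0 :: sym) \<in> range \<theta>" using range_\<theta>_of_int[of 0] by simp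
      show "(- 1) ^ i \<in> range \<theta>" for i using range_\<theta>_of_int[of "(- 1) ^ i"] by simp
    qed (use less in auto)
    finally have "of_int ((- 1) ^ n) * ((- 1) ^ n * e_sym n) \<in> range \<theta>"
      by (rule range_\<theta>_mult[OF range_\<theta>_of_int])
    then show ?thesis by (simp flip: mult.assoc power_mult_distrib)
  qed
qed

lemma exponents_superset:
  assumes "finite S" "set_mset \<delta> \<subseteq> S"
  shows "exponents \<delta> = filter_mset (\<lambda>k. k \<noteq> 0) (image_mset (count \<delta>) (mset_set S))"
proof -
  have "{i \<in> S. count \<delta> i \<noteq> 0} = set_mset \<delta>"
    using assms(2) by auto
  then have "mset_set (set_mset \<delta>) = filter_mset (\<lambda>i. count \<delta> i \<noteq> 0) (mset_set S)"
    using assms(1) by (simp add: filter_mset_mset_set)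
  then show ?thesis by (simp add: exponents_def filter_mset_image_mset)
qed

text \<open>Removal of the first column of the diagram of a partition.\<close>

definition decr :: "nat multiset \<Rightarrow> nat multiset" where
  "decr p = filter_mset (\<lambda>k. k \<noteq> 0) (image_mset (\<lambda>k. k - 1) p)"

text \<open>Only the number of parts equal to 1 is lost by \<open>decr\<close>, and it can be
  recovered from the number of all parts.\<close>

lemma decr_inj:
  assumes "decr p = decr q" "size p = size q" "0 \<notin># p" "0 \<notin># q"
  shows "p = q"
proof -
  have split: "image_mset (\<lambda>k. k - 1) r = decr r + replicate_mset (size r - size (decr r)) 0" for r :: "nat multiset"
  proof -
    have 1: "image_mset (\<lambda>k. k - 1) r = decr r + filter_mset (\<lambda>k. k = 0) (image_mset (\<lambda>k. k - 1) r)"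
      unfolding decr_def by (simp add: union_filter_mset_complement)
    have "filter_mset (\<lambda>k. k = 0) s = replicate_mset (size (filter_mset (\<lambda>k. k = 0) s)) 0" for s :: "nat multiset"
      by (induction s) auto
    moreover have "size (filter_mset (\<lambda>k. k = 0) (image_mset (\<lambda>k. k - 1) r)) = size r - size (decr r)"
      using arg_cong[OF 1, of size] by simp
    ultimately show ?thesis using 1 by metis
  qed
  have "image_mset (\<lambda>k. k - 1) p = image_mset (\<lambda>k. k - 1) q"
    unfolding split[of p] split[of q] assms(1,2) ..
  then have "image_mset Suc (image_mset (\<lambda>k. k - 1) p) = image_mset Suc (image_mset (\<lambda>k. k - 1) q)"
    by simp
  moreover have "image_mset Suc (image_mset (\<lambda>k. k - 1) r) = image_mset id r" if "0 \<notin># r" for r :: "nat multiset"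
    unfolding image_mset.compositionality
  proof (rule image_mset_cong)
    show "(Suc \<circ> (\<lambda>k. k - 1)) x = id x" if "x \<in># r" for x
      using that \<open>0 \<notin># r\<close> by (cases x) auto
  qed
  ultimately show ?thesis using assms(3,4) by simp
qed

lemma sum_mset_decr: "0 \<notin># p \<Longrightarrow> sum_mset (decr p) + size p = sum_mset p"
  by (induction p) (auto simp: decr_def)

text \<open>Dividing a monomial by the product of its variables lowers each exponent by 1.\<close>

lemma exponents_diff_support: "exponents (\<gamma> - mset_set (set_mset \<gamma>)) = decr (exponents \<gamma>)"
proof -
  have "set_mset (\<gamma> - mset_set (set_mset \<gamma>)) \<subseteq> set_mset \<gamma>"
    by (meson in_diffD subsetI)
  then have "exponents (\<gamma> - mset_set (set_mset \<gamma>)) =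
      filter_mset (\<lambda>k. k \<noteq> 0) (image_mset (count (\<gamma> - mset_set (set_mset \<gamma>))) (mset_set (set_mset \<gamma>)))"
    by (intro exponents_superset) auto
  also have "image_mset (count (\<gamma> - mset_set (set_mset \<gamma>))) (mset_set (set_mset \<gamma>)) =
      image_mset (\<lambda>i. count \<gamma> i - 1) (mset_set (set_mset \<gamma>))"
    by (rule image_mset_cong) (simp add: count_mset_set')
  finally show ?thesis
    by (simp add: decr_def exponents_def image_mset.compositionality comp_def)
qed

lemma squarefree_eq_mset_set:
  assumes "\<forall>i. count \<alpha> i \<le> 1"
  shows "\<alpha> = mset_set (set_mset \<alpha>)"
proof (rule multiset_eqI)
  fix i
  show "count \<alpha> i = count (mset_set (set_mset \<alpha>)) i"
  proof (cases "i \<in># \<alpha>")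
    case True
    then have "0 < count \<alpha> i" by simp
    then have "count \<alpha> i = 1" using assms[rule_format, of i] by linarith
    then show ?thesis using True by simp
  qed (simp add: not_in_iff)
qed

lemma size_exponents: "size (exponents \<gamma>) = card (set_mset \<gamma>)"
  by (simp add: exponents_def)

text \<open>
  The monomials with exponents \<open>l\<close> are those of least support in \<open>e\<^sub>n m\<^sub>k\<close>, where \<open>n\<close> is the number of
  parts of \<open>l\<close> and \<open>k\<close> is obtained from \<open>l\<close> by removing the first column of its diagram.
\<close>

lemma m_sym_in_range_\<theta>: "m_sym l \<in> range \<theta>"
\<comment> \<open>At fixed weight the second measure decreases when the number of parts grows; it is
  not truncated because a partition has at most as many parts as its weight.\<close>
proof (induction l rule: wf_induct[OF wf_measures[of "[weight, \<lambda>l. weight l - size (parts l)]"]])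
  case (1 l)
  show ?case
  proof (cases "l = 0")
    case True
    have "m_sym 0 = 1"
      by (rule sym_eqI) (auto simp: m_sym.rep_eq one_sym.rep_eq exponents_def mset_set_empty_iff)
    then show ?thesis using True range_\<theta>_of_int[of 1] by simp
  next
    case False
    define n where "n = size (parts l)"
    define k where "k = Abs_partition (decr (parts l))"
    have pk: "parts k = decr (parts l)"
      unfolding k_def by (rule parts_Abs) (simp add: decr_def)
    have wk: "weight k + n = weight l"
      unfolding weight_def pk n_def by (rule sum_mset_decr) simp
    have "n > 0"
      using False by (metis n_def neq0_conv parts_0 partition_eqI size_eq_0_iff_empty)
    \<comment> \<open>The remainder after subtracting the leading term. Its monomials turn out to
      have the same degree and more than n variables, so the induction hypothesis covers it.\<close>
    define g where "g = e_sym n * m_sym k - m_sym l"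
    have g: "sym_coeff g \<gamma> = (\<Sum>\<alpha> | \<alpha> \<subseteq># \<gamma>. if size \<alpha> = n \<and> (\<forall>i. count \<alpha> i \<le> 1) \<and> exponents (\<gamma> - \<alpha>) = parts k then 1 else 0)
        - (if exponents \<gamma> = parts l then 1 else 0)" for \<gamma>
      unfolding g_def sym_coeff_simps sym_coeff_mult e_sym.rep_eq m_sym.rep_eq
      by (intro arg_cong2[of _ _ _ _ "(-)"] refl sum.cong) auto
    have g_supp: "size \<gamma> = weight l \<and> n < card (set_mset \<gamma>)" if nz: "sym_coeff g \<gamma> \<noteq> 0" for \<gamma>
    proof -
      let ?P = "\<lambda>\<alpha>. \<alpha> \<subseteq># \<gamma> \<and> size \<alpha> = n \<and> (\<forall>i. count \<alpha> i \<le> 1) \<and> exponents (\<gamma> - \<alpha>) = parts k"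
      \<comment> \<open>A squarefree divisor with n variables of a monomial with at most n variables
        uses all of them.\<close>
      have eq: "\<alpha> = mset_set (set_mset \<gamma>)" if "?P \<alpha>" "card (set_mset \<gamma>) \<le> n" for \<alpha>
      proof -
        have "card (set_mset \<alpha>) = n"
          using squarefree_eq_mset_set[of \<alpha>] that(1) by (metis size_mset_set)
        then have "set_mset \<alpha> = set_mset \<gamma>"
          using that by (intro card_seteq) (auto simp: set_mset_mono)
        then show ?thesis using squarefree_eq_mset_set[of \<alpha>] that(1) by metis
      qed
      have n: "n < card (set_mset \<gamma>)"
      proof (rule ccontr)
        assume "\<not> n < card (set_mset \<gamma>)"
        then consider "card (set_mset \<gamma>) < n" | "card (set_mset \<gamma>) = n" by linarith
        then show False
        proof cases
          case 1
          have "\<not> ?P \<alpha>" for \<alpha>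
            using eq[of \<alpha>] 1 by (metis finite_set_mset less_imp_le nat_neq_iff size_mset_set)
          then have "sym_coeff g \<gamma> = 0"
            unfolding g using size_exponents[of \<gamma>] 1 by (auto simp: n_def intro!: sum.neutral)
          with nz show False ..
        next
          case 2
          let ?\<alpha> = "mset_set (set_mset \<gamma>)"
          have a: "?\<alpha> \<subseteq># \<gamma>" "size ?\<alpha> = n" "\<forall>i. count ?\<alpha> i \<le> 1"
            using 2 by (auto simp: subseteq_mset_def count_mset_set' Suc_le_eq)
          have "(\<Sum>\<alpha> | \<alpha> \<subseteq># \<gamma>. if size \<alpha> = n \<and> (\<forall>i. count \<alpha> i \<le> 1) \<and> exponents (\<gamma> - \<alpha>) = parts k then 1 else 0) =
              (\<Sum>\<alpha> | \<alpha> \<subseteq># \<gamma>. if \<alpha> = ?\<alpha> then (if exponents (\<gamma> - ?\<alpha>) = parts k then 1 else 0) else (0 :: int))"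
          proof (rule sum.cong[OF refl])
            fix \<alpha> assume \<alpha>: "\<alpha> \<in> {\<alpha>. \<alpha> \<subseteq># \<gamma>}"
            show "(if size \<alpha> = n \<and> (\<forall>i. count \<alpha> i \<le> 1) \<and> exponents (\<gamma> - \<alpha>) = parts k then 1 else 0) =
              (if \<alpha> = ?\<alpha> then (if exponents (\<gamma> - ?\<alpha>) = parts k then 1 else 0) else (0 :: int))"
            proof (cases "\<alpha> = ?\<alpha>")
              case True
              then show ?thesis using a(2,3) by (simp only: simp_thms if_True)
            next
              case False
              then have "\<not> ?P \<alpha>" using eq[of \<alpha>] eq_refl[OF 2] by blast
              then show ?thesis using False \<alpha> by (simp only: mem_Collect_eq simp_thms if_False)
            qed
          qed
          also have "\<dots> = (if exponents (\<gamma> - ?\<alpha>) = parts k then 1 else 0)"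
            using a by (simp add: sum.delta)
          \<comment> \<open>With exactly n variables the only possible cofactor has type k precisely
            when \<gamma> has type l, by injectivity of \<open>decr\<close>; the two coefficients in
            g cancel.\<close>
          also have "exponents (\<gamma> - ?\<alpha>) = parts k \<longleftrightarrow> exponents \<gamma> = parts l"
            unfolding exponents_diff_support pk
            using decr_inj[of "exponents \<gamma>" "parts l"] 2 by (auto simp: size_exponents n_def)
          finally have "sym_coeff g \<gamma> = 0" unfolding g by simp
          with nz show False ..
        qed
      qed
      then have "exponents \<gamma> \<noteq> parts l" using size_exponents[of \<gamma>] by (auto simp: n_def)
      with nz have "\<exists>\<alpha>. ?P \<alpha>" unfolding g by (auto intro: ccontr sum.neutral)
      then obtain \<alpha> where \<alpha>: "?P \<alpha>" by blast
      then have "size \<gamma> = size \<alpha> + size (\<gamma> - \<alpha>)" by (metis size_union subset_mset.add_diff_inverse)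
      moreover have "size (\<gamma> - \<alpha>) = weight k" using \<alpha> by (simp add: weight_def flip: sum_exponents)
      ultimately show ?thesis using \<alpha> wk n by simp
    qed
    have IH: "m_sym p \<in> range \<theta>" if "weight p < weight l \<or> weight p = weight l \<and> n < size (parts p)" for p
      using 1[rule_format, of p] that size_le_weight[of p] by (auto simp: n_def)
    have "Sm.ext m_sym g \<in> range \<theta>"
      unfolding Sm.ext_def zmul_of_int
    proof (intro range_\<theta>_sum range_\<theta>_mult range_\<theta>_of_int IH disjI2)
      fix p assume "p \<in> {p. sym_coeff g (gam p) \<noteq> 0}"
      then show "weight p = weight l \<and> n < size (parts p)"
        using g_supp[of "gam p"] size_exponents[of "gam p"] by simp
    qed
    then have "g \<in> range \<theta>" by (simp only: Sm.expand)
    \<comment> \<open>Removing a nonempty column lowers the weight, so the other factor is covered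
      too.\<close>
    moreover have "m_sym k \<in> range \<theta>" using wk \<open>n > 0\<close> by (intro IH) simp
    ultimately have "e_sym n * m_sym k - g \<in> range \<theta>"
      by (intro range_\<theta>_diff range_\<theta>_mult range_\<theta>_e_sym)
    then show ?thesis by (simp add: g_def)
  qed
qed

lemma surj_\<theta>: "range \<theta> = UNIV"
proof -
  have "Sm.ext m_sym f \<in> range \<theta>" for f
    unfolding Sm.ext_def zmul_of_int
    by (intro range_\<theta>_sum range_\<theta>_mult range_\<theta>_of_int m_sym_in_range_\<theta>)
  then show ?thesis by (auto simp: Sm.expand)
qed

section \<open>The pairing on symmetric functions\<close>

text \<open>As b_0 = 1, variables of exponent 0 may be included. All divisors of a monomial can thus
  be treated over one index set.\<close>

lemma b_mono_mtype:
  assumes "finite S" "set_mset \<delta> \<subseteq> S"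
  shows "b_mono (mtype \<delta>) = (\<Prod>i\<in>S. b_gen (count \<delta> i))"
proof -
  have "b_mono (mtype \<delta>) = (\<Prod>i\<in>set_mset \<delta>. b_gen (count \<delta> i))"
    by (simp add: b_mono_prod parts_mtype exponents_def prod_unfold_prod_mset image_mset.compositionality comp_def)
  also have "\<dots> = (\<Prod>i\<in>S. b_gen (count \<delta> i))"
    by (rule prod.mono_neutral_left) (use assms in \<open>auto simp: not_in_iff\<close>)
  finally show ?thesis .
qed

text \<open>Explicit finite sums are preferable to additivity arguments where several
  comultiplications are expanded at once.\<close>

lemma tensor_rep: "\<exists>(n :: nat) a b. (t :: ('a::ab_group_add, 'b::ab_group_add) tensor) = (\<Sum>i<n. a i \<otimes> b i)"
proof (induction t rule: tensor_induct)
  case zero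
  show ?case by (rule exI[of _ 0]) simp
next
  case (tens a b)
  show ?case by (rule exI[of _ 1], rule exI[of _ "\<lambda>_. a"], rule exI[of _ "\<lambda>_. b"]) simp
next
  case (diff s t)
  then obtain n m :: nat and a b c d where s: "s = (\<Sum>i<n. a i \<otimes> b i)" and t: "t = (\<Sum>i<m. c i \<otimes> d i)" by blast
  have neg: "(- x) \<otimes> y = - (x \<otimes> y)" for x :: 'a and y :: 'b
    by (rule additive.minus[OF tens_left[OF additive_ident]])
  let ?a = "\<lambda>i. if i < n then a i else - c (i - n)" and ?b = "\<lambda>i. if i < n then b i else d (i - n)"
  have "(\<Sum>i<n + m. ?a i \<otimes> ?b i) = (\<Sum>i<n. ?a i \<otimes> ?b i) + (\<Sum>i\<in>{n..<n + m}. ?a i \<otimes> ?b i)"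
    by (subst sum.union_disjoint[symmetric]) (auto intro: sum.cong)
  also have "(\<Sum>i\<in>{n..<n + m}. ?a i \<otimes> ?b i) = (\<Sum>i<m. - (c i \<otimes> d i))"
    by (rule sum.reindex_bij_witness[of _ "\<lambda>i. i + n" "\<lambda>i. i - n"]) (auto simp: neg)
  also have "\<dots> = - t"
    by (simp add: t sum_negf)
  finally have "s - t = (\<Sum>i<n + m. ?a i \<otimes> ?b i)" by (simp add: s)
  then show ?case by (intro exI[of _ "n + m"] exI[of _ ?a] exI[of _ ?b])
qed

text \<open>The interchange of the middle two factors when (x \<otimes> y)(z \<otimes> w) is paired
  with products on the other side; it is the combinatorial content of both bialgebra dualities
  below.\<close>

lemma sum_fourfold:
  fixes f g p q :: "nat \<Rightarrow> nat \<Rightarrow> int"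
  shows "(\<Sum>k<r. \<Sum>l<s. (\<Sum>i<n. f i k * p i l) * (\<Sum>j<m. g j k * q j l)) =
    (\<Sum>i<n. \<Sum>j<m. (\<Sum>k<r. f i k * g j k) * (\<Sum>l<s. p i l * q j l))"
proof -
  have "(\<Sum>k<r. \<Sum>l<s. (\<Sum>i<n. f i k * p i l) * (\<Sum>j<m. g j k * q j l)) =
      (\<Sum>k<r. \<Sum>l<s. \<Sum>i<n. \<Sum>j<m. f i k * g j k * (p i l * q j l))"
    by (simp only: sum_product mult_ac)
  also have "\<dots> = (\<Sum>k<r. \<Sum>i<n. \<Sum>l<s. \<Sum>j<m. f i k * g j k * (p i l * q j l))"
    by (rule sum.cong[OF refl], rule sum.swap)
  also have "\<dots> = (\<Sum>i<n. \<Sum>k<r. \<Sum>j<m. \<Sum>l<s. f i k * g j k * (p i l * q j l))"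
    by (subst sum.swap, rule sum.cong[OF refl], rule sum.cong[OF refl], rule sum.swap)
  also have "\<dots> = (\<Sum>i<n. \<Sum>j<m. \<Sum>k<r. \<Sum>l<s. f i k * g j k * (p i l * q j l))"
    by (rule sum.cong[OF refl], rule sum.swap)
  finally show ?thesis by (simp only: sum_product)
qed

definition tpair :: "('a::ab_group_add \<Rightarrow> int) \<Rightarrow> ('b::ab_group_add \<Rightarrow> int) \<Rightarrow> ('a, 'b) tensor \<Rightarrow> int" where
  "tpair \<phi> \<psi> = tlift (\<lambda>a b. \<phi> a * \<psi> b)"

lemma additive_tpair: "additive \<phi> \<Longrightarrow> additive \<psi> \<Longrightarrow> additive (tpair \<phi> \<psi>)"
  unfolding tpair_def by (intro additive_tlift additive_intros)

lemma tpair_tens: "additive \<phi> \<Longrightarrow> additive \<psi> \<Longrightarrow> tpair \<phi> \<psi> (a \<otimes> b) = \<phi> a * \<psi> b"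
  unfolding tpair_def by (rule tlift_tens) (intro additive_intros)

lemma tpair_tmap:
  assumes "additive \<phi>" "additive \<psi>" "additive f" "additive g"
  shows "tpair \<phi> \<psi> (tmap f g t) = tpair (\<lambda>x. \<phi> (f x)) (\<lambda>x. \<psi> (g x)) t"
  by (rule additive_eqI_tensor[of "\<lambda>t. tpair \<phi> \<psi> (tmap f g t)"])
    (intro additive_comp[OF additive_tpair] additive_tpair additive_tmap assms additive_comp[OF assms(1)]
      additive_comp[OF assms(2)]
      | simp add: tpair_tens tmap_tens assms additive_comp[OF assms(1) assms(3)] additive_comp[OF assms(2) assms(4)])+

text \<open>The comultiplication of symmetric functions, read on polynomials in the \<open>b\<^sub>n\<close> through \<open>b\<^sub>n \<mapsto> h\<^sub>n\<close>.\<close>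

definition \<delta>b :: "Dlower \<Rightarrow> (Dlower, Dlower) tensor" where
  "\<delta>b = ev (\<lambda>n. \<Sum>k\<le>n. b_gen k \<otimes> b_gen (n - k))"

lemma rhom_\<delta>b: "rhom \<delta>b"
  unfolding \<delta>b_def by (rule rhom_ev)

lemma \<delta>b_b_gen: "\<delta>b (b_gen n) = (\<Sum>k\<le>n. b_gen k \<otimes> b_gen (n - k))"
  by (cases "n = 0") (simp_all add: rhom_1[OF rhom_\<delta>b] tens_1, simp add: \<delta>b_def ev_b_gen)

lemma submset_count_le: "\<alpha> \<subseteq># \<gamma> \<Longrightarrow> count \<alpha> i \<le> count \<gamma> i"
  by (rule mset_subset_eq_count)

lemma \<delta>b_b_mono:
  "\<delta>b (b_mono (mtype \<gamma>)) = (\<Sum>\<alpha> | \<alpha> \<subseteq># \<gamma>. b_mono (mtype \<alpha>) \<otimes> b_mono (mtype (\<gamma> - \<alpha>)))"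
proof -
  let ?S = "set_mset \<gamma>"
  have "\<delta>b (b_mono (mtype \<gamma>)) = (\<Prod>i\<in>?S. \<Sum>k\<le>count \<gamma> i. b_gen k \<otimes> b_gen (count \<gamma> i - k))"
    by (simp only: b_mono_mtype[OF finite_set_mset order_refl] rhom_prod[OF rhom_\<delta>b] \<delta>b_b_gen)
  also have "\<dots> = (\<Sum>\<alpha> | \<alpha> \<subseteq># \<gamma>. \<Prod>i\<in>?S. b_gen (count \<alpha> i) \<otimes> b_gen (count \<gamma> i - count \<alpha> i))"
    by (rule sum_submsets_prod[symmetric])
  also have "\<dots> = (\<Sum>\<alpha> | \<alpha> \<subseteq># \<gamma>. b_mono (mtype \<alpha>) \<otimes> b_mono (mtype (\<gamma> - \<alpha>)))"
  proof (rule sum.cong[OF refl])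
    fix \<alpha> assume "\<alpha> \<in> {\<alpha>. \<alpha> \<subseteq># \<gamma>}"
    then have "set_mset \<alpha> \<subseteq> ?S" "set_mset (\<gamma> - \<alpha>) \<subseteq> ?S" by (auto simp: set_mset_mono dest: in_diffD)
    then show "(\<Prod>i\<in>?S. b_gen (count \<alpha> i) \<otimes> b_gen (count \<gamma> i - count \<alpha> i)) = b_mono (mtype \<alpha>) \<otimes> b_mono (mtype (\<gamma> - \<alpha>))"
      by (simp add: prod_tens b_mono_mtype[of ?S])
  qed
  finally show ?thesis .
qed

text \<open>The standard pairing with the second argument taken in \<int>[b] instead of Sym. It is
  available before the h-products are known to be a basis.\<close>

definition cpair :: "sym \<Rightarrow> Dlower \<Rightarrow> int" where
  "cpair f = Db.ext (\<lambda>l. sym_coeff f (gam l))"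

lemma cpair_b_mono: "cpair f (b_mono l) = sym_coeff f (gam l)"
  unfolding cpair_def by (rule Db.ext_basis)

lemma additive_cpair_right: "additive (cpair f)"
  unfolding cpair_def by (rule Db.additive_ext)

lemma additive_cpair_left: "additive (\<lambda>f. cpair f p)"
  unfolding cpair_def Db.ext_def by (intro additive_intros additive_sym_coeff)

lemma Dlower_eqI_mtype:
  assumes "additive f" "additive g" "\<And>\<gamma>. f (b_mono (mtype \<gamma>)) = g (b_mono (mtype \<gamma>))"
  shows "f p = g p"
  by (rule Db.additive_eqI[OF assms(1,2)]) (metis assms(3) mtype_gam)

text \<open>The coefficient of a product at \<gamma> runs over the factorizations of \<gamma>, and
  so does \<open>\<delta>b\<close> of the corresponding monomial in the b_n.\<close>

lemma cpair_mult: "cpair (f * g) p = tpair (cpair f) (cpair g) (\<delta>b p)"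
proof (rule Dlower_eqI_mtype[of "cpair (f * g)"])
  note a = additive_tpair[OF additive_cpair_right additive_cpair_right]
  show "additive (\<lambda>p. tpair (cpair f) (cpair g) (\<delta>b p))"
    by (rule additive_comp[OF a rhom_additive[OF rhom_\<delta>b]])
  show "cpair (f * g) (b_mono (mtype \<gamma>)) = tpair (cpair f) (cpair g) (\<delta>b (b_mono (mtype \<gamma>)))" for \<gamma>
    by (simp add: \<delta>b_b_mono additive_sum[OF a] tpair_tens additive_cpair_right cpair_b_mono sym_coeff_gam sym_coeff_mult)
qed (rule additive_cpair_right)

text \<open>The form \<open>\<langle>h_l, h_m\<rangle>\<close> on \<int>[b]. Only the first argument
  passes through \<theta>, so the symmetry of the form carries information about the kernel of
  \<theta>.\<close>

definition C :: "Dlower \<Rightarrow> Dlower \<Rightarrow> int" where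
  "C p q = cpair (\<theta> p) q"

lemma additive_C_right: "additive (C p)"
  unfolding C_def[abs_def] by (rule additive_cpair_right)

lemma additive_C_left: "additive (\<lambda>p. C p q)"
  unfolding C_def by (rule additive_comp[OF additive_cpair_left rhom_additive[OF rhom_\<theta>]])

lemma C_mult_left: "C (p * p') q = tpair (C p) (C p') (\<delta>b q)"
  unfolding C_def[abs_def] rhom_mult[OF rhom_\<theta>] by (rule cpair_mult)

lemma C_b_gen: "C (b_gen n) (b_mono l) = (if weight l = n then 1 else 0)"
  by (simp add: C_def cpair_b_mono \<theta>_b_gen h_sym.rep_eq)

lemma C_one_left: "C 1 (b_mono l) = (if l = 0 then 1 else 0)"
  using C_b_gen[of 0 l] by (simp add: weight_eq_0)

text \<open>For a generator in the first argument this holds because h_n has coefficient 1 at every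
  monomial of degree n. Multiplicativity in the first argument then carries it to products of
  generators.\<close>

lemma C_mult_right: "C p (q * q') = tpair (\<lambda>x. C x q) (\<lambda>y. C y q') (\<delta>b p)"
proof (rule Db.additive_eqI[of "\<lambda>p. C p (q * q')"])
  note al = additive_tpair[OF additive_C_left additive_C_left]
  note ar = additive_tpair[OF additive_C_right additive_C_right]
  show "additive (\<lambda>p. tpair (\<lambda>x. C x q) (\<lambda>y. C y q') (\<delta>b p))"
    by (rule additive_comp[OF al rhom_additive[OF rhom_\<delta>b]])
  show "additive (\<lambda>p. C p (q * q'))" by (rule additive_C_left)
  have gen: "C (b_gen n) (q * q') = tpair (\<lambda>x. C x q) (\<lambda>y. C y q') (\<delta>b (b_gen n))" for n q q'
  proof (rule Db.additive_eqI[of "\<lambda>q. C (b_gen n) (q * q')"])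
    show "C (b_gen n) (b_mono l * q') = tpair (\<lambda>x. C x (b_mono l)) (\<lambda>y. C y q') (\<delta>b (b_gen n))" for l
    proof (rule Db.additive_eqI[of "\<lambda>q'. C (b_gen n) (b_mono l * q')"])
      fix m
      have "tpair (\<lambda>x. C x (b_mono l)) (\<lambda>y. C y (b_mono m)) (\<delta>b (b_gen n)) =
          (\<Sum>k\<le>n. if k = weight l then (if weight m = n - k then 1 else 0) else 0)"
        unfolding \<delta>b_b_gen additive_sum[OF al] tpair_tens[OF additive_C_left additive_C_left] C_b_gen
        by (intro sum.cong) auto
      also have "\<dots> = C (b_gen n) (b_mono (l + m))"
        by (auto simp: sum.delta C_b_gen)
      finally show "C (b_gen n) (b_mono l * b_mono m) = tpair (\<lambda>x. C x (b_mono l)) (\<lambda>y. C y (b_mono m)) (\<delta>b (b_gen n))"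
        by (simp only: b_mono_plus)
    qed (intro additive_comp[OF additive_C_right] additive_intros,
        unfold tpair_def, intro additive_intros additive_C_left additive_C_right)
  qed (intro additive_comp[OF additive_C_right] additive_intros,
      unfold tpair_def, intro additive_intros additive_C_left additive_C_right)
  \<comment> \<open>Expanding both arguments by their comultiplications gives one fourfold sum,
    grouped in two ways.\<close>
  have mult: "C (p1 * p2) (q * q') = tpair (\<lambda>x. C x q) (\<lambda>y. C y q') (\<delta>b (p1 * p2))"
    if 1: "\<And>q q'. C p1 (q * q') = tpair (\<lambda>x. C x q) (\<lambda>y. C y q') (\<delta>b p1)"
      and 2: "\<And>q q'. C p2 (q * q') = tpair (\<lambda>x. C x q) (\<lambda>y. C y q') (\<delta>b p2)" for p1 p2 q q'
  proof -
    obtain nx :: nat and x y where x: "\<delta>b p1 = (\<Sum>i<nx. x i \<otimes> y i)" using tensor_rep by blast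
    obtain nz :: nat and z w where z: "\<delta>b p2 = (\<Sum>j<nz. z j \<otimes> w j)" using tensor_rep by blast
    obtain na :: nat and a b where a: "\<delta>b q = (\<Sum>k<na. a k \<otimes> b k)" using tensor_rep by blast
    obtain nc :: nat and c d where c: "\<delta>b q' = (\<Sum>l<nc. c l \<otimes> d l)" using tensor_rep by blast
    have "C (p1 * p2) (q * q') = (\<Sum>k<na. \<Sum>l<nc. (\<Sum>i<nx. C (x i) (a k) * C (y i) (c l)) *
        (\<Sum>j<nz. C (z j) (b k) * C (w j) (d l)))"
      unfolding C_mult_left[of p1] rhom_mult[OF rhom_\<delta>b] a c sum_product[of "\<lambda>k. a k \<otimes> b k"] tens_times
        additive_sum[OF ar] tpair_tens[OF additive_C_right additive_C_right] 1 2 x z additive_sum[OF al]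
        tpair_tens[OF additive_C_left additive_C_left] ..
    also have "\<dots> = (\<Sum>i<nx. \<Sum>j<nz. (\<Sum>k<na. C (x i) (a k) * C (z j) (b k)) *
        (\<Sum>l<nc. C (y i) (c l) * C (w j) (d l)))"
      by (rule sum_fourfold)
    also have "\<dots> = tpair (\<lambda>x. C x q) (\<lambda>y. C y q') (\<delta>b (p1 * p2))"
      unfolding rhom_mult[OF rhom_\<delta>b] x z sum_product[of "\<lambda>i. x i \<otimes> y i"] tens_times additive_sum[OF al]
        tpair_tens[OF additive_C_left additive_C_left] C_mult_left a c additive_sum[OF ar]
        tpair_tens[OF additive_C_right additive_C_right] ..
    finally show ?thesis .
  qed
  have "\<And>q q'. C (b_mono l) (q * q') = tpair (\<lambda>x. C x q) (\<lambda>y. C y q') (\<delta>b (b_mono l))" for l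
  proof (induction l rule: partition_induct)
    case 0
    then show ?case using gen[of 0] by (simp add: b_mono_0)
  next
    case (add k l)
    show ?case
      unfolding b_mono_plus b_gen_part1[OF add(1), symmetric] by (rule mult[OF gen add(2)])
  qed
  then show "C (b_mono l) (q * q') = tpair (\<lambda>x. C x q) (\<lambda>y. C y q') (\<delta>b (b_mono l))" for l .
qed

text \<open>Together with \<open>C_b_gen\<close> this is symmetry of the form when one argument is a
  generator, from which \<open>C_commute\<close> starts.\<close>

lemma C_b_mono_b_gen: "C (b_mono l) (b_gen n) = (if weight l = n then 1 else 0)"
proof (induction l arbitrary: n rule: partition_induct)
  case 0
  then show ?case
    using C_one_left[of 0] C_one_left[of "part1 n"] by (cases "n = 0") (auto simp: b_mono_0 b_gen_part1 part1_neq_0)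
next
  case (add k l)
  note ar = additive_tpair[OF additive_C_right additive_C_right]
  have g: "C (b_gen k) (b_gen j) = (if j = k then 1 else 0)" for j
    using C_b_gen[of k 0] C_b_gen[of k "part1 j"] add(1)
    by (cases "j = 0") (auto simp: b_mono_0 b_gen_part1 weight_part1)
  have "C (b_mono (part1 k + l)) (b_gen n) = (\<Sum>j\<le>n. if j = k then (if weight l = n - k then 1 else 0) else 0)"
    unfolding b_mono_plus b_gen_part1[OF add(1), symmetric] C_mult_left \<delta>b_b_gen additive_sum[OF ar]
      tpair_tens[OF additive_C_right additive_C_right] g add(2) by (intro sum.cong) auto
  also have "\<dots> = (if weight (part1 k + l) = n then 1 else 0)"
    using add(1) by (auto simp: sum.delta weight_part1)
  finally show ?case .
qed

lemma C_commute: "C p q = C q p"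
proof (rule Db.additive_eqI[of "\<lambda>p. C p q"])
  have gen: "C (b_gen k) q = C q (b_gen k)" for k q
    by (rule Db.additive_eqI[of "C (b_gen k)"])
      (simp_all add: additive_C_right additive_C_left C_b_gen C_b_mono_b_gen)
  show "C (b_mono l) q = C q (b_mono l)" for l
  proof (induction l arbitrary: q rule: partition_induct)
    case 0
    then show ?case using gen[of 0] by (simp add: b_mono_0)
  next
    case (add k l)
    obtain n :: nat and a b where a: "\<delta>b q = (\<Sum>i<n. a i \<otimes> b i)" using tensor_rep by blast
    show ?case
      unfolding b_mono_plus b_gen_part1[OF add(1), symmetric] C_mult_left C_mult_right a
        additive_sum[OF additive_tpair[OF additive_C_right additive_C_right]]
        additive_sum[OF additive_tpair[OF additive_C_left additive_C_left]]
        tpair_tens[OF additive_C_right additive_C_right] tpair_tens[OF additive_C_left additive_C_left]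
        gen add(2) ..
  qed
qed (rule additive_C_left additive_C_right)+

text \<open>The kernel of \<open>\<theta>\<close> is the radical of the symmetric form \<open>C\<close>, which is nondegenerate on the right.\<close>

lemma inj_\<theta>: "inj \<theta>"
proof (rule injI)
  fix p q assume "\<theta> p = \<theta> q"
  \<comment> \<open>After the exchange of arguments, p and q enter only through their images under
    \<theta>.\<close>
  then have "C r p = C r q" for r unfolding C_commute[of r] by (simp add: C_def)
  then have "cpair f p = cpair f q" for f
    using surj_\<theta> by (metis C_def rangeE UNIV_I)
  \<comment> \<open>Surjectivity of \<theta> allows every symmetric function as first argument; the
    m_l recover the coefficients of p.\<close>
  moreover have "cpair (m_sym l) p = Poly_Mapping.lookup p l" for l p
    by (rule Db.additive_eqI[OF additive_cpair_right Db.additive_coord])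
      (simp add: cpair_b_mono Sm.coord_basis Db.coord_basis)
  ultimately show "p = q" by (metis poly_mapping_eqI)
qed

definition \<theta>' :: "sym \<Rightarrow> Dlower" where
  "\<theta>' = inv \<theta>"

lemma \<theta>'_\<theta> [simp]: "\<theta>' (\<theta> p) = p"
  by (simp add: \<theta>'_def inj_\<theta>)

lemma \<theta>_\<theta>' [simp]: "\<theta> (\<theta>' f) = f"
  by (simp add: \<theta>'_def f_inv_into_f surj_\<theta>)

lemma rhom_\<theta>': "rhom \<theta>'"
  unfolding rhom_def additive_def
proof (intro conjI allI)
  fix f g
  have "\<theta>' (f + g) = \<theta>' (\<theta> (\<theta>' f + \<theta>' g))"
    by (simp only: additive_add[OF rhom_additive[OF rhom_\<theta>]] \<theta>_\<theta>')
  then show "\<theta>' (f + g) = \<theta>' f + \<theta>' g" by (simp only: \<theta>'_\<theta>)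
  have "\<theta>' (f * g) = \<theta>' (\<theta> (\<theta>' f * \<theta>' g))"
    by (simp only: rhom_mult[OF rhom_\<theta>] \<theta>_\<theta>')
  then show "\<theta>' (f * g) = \<theta>' f * \<theta>' g" by (simp only: \<theta>'_\<theta>)
  have "\<theta>' 1 = \<theta>' (\<theta> 1)"
    by (simp only: rhom_1[OF rhom_\<theta>])
  then show "\<theta>' 1 = 1" by (simp only: \<theta>'_\<theta>)
qed

section \<open>The Hopf algebra of symmetric functions\<close>

lemma \<theta>'_h_prod [simp]: "\<theta>' (h_prod l) = b_mono l"
  by (simp flip: \<theta>_b_mono)

interpretation Sh: free_on h_prod "\<lambda>l f. Poly_Mapping.lookup (\<theta>' f) l"
proof (rule free_on.intro)
  show "additive (\<lambda>f. Poly_Mapping.lookup (\<theta>' f) l)" for l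
    by (rule additive_comp[OF Db.additive_coord rhom_additive[OF rhom_\<theta>']])
  show "Poly_Mapping.lookup (\<theta>' (h_prod m)) l = (if l = m then 1 else 0)" for l m
    unfolding \<theta>'_h_prod by (rule Db.coord_basis)
  have "\<theta> p \<in> zmod.span (range h_prod)" for p
    by (rule additive_span_image[OF rhom_additive[OF rhom_\<theta>] _ zmod.subspace_span Db.in_span])
      (auto simp: \<theta>_b_mono intro: zmod.span_base)
  then show "zmod.span (range h_prod) = UNIV" using surj_\<theta> by (metis UNIV_eq_I \<theta>_\<theta>')
qed

lemma sym_pairing_eq: "sym_pairing f g = cpair f (\<theta>' g)"
proof -
  have bi: "biadditive (\<lambda>f g. cpair f (\<theta>' g))"
    by (intro biadditiveI additive_comp[OF additive_cpair_right] rhom_additive[OF rhom_\<theta>'] additive_cpair_left)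
  have *: "sym_pairing = (\<lambda>f g. cpair f (\<theta>' g))"
    unfolding sym_pairing_def
  proof (rule the_equality)
    show "biadditive (\<lambda>f g. cpair f (\<theta>' g)) \<and>
        (\<forall>l m. cpair (m_sym l) (\<theta>' (h_prod m)) = (if l = m then 1 else 0))"
      by (simp add: bi cpair_b_mono Sm.coord_basis)
  next
    fix B assume B: "biadditive B \<and> (\<forall>l m. B (m_sym l) (h_prod m) = (if l = m then 1 else (0 :: int)))"
    then have bB: "biadditive B" by blast
    have "B (m_sym l) g = cpair (m_sym l) (\<theta>' g)" for l g
      by (rule Sh.additive_eqI[OF biadditive_right[OF bB] biadditive_right[OF bi]])
        (simp add: B cpair_b_mono Sm.coord_basis)
    then have "B f g = cpair f (\<theta>' g)" for f g
      by (rule Sm.additive_eqI[OF biadditive_left[OF bB] biadditive_left[OF bi]])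
    then show "B = (\<lambda>f g. cpair f (\<theta>' g))" by blast
  qed
  show ?thesis unfolding * ..
qed

lemma additive_pairing_right: "additive (sym_pairing f)"
  unfolding sym_pairing_eq[abs_def] by (rule additive_comp[OF additive_cpair_right rhom_additive[OF rhom_\<theta>']])

lemma additive_pairing_left: "additive (\<lambda>f. sym_pairing f g)"
  unfolding sym_pairing_eq by (rule additive_cpair_left)

text \<open>The symmetry of \<open>C\<close> transported along \<theta>. It makes statements about
  either argument interchangeable, as the identification of Sym with its dual demands.\<close>

lemma sym_pairing_commute: "sym_pairing f g = sym_pairing g f"
  using C_commute[of "\<theta>' f" "\<theta>' g"] by (simp add: C_def sym_pairing_eq)

lemma sym_pairing_h_prod: "sym_pairing f (h_prod l) = sym_coeff f (gam l)"
  by (simp add: sym_pairing_eq cpair_b_mono)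

lemma sym_pairing_eqI: "(\<And>g. sym_pairing f g = sym_pairing f' g) \<Longrightarrow> f = f'"
  by (rule Sm.coord_eqI) (metis sym_pairing_h_prod)

lemma sym_pairing_eqI_right: "(\<And>f. sym_pairing f g = sym_pairing f g') \<Longrightarrow> g = g'"
  by (rule sym_pairing_eqI) (simp add: sym_pairing_commute)

lemma rhom_sym_eqI:
  assumes "rhom f" "rhom g" "\<And>n. f (h_sym n) = g (h_sym n)"
  shows "f x = g x"
proof -
  have "f (\<theta> p) = g (\<theta> p)" for p
    by (rule rhom_Dlower_eqI[OF rhom_comp[OF assms(1) rhom_\<theta>] rhom_comp[OF assms(2) rhom_\<theta>]])
      (simp add: \<theta>_b_gen assms(3))
  from this[of "\<theta>' x"] show ?thesis by simp
qed

lemma h_prod_homogeneous: "h_prod l \<in> homogeneous (int (weight l))"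
  unfolding \<theta>_b_mono[symmetric]
  by (rule rhom_Dlower_graded[OF rhom_\<theta> subspace_homogeneous one_homogeneous homogeneous_mult _ b_mono_grade])
    (simp_all add: \<theta>_b_gen h_sym_homogeneous)

lemma homogeneous_eq_h: "homogeneous n = zmod.span {h_prod l |l. int (weight l) = n}"
  by (rule Sh.grading_eq_span[OF grading_homogeneous h_prod_homogeneous])

lemma \<theta>'_grade: "f \<in> homogeneous n \<Longrightarrow> \<theta>' f \<in> Dlower_grade n"
  unfolding homogeneous_eq_h
  by (erule additive_span_image[OF rhom_additive[OF rhom_\<theta>'] _ subspace_Dlower_grade, rotated])
    (auto simp: b_mono_grade)

lemma rhom_sym_graded:
  fixes f :: "sym \<Rightarrow> 'b::comm_ring_1"
  assumes f: "rhom f" and G: "\<And>n. zmod.subspace (G n)" "1 \<in> G 0"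
    "\<And>i j x y. x \<in> G i \<Longrightarrow> y \<in> G j \<Longrightarrow> x * y \<in> G (i + j)"
    and gen: "\<And>k. f (h_sym k) \<in> G (int k)"
    and x: "x \<in> homogeneous n"
  shows "f x \<in> G n"
  using rhom_Dlower_graded[OF rhom_comp[OF f rhom_\<theta>] G _ \<theta>'_grade[OF x]] gen by (simp add: \<theta>_b_gen)

lemma tensor_grade_mult:
  assumes "\<And>i j x y. x \<in> G i \<Longrightarrow> y \<in> G j \<Longrightarrow> x * y \<in> G (i + j)"
    "\<And>i j x y. x \<in> G' i \<Longrightarrow> y \<in> G' j \<Longrightarrow> x * y \<in> G' (i + j)"
    "s \<in> tensor_grade G G' p" "t \<in> tensor_grade G G' q"
  shows "s * t \<in> tensor_grade G G' (p + q)"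
  using tensor_mult_grade[OF biadditive_mult biadditive_mult assms] by (simp add: tensor_mult_times)

lemma one_tensor_grade: "1 \<in> G 0 \<Longrightarrow> 1 \<in> G' 0 \<Longrightarrow> 1 \<in> tensor_grade G G' 0"
  unfolding tens_1[symmetric] by (rule tens_in_tensor_grade[of _ _ 0 _ _ 0]) simp_all

lemma sym_comult_eq: "sym_comult = (\<lambda>f. tmap \<theta> \<theta> (\<delta>b (\<theta>' f)))"
proof -
  let ?D = "\<lambda>f. tmap \<theta> \<theta> (\<delta>b (\<theta>' f))"
  have r: "rhom ?D"
    by (intro rhom_comp[OF rhom_tmap[OF rhom_\<theta> rhom_\<theta>]] rhom_comp[OF rhom_\<delta>b] rhom_\<theta>')
  have h: "?D (h_sym n) = (\<Sum>k\<le>n. h_sym k \<otimes> h_sym (n - k))" for n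
    by (simp only: \<theta>_b_gen[symmetric] \<theta>'_\<theta> \<delta>b_b_gen rhom_sum[OF rhom_tmap[OF rhom_\<theta> rhom_\<theta>]]
        tmap_tens rhom_additive[OF rhom_\<theta>])
  show ?thesis
    unfolding sym_comult_def
  proof (rule the_equality)
    show "additive ?D \<and> ?D 1 = 1 \<otimes> 1 \<and> (\<forall>f g. ?D (f * g) = tensor_mult (*) (*) (?D f) (?D g)) \<and>
        (\<forall>n. ?D (h_sym n) = (\<Sum>k\<le>n. h_sym k \<otimes> h_sym (n - k)))"
      using r h by (simp add: rhom_def tens_1 tensor_mult_times)
  next
    fix D assume D: "additive D \<and> D 1 = 1 \<otimes> 1 \<and> (\<forall>f g. D (f * g) = tensor_mult (*) (*) (D f) (D g)) \<and>
        (\<forall>n. D (h_sym n) = (\<Sum>k\<le>n. h_sym k \<otimes> h_sym (n - k)))"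
    then have "rhom D" by (simp add: rhom_def tens_1 tensor_mult_times)
    then show "D = ?D" by (intro ext) (rule rhom_sym_eqI[OF _ r], use D h in simp_all)
  qed
qed

lemma rhom_sym_comult: "rhom sym_comult"
  unfolding sym_comult_eq
  by (intro rhom_comp[OF rhom_tmap[OF rhom_\<theta> rhom_\<theta>]] rhom_comp[OF rhom_\<delta>b] rhom_\<theta>')

lemma sym_comult_h: "sym_comult (h_sym n) = (\<Sum>k\<le>n. h_sym k \<otimes> h_sym (n - k))"
  by (simp only: sym_comult_eq \<theta>_b_gen[symmetric] \<theta>'_\<theta> \<delta>b_b_gen rhom_sum[OF rhom_tmap[OF rhom_\<theta> rhom_\<theta>]]
      tmap_tens rhom_additive[OF rhom_\<theta>])

lemma sym_pairing_mult_left: "sym_pairing (f * g) h = tpair (sym_pairing f) (sym_pairing g) (sym_comult h)"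
proof -
  note a = rhom_additive[OF rhom_\<theta>]
  have "tpair (sym_pairing f) (sym_pairing g) (sym_comult h) =
      tpair (\<lambda>x. sym_pairing f (\<theta> x)) (\<lambda>x. sym_pairing g (\<theta> x)) (\<delta>b (\<theta>' h))"
    unfolding sym_comult_eq by (rule tpair_tmap[OF additive_pairing_right additive_pairing_right a a])
  then show ?thesis
    by (simp add: sym_pairing_eq cpair_mult[symmetric])
qed

text \<open>Self-duality of Sym: by symmetry of the pairing, the comultiplication is adjoint to the
  multiplication on either side.\<close>

lemma sym_pairing_mult_right:
  "sym_pairing f (g * h) = tpair (\<lambda>x. sym_pairing x g) (\<lambda>x. sym_pairing x h) (sym_comult f)"
proof -
  have "sym_pairing g = (\<lambda>x. sym_pairing x g)" for g
    by (rule ext) (rule sym_pairing_commute)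
  from this[of g] this[of h] show ?thesis
    unfolding sym_pairing_commute[of f] sym_pairing_mult_left by (rule arg_cong2[where f = "\<lambda>u v. tpair u v _"])
qed

lemma sym_counit_h: "sym_counit (h_sym n) = (if n = 0 then 1 else 0)"
  by (simp add: sym_counit_def h_sym.rep_eq)

lemma sym_counit_homogeneous: "f \<in> homogeneous n \<Longrightarrow> n \<noteq> 0 \<Longrightarrow> sym_counit f = 0"
  by (force simp: homogeneous_def sym_counit_def)

lemma sym_coassoc: "tassoc (tmap sym_comult id (sym_comult f)) = tmap id sym_comult (sym_comult f)"
proof (rule rhom_sym_eqI[of "\<lambda>f. tassoc (tmap sym_comult id (sym_comult f))"])
  note \<delta> = rhom_sym_comult
  note a = rhom_additive[OF \<delta>]
  show "rhom (\<lambda>f. tassoc (tmap sym_comult id (sym_comult f)))"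
    by (intro rhom_comp[OF rhom_tassoc] rhom_comp[OF rhom_tmap[OF \<delta> rhom_id]] \<delta>)
  show "rhom (\<lambda>f. tmap id sym_comult (sym_comult f))"
    by (intro rhom_comp[OF rhom_tmap[OF rhom_id \<delta>]] \<delta>)
  fix n
  have "tassoc (tmap sym_comult id (sym_comult (h_sym n))) =
      (\<Sum>k\<le>n. \<Sum>j\<le>k. h_sym j \<otimes> h_sym (k - j) \<otimes> h_sym (n - k))"
    by (simp only: sym_comult_h additive_sum[OF additive_tmap[OF a additive_id]] tmap_tens[OF a additive_id]
        sum_tens id_apply additive_sum[OF additive_tassoc] tassoc_tens)
  also have "\<dots> = (\<Sum>(k, j)\<in>(SIGMA k:{..n}. {..k}). h_sym j \<otimes> h_sym (k - j) \<otimes> h_sym (n - k))"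
    by (simp add: sum.Sigma)
  also have "\<dots> = (\<Sum>(j, i)\<in>(SIGMA j:{..n}. {..n - j}). h_sym j \<otimes> h_sym i \<otimes> h_sym (n - j - i))"
    by (rule sum.reindex_bij_witness[of _ "\<lambda>(j, i). (j + i, j)" "\<lambda>(k, j). (j, k - j)"]) auto
  also have "\<dots> = (\<Sum>j\<le>n. \<Sum>i\<le>n - j. h_sym j \<otimes> h_sym i \<otimes> h_sym (n - j - i))"
    by (simp add: sum.Sigma)
  also have "\<dots> = tmap id sym_comult (sym_comult (h_sym n))"
    by (simp only: sym_comult_h additive_sum[OF additive_tmap[OF additive_id a]] tmap_tens[OF additive_id a]
        tens_sum id_apply)
  finally show "tassoc (tmap sym_comult id (sym_comult (h_sym n))) = tmap id sym_comult (sym_comult (h_sym n))" .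
qed

lemma sym_counit_left: "tlift (\<lambda>a b. zmul (sym_counit a) b) (sym_comult f) = f"
proof -
  have r: "rhom (tlift (\<lambda>a b. of_int (sym_counit a) * b) :: (sym, sym) tensor \<Rightarrow> sym)"
    by (intro rhom_tlift rhom_of_int_comp rhom_sym_counit rhom_ident)
  have b: "biadditive (\<lambda>a (b :: sym). of_int (sym_counit a) * b)"
    unfolding zmul_of_int[symmetric] by (intro additive_intros rhom_additive[OF rhom_sym_counit])
  show ?thesis
    unfolding zmul_of_int
  proof (rule rhom_sym_eqI[OF rhom_comp[OF r rhom_sym_comult] rhom_ident])
    fix n
    have "tlift (\<lambda>a b. of_int (sym_counit a) * b) (sym_comult (h_sym n)) = (\<Sum>k\<le>n. if k = 0 then h_sym n else 0)"
      unfolding sym_comult_h rhom_sum[OF r] tlift_tens[OF b] by (intro sum.cong) (auto simp: sym_counit_h)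
    then show "tlift (\<lambda>a b. of_int (sym_counit a) * b) (sym_comult (h_sym n)) = h_sym n" by simp
  qed
qed

lemma sym_counit_right: "tlift (\<lambda>a b. zmul (sym_counit b) a) (sym_comult f) = f"
proof -
  have r: "rhom (tlift (\<lambda>a b. a * of_int (sym_counit b)) :: (sym, sym) tensor \<Rightarrow> sym)"
    by (intro rhom_tlift rhom_of_int_comp rhom_sym_counit rhom_ident)
  have b: "biadditive (\<lambda>(a :: sym) b. a * of_int (sym_counit b))"
    unfolding mult.commute[of _ "of_int _"] zmul_of_int[symmetric]
    by (intro additive_intros rhom_additive[OF rhom_sym_counit])
  show ?thesis
    unfolding zmul_of_int mult.commute[of "of_int _"]
  proof (rule rhom_sym_eqI[OF rhom_comp[OF r rhom_sym_comult] rhom_ident])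
    fix n
    have "tlift (\<lambda>a b. a * of_int (sym_counit b)) (sym_comult (h_sym n)) = (\<Sum>k\<le>n. if k = n then h_sym n else 0)"
      unfolding sym_comult_h rhom_sum[OF r] tlift_tens[OF b] by (intro sum.cong) (auto simp: sym_counit_h)
    then show "tlift (\<lambda>a b. a * of_int (sym_counit b)) (sym_comult (h_sym n)) = h_sym n" by simp
  qed
qed

lemma sym_comult_graded: "f \<in> homogeneous n \<Longrightarrow> sym_comult f \<in> tensor_grade homogeneous homogeneous n"
proof (rule rhom_sym_graded[OF rhom_sym_comult subspace_tensor_grade])
  show "sym_comult (h_sym k) \<in> tensor_grade homogeneous homogeneous (int k)" for k
    unfolding sym_comult_h
    by (intro tensor_grade_sum tens_in_tensor_grade[where G = homogeneous and G' = homogeneous, OF h_sym_homogeneous h_sym_homogeneous]) simp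
qed (auto intro: one_tensor_grade one_homogeneous tensor_grade_mult homogeneous_mult)

lemma e_sym_homogeneous: "e_sym n \<in> homogeneous (int n)"
  by (simp add: homogeneous_def e_sym.rep_eq)

text \<open>E(-t) H(t) = 1 says that these values on the h_n are the only ones an antipode can
  have.\<close>

definition sym_S :: "sym \<Rightarrow> sym" where
  "sym_S f = ev (\<lambda>n. (- 1) ^ n * e_sym n) (\<theta>' f)"

lemma rhom_sym_S: "rhom sym_S"
  unfolding sym_S_def by (rule rhom_comp[OF rhom_ev rhom_\<theta>'])

lemma e_sym_0: "e_sym 0 = 1"
  by (rule sym_eqI) (simp add: e_sym.rep_eq one_sym.rep_eq)

lemma sym_S_h: "sym_S (h_sym n) = (- 1) ^ n * e_sym n"
  by (cases "n = 0") (simp_all add: rhom_1[OF rhom_sym_S] e_sym_0, simp add: sym_S_def ev_b_gen flip: \<theta>_b_gen)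

lemma sym_S_conv: "(\<Sum>k\<le>n. sym_S (h_sym k) * h_sym (n - k)) = (if n = 0 then 1 else 0)"
  using e_h_convolution[of n] by (simp add: sym_S_h e_sym_0)

lemma sym_S_homogeneous: "f \<in> homogeneous n \<Longrightarrow> sym_S f \<in> homogeneous n"
proof (rule rhom_sym_graded[OF rhom_sym_S subspace_homogeneous one_homogeneous homogeneous_mult])
  show "sym_S (h_sym k) \<in> homogeneous (int k)" for k
    using zmod.subspace_scale[OF subspace_homogeneous e_sym_homogeneous, of "(- 1) ^ k"]
    by (simp add: sym_S_h zmul_of_int)
qed

text \<open>The grading is the only difference between \<open>Sym_lower\<close> and \<open>Sym_upper\<close>.\<close>

definition Sym_graded :: "(int \<Rightarrow> sym set) \<Rightarrow> sym hopf_data" where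
  "Sym_graded G = \<lparr>hgrade = G, hmult = (*), hone = 1, hcomult = sym_comult, hcounit = sym_counit\<rparr>"

lemma Sym_lower_eq: "Sym_lower = Sym_graded homogeneous"
  by (simp add: Sym_lower_def Sym_graded_def)

lemma Sym_upper_eq: "Sym_upper = Sym_graded (\<lambda>n. homogeneous (- n))"
  by (simp add: Sym_upper_def Sym_lower_def Sym_graded_def)

lemma Sym_graded_simps [simp]:
  "hgrade (Sym_graded G) = G" "hmult (Sym_graded G) = (*)" "hone (Sym_graded G) = 1"
  "hcomult (Sym_graded G) = sym_comult" "hcounit (Sym_graded G) = sym_counit"
  by (simp_all add: Sym_graded_def)

text \<open>Everything that mentions degrees is a hypothesis here, so the axioms free of degrees are
  proved once for both gradings.\<close>

lemma Sym_graded_hopf: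
  assumes "grading G"
    and mult: "\<And>i j x y. x \<in> G i \<Longrightarrow> y \<in> G j \<Longrightarrow> x * y \<in> G (i + j)" and one: "1 \<in> G 0"
    and comult: "\<And>n x. x \<in> G n \<Longrightarrow> sym_comult x \<in> tensor_grade G G n"
    and counit: "\<And>n x. x \<in> G n \<Longrightarrow> n \<noteq> 0 \<Longrightarrow> sym_counit x = 0"
    and S: "\<And>n x. x \<in> G n \<Longrightarrow> sym_S x \<in> G n"
  shows "graded_bialgebra (Sym_graded G)" "is_antipode (Sym_graded G) sym_S"
proof -
  show bi: "graded_bialgebra (Sym_graded G)"
    unfolding graded_bialgebra_def graded_algebra_def graded_coalgebra_def Sym_graded_simps
    by (intro conjI allI ballI impI assms biadditive_mult
        rhom_additive[OF rhom_sym_comult] rhom_additive[OF rhom_sym_counit] sym_coassoc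
        sym_counit_left sym_counit_right)
      (simp_all add: mult.assoc tensor_mult_times rhom_mult rhom_1 rhom_sym_comult rhom_sym_counit tens_1)
  have u: "rhom (\<lambda>x. of_int (sym_counit x) :: sym)"
    by (rule rhom_of_int_comp[OF rhom_sym_counit])
  have r: "rhom (tlift (\<lambda>a b. sym_S a * b) :: (sym, sym) tensor \<Rightarrow> sym)"
      "rhom (tlift (\<lambda>a b. a * sym_S b) :: (sym, sym) tensor \<Rightarrow> sym)"
    by (intro rhom_tlift rhom_sym_S rhom_ident)+
  have b: "biadditive (\<lambda>a b. sym_S a * b)" "biadditive (\<lambda>a b. a * sym_S b)"
    by (intro additive_intros rhom_additive[OF rhom_sym_S])+
  have "tlift (\<lambda>a b. sym_S a * b) (sym_comult x) = of_int (sym_counit x)" for x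
    by (rule rhom_sym_eqI[OF rhom_comp[OF r(1) rhom_sym_comult] u])
      (simp add: sym_comult_h rhom_sum[OF r(1)] tlift_tens[OF b(1)] sym_S_conv sym_counit_h)
  moreover have "tlift (\<lambda>a b. a * sym_S b) (sym_comult x) = of_int (sym_counit x)" for x
  proof (rule rhom_sym_eqI[OF rhom_comp[OF r(2) rhom_sym_comult] u])
    fix n
    have "(\<Sum>k\<le>n. h_sym k * sym_S (h_sym (n - k))) = (\<Sum>k\<le>n. sym_S (h_sym k) * h_sym (n - k))"
      by (rule sum.reindex_bij_witness[of _ "\<lambda>k. n - k" "\<lambda>k. n - k"]) (auto simp: mult.commute)
    then show "tlift (\<lambda>a b. a * sym_S b) (sym_comult (h_sym n)) = of_int (sym_counit (h_sym n))"
      by (simp add: sym_comult_h rhom_sum[OF r(2)] tlift_tens[OF b(2)] sym_S_conv sym_counit_h)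
  qed
  ultimately show "is_antipode (Sym_graded G) sym_S"
    using S by (auto simp: is_antipode_def rhom_additive[OF rhom_sym_S] zmul_of_int)
qed

lemma grading_homogeneous_neg: "grading (\<lambda>n. homogeneous (- n))"
proof -
  have "homogeneous (- n) = zmod.span {m_sym l |l. - int (weight l) = n}" for n
    unfolding homogeneous_eq by (intro arg_cong[of _ _ zmod.span]) auto
  then show ?thesis using Sm.grading_span[of "\<lambda>l. - int (weight l)"] by simp
qed

lemma tensor_grade_neg: "tensor_grade (\<lambda>n. G (- n)) (\<lambda>n. G' (- n)) n = tensor_grade G G' (- n)"
  unfolding tensor_grade_def
proof (intro arg_cong[of _ _ zmod.span] set_eqI iffI)
  show "t \<in> {a \<otimes> b |a b i j. a \<in> G i \<and> b \<in> G' j \<and> i + j = - n}"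
    if "t \<in> {a \<otimes> b |a b i j. a \<in> G (- i) \<and> b \<in> G' (- j) \<and> i + j = n}" for t
  proof -
    from that obtain a b i j where "t = a \<otimes> b" "a \<in> G (- i)" "b \<in> G' (- j)" "- i + - j = - n" by auto
    then show ?thesis by blast
  qed
  show "t \<in> {a \<otimes> b |a b i j. a \<in> G (- i) \<and> b \<in> G' (- j) \<and> i + j = n}"
    if "t \<in> {a \<otimes> b |a b i j. a \<in> G i \<and> b \<in> G' j \<and> i + j = - n}" for t
  proof -
    from that obtain a b i j where "t = a \<otimes> b" "a \<in> G (- (- i))" "b \<in> G' (- (- j))" "(- i) + (- j) = n" by auto
    then show ?thesis by blast
  qed
qed

lemma Sym_lower_hopf: "graded_bialgebra Sym_lower" "is_antipode Sym_lower sym_S"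
  unfolding Sym_lower_eq
  by (rule Sym_graded_hopf; intro grading_homogeneous homogeneous_mult one_homogeneous sym_comult_graded
      sym_counit_homogeneous sym_S_homogeneous; assumption)+

lemma Sym_upper_hopf: "graded_bialgebra Sym_upper" "is_antipode Sym_upper sym_S"
proof -
  have *: "x * y \<in> homogeneous (- (i + j))" if "x \<in> homogeneous (- i)" "y \<in> homogeneous (- j)" for x y i j
    using homogeneous_mult[OF that] by simp
  have **: "sym_counit x = 0" if "x \<in> homogeneous (- n)" "n \<noteq> 0" for x n
    using sym_counit_homogeneous[OF that(1)] that(2) by simp
  show "graded_bialgebra Sym_upper" "is_antipode Sym_upper sym_S"
    unfolding Sym_upper_eq
    by (rule Sym_graded_hopf; (rule grading_homogeneous_neg * ** sym_S_homogeneous; assumption)?;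
        simp add: one_homogeneous tensor_grade_neg sym_comult_graded grading_homogeneous_neg)+
qed

lemma hopf_algebra_Sym: "hopf_algebra Sym_lower" "hopf_algebra Sym_upper"
  unfolding hopf_algebra_def using Sym_lower_hopf Sym_upper_hopf by blast+

lemma antipode_Sym: "antipode Sym_lower = sym_S" "antipode Sym_upper = sym_S"
  using antipode_eq[OF Sym_lower_hopf] antipode_eq[OF Sym_upper_hopf] .

section \<open>The coaction\<close>

definition \<rho> :: "sym \<Rightarrow> (Dlower, sym) tensor" where
  "\<rho> f = ev (\<lambda>n. \<Sum>m\<le>n. M n m \<otimes> h_sym m) (\<theta>' f)"

lemma rhom_\<rho>: "rhom \<rho>"
  unfolding \<rho>_def by (rule rhom_comp[OF rhom_ev rhom_\<theta>'])

lemma \<rho>_h: "\<rho> (h_sym n) = (\<Sum>m\<le>n. M n m \<otimes> h_sym m)"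
  by (cases "n = 0") (simp_all add: rhom_1[OF rhom_\<rho>] tens_1, simp add: \<rho>_def ev_b_gen flip: \<theta>_b_gen)

text \<open>The same matrix calculation as for D_*, with the column of the h_e as last
  factor.\<close>

lemma \<rho>_coassoc: "tassoc (tmap Dlower_comult id (\<rho> f)) = tmap id \<rho> (\<rho> f)"
proof (rule rhom_sym_eqI[of "\<lambda>f. tassoc (tmap Dlower_comult id (\<rho> f))"])
  note \<Delta> = rhom_Dlower_comult
  show "rhom (\<lambda>f. tassoc (tmap Dlower_comult id (\<rho> f)))"
    by (intro rhom_comp[OF rhom_tassoc] rhom_comp[OF rhom_tmap[OF \<Delta> rhom_id]] rhom_\<rho>)
  show "rhom (\<lambda>f. tmap id \<rho> (\<rho> f))"
    by (intro rhom_comp[OF rhom_tmap[OF rhom_id rhom_\<rho>]] rhom_\<rho>)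
  note a = rhom_additive[OF \<Delta>] and b = rhom_additive[OF rhom_\<rho>]
  fix n
  have "tassoc (tmap Dlower_comult id (\<rho> (h_sym n))) = (\<Sum>e\<le>n. \<Sum>f\<le>n. M n f \<otimes> M f e \<otimes> h_sym e)"
    by (simp only: \<rho>_h Dlower_comult_M additive_sum[OF additive_tmap[OF a additive_id]] tmap_tens[OF a additive_id]
        sum_tens id_apply additive_sum[OF additive_tassoc] tassoc_tens)
  also have "\<dots> = (\<Sum>f\<le>n. \<Sum>e\<le>n. M n f \<otimes> M f e \<otimes> h_sym e)"
    by (rule sum.swap)
  also have "\<dots> = (\<Sum>f\<le>n. \<Sum>e\<le>f. M n f \<otimes> M f e \<otimes> h_sym e)"
    by (intro sum.cong refl sum.mono_neutral_right) (auto simp: M_less)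
  also have "\<dots> = tmap id \<rho> (\<rho> (h_sym n))"
    by (simp only: \<rho>_h additive_sum[OF additive_tmap[OF additive_id b]] tmap_tens[OF additive_id b]
        tens_sum id_apply)
  finally show "tassoc (tmap Dlower_comult id (\<rho> (h_sym n))) = tmap id \<rho> (\<rho> (h_sym n))" .
qed

lemma \<rho>_counit: "tlift (\<lambda>a b. zmul (Dlower_counit a) b) (\<rho> f) = f"
proof -
  have r: "rhom (tlift (\<lambda>a b. of_int (Dlower_counit a) * b) :: (Dlower, sym) tensor \<Rightarrow> sym)"
    by (intro rhom_tlift rhom_of_int_comp rhom_Dlower_counit rhom_ident)
  have b: "biadditive (\<lambda>a (b :: sym). of_int (Dlower_counit a) * b)"
    unfolding zmul_of_int[symmetric] by (intro additive_intros rhom_additive[OF rhom_Dlower_counit])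
  show ?thesis
    unfolding zmul_of_int
  proof (rule rhom_sym_eqI[OF rhom_comp[OF r rhom_\<rho>] rhom_ident])
    fix n
    have "tlift (\<lambda>a b. of_int (Dlower_counit a) * b) (\<rho> (h_sym n)) = (\<Sum>e\<le>n. if e = n then h_sym n else 0)"
      unfolding \<rho>_h rhom_sum[OF r] tlift_tens[OF b] by (intro sum.cong) (auto simp: Dlower_counit_M)
    then show "tlift (\<lambda>a b. of_int (Dlower_counit a) * b) (\<rho> (h_sym n)) = h_sym n" by simp
  qed
qed

lemma \<rho>_graded: "f \<in> homogeneous n \<Longrightarrow> \<rho> f \<in> tensor_grade Dlower_grade homogeneous n"
proof (rule rhom_sym_graded[OF rhom_\<rho> subspace_tensor_grade])
  show "\<rho> (h_sym k) \<in> tensor_grade Dlower_grade homogeneous (int k)" for k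
    unfolding \<rho>_h
    by (intro tensor_grade_sum tens_in_tensor_grade[where G = Dlower_grade and G' = homogeneous, OF M_grade h_sym_homogeneous]) simp
qed (auto intro: one_tensor_grade one_Dlower_grade one_homogeneous tensor_grade_mult Dlower_grade_mult homogeneous_mult)

text \<open>Inserting 1 into the free slot turns the tensor coaction into a product in the ring D_*
  \<otimes> (A \<otimes> B). In this form it is visibly a ring homomorphism when the two coactions
  are.\<close>

lemma tensor_coact_eq:
  fixes \<rho>1 :: "'a::aug_ring \<Rightarrow> (Dlower, 'a) tensor" and \<rho>2 :: "'b::aug_ring \<Rightarrow> (Dlower, 'b) tensor"
  assumes "additive \<rho>1" "additive \<rho>2"
  shows "tensor_coact Dlower_hopf \<rho>1 \<rho>2 =
    tlift (\<lambda>a b. tmap id (\<lambda>a'. a' \<otimes> 1) (\<rho>1 a) * tmap id (\<lambda>b'. 1 \<otimes> b') (\<rho>2 b))"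
proof -
  have t1: "additive (\<lambda>a' :: 'a. a' \<otimes> (1 :: 'b))" and t2: "additive (\<lambda>b' :: 'b. (1 :: 'a) \<otimes> b')"
    by (intro additive_intros)+
  have bi: "biadditive (\<lambda>k b'. (h * k) \<otimes> a' \<otimes> b')" for h :: Dlower and a' :: 'a
    by (intro additive_intros)
  have bi2: "biadditive (\<lambda>h a'. tlift (\<lambda>k b'. (h * k) \<otimes> a' \<otimes> b') t)" for t :: "(Dlower, 'b) tensor"
    by (intro additive_intros)
  have "tlift (\<lambda>h a'. tlift (\<lambda>k b'. (h * k) \<otimes> a' \<otimes> b') t) s = tmap id (\<lambda>a'. a' \<otimes> 1) s * tmap id (\<lambda>b'. 1 \<otimes> b') t"
    for s :: "(Dlower, 'a) tensor" and t :: "(Dlower, 'b) tensor"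
  proof (rule additive_eqI_tensor[OF additive_tlift[OF bi2]])
    show "additive (\<lambda>s. tmap id (\<lambda>a'. a' \<otimes> 1) s * tmap id (\<lambda>b'. 1 \<otimes> b') t)"
      by (intro additive_intros additive_tmap additive_id t1)
    show "tlift (\<lambda>h a'. tlift (\<lambda>k b'. (h * k) \<otimes> a' \<otimes> b') t) (h \<otimes> a) =
        tmap id (\<lambda>a'. a' \<otimes> 1) (h \<otimes> a) * tmap id (\<lambda>b'. 1 \<otimes> b') t" for h :: Dlower and a :: 'a
    proof -
      have e: "tmap id (\<lambda>a'. a' \<otimes> (1 :: 'b)) (h \<otimes> a) = h \<otimes> a \<otimes> 1"
        using tmap_tens[OF additive_id t1] by (simp only: id_apply)
      have "tlift (\<lambda>k b'. (h * k) \<otimes> a \<otimes> b') t = (h \<otimes> a \<otimes> 1) * tmap id (\<lambda>b'. 1 \<otimes> b') t"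
        by (rule additive_eqI_tensor[OF additive_tlift[OF bi]])
          (intro additive_intros additive_tmap additive_id t2
            | simp add: tlift_tens[OF bi] tmap_tens additive_ident t2 tens_times)+
      then show ?thesis unfolding tlift_tens[OF bi2] e .
    qed
  qed
  then show ?thesis by (simp add: tensor_coact_def)
qed

lemma rhom_tensor_coact:
  fixes \<rho>1 :: "'a::aug_ring \<Rightarrow> (Dlower, 'a) tensor" and \<rho>2 :: "'b::aug_ring \<Rightarrow> (Dlower, 'b) tensor"
  assumes "rhom \<rho>1" "rhom \<rho>2"
  shows "rhom (tensor_coact Dlower_hopf \<rho>1 \<rho>2)"
proof -
  have "rhom (\<lambda>a' :: 'a. a' \<otimes> (1 :: 'b))" "rhom (\<lambda>b' :: 'b. (1 :: 'a) \<otimes> b')"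
    by (simp_all add: rhom_def tens_1 tens_times additive_intros)
  then show ?thesis
    unfolding tensor_coact_eq[OF assms[THEN rhom_additive]]
    by (intro rhom_tlift rhom_comp[OF rhom_tmap[OF rhom_id]] assms)
qed

lemma tensor_coact_tens:
  assumes "additive \<rho>1" "additive \<rho>2"
  shows "tensor_coact Dlower_hopf \<rho>1 \<rho>2 (a \<otimes> b) = tmap id (\<lambda>a'. a' \<otimes> 1) (\<rho>1 a) * tmap id (\<lambda>b'. 1 \<otimes> b') (\<rho>2 b)"
  unfolding tensor_coact_eq[OF assms]
  by (rule tlift_tens)
    (intro additive_intros additive_tmap_comp additive_id assms)

text \<open>Multiplying the two slots together undoes the insertion of 1, and what remains is
  multiplicativity of \<rho>.\<close>

lemma \<rho>_mult: "comodule_map (tensor_coact Dlower_hopf \<rho> \<rho>) \<rho> (tlift (*))"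
  unfolding comodule_map_def
proof (intro conjI allI)
  have m: "rhom (tlift (*) :: (sym, sym) tensor \<Rightarrow> sym)"
    by (rule rhom_tlift[OF rhom_ident rhom_ident])
  show a: "additive (tlift (*) :: (sym, sym) tensor \<Rightarrow> sym)" by (rule rhom_additive[OF m])
  have t1: "additive (\<lambda>a :: sym. a \<otimes> (1 :: sym))" and t2: "additive (\<lambda>a :: sym. (1 :: sym) \<otimes> a)"
    by (intro additive_intros)+
  have i: "tmap id (tlift (*)) (tmap id (\<lambda>a'. a' \<otimes> 1) s) = s"
      "tmap id (tlift (*)) (tmap id (\<lambda>a'. 1 \<otimes> a') s) = s" for s :: "(Dlower, sym) tensor"
  proof -
    show "tmap id (tlift (*)) (tmap id (\<lambda>a'. a' \<otimes> 1) s) = s"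
    proof (rule additive_eqI_tensor[of "\<lambda>s. tmap id (tlift (*)) (tmap id (\<lambda>a'. a' \<otimes> 1) s)" "\<lambda>s. s"])
      show "additive (\<lambda>s :: (Dlower, sym) tensor. tmap id (tlift (*)) (tmap id (\<lambda>a'. a' \<otimes> 1) s))"
        by (intro additive_tmap_comp[OF additive_id a] additive_tmap additive_id t1)
      show "tmap id (tlift (*)) (tmap id (\<lambda>a'. a' \<otimes> 1) (x \<otimes> y)) = x \<otimes> y" for x :: Dlower and y :: sym
        unfolding tmap_tens[OF additive_id t1] tmap_tens[OF additive_id a] tlift_tens[OF biadditive_mult] by simp
    qed (rule additive_ident)
    show "tmap id (tlift (*)) (tmap id (\<lambda>a'. 1 \<otimes> a') s) = s"
    proof (rule additive_eqI_tensor[of "\<lambda>s. tmap id (tlift (*)) (tmap id (\<lambda>a'. 1 \<otimes> a') s)" "\<lambda>s. s"])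
      show "additive (\<lambda>s :: (Dlower, sym) tensor. tmap id (tlift (*)) (tmap id (\<lambda>a'. 1 \<otimes> a') s))"
        by (intro additive_tmap_comp[OF additive_id a] additive_tmap additive_id t2)
      show "tmap id (tlift (*)) (tmap id (\<lambda>a'. 1 \<otimes> a') (x \<otimes> y)) = x \<otimes> y" for x :: Dlower and y :: sym
        unfolding tmap_tens[OF additive_id t2] tmap_tens[OF additive_id a] tlift_tens[OF biadditive_mult] by simp
    qed (rule additive_ident)
  qed
  fix t
  show "\<rho> (tlift (*) t) = tmap id (tlift (*)) (tensor_coact Dlower_hopf \<rho> \<rho> t)"
  proof (rule additive_eqI_tensor[of "\<lambda>t. \<rho> (tlift (*) t)"])
    show "additive (\<lambda>t. \<rho> (tlift (*) t))" by (rule additive_comp[OF rhom_additive[OF rhom_\<rho>] a])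
    show "additive (\<lambda>t. tmap id (tlift (*)) (tensor_coact Dlower_hopf \<rho> \<rho> t))"
      by (intro rhom_additive rhom_comp[OF rhom_tmap[OF rhom_id m]] rhom_tensor_coact rhom_\<rho>)
    show "\<rho> (tlift (*) (x \<otimes> y)) = tmap id (tlift (*)) (tensor_coact Dlower_hopf \<rho> \<rho> (x \<otimes> y))" for x y
      unfolding tensor_coact_tens[OF rhom_additive[OF rhom_\<rho>] rhom_additive[OF rhom_\<rho>]]
        rhom_mult[OF rhom_tmap[OF rhom_id m]] i tlift_tens[OF biadditive_mult] by (rule rhom_mult[OF rhom_\<rho>])
  qed
qed

lemma \<rho>_unit: "comodule_map (trivial_coact Dlower_hopf) \<rho> (\<lambda>n. zmul n 1)"
proof -
  have a: "additive (\<lambda>n. zmul n (1 :: sym))" by (intro additive_intros)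
  have "\<rho> (zmul n 1) = 1 \<otimes> zmul n 1" for n
    by (simp add: additive_zmul[OF rhom_additive[OF rhom_\<rho>]] rhom_1[OF rhom_\<rho>] zmul_tens_right flip: tens_1)
  then show ?thesis
    unfolding comodule_map_def trivial_coact_def tmap_tens[OF additive_id a] id_apply Dlower_hopf_simps
    using a by blast
qed

lemma \<rho>_comult: "comodule_map \<rho> (tensor_coact Dlower_hopf \<rho> \<rho>) sym_comult"
  unfolding comodule_map_def
proof (intro conjI allI)
  show "additive sym_comult" by (rule rhom_additive[OF rhom_sym_comult])
  fix f
  let ?T = "tensor_coact Dlower_hopf \<rho> \<rho>"
  have rT: "rhom ?T" by (rule rhom_tensor_coact[OF rhom_\<rho> rhom_\<rho>])
  have rD: "rhom (tmap id sym_comult :: (Dlower, sym) tensor \<Rightarrow> _)" by (rule rhom_tmap[OF rhom_id rhom_sym_comult])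
  have t: "additive (\<lambda>a :: sym. a \<otimes> (1 :: sym))" "additive (\<lambda>a :: sym. (1 :: sym) \<otimes> a)"
    by (intro additive_intros)+
  show "?T (sym_comult f) = tmap id sym_comult (\<rho> f)"
  proof (rule rhom_sym_eqI[OF rhom_comp[OF rT rhom_sym_comult] rhom_comp[OF rD rhom_\<rho>]])
    fix n
    have "?T (sym_comult (h_sym n)) =
        (\<Sum>k\<le>n. (\<Sum>a\<le>k. M k a \<otimes> (h_sym a \<otimes> 1)) * (\<Sum>c\<le>n - k. M (n - k) c \<otimes> (1 \<otimes> h_sym c)))"
      unfolding sym_comult_h rhom_sum[OF rT] tensor_coact_tens[OF rhom_additive[OF rhom_\<rho>] rhom_additive[OF rhom_\<rho>]] \<rho>_h
        additive_sum[OF additive_tmap[OF additive_id t(1)]] additive_sum[OF additive_tmap[OF additive_id t(2)]]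
        tmap_tens[OF additive_id t(1)] tmap_tens[OF additive_id t(2)] id_apply ..
    \<comment> \<open>\<open>M_convolution\<close> with X a = h_a \<otimes> 1 and Y c = 1 \<otimes>
      h_c, whose Cauchy product is the comultiplication of h_e.\<close>
    also have "\<dots> = (\<Sum>e\<le>n. M n e \<otimes> sym_comult (h_sym e))"
      unfolding M_convolution by (simp add: tens_times sym_comult_h)
    also have "\<dots> = tmap id sym_comult (\<rho> (h_sym n))"
      unfolding \<rho>_h rhom_sum[OF rD] tmap_tens[OF additive_id rhom_additive[OF rhom_sym_comult]] id_apply ..
    finally show "?T (sym_comult (h_sym n)) = tmap id sym_comult (\<rho> (h_sym n))" .
  qed
qed

text \<open>A power series with constant term 1 can be cancelled, since its coefficients can be
  solved for recursively.\<close>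

lemma convolution_cancel:
  fixes X Y Z :: "nat \<Rightarrow> 'a::comm_ring_1"
  assumes "\<And>n. (\<Sum>k\<le>n. X k * Z (n - k)) = (\<Sum>k\<le>n. Y k * Z (n - k))" "Z 0 = 1"
  shows "X n = Y n"
proof (induction n rule: less_induct)
  case (less n)
  have "(\<Sum>k<n. X k * Z (n - k)) = (\<Sum>k<n. Y k * Z (n - k))"
    using less by (intro sum.cong) auto
  then show ?case using assms(1)[of n] assms(2) by (simp add: lessThan_Suc_atMost[symmetric])
qed

text \<open>Both sides on h_n form the inverse of the series with coefficients \<rho> h_n: one
  because \<rho> is multiplicative, the other by \<open>M_convolution\<close>. Inverses of series
  are unique.\<close>

lemma \<rho>_antipode: "comodule_map \<rho> \<rho> sym_S"
  unfolding comodule_map_def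
proof (intro conjI allI)
  show aS: "additive sym_S" by (rule rhom_additive[OF rhom_sym_S])
  fix f
  have rS: "rhom (tmap id sym_S :: (Dlower, sym) tensor \<Rightarrow> _)" by (rule rhom_tmap[OF rhom_id rhom_sym_S])
  show "\<rho> (sym_S f) = tmap id sym_S (\<rho> f)"
  proof (rule rhom_sym_eqI[OF rhom_comp[OF rhom_\<rho> rhom_sym_S] rhom_comp[OF rS rhom_\<rho>]])
    show "\<rho> (sym_S (h_sym n)) = tmap id sym_S (\<rho> (h_sym n))" for n
    proof (rule convolution_cancel[of _ "\<lambda>n. \<rho> (h_sym n)" "\<lambda>n. tmap id sym_S (\<rho> (h_sym n))"])
      fix n
      have "(\<Sum>k\<le>n. tmap id sym_S (\<rho> (h_sym k)) * \<rho> (h_sym (n - k))) =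
          (\<Sum>k\<le>n. (\<Sum>a\<le>k. M k a \<otimes> sym_S (h_sym a)) * (\<Sum>c\<le>n - k. M (n - k) c \<otimes> h_sym c))"
        unfolding \<rho>_h rhom_sum[OF rS] tmap_tens[OF additive_id aS] id_apply ..
      also have "\<dots> = (\<Sum>e\<le>n. if e = 0 then M n 0 \<otimes> 1 else 0)"
        unfolding M_convolution sym_S_conv by (intro sum.cong) auto
      also have "\<dots> = \<rho> (\<Sum>k\<le>n. sym_S (h_sym k) * h_sym (n - k))"
        by (simp add: sym_S_conv M_0_right rhom_1[OF rhom_\<rho>] rhom_0[OF rhom_\<rho>] tens_1)
      also have "\<dots> = (\<Sum>k\<le>n. \<rho> (sym_S (h_sym k)) * \<rho> (h_sym (n - k)))"
        by (simp only: rhom_sum[OF rhom_\<rho>] rhom_mult[OF rhom_\<rho>])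
      finally show "(\<Sum>k\<le>n. \<rho> (sym_S (h_sym k)) * \<rho> (h_sym (n - k))) =
          (\<Sum>k\<le>n. tmap id sym_S (\<rho> (h_sym k)) * \<rho> (h_sym (n - k)))" ..
    qed (simp add: rhom_1[OF rhom_\<rho>])
  qed
qed

lemma comodule_hopf_\<rho>: "left_comodule_hopf_algebra Dlower_hopf Sym_lower \<rho>"
  unfolding left_comodule_hopf_algebra_def left_comodule_def antipode_Sym
  using hopf_algebra_Dlower hopf_algebra_Sym \<rho>_coassoc \<rho>_counit \<rho>_graded \<rho>_mult \<rho>_unit \<rho>_comult \<rho>_antipode
    rhom_additive[OF rhom_\<rho>]
  by (simp add: Sym_lower_eq)

section \<open>The matrix of the substitution on monomials\<close>

text \<open>\<open>K \<gamma> \<delta>\<close> is the coefficient of \<open>x\<^sup>\<gamma>\<close> in \<open>x\<^sup>\<delta>\<close> after the substitution \<open>x\<^sub>i \<mapsto> x\<^sub>i + b\<^sub>1 x\<^sub>i\<^sup>2 + \<dots>\<close>.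
  Variables of \<open>\<delta>\<close> outside \<open>\<gamma>\<close> are ignored, so this is only meant for \<open>\<delta> \<subseteq># \<gamma>\<close>.\<close>

definition K :: "mono \<Rightarrow> mono \<Rightarrow> Dlower" where
  "K \<gamma> \<delta> = (\<Prod>i\<in>set_mset \<gamma>. M (count \<gamma> i) (count \<delta> i))"

lemma h_prod_mtype:
  assumes "finite S" "set_mset \<delta> \<subseteq> S"
  shows "h_prod (mtype \<delta>) = (\<Prod>i\<in>S. h_sym (count \<delta> i))"
  by (simp only: \<theta>_b_mono[symmetric] b_mono_mtype[OF assms] rhom_prod[OF rhom_\<theta>] \<theta>_b_gen)

text \<open>The bridge between the two worlds: the coaction on products of h_n has the same matrix
  as the substitution on monomials.\<close>

lemma \<rho>_h_prod: "\<rho> (h_prod (mtype \<gamma>)) = (\<Sum>\<delta> | \<delta> \<subseteq># \<gamma>. K \<gamma> \<delta> \<otimes> h_prod (mtype \<delta>))"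
proof -
  have "\<rho> (h_prod (mtype \<gamma>)) = (\<Prod>i\<in>set_mset \<gamma>. \<Sum>d\<le>count \<gamma> i. M (count \<gamma> i) d \<otimes> h_sym d)"
    by (simp only: h_prod_mtype[OF finite_set_mset order_refl] rhom_prod[OF rhom_\<rho>] \<rho>_h)
  also have "\<dots> = (\<Sum>\<delta> | \<delta> \<subseteq># \<gamma>. \<Prod>i\<in>set_mset \<gamma>. M (count \<gamma> i) (count \<delta> i) \<otimes> h_sym (count \<delta> i))"
    by (rule sum_submsets_prod[symmetric])
  also have "\<dots> = (\<Sum>\<delta> | \<delta> \<subseteq># \<gamma>. K \<gamma> \<delta> \<otimes> h_prod (mtype \<delta>))"
    by (intro sum.cong refl) (simp add: prod_tens K_def h_prod_mtype[of "set_mset \<gamma>"] set_mset_mono)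
  finally show ?thesis .
qed

text \<open>Over a common index set the product also sees variables of \<epsilon> outside \<delta>,
  which K ignores; each of them contributes a factor 0.\<close>

lemma K_extend:
  assumes "finite S" "set_mset \<delta> \<subseteq> S" "set_mset \<epsilon> \<subseteq> S"
  shows "(\<Prod>i\<in>S. M (count \<delta> i) (count \<epsilon> i)) = (if \<epsilon> \<subseteq># \<delta> then K \<delta> \<epsilon> else 0)"
proof (cases "\<epsilon> \<subseteq># \<delta>")
  case True
  have "K \<delta> \<epsilon> = (\<Prod>i\<in>S. M (count \<delta> i) (count \<epsilon> i))"
    unfolding K_def
  proof (rule prod.mono_neutral_left[OF assms(1,2)], intro ballI)
    fix i assume "i \<in> S - set_mset \<delta>"
    then have "count \<delta> i = 0" "count \<epsilon> i = 0"
      using submset_count_le[OF True, of i] by (auto simp: not_in_iff)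
    then show "M (count \<delta> i) (count \<epsilon> i) = 1" by (simp only: M_refl)
  qed
  with True show ?thesis by simp
next
  case False
  then obtain i where i: "count \<delta> i < count \<epsilon> i" by (meson not_le subseteq_mset_def)
  then have "i \<in> S" using assms(3) by (metis count_eq_zero_iff gr_implies_not0 subsetD)
  moreover have "M (count \<delta> i) (count \<epsilon> i) = 0" using i by (rule M_less)
  ultimately have "(\<Prod>i\<in>S. M (count \<delta> i) (count \<epsilon> i)) = 0"
    using assms(1) by (intro prod_zero) blast+
  with False show ?thesis by simp
qed

lemma Dlower_comult_K:
  assumes "\<epsilon> \<subseteq># \<gamma>"
  shows "Dlower_comult (K \<gamma> \<epsilon>) = (\<Sum>\<delta> | \<delta> \<subseteq># \<gamma>. K \<gamma> \<delta> \<otimes> (if \<epsilon> \<subseteq># \<delta> then K \<delta> \<epsilon> else 0))"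
proof -
  have "Dlower_comult (K \<gamma> \<epsilon>) = (\<Prod>i\<in>set_mset \<gamma>. \<Sum>d\<le>count \<gamma> i. M (count \<gamma> i) d \<otimes> M d (count \<epsilon> i))"
    by (simp only: K_def rhom_prod[OF rhom_Dlower_comult] Dlower_comult_M)
  also have "\<dots> = (\<Sum>\<delta> | \<delta> \<subseteq># \<gamma>. \<Prod>i\<in>set_mset \<gamma>. M (count \<gamma> i) (count \<delta> i) \<otimes> M (count \<delta> i) (count \<epsilon> i))"
    by (rule sum_submsets_prod[symmetric])
  also have "\<dots> = (\<Sum>\<delta> | \<delta> \<subseteq># \<gamma>. K \<gamma> \<delta> \<otimes> (if \<epsilon> \<subseteq># \<delta> then K \<delta> \<epsilon> else 0))"
    by (intro sum.cong refl)
      (simp only: prod_tens K_def[symmetric] K_extend[OF finite_set_mset set_mset_mono set_mset_mono[OF assms]] mem_Collect_eq)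
  finally show ?thesis .
qed

lemma K_grade: "\<delta> \<subseteq># \<gamma> \<Longrightarrow> K \<gamma> \<delta> \<in> Dlower_grade (int (size \<gamma>) - int (size \<delta>))"
proof -
  assume \<delta>: "\<delta> \<subseteq># \<gamma>"
  have "(\<Prod>i\<in>I. M (count \<gamma> i) (count \<delta> i)) \<in> Dlower_grade (\<Sum>i\<in>I. int (count \<gamma> i) - int (count \<delta> i))" for I
    by (induction I rule: infinite_finite_induct)
      (auto simp: one_Dlower_grade intro: Dlower_grade_mult M_grade)
  moreover have "size \<delta> = (\<Sum>i\<in>set_mset \<gamma>. count \<delta> i)"
    unfolding size_multiset_overloaded_eq using set_mset_mono[OF \<delta>]
    by (intro sum.mono_neutral_left) (auto simp: not_in_iff)
  ultimately show ?thesis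
    by (simp add: K_def sum_subtractf size_multiset_overloaded_eq)
qed

section \<open>The differential operators\<close>

lemma sum_submsets_split:
  fixes g :: "mono \<Rightarrow> mono \<Rightarrow> 'a::comm_monoid_add"
  shows "(\<Sum>\<alpha> | \<alpha> \<subseteq># \<gamma>. \<Sum>\<alpha>' | \<alpha>' \<subseteq># \<alpha>. g \<alpha>' (\<alpha> - \<alpha>')) = (\<Sum>\<alpha>' | \<alpha>' \<subseteq># \<gamma>. \<Sum>\<alpha>1 | \<alpha>1 \<subseteq># \<gamma> - \<alpha>'. g \<alpha>' \<alpha>1)"
proof -
  have "(\<Sum>(\<alpha>, \<alpha>')\<in>(SIGMA \<alpha>:{\<alpha>. \<alpha> \<subseteq># \<gamma>}. {\<alpha>'. \<alpha>' \<subseteq># \<alpha>}). g \<alpha>' (\<alpha> - \<alpha>')) =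
      (\<Sum>(\<alpha>', \<alpha>1)\<in>(SIGMA \<alpha>':{\<alpha>'. \<alpha>' \<subseteq># \<gamma>}. {\<alpha>1. \<alpha>1 \<subseteq># \<gamma> - \<alpha>'}). g \<alpha>' \<alpha>1)"
  proof (rule sum.reindex_bij_witness[of _ "\<lambda>(\<alpha>', \<alpha>1). (\<alpha>' + \<alpha>1, \<alpha>')" "\<lambda>(\<alpha>, \<alpha>'). (\<alpha>', \<alpha> - \<alpha>')"], goal_cases)
    case (2 a)
    then obtain \<alpha> \<beta> where a: "a = (\<alpha>, \<beta>)" "\<alpha> \<subseteq># \<gamma>" "\<beta> \<subseteq># \<alpha>" by auto
    have "\<beta> \<subseteq># \<gamma>" using a by (metis subset_mset.order_trans)
    moreover have "\<alpha> - \<beta> \<subseteq># \<gamma> - \<beta>" using a(2) by (simp add: subseteq_mset_def diff_le_mono)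
    ultimately show ?case by (simp add: a(1))
  next
    case (4 b)
    then obtain \<alpha> \<beta> where b: "b = (\<alpha>, \<beta>)" "\<alpha> \<subseteq># \<gamma>" "\<beta> \<subseteq># \<gamma> - \<alpha>" by auto
    then have "\<alpha> + \<beta> \<subseteq># \<gamma>" by (metis add.commute subset_mset.le_diff_conv2)
    then show ?case by (simp add: b(1))
  qed auto
  then show ?thesis by (simp add: sum.Sigma)
qed

lemma sum_submsets_flip:
  fixes g :: "mono \<Rightarrow> 'a::comm_monoid_add"
  shows "(\<Sum>\<alpha> | \<alpha> \<subseteq># \<gamma>. g (\<gamma> - \<alpha>)) = (\<Sum>\<alpha> | \<alpha> \<subseteq># \<gamma>. g \<alpha>)"
  by (rule sum.reindex_bij_witness[of _ "\<lambda>\<alpha>. \<gamma> - \<alpha>" "\<lambda>\<alpha>. \<gamma> - \<alpha>"])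
    (auto simp: subset_mset.diff_diff_right)

lemma sum_submsets_swap:
  fixes g :: "mono \<Rightarrow> mono \<Rightarrow> 'a::comm_monoid_add"
  shows "(\<Sum>\<alpha>' | \<alpha>' \<subseteq># \<gamma>. \<Sum>\<alpha>1 | \<alpha>1 \<subseteq># \<gamma> - \<alpha>'. g \<alpha>' \<alpha>1) = (\<Sum>\<alpha>' | \<alpha>' \<subseteq># \<gamma>. \<Sum>\<alpha>1 | \<alpha>1 \<subseteq># \<gamma> - \<alpha>'. g \<alpha>1 \<alpha>')"
  unfolding sum_submsets_split[symmetric] sum_submsets_split[of "\<lambda>\<alpha>' \<alpha>1. g \<alpha>1 \<alpha>'", symmetric]
proof (rule sum.cong[OF refl])
  fix \<alpha> :: mono
  have "(\<Sum>\<alpha>' | \<alpha>' \<subseteq># \<alpha>. g \<alpha>' (\<alpha> - \<alpha>')) = (\<Sum>\<alpha>' | \<alpha>' \<subseteq># \<alpha>. g (\<alpha> - \<alpha>') (\<alpha> - (\<alpha> - \<alpha>')))"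
    by (rule sum_submsets_flip[symmetric])
  then show "(\<Sum>\<alpha>' | \<alpha>' \<subseteq># \<alpha>. g \<alpha>' (\<alpha> - \<alpha>')) = (\<Sum>\<alpha>' | \<alpha>' \<subseteq># \<alpha>. g (\<alpha> - \<alpha>') \<alpha>')"
    by (simp add: subset_mset.diff_diff_right)
qed

text \<open>This makes the fold in \<open>D_form\<close> independent of the order of the parts, so
  that it can be unfolded one part at a time.\<close>

lemma vee_left_commute: "P \<^bold>\<or> (Q \<^bold>\<or> R) = Q \<^bold>\<or> (P \<^bold>\<or> R)"
proof (intro ext)
  fix \<alpha> \<beta>
  have exp: "(P \<^bold>\<or> (Q \<^bold>\<or> R)) \<alpha> \<beta> = (\<Sum>\<alpha>' | \<alpha>' \<subseteq># \<alpha>. \<Sum>\<alpha>1 | \<alpha>1 \<subseteq># \<alpha> - \<alpha>'. \<Sum>\<beta>' | \<beta>' \<subseteq># \<beta>. \<Sum>\<beta>1 | \<beta>1 \<subseteq># \<beta> - \<beta>'.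
      P \<alpha>' \<beta>' * (Q \<alpha>1 \<beta>1 * R (\<alpha> - (\<alpha>' + \<alpha>1)) (\<beta> - (\<beta>' + \<beta>1))))" for P Q
    unfolding vee_def sum_distrib_left diff_diff_add by (rule sum.cong[OF refl], rule sum.swap)
  have "(P \<^bold>\<or> (Q \<^bold>\<or> R)) \<alpha> \<beta> = (\<Sum>\<alpha>' | \<alpha>' \<subseteq># \<alpha>. \<Sum>\<alpha>1 | \<alpha>1 \<subseteq># \<alpha> - \<alpha>'. \<Sum>\<beta>' | \<beta>' \<subseteq># \<beta>. \<Sum>\<beta>1 | \<beta>1 \<subseteq># \<beta> - \<beta>'.
      P \<alpha>1 \<beta>1 * (Q \<alpha>' \<beta>' * R (\<alpha> - (\<alpha>1 + \<alpha>')) (\<beta> - (\<beta>1 + \<beta>'))))"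
    unfolding exp
    by (rule trans[OF sum_submsets_swap], rule sum.cong[OF refl], rule sum.cong[OF refl], rule sum_submsets_swap)
  also have "\<dots> = (Q \<^bold>\<or> (P \<^bold>\<or> R)) \<alpha> \<beta>"
    unfolding exp by (intro sum.cong refl) (simp add: mult.left_commute add.commute)
  finally show "(P \<^bold>\<or> (Q \<^bold>\<or> R)) \<alpha> \<beta> = (Q \<^bold>\<or> (P \<^bold>\<or> R)) \<alpha> \<beta>" .
qed

lemma partial_deriv_commute: "partial_deriv i (partial_deriv j f) = partial_deriv j (partial_deriv i f)"
  by (cases "i = j") (auto simp: partial_deriv_def fun_eq_iff add_mset_commute)

interpretation pd: comp_fun_commute partial_deriv
  by standard (auto simp: partial_deriv_commute)

lemma partial_derivs_0 [simp]: "partial_derivs {#} f = f"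
  by (simp add: partial_derivs_def)

lemma partial_derivs_plus: "partial_derivs (\<beta> + \<beta>') f = partial_derivs \<beta>' (partial_derivs \<beta> f)"
  by (simp add: partial_derivs_def)

lemma partial_derivs_single: "partial_derivs {#i#} f = partial_deriv i f"
  by (simp add: partial_derivs_def)

text \<open>Each \<partial>_i in a D_l is accompanied by a positive power of x_i. This makes the
  inner sum of \<open>diffop_apply\<close> finite and lets it run over a fixed finite set.\<close>

definition dominated :: "diffop \<Rightarrow> bool" where
  "dominated P \<longleftrightarrow> (\<forall>\<alpha> \<beta>. P \<alpha> \<beta> \<noteq> 0 \<longrightarrow> \<beta> \<subseteq># \<alpha>)"

lemma diffop_apply_dominated:
  assumes "dominated P" "finite B" "{\<beta>. \<beta> \<subseteq># \<gamma>} \<subseteq> B"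
  shows "diffop_apply P f \<gamma> = (\<Sum>\<alpha> | \<alpha> \<subseteq># \<gamma>. \<Sum>\<beta>\<in>B. P \<alpha> \<beta> * partial_derivs \<beta> f (\<gamma> - \<alpha>))"
  unfolding diffop_apply_def
proof (rule sum.cong[OF refl])
  fix \<alpha> assume "\<alpha> \<in> {\<alpha>. \<alpha> \<subseteq># \<gamma>}"
  then have "{\<beta>. P \<alpha> \<beta> \<noteq> 0} \<subseteq> B"
    using assms by (auto simp: dominated_def intro: subset_mset.order_trans)
  then show "(\<Sum>\<beta> | P \<alpha> \<beta> \<noteq> 0. P \<alpha> \<beta> * partial_derivs \<beta> f (\<gamma> - \<alpha>)) = (\<Sum>\<beta>\<in>B. P \<alpha> \<beta> * partial_derivs \<beta> f (\<gamma> - \<alpha>))"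
    using assms(2) by (intro sum.mono_neutral_left) auto
qed

lemma dominated_vee:
  assumes "dominated P" "dominated Q"
  shows "dominated (P \<^bold>\<or> Q)"
  unfolding dominated_def
proof (intro allI impI)
  fix \<alpha> \<beta> assume "(P \<^bold>\<or> Q) \<alpha> \<beta> \<noteq> 0"
  then obtain \<alpha>' \<beta>' where 1: "\<alpha>' \<subseteq># \<alpha>" "\<beta>' \<subseteq># \<beta>" "P \<alpha>' \<beta>' * Q (\<alpha> - \<alpha>') (\<beta> - \<beta>') \<noteq> 0"
    unfolding vee_def by (metis (no_types, lifting) mem_Collect_eq sum.not_neutral_contains_not_neutral)
  then have "\<beta>' \<subseteq># \<alpha>'" "\<beta> - \<beta>' \<subseteq># \<alpha> - \<alpha>'" using assms by (auto simp: dominated_def)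
  then have "\<beta>' + (\<beta> - \<beta>') \<subseteq># \<alpha>' + (\<alpha> - \<alpha>')" by (rule subset_mset.add_mono)
  then show "\<beta> \<subseteq># \<alpha>" using 1 by simp
qed

text \<open>Derivatives commute and stay to the right of the variables, so each term of P
  differentiates f first, then Q acts, and the monomial of P multiplies last.\<close>

lemma diffop_apply_vee:
  assumes P: "dominated P" and Q: "dominated Q"
  shows "diffop_apply (P \<^bold>\<or> Q) f \<gamma> =
    (\<Sum>\<alpha>' | \<alpha>' \<subseteq># \<gamma>. \<Sum>\<beta>' | \<beta>' \<subseteq># \<gamma>. P \<alpha>' \<beta>' * diffop_apply Q (partial_derivs \<beta>' f) (\<gamma> - \<alpha>'))"
proof -
  let ?X = "\<lambda>\<alpha>' \<alpha>1 \<beta>' \<beta>1. P \<alpha>' \<beta>' * (Q \<alpha>1 \<beta>1 * partial_derivs (\<beta>' + \<beta>1) f (\<gamma> - (\<alpha>' + \<alpha>1)))"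
  have "diffop_apply (P \<^bold>\<or> Q) f \<gamma> = (\<Sum>\<alpha> | \<alpha> \<subseteq># \<gamma>. \<Sum>\<beta> | \<beta> \<subseteq># \<gamma>. \<Sum>\<alpha>' | \<alpha>' \<subseteq># \<alpha>. \<Sum>\<beta>' | \<beta>' \<subseteq># \<beta>. ?X \<alpha>' (\<alpha> - \<alpha>') \<beta>' (\<beta> - \<beta>'))"
    unfolding diffop_apply_dominated[OF dominated_vee[OF P Q] finite_submsets order_refl]
    unfolding vee_def sum_distrib_right
    by (intro sum.cong refl) (simp add: mult.assoc)
  also have "\<dots> = (\<Sum>\<alpha> | \<alpha> \<subseteq># \<gamma>. \<Sum>\<alpha>' | \<alpha>' \<subseteq># \<alpha>. \<Sum>\<beta> | \<beta> \<subseteq># \<gamma>. \<Sum>\<beta>' | \<beta>' \<subseteq># \<beta>. ?X \<alpha>' (\<alpha> - \<alpha>') \<beta>' (\<beta> - \<beta>'))"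
    by (rule sum.cong[OF refl], rule sum.swap)
  also have "\<dots> = (\<Sum>\<alpha>' | \<alpha>' \<subseteq># \<gamma>. \<Sum>\<alpha>1 | \<alpha>1 \<subseteq># \<gamma> - \<alpha>'. \<Sum>\<beta>' | \<beta>' \<subseteq># \<gamma>. \<Sum>\<beta>1 | \<beta>1 \<subseteq># \<gamma> - \<beta>'. ?X \<alpha>' \<alpha>1 \<beta>' \<beta>1)"
    unfolding sum_submsets_split[of "\<lambda>\<beta>' \<beta>1. ?X _ _ \<beta>' \<beta>1"]
    by (rule sum_submsets_split)
  also have "\<dots> = (\<Sum>\<alpha>' | \<alpha>' \<subseteq># \<gamma>. \<Sum>\<beta>' | \<beta>' \<subseteq># \<gamma>. \<Sum>\<alpha>1 | \<alpha>1 \<subseteq># \<gamma> - \<alpha>'. \<Sum>\<beta>1 | \<beta>1 \<subseteq># \<gamma> - \<beta>'. ?X \<alpha>' \<alpha>1 \<beta>' \<beta>1)"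
    by (rule sum.cong[OF refl], rule sum.swap)
  also have "\<dots> = (\<Sum>\<alpha>' | \<alpha>' \<subseteq># \<gamma>. \<Sum>\<beta>' | \<beta>' \<subseteq># \<gamma>. P \<alpha>' \<beta>' * diffop_apply Q (partial_derivs \<beta>' f) (\<gamma> - \<alpha>'))"
  proof (intro sum.cong refl)
    fix \<alpha>' \<beta>' assume "\<alpha>' \<in> {\<alpha>'. \<alpha>' \<subseteq># \<gamma>}" "\<beta>' \<in> {\<beta>'. \<beta>' \<subseteq># \<gamma>}"
    show "(\<Sum>\<alpha>1 | \<alpha>1 \<subseteq># \<gamma> - \<alpha>'. \<Sum>\<beta>1 | \<beta>1 \<subseteq># \<gamma> - \<beta>'. ?X \<alpha>' \<alpha>1 \<beta>' \<beta>1) =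
        P \<alpha>' \<beta>' * diffop_apply Q (partial_derivs \<beta>' f) (\<gamma> - \<alpha>')"
    proof (cases "P \<alpha>' \<beta>' = 0")
      case False
      then have "\<beta>' \<subseteq># \<alpha>'" using P by (auto simp: dominated_def)
      \<comment> \<open>Hence the derivatives relevant for Q at \<gamma> - \<alpha>' lie in the
        range of \<beta>1, and that range may be used to apply Q.\<close>
      then have "\<gamma> - \<alpha>' \<subseteq># \<gamma> - \<beta>'" by (simp add: subseteq_mset_def diff_le_mono2)
      then have sub: "{\<beta>. \<beta> \<subseteq># \<gamma> - \<alpha>'} \<subseteq> {\<beta>. \<beta> \<subseteq># \<gamma> - \<beta>'}" by (auto intro: subset_mset.order_trans)
      show ?thesis
        by (simp add: diffop_apply_dominated[OF Q finite_submsets sub] sum_distrib_left partial_derivs_plus)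
    qed simp
  qed
  finally show ?thesis .
qed

lemma dominated_D_gen: "dominated (D_gen k)"
  by (auto simp: dominated_def D_gen_def)

text \<open>Only the terms x_i^(k+1) \<partial>_i of D_k with x_i^(k+1) dividing \<gamma>
  survive.\<close>

lemma diffop_apply_D_gen_vee:
  assumes Q: "dominated Q"
  shows "diffop_apply (D_gen k \<^bold>\<or> Q) f \<gamma> =
    (\<Sum>i | k < count \<gamma> i. diffop_apply Q (partial_deriv i f) (\<gamma> - replicate_mset (Suc k) i))"
proof -
  let ?A = "{\<alpha>'. \<alpha>' \<subseteq># \<gamma>} \<times> {\<beta>'. \<beta>' \<subseteq># \<gamma>}"
  let ?I = "{i. k < count \<gamma> i}"
  let ?g = "\<lambda>i. (replicate_mset (Suc k) i, {#i#})"
  have sub: "?g ` ?I \<subseteq> ?A"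
    by (auto simp: count_le_replicate_mset_subset_eq[symmetric] Suc_le_eq simp flip: count_greater_zero_iff
        simp del: replicate_mset_Suc)
  have "diffop_apply (D_gen k \<^bold>\<or> Q) f \<gamma> =
      (\<Sum>(\<alpha>', \<beta>')\<in>?A. D_gen k \<alpha>' \<beta>' * diffop_apply Q (partial_derivs \<beta>' f) (\<gamma> - \<alpha>'))"
    unfolding diffop_apply_vee[OF dominated_D_gen Q] by (simp add: sum.cartesian_product)
  also have "\<dots> = (\<Sum>(\<alpha>', \<beta>')\<in>?g ` ?I. D_gen k \<alpha>' \<beta>' * diffop_apply Q (partial_derivs \<beta>' f) (\<gamma> - \<alpha>'))"
  proof (rule sum.mono_neutral_right[OF _ sub])
    show "\<forall>x\<in>?A - ?g ` ?I. (case x of (\<alpha>', \<beta>') \<Rightarrow> D_gen k \<alpha>' \<beta>' * diffop_apply Q (partial_derivs \<beta>' f) (\<gamma> - \<alpha>')) = 0"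
    proof
      fix x assume x: "x \<in> ?A - ?g ` ?I"
      obtain \<alpha>' \<beta>' where ab: "x = (\<alpha>', \<beta>')" by fastforce
      have "D_gen k \<alpha>' \<beta>' = 0"
      proof (rule ccontr)
        assume "D_gen k \<alpha>' \<beta>' \<noteq> 0"
        then obtain i where i: "\<alpha>' = replicate_mset (Suc k) i" "\<beta>' = {#i#}"
          by (auto simp: D_gen_def split: if_splits)
        then have "Suc k \<le> count \<gamma> i"
          using x ab submset_count_le[of "replicate_mset (Suc k) i" \<gamma> i] by simp
        then show False using x ab i by auto
      qed
      then show "(case x of (\<alpha>', \<beta>') \<Rightarrow> D_gen k \<alpha>' \<beta>' * diffop_apply Q (partial_derivs \<beta>' f) (\<gamma> - \<alpha>')) = 0"
        by (simp add: ab)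
    qed
  qed simp
  also have "\<dots> = (\<Sum>i\<in>?I. diffop_apply Q (partial_deriv i f) (\<gamma> - replicate_mset (Suc k) i))"
  proof (subst sum.reindex)
    show "inj_on ?g ?I" by (auto intro: inj_onI)
    have "D_gen k (replicate_mset (Suc k) i) {#i#} = 1" for i
      unfolding D_gen_def by auto
    then show "sum ((\<lambda>(\<alpha>', \<beta>'). D_gen k \<alpha>' \<beta>' * diffop_apply Q (partial_derivs \<beta>' f) (\<gamma> - \<alpha>')) \<circ> ?g) ?I =
        (\<Sum>i\<in>?I. diffop_apply Q (partial_deriv i f) (\<gamma> - replicate_mset (Suc k) i))"
      by (simp add: partial_derivs_single del: replicate_mset_Suc)
  qed
  finally show ?thesis .
qed

text \<open>The operator \<open>D_form l\<close> without its denominator.\<close>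

definition W :: "partition \<Rightarrow> diffop" where
  "W l = fold_mset (\<lambda>k P. D_gen k \<^bold>\<or> P) diffop_id (parts l)"

interpretation vc: comp_fun_commute "\<lambda>k P. D_gen k \<^bold>\<or> P"
  by standard (auto simp: vee_left_commute)

lemma W_0: "W 0 = diffop_id"
  by (simp add: W_def)

lemma W_add: "0 < k \<Longrightarrow> W (part1 k + l) = D_gen k \<^bold>\<or> W l"
  by (simp add: W_def parts_part1)

lemma dominated_W: "dominated (W l)"
proof (induction l rule: partition_induct)
  case 0
  then show ?case by (simp add: W_0 dominated_def diffop_id_def)
next
  case (add k l)
  then show ?case by (simp add: W_add dominated_vee dominated_D_gen)
qed

lemma diffop_apply_id: "diffop_apply diffop_id f \<gamma> = f \<gamma>"
proof -
  have "dominated diffop_id" by (simp add: dominated_def diffop_id_def)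
  then have "diffop_apply diffop_id f \<gamma> =
      (\<Sum>\<alpha> | \<alpha> \<subseteq># \<gamma>. \<Sum>\<beta> | \<beta> \<subseteq># \<gamma>. diffop_id \<alpha> \<beta> * partial_derivs \<beta> f (\<gamma> - \<alpha>))"
    by (rule diffop_apply_dominated) simp_all
  also have "\<dots> = (\<Sum>\<alpha> | \<alpha> \<subseteq># \<gamma>. if \<alpha> = {#} then f \<gamma> else 0)"
  proof (rule sum.cong[OF refl])
    fix \<alpha>
    have "(\<Sum>\<beta> | \<beta> \<subseteq># \<gamma>. diffop_id \<alpha> \<beta> * partial_derivs \<beta> f (\<gamma> - \<alpha>)) =
        (\<Sum>\<beta> | \<beta> \<subseteq># \<gamma>. if \<beta> = {#} then (if \<alpha> = {#} then f (\<gamma> - \<alpha>) else 0) else 0)"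
      by (rule sum.cong[OF refl]) (simp add: diffop_id_def)
    then show "(\<Sum>\<beta> | \<beta> \<subseteq># \<gamma>. diffop_id \<alpha> \<beta> * partial_derivs \<beta> f (\<gamma> - \<alpha>)) = (if \<alpha> = {#} then f \<gamma> else 0)"
      by (simp add: sum.delta)
  qed
  also have "\<dots> = f \<gamma>"
    by (simp add: sum.delta)
  finally show ?thesis .
qed

section \<open>Derivations of \<int>[b] and their effect on M and K\<close>

definition minus_part :: "partition \<Rightarrow> nat \<Rightarrow> partition" where
  "minus_part l k = Abs_partition (parts l - {#k#})"

lemma parts_minus_part: "parts (minus_part l k) = parts l - {#k#}"
  unfolding minus_part_def by (rule parts_Abs) (meson in_diffD zero_notin_parts)

text \<open>The derivation \<open>\<partial>/\<partial>b\<^sub>k\<close>. Applied to the matrix \<open>K\<close> it has the same effect as one more factor \<open>D\<^sub>k\<close> in an operator.\<close>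

definition db :: "nat \<Rightarrow> Dlower \<Rightarrow> Dlower" where
  "db k = Db.ext (\<lambda>l. zmul (int (count (parts l) k)) (b_mono (minus_part l k)))"

lemma additive_db: "additive (db k)"
  unfolding db_def by (rule Db.additive_ext)

lemma db_b_mono: "db k (b_mono l) = zmul (int (count (parts l) k)) (b_mono (minus_part l k))"
  unfolding db_def by (rule Db.ext_basis)

lemma db_mult: "db k (p * q) = db k p * q + p * db k q"
proof (rule Db.additive_eqI[of "\<lambda>p. db k (p * q)"])
  fix l
  show "db k (b_mono l * q) = db k (b_mono l) * q + b_mono l * db k q"
  proof (rule Db.additive_eqI[of "\<lambda>q. db k (b_mono l * q)"])
    fix m
    \<comment> \<open>If k is not a part, removing it changes nothing and this fails; the
      multiplicity in front of the monomial is then 0, which \<open>zmul_cong0\<close> takes into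
      account.\<close>
    have 1: "minus_part (l + m) k = minus_part l k + m" if "0 < count (parts l) k" for l m
      using that by (intro partition_eqI) (simp add: parts_minus_part)
    have 2: "minus_part (l + m) k = l + minus_part m k" if "0 < count (parts m) k"
      using 1[OF that, of l] by (simp add: add.commute)
    have "zmul (int (count (parts l) k)) (b_mono (minus_part (l + m) k)) = zmul (int (count (parts l) k)) (b_mono (minus_part l k + m))"
      by (rule zmul_cong0) (subst 1, auto)
    moreover have "zmul (int (count (parts m) k)) (b_mono (minus_part (l + m) k)) = zmul (int (count (parts m) k)) (b_mono (l + minus_part m k))"
      by (rule zmul_cong0) (subst 2, auto)
    ultimately show "db k (b_mono l * b_mono m) = db k (b_mono l) * b_mono m + b_mono l * db k (b_mono m)"
      unfolding b_mono_plus[symmetric] db_b_mono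
      by (simp add: zmod.scale_left_distrib) (simp add: b_mono_plus zmul_of_int mult_ac)
  qed (intro additive_intros additive_comp[OF additive_db] additive_db)+
qed (intro additive_intros additive_comp[OF additive_db] additive_db)+

text \<open>The factor that differentiation brings down is the one by which the factorials in D_l
  grow when a part k is added.\<close>

lemma lookup_db:
  assumes "0 < k"
  shows "Poly_Mapping.lookup (db k p) l = int (count (parts l) k + 1) * Poly_Mapping.lookup p (part1 k + l)"
proof (rule Db.additive_eqI[of "\<lambda>p. Poly_Mapping.lookup (db k p) l"])
  show "additive (\<lambda>p. Poly_Mapping.lookup (db k p) l)"
    by (rule Db.additive_coord_comp[OF additive_db])
  show "additive (\<lambda>p. int (count (parts l) k + 1) * Poly_Mapping.lookup p (part1 k + l))"
    by (intro additive_intros Db.additive_coord)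
  fix m
  show "Poly_Mapping.lookup (db k (b_mono m)) l = int (count (parts l) k + 1) * Poly_Mapping.lookup (b_mono m) (part1 k + l)"
  proof (cases "part1 k + l = m")
    case True
    then have "minus_part m k = l" "count (parts m) k = count (parts l) k + 1"
      using assms by (auto simp: parts_part1 parts_minus_part intro!: partition_eqI)
    with True show ?thesis by (simp add: db_b_mono Db.coord_simps Db.coord_basis)
  next
    case False
    have "minus_part m k \<noteq> l \<or> count (parts m) k = 0"
    proof (rule ccontr)
      assume "\<not> (minus_part m k \<noteq> l \<or> count (parts m) k = 0)"
      then have "k \<in># parts m" "parts l = parts m - {#k#}"
        by (auto simp: parts_minus_part simp flip: count_greater_zero_iff)
      then have "part1 k + l = m" by (intro partition_eqI) (simp add: parts_part1 assms)
      with False show False ..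
    qed
    with False show ?thesis by (auto simp: db_b_mono Db.coord_simps Db.coord_basis)
  qed
qed

lemma db_1: "db k 1 = 0"
  using db_b_mono[of k 0] by (simp add: b_mono_0)

lemma db_b_gen:
  assumes "0 < k"
  shows "db k (b_gen j) = (if j = k then 1 else 0)"
proof (cases "j = 0")
  case True
  then show ?thesis using assms by (simp add: db_1)
next
  case False
  have "minus_part (part1 k) k = 0" using assms by (intro partition_eqI) (simp add: parts_minus_part parts_part1)
  then show ?thesis using False assms by (simp add: b_gen_part1 db_b_mono parts_part1 b_mono_0)
qed

lemma db_M_1: "0 < k \<Longrightarrow> db k (M n 1) = (if n = Suc k then 1 else 0)"
  by (cases n) (auto simp: M_less M_1 db_b_gen additive_0[OF additive_db])

text \<open>The derivative with respect to b_k of the m-th power of x + b_1 x^2 + ... is m x^(k+1)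
  times the (m-1)-th power. The guard k < n excludes the truncated difference 0, at which
  \<open>M 0 0\<close> would give 1.\<close>

lemma db_M:
  assumes "0 < k"
  shows "db k (M n m) = (if k < n \<and> 0 < m then of_nat m * M (n - Suc k) (m - 1) else 0)"
proof (induction m arbitrary: n)
  case 0
  then show ?case by (simp add: M_0_right db_1 additive_0[OF additive_db])
next
  case (Suc m)
  have "db k (M n (Suc m)) = (\<Sum>j\<le>n. db k (M j m) * M (n - j) 1) + (\<Sum>j\<le>n. M j m * db k (M (n - j) 1))"
    using M_add[of n m 1] by (simp add: additive_sum[OF additive_db] db_mult sum.distrib)
  also have "(\<Sum>j\<le>n. M j m * db k (M (n - j) 1)) = (if k < n then M (n - Suc k) m else 0)"
  proof -
    have "(\<Sum>j\<le>n. M j m * db k (M (n - j) 1)) = (\<Sum>j\<le>n. if j = n - Suc k then (if k < n then M (n - Suc k) m else 0) else 0)"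
      unfolding db_M_1[OF assms] by (rule sum.cong[OF refl]) auto
    then show ?thesis by (simp add: sum.delta)
  qed
  also have "(\<Sum>j\<le>n. db k (M j m) * M (n - j) 1) = (if k < n then of_nat m * M (n - Suc k) m else 0)"
  proof (cases "k < n \<and> 0 < m")
    case True
    have "(\<Sum>j\<le>n. db k (M j m) * M (n - j) 1) = (\<Sum>j\<in>{Suc k..n}. of_nat m * M (j - Suc k) (m - 1) * M (n - j) 1)"
      unfolding Suc using True by (intro sum.mono_neutral_cong_right) auto
    also have "\<dots> = (\<Sum>j\<le>n - Suc k. of_nat m * (M j (m - 1) * M (n - Suc k - j) 1))"
      by (rule sum.reindex_bij_witness[of _ "\<lambda>j. j + Suc k" "\<lambda>j. j - Suc k"]) (use True in \<open>auto simp: mult.assoc\<close>)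
    also have "\<dots> = of_nat m * M (n - Suc k) m"
      using M_add[of "n - Suc k" "m - 1" 1] True by (simp add: sum_distrib_left)
    finally show ?thesis using True by simp
  next
    case False
    then have "db k (M j m) = 0" if "j \<le> n" for j using that Suc[of j] by auto
    then show ?thesis using False by (auto simp: M_0_right)
  qed
  finally show ?case by (simp add: algebra_simps)
qed

lemma db_prod:
  assumes "finite I"
  shows "db k (\<Prod>i\<in>I. f i) = (\<Sum>i\<in>I. db k (f i) * (\<Prod>j\<in>I - {i}. f j))"
  using assms
proof (induction I)
  case (insert a I)
  have "(\<Sum>i\<in>I. db k (f i) * (\<Prod>j\<in>insert a I - {i}. f j)) = f a * (\<Sum>i\<in>I. db k (f i) * (\<Prod>j\<in>I - {i}. f j))"
    unfolding sum_distrib_left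
  proof (rule sum.cong[OF refl])
    fix i assume "i \<in> I"
    then have "insert a I - {i} = insert a (I - {i})" using insert by auto
    then show "db k (f i) * (\<Prod>j\<in>insert a I - {i}. f j) = f a * (db k (f i) * (\<Prod>j\<in>I - {i}. f j))"
      using insert by (simp add: mult_ac)
  qed
  then show ?case using insert by (simp add: db_mult)
qed (simp add: db_1)

text \<open>The product rule over the variables: differentiating the factor at i lowers the exponent
  of x_i by k + 1 in \<gamma> and by 1 in \<delta>.\<close>

lemma db_K:
  assumes k: "0 < k" and sub: "\<delta> \<subseteq># \<gamma>"
  shows "db k (K \<gamma> \<delta>) = (\<Sum>i | k < count \<gamma> i. if i \<in># \<delta> \<and> \<delta> - {#i#} \<subseteq># \<gamma> - replicate_mset (Suc k) i
    then of_nat (count \<delta> i) * K (\<gamma> - replicate_mset (Suc k) i) (\<delta> - {#i#}) else 0)"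
proof -
  let ?S = "set_mset \<gamma>"
  have "db k (K \<gamma> \<delta>) = (\<Sum>i\<in>?S. db k (M (count \<gamma> i) (count \<delta> i)) * (\<Prod>j\<in>?S - {i}. M (count \<gamma> j) (count \<delta> j)))"
    unfolding K_def by (rule db_prod) simp
  also have "\<dots> = (\<Sum>i | k < count \<gamma> i. db k (M (count \<gamma> i) (count \<delta> i)) * (\<Prod>j\<in>?S - {i}. M (count \<gamma> j) (count \<delta> j)))"
    by (rule sum.mono_neutral_right) (auto simp: db_M[OF k] simp flip: count_greater_zero_iff)
  also have "\<dots> = (\<Sum>i | k < count \<gamma> i. if i \<in># \<delta> \<and> \<delta> - {#i#} \<subseteq># \<gamma> - replicate_mset (Suc k) i
    then of_nat (count \<delta> i) * K (\<gamma> - replicate_mset (Suc k) i) (\<delta> - {#i#}) else 0)"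
  proof (rule sum.cong[OF refl])
    fix i assume "i \<in> {i. k < count \<gamma> i}"
    then have i: "k < count \<gamma> i" "i \<in> ?S" by (auto simp flip: count_greater_zero_iff)
    let ?\<gamma> = "\<gamma> - replicate_mset (Suc k) i" and ?\<delta> = "\<delta> - {#i#}"
    show "db k (M (count \<gamma> i) (count \<delta> i)) * (\<Prod>j\<in>?S - {i}. M (count \<gamma> j) (count \<delta> j)) =
      (if i \<in># \<delta> \<and> ?\<delta> \<subseteq># ?\<gamma> then of_nat (count \<delta> i) * K ?\<gamma> ?\<delta> else 0)"
    proof (cases "i \<in># \<delta>")
      case True
      have "(\<Prod>j\<in>?S - {i}. M (count \<gamma> j) (count \<delta> j)) = (\<Prod>j\<in>?S - {i}. M (count ?\<gamma> j) (count ?\<delta> j))"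
        by (rule prod.cong) auto
      then have "M (count ?\<gamma> i) (count ?\<delta> i) * (\<Prod>j\<in>?S - {i}. M (count \<gamma> j) (count \<delta> j)) =
          (\<Prod>j\<in>?S. M (count ?\<gamma> j) (count ?\<delta> j))"
        using i(2) by (simp add: prod.remove)
      \<comment> \<open>The support may have shrunk; the product over the old support is K or 0
        depending on divisibility.\<close>
      also have "\<dots> = (if ?\<delta> \<subseteq># ?\<gamma> then K ?\<gamma> ?\<delta> else 0)"
        by (rule K_extend) (use set_mset_mono[OF sub] in \<open>auto dest: in_diffD\<close>)
      finally have *: "M (count ?\<gamma> i) (count ?\<delta> i) * (\<Prod>j\<in>?S - {i}. M (count \<gamma> j) (count \<delta> j)) =
          (if ?\<delta> \<subseteq># ?\<gamma> then K ?\<gamma> ?\<delta> else 0)" .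
      have d: "db k (M (count \<gamma> i) (count \<delta> i)) = of_nat (count \<delta> i) * M (count ?\<gamma> i) (count ?\<delta> i)"
        using True i by (simp add: db_M[OF k])
      show ?thesis
        unfolding d mult.assoc * using True
        by (cases "?\<delta> \<subseteq># ?\<gamma>") (simp_all only: if_True if_False simp_thms mult_zero_right)
    next
      case False
      then show ?thesis by (simp add: db_M[OF k] not_in_iff)
    qed
  qed
  finally show ?thesis .
qed

text \<open>The exponent brought down by the derivation, together with the shift of \<delta>, is a
  partial derivative of f. The right-hand side has the form of the action of one more factor D_k in
  \<open>diffop_apply_D_gen_vee\<close>.\<close>

lemma sum_db_K:
  fixes f :: "rat series"
  assumes k: "0 < k"
  shows "(\<Sum>\<delta> | \<delta> \<subseteq># \<gamma>. of_int (Poly_Mapping.lookup (db k (K \<gamma> \<delta>)) l) * f \<delta>) =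
    (\<Sum>i | k < count \<gamma> i. \<Sum>\<delta> | \<delta> \<subseteq># \<gamma> - replicate_mset (Suc k) i.
      of_int (Poly_Mapping.lookup (K (\<gamma> - replicate_mset (Suc k) i) \<delta>) l) * partial_deriv i f \<delta>)"
proof -
  let ?\<gamma> = "\<lambda>i. \<gamma> - replicate_mset (Suc k) i"
  let ?t = "\<lambda>i \<delta>. of_nat (count \<delta> i) * (of_int (Poly_Mapping.lookup (K (?\<gamma> i) (\<delta> - {#i#})) l) * f \<delta>)"
  have "(\<Sum>\<delta> | \<delta> \<subseteq># \<gamma>. of_int (Poly_Mapping.lookup (db k (K \<gamma> \<delta>)) l) * f \<delta>) =
      (\<Sum>\<delta> | \<delta> \<subseteq># \<gamma>. \<Sum>i | k < count \<gamma> i. if i \<in># \<delta> \<and> \<delta> - {#i#} \<subseteq># ?\<gamma> i then ?t i \<delta> else 0)"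
  proof (rule sum.cong[OF refl])
    fix \<delta> assume "\<delta> \<in> {\<delta>. \<delta> \<subseteq># \<gamma>}"
    then have "db k (K \<gamma> \<delta>) = (\<Sum>i | k < count \<gamma> i. if i \<in># \<delta> \<and> \<delta> - {#i#} \<subseteq># ?\<gamma> i
        then zmul (int (count \<delta> i)) (K (?\<gamma> i) (\<delta> - {#i#})) else 0)"
      by (simp only: mem_Collect_eq db_K[OF k] zmul_of_int of_int_of_nat_eq)
    then have "Poly_Mapping.lookup (db k (K \<gamma> \<delta>)) l = (\<Sum>i | k < count \<gamma> i. if i \<in># \<delta> \<and> \<delta> - {#i#} \<subseteq># ?\<gamma> i
        then int (count \<delta> i) * Poly_Mapping.lookup (K (?\<gamma> i) (\<delta> - {#i#})) l else 0)"
      by (simp only: Db.coord_simps if_distrib[of "\<lambda>p. Poly_Mapping.lookup p l"])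
    then show "of_int (Poly_Mapping.lookup (db k (K \<gamma> \<delta>)) l) * f \<delta> =
        (\<Sum>i | k < count \<gamma> i. if i \<in># \<delta> \<and> \<delta> - {#i#} \<subseteq># ?\<gamma> i then ?t i \<delta> else 0)"
      unfolding of_int_sum sum_distrib_right
      by (simp only: of_int_sum sum_distrib_right if_distrib[of of_int] if_distrib[of "\<lambda>c. c * f \<delta>"]
          of_int_mult of_int_of_nat_eq of_int_0 mult_zero_left mult.assoc)
  qed
  also have "\<dots> = (\<Sum>i | k < count \<gamma> i. \<Sum>\<delta> | \<delta> \<subseteq># \<gamma>. if i \<in># \<delta> \<and> \<delta> - {#i#} \<subseteq># ?\<gamma> i then ?t i \<delta> else 0)"
    by (rule sum.swap)
  also have "\<dots> = (\<Sum>i | k < count \<gamma> i. \<Sum>\<delta> | \<delta> \<subseteq># ?\<gamma> i.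
      of_int (Poly_Mapping.lookup (K (?\<gamma> i) \<delta>) l) * partial_deriv i f \<delta>)"
  proof (rule sum.cong[OF refl])
    fix i assume "i \<in> {i. k < count \<gamma> i}"
    then have i: "replicate_mset (Suc k) i \<subseteq># \<gamma>"
      by (simp add: count_le_replicate_mset_subset_eq[symmetric] Suc_le_eq del: replicate_mset_Suc)
    have "(\<Sum>\<delta> | \<delta> \<subseteq># \<gamma>. if i \<in># \<delta> \<and> \<delta> - {#i#} \<subseteq># ?\<gamma> i then ?t i \<delta> else 0) =
        (\<Sum>\<delta> | \<delta> \<subseteq># \<gamma> \<and> i \<in># \<delta> \<and> \<delta> - {#i#} \<subseteq># ?\<gamma> i. ?t i \<delta>)"
      by (rule sum.mono_neutral_cong_right) auto
    also have "\<dots> = (\<Sum>\<delta> | \<delta> \<subseteq># ?\<gamma> i. of_int (Poly_Mapping.lookup (K (?\<gamma> i) \<delta>) l) * partial_deriv i f \<delta>)"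
    \<comment> \<open>The new summation index is the old one divided by x_i.\<close>
    proof (rule sum.reindex_bij_witness[of _ "\<lambda>\<delta>. add_mset i \<delta>" "\<lambda>\<delta>. \<delta> - {#i#}"])
      fix \<delta> assume \<delta>: "\<delta> \<in> {\<delta>. \<delta> \<subseteq># ?\<gamma> i}"
      have "{#i#} \<subseteq># replicate_mset (Suc k) i" by simp
      then have "\<delta> + {#i#} \<subseteq># ?\<gamma> i + replicate_mset (Suc k) i"
        using \<delta> by (intro subset_mset.add_mono) auto
      then have "add_mset i \<delta> \<subseteq># \<gamma>" using i by (simp del: replicate_mset_Suc)
      then show "add_mset i \<delta> \<in> {\<delta>. \<delta> \<subseteq># \<gamma> \<and> i \<in># \<delta> \<and> \<delta> - {#i#} \<subseteq># ?\<gamma> i}"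
        using \<delta> by simp
    next
      fix \<delta> assume "\<delta> \<in> {\<delta>. \<delta> \<subseteq># \<gamma> \<and> i \<in># \<delta> \<and> \<delta> - {#i#} \<subseteq># ?\<gamma> i}"
      then have "add_mset i (\<delta> - {#i#}) = \<delta>" "count (\<delta> - {#i#}) i + 1 = count \<delta> i"
        by (auto simp flip: count_greater_zero_iff)
      then show "of_int (Poly_Mapping.lookup (K (?\<gamma> i) (\<delta> - {#i#})) l) * partial_deriv i f (\<delta> - {#i#}) = ?t i \<delta>"
        unfolding partial_deriv_def by (simp only: mult_ac)
    qed auto
    finally show "(\<Sum>\<delta> | \<delta> \<subseteq># \<gamma>. if i \<in># \<delta> \<and> \<delta> - {#i#} \<subseteq># ?\<gamma> i then ?t i \<delta> else 0) = \<dots>" .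
  qed
  finally show ?thesis .
qed

definition part_fact :: "partition \<Rightarrow> nat" where
  "part_fact l = (\<Prod>k\<in>set_mset (parts l). fact (count (parts l) k))"

lemma part_fact_superset:
  "finite S \<Longrightarrow> set_mset (parts l) \<subseteq> S \<Longrightarrow> part_fact l = (\<Prod>k\<in>S. fact (count (parts l) k))"
  unfolding part_fact_def by (rule prod.mono_neutral_left) (auto simp: not_in_iff)

lemma part_fact_add:
  assumes "0 < k"
  shows "part_fact (part1 k + l) = part_fact l * (count (parts l) k + 1)"
proof -
  let ?S = "insert k (set_mset (parts l))"
  have "part_fact (part1 k + l) = (\<Prod>j\<in>?S. fact (count (parts (part1 k + l)) j))"
    by (rule part_fact_superset) (auto simp: parts_part1 assms)
  also have "\<dots> = fact (count (parts l) k + 1) * (\<Prod>j\<in>?S - {k}. fact (count (parts l) j))"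
  proof -
    have "(\<Prod>j\<in>?S - {k}. fact (count (parts (part1 k + l)) j)) = (\<Prod>j\<in>?S - {k}. fact (count (parts l) j) :: nat)"
      by (rule prod.cong) (auto simp: parts_part1 assms)
    then show ?thesis by (subst prod.remove[of ?S k]) (simp_all add: parts_part1 assms)
  qed
  also have "\<dots> = (count (parts l) k + 1) * (\<Prod>j\<in>?S. fact (count (parts l) j))"
    using prod.remove[of ?S k "\<lambda>j. fact (count (parts l) j) :: nat"] by (simp add: algebra_simps)
  also have "(\<Prod>j\<in>?S. fact (count (parts l) j)) = part_fact l"
    by (rule part_fact_superset[symmetric]) auto
  finally show ?thesis by simp
qed

lemma part_fact_0: "part_fact 0 = 1"
  by (simp add: part_fact_def)

text \<open>Taylor's formula at the coefficient of b_l, by induction on the parts. A new part k is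
  matched by \<partial>/\<partial>b_k on K, and its multiplicity enters both the derivative and the
  factorials.\<close>

lemma diffop_apply_W:
  "diffop_apply (W l) f \<gamma> = of_nat (part_fact l) * (\<Sum>\<delta> | \<delta> \<subseteq># \<gamma>. of_int (Poly_Mapping.lookup (K \<gamma> \<delta>) l) * f \<delta>)"
proof (induction l arbitrary: f \<gamma> rule: partition_induct)
  case 0
  \<comment> \<open>The constant term is the counit, which turns M and hence K into an identity
    matrix.\<close>
  have "Poly_Mapping.lookup (K \<gamma> \<delta>) 0 = (if \<delta> = \<gamma> then 1 else 0)" if "\<delta> \<subseteq># \<gamma>" for \<delta>
  proof -
    have "Dlower_counit (K \<gamma> \<delta>) = (\<Prod>i\<in>set_mset \<gamma>. if count \<gamma> i = count \<delta> i then 1 else 0)"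
      by (simp add: K_def rhom_prod[OF rhom_Dlower_counit] Dlower_counit_M)
    also have "\<dots> = (if \<delta> = \<gamma> then 1 else 0)"
    proof (cases "\<delta> = \<gamma>")
      case False
      have "\<exists>i\<in>set_mset \<gamma>. count \<gamma> i \<noteq> count \<delta> i"
      proof (rule ccontr)
        assume "\<not> ?thesis"
        then have "\<gamma> \<subseteq># \<delta>" by (intro mset_subset_eqI) (metis count_eq_zero_iff le0 order_refl)
        then show False using False that by (simp add: subset_mset.antisym)
      qed
      then show ?thesis using False by (auto intro!: prod_zero)
    qed simp
    finally show ?thesis by (simp add: Dlower_counit_def)
  qed
  then have "(\<Sum>\<delta> | \<delta> \<subseteq># \<gamma>. of_int (Poly_Mapping.lookup (K \<gamma> \<delta>) 0) * f \<delta>) = (\<Sum>\<delta> | \<delta> \<subseteq># \<gamma>. if \<delta> = \<gamma> then f \<gamma> else 0)"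
    by (intro sum.cong refl) auto
  then show ?case by (simp add: W_0 diffop_apply_id part_fact_0 sum.delta)
next
  case (add k l)
  note k = add(1)
  have "diffop_apply (W (part1 k + l)) f \<gamma> = of_nat (part_fact l) *
      (\<Sum>i | k < count \<gamma> i. \<Sum>\<delta> | \<delta> \<subseteq># \<gamma> - replicate_mset (Suc k) i.
        of_int (Poly_Mapping.lookup (K (\<gamma> - replicate_mset (Suc k) i) \<delta>) l) * partial_deriv i f \<delta>)"
    unfolding W_add[OF k] diffop_apply_D_gen_vee[OF dominated_W] add(2) by (simp only: sum_distrib_left)
  also have "\<dots> = of_nat (part_fact l) * (\<Sum>\<delta> | \<delta> \<subseteq># \<gamma>. of_int (Poly_Mapping.lookup (db k (K \<gamma> \<delta>)) l) * f \<delta>)"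
    by (simp only: sum_db_K[OF k])
  also have "\<dots> = of_nat (part_fact (part1 k + l)) *
      (\<Sum>\<delta> | \<delta> \<subseteq># \<gamma>. of_int (Poly_Mapping.lookup (K \<gamma> \<delta>) (part1 k + l)) * f \<delta>)"
    unfolding lookup_db[OF k] part_fact_add[OF k] of_nat_mult sum_distrib_left
    by (intro sum.cong refl) simp
  finally show ?case .
qed

text \<open>The factorials cancel, so D_l has an integer matrix although its standard form has
  denominators.\<close>

lemma operator_D_basis:
  "operator (D_basis l) f \<gamma> = (\<Sum>\<delta> | \<delta> \<subseteq># \<gamma>. of_int (Poly_Mapping.lookup (K \<gamma> \<delta>) l) * f \<delta>)"
proof -
  have "part_fact l \<noteq> 0" by (simp add: part_fact_def)
  have "(\<Prod>k\<in>set_mset (parts l). fact (count (parts l) k)) = (of_nat (part_fact l) :: rat)"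
    by (simp add: part_fact_def)
  then have "D_form l = (\<lambda>\<alpha> \<beta>. W l \<alpha> \<beta> / of_nat (part_fact l))"
    by (simp add: D_form_def W_def)
  then have "operator (D_basis l) f \<gamma> = diffop_apply (W l) f \<gamma> / of_nat (part_fact l)"
    using \<open>part_fact l \<noteq> 0\<close> by (simp add: D_basis.rep_eq diffop_apply_def sum_divide_distrib)
  then show ?thesis using \<open>part_fact l \<noteq> 0\<close> by (simp add: diffop_apply_W)
qed

section \<open>The Hopf algebra \<open>D\<^sup>*\<close>\<close>

lemma additive_operator: "additive operator"
  by (simp add: additive_def plus_Dupper.rep_eq)

lemma additive_fun_apply: "additive F \<Longrightarrow> additive (\<lambda>x. F x f \<gamma>)"
  by (simp add: additive_def)

lemma additive_operator_apply: "additive (\<lambda>P. operator P f \<gamma>)"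
  by (rule additive_fun_apply[OF additive_operator])

text \<open>Exponents are raised by 1 because b_j is the entry of M in row j + 1 and column
  1.\<close>

definition incr :: "partition \<Rightarrow> mono" where
  "incr l = gam (Abs_partition (image_mset Suc (parts l)))"

lemma exponents_incr: "exponents (incr l) = image_mset Suc (parts l)"
  by (auto simp: incr_def parts_Abs)

text \<open>
  Applied to the product of the variables in \<open>incr l\<close>, the operator \<open>D_basis m\<close> produces the
  monomial \<open>incr l\<close> with coefficient 1 if \<open>m = l\<close> and 0 otherwise.
\<close>

lemma K_incr: "K (incr l) (mset_set (set_mset (incr l))) = b_mono l"
proof -
  have "K (incr l) (mset_set (set_mset (incr l))) = (\<Prod>i\<in>set_mset (incr l). b_gen (count (incr l) i - 1))"
    unfolding K_def
  proof (rule prod.cong[OF refl])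
    fix i assume "i \<in># incr l"
    then have "Suc (count (incr l) i - 1) = count (incr l) i" by simp
    then show "M (count (incr l) i) (count (mset_set (set_mset (incr l))) i) = b_gen (count (incr l) i - 1)"
      using M_1[of "count (incr l) i - 1"] \<open>i \<in># incr l\<close> by simp
  qed
  also have "\<dots> = (\<Prod>k\<in>#exponents (incr l). b_gen (k - 1))"
    by (simp add: exponents_def prod_unfold_prod_mset image_mset.compositionality comp_def)
  finally show ?thesis
    by (simp add: exponents_incr b_mono_prod image_mset.compositionality comp_def)
qed

definition D_value :: "partition \<Rightarrow> Dupper \<Rightarrow> rat" where
  "D_value l P = operator P (\<lambda>\<epsilon>. if \<epsilon> = mset_set (set_mset (incr l)) then 1 else 0) (incr l)"

text \<open>The rational \<open>D_value l P\<close> is an integer by \<open>D_value_int\<close>, so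
  the floor only changes the type. These functionals are what proves the D_l linearly
  independent.\<close>

definition D_coord :: "partition \<Rightarrow> Dupper \<Rightarrow> int" where
  "D_coord l P = \<lfloor>D_value l P\<rfloor>"

lemma additive_D_value: "additive (D_value l)"
  unfolding D_value_def by (rule additive_operator_apply)

lemma D_value_basis: "D_value l (D_basis m) = (if l = m then 1 else 0)"
proof -
  let ?e = "mset_set (set_mset (incr l))"
  have "?e \<subseteq># incr l" by (auto simp: subseteq_mset_def count_mset_set' Suc_le_eq)
  have "D_value l (D_basis m) = (\<Sum>\<delta> | \<delta> \<subseteq># incr l. if \<delta> = ?e then of_int (Poly_Mapping.lookup (K (incr l) ?e) m) else 0)"
    unfolding D_value_def operator_D_basis by (rule sum.cong[OF refl]) simp
  then show ?thesis
    using \<open>?e \<subseteq># incr l\<close> by (simp add: sum.delta K_incr Db.coord_basis)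
qed

lemma span_D_basis: "zmod.span (range D_basis) = UNIV"
proof -
  have "\<exists>P\<in>zmod.span (range D_basis). operator P = F"
    if "F \<in> zmod.span (range (\<lambda>l. diffop_apply (D_form l)))" for F
    using that
  proof (induction rule: zmod.span_induct_alt)
    case base
    show ?case by (rule bexI[of _ 0]) (simp_all add: zmod.span_zero zero_Dupper.rep_eq)
  next
    case (step n G F)
    then obtain l P where "G = operator (D_basis l)" and P: "P \<in> zmod.span (range D_basis)" "operator P = F"
      by (auto simp: D_basis.rep_eq)
    then have "operator (zmul n (D_basis l) + P) = zmul n G + F"
      by (simp add: additive_add[OF additive_operator] additive_zmul[OF additive_operator])
    moreover have "zmul n (D_basis l) + P \<in> zmod.span (range D_basis)"
      by (intro zmod.span_add zmod.span_scale zmod.span_base P) simp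
    ultimately show ?case by blast
  qed
  then have "P \<in> zmod.span (range D_basis)" for P
    using operator[of P] by (metis operator_inject)
  then show ?thesis by blast
qed

lemma D_value_int: "D_value l P \<in> \<int>"
proof -
  have "P \<in> zmod.span (range D_basis)" by (simp add: span_D_basis)
  then show ?thesis
    by (induction rule: zmod.span_induct_alt)
      (auto simp: additive_0[OF additive_D_value] additive_add[OF additive_D_value]
        additive_zmul[OF additive_D_value] D_value_basis zmul_of_int)
qed

interpretation Du: free_on D_basis D_coord
proof (rule free_on.intro)
  show "additive (D_coord l)" for l
  proof (rule additive.intro)
    fix P Q
    obtain n where "D_value l P = of_int n" using D_value_int[of l P] by (rule Ints_cases)
    then show "D_coord l (P + Q) = D_coord l P + D_coord l Q"
      by (simp add: D_coord_def additive_add[OF additive_D_value])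
  qed
  show "D_coord l (D_basis m) = (if l = m then 1 else 0)" for l m
    by (simp add: D_coord_def D_value_basis)
qed (rule span_D_basis)

lemma biadditive_ext_right: "biadditive (\<lambda>P b. Db.ext (\<lambda>l. D_coord l P) b)"
  by (rule biadditiveI, rule Db.additive_ext)
    (unfold Db.ext_def, intro additive_intros Du.additive_coord)

lemma D_pairing_eq: "D_pairing = (\<lambda>P. Db.ext (\<lambda>l. D_coord l P))"
  unfolding D_pairing_def
proof (rule the_equality)
  show "biadditive (\<lambda>P. Db.ext (\<lambda>l. D_coord l P)) \<and>
      (\<forall>l m. Db.ext (\<lambda>k. D_coord k (D_basis l)) (b_mono m) = (if l = m then 1 else 0))"
    using biadditive_ext_right by (simp add: Db.ext_basis Du.coord_basis)
next
  fix B assume B: "biadditive B \<and> (\<forall>l m. B (D_basis l) (b_mono m) = (if l = m then 1 else (0 :: int)))"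
  then have bB: "biadditive B" by blast
  have "B (D_basis l) b = Db.ext (\<lambda>k. D_coord k (D_basis l)) b" for l b
    by (rule Db.additive_eqI[OF biadditive_right[OF bB] Db.additive_ext])
      (use B in \<open>simp add: Db.ext_basis Du.coord_basis\<close>)
  then have "B P b = Db.ext (\<lambda>k. D_coord k P) b" for P b
    by (rule Du.additive_eqI[OF biadditive_left[OF bB] biadditive_left[OF biadditive_ext_right]])
  then show "B = (\<lambda>P. Db.ext (\<lambda>l. D_coord l P))" by blast
qed

lemma biadditive_D_pairing: "biadditive D_pairing"
  unfolding D_pairing_eq by (rule biadditive_ext_right)

lemmas additive_D_pairing_right = biadditive_right[OF biadditive_D_pairing]
lemmas additive_D_pairing_left = biadditive_left[OF biadditive_D_pairing]

lemma D_pairing_b_mono: "D_pairing P (b_mono l) = D_coord l P"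
  by (simp add: D_pairing_eq Db.ext_basis)

lemma D_pairing_D_basis: "D_pairing (D_basis l) b = Poly_Mapping.lookup b l"
  by (rule Db.additive_eqI[OF additive_D_pairing_right Db.additive_coord])
    (simp add: D_pairing_b_mono Du.coord_basis Db.coord_basis)

lemma D_pairing_eqI: "(\<And>b. D_pairing P b = D_pairing Q b) \<Longrightarrow> P = Q"
  by (rule Du.coord_eqI) (metis D_pairing_b_mono)

text \<open>An operator acts by the matrix K evaluated under its functional on D_*; identities of
  operators thus become identities of functionals.\<close>

lemma operator_eq:
  "operator P f \<gamma> = (\<Sum>\<delta> | \<delta> \<subseteq># \<gamma>. of_int (D_pairing P (K \<gamma> \<delta>)) * f \<delta>)"
proof (rule Du.additive_eqI[OF additive_operator_apply])
  have "additive (\<lambda>P. of_int (D_pairing P b) :: rat)" for b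
    by (rule additive_comp[OF rhom_additive[OF rhom_of_int'] additive_D_pairing_left])
  then show "additive (\<lambda>P. \<Sum>\<delta> | \<delta> \<subseteq># \<gamma>. of_int (D_pairing P (K \<gamma> \<delta>)) * f \<delta>)"
    by (intro additive_intros)
qed (simp add: operator_D_basis D_pairing_D_basis)

lemma additive_operator_arg: "additive (operator P)"
  unfolding additive_def fun_eq_iff by (simp add: operator_eq distrib_left sum.distrib)

section \<open>Composition as the transpose of the comultiplication of D_*\<close>

definition pair2 :: "Dupper \<Rightarrow> Dupper \<Rightarrow> (Dlower, Dlower) tensor \<Rightarrow> int" where
  "pair2 P Q = tpair (D_pairing P) (D_pairing Q)"

lemma additive_pair2: "additive (pair2 P Q)"
  unfolding pair2_def by (rule additive_tpair[OF additive_D_pairing_right additive_D_pairing_right])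

lemma pair2_tens: "pair2 P Q (a \<otimes> b) = D_pairing P a * D_pairing Q b"
  unfolding pair2_def by (rule tpair_tens[OF additive_D_pairing_right additive_D_pairing_right])

lemma additive_pair2_left: "additive (\<lambda>P. pair2 P Q t)"
  unfolding pair2_def tpair_def
  by (intro additive_intros additive_D_pairing_right additive_D_pairing_left)

lemma additive_pair2_right: "additive (\<lambda>Q. pair2 P Q t)"
  unfolding pair2_def tpair_def
  by (intro additive_intros additive_D_pairing_right additive_D_pairing_left)

lemma D_pairing_grade:
  assumes "b \<in> Dlower_grade n" "int (weight l) \<noteq> n"
  shows "D_pairing (D_basis l) b = 0"
  using assms by (auto simp: D_pairing_D_basis Dlower_grade_def in_keys_iff)

lemma pair2_comult_grade:
  assumes "b \<in> Dlower_grade n" "int (weight p) + int (weight q) \<noteq> n"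
  shows "pair2 (D_basis p) (D_basis q) (Dlower_comult b) = 0"
proof -
  have "pair2 (D_basis p) (D_basis q) (Dlower_comult b) \<in> {0}"
  proof (rule additive_tensor_grade[OF additive_pair2 _ Dlower_comult_graded[OF assms(1)]])
    show "zmod.subspace {0 :: int}" by (simp add: zmod.subspace_def)
    show "pair2 (D_basis p) (D_basis q) (x \<otimes> y) \<in> {0}"
      if "x \<in> Dlower_grade i" "y \<in> Dlower_grade j" "i + j = n" for x y i j
      using that assms(2) D_pairing_grade[of x i p] D_pairing_grade[of y j q]
      by (cases "int (weight p) = i") (auto simp: pair2_tens)
  qed
  then show ?thesis by simp
qed

lemma operator_comp_pairing:
  assumes "\<And>b. D_pairing R b = pair2 P Q (Dlower_comult b)"
  shows "operator R = operator P \<circ> operator Q"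
proof (intro ext)
  fix f :: "rat series" and \<gamma>
  \<comment> \<open>With the condition inside the term, both indices range over the divisors of
    \<gamma> and the sums can be swapped.\<close>
  let ?T = "\<lambda>\<delta> \<epsilon>. if \<epsilon> \<subseteq># \<delta> then of_int (D_pairing P (K \<gamma> \<delta>) * D_pairing Q (K \<delta> \<epsilon>)) * f \<epsilon> else 0"
  have "operator R f \<gamma> = (\<Sum>\<epsilon> | \<epsilon> \<subseteq># \<gamma>. \<Sum>\<delta> | \<delta> \<subseteq># \<gamma>. ?T \<delta> \<epsilon>)"
    unfolding operator_eq[of R] assms
  proof (rule sum.cong[OF refl])
    fix \<epsilon> assume "\<epsilon> \<in> {\<epsilon>. \<epsilon> \<subseteq># \<gamma>}"
    then have "pair2 P Q (Dlower_comult (K \<gamma> \<epsilon>)) =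
        (\<Sum>\<delta> | \<delta> \<subseteq># \<gamma>. D_pairing P (K \<gamma> \<delta>) * D_pairing Q (if \<epsilon> \<subseteq># \<delta> then K \<delta> \<epsilon> else 0))"
      by (simp only: Dlower_comult_K mem_Collect_eq additive_sum[OF additive_pair2] pair2_tens)
    then show "of_int (pair2 P Q (Dlower_comult (K \<gamma> \<epsilon>))) * f \<epsilon> = (\<Sum>\<delta> | \<delta> \<subseteq># \<gamma>. ?T \<delta> \<epsilon>)"
      by (auto simp: of_int_sum sum_distrib_right additive_0[OF additive_D_pairing_right] intro!: sum.cong)
  qed
  also have "\<dots> = (\<Sum>\<delta> | \<delta> \<subseteq># \<gamma>. \<Sum>\<epsilon> | \<epsilon> \<subseteq># \<gamma>. ?T \<delta> \<epsilon>)"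
    by (rule sum.swap)
  also have "\<dots> = (operator P \<circ> operator Q) f \<gamma>"
    unfolding comp_apply operator_eq[of P] operator_eq[of Q] sum_distrib_left
  proof (rule sum.cong[OF refl])
    fix \<delta> assume "\<delta> \<in> {\<delta>. \<delta> \<subseteq># \<gamma>}"
    then show "(\<Sum>\<epsilon> | \<epsilon> \<subseteq># \<gamma>. ?T \<delta> \<epsilon>) =
        (\<Sum>\<epsilon> | \<epsilon> \<subseteq># \<delta>. of_int (D_pairing P (K \<gamma> \<delta>)) * (of_int (D_pairing Q (K \<delta> \<epsilon>)) * f \<epsilon>))"
      by (intro sum.mono_neutral_cong_right) (auto intro: subset_mset.order_trans)
  qed
  finally show "operator R f \<gamma> = (operator P \<circ> operator Q) f \<gamma>" .
qed

text \<open>A functional on D_* comes from D^* only if it meets finitely many monomials. For basis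
  elements this follows from degrees, and it is the reason why D^* is closed under
  composition.\<close>

lemma ex_D_comp: "\<exists>R. \<forall>b. D_pairing R b = pair2 P Q (Dlower_comult b)"
proof -
  \<comment> \<open>The bound only serves finiteness: the coefficients vanish unless the weights add
    up exactly.\<close>
  define R0 where "R0 p q = (\<Sum>l | weight l \<le> weight p + weight q.
    zmul (pair2 (D_basis p) (D_basis q) (Dlower_comult (b_mono l))) (D_basis l))" for p q
  define R where "R P Q = Du.ext (\<lambda>p. Du.ext (R0 p) Q) P" for P Q
  have R0: "D_pairing (R0 p q) b = pair2 (D_basis p) (D_basis q) (Dlower_comult b)" for p q b
  proof (rule Db.additive_eqI[OF additive_D_pairing_right])
    show "additive (\<lambda>b. pair2 (D_basis p) (D_basis q) (Dlower_comult b))"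
      by (rule additive_comp[OF additive_pair2 rhom_additive[OF rhom_Dlower_comult]])
    show "D_pairing (R0 p q) (b_mono l) = pair2 (D_basis p) (D_basis q) (Dlower_comult (b_mono l))" for l
      using pair2_comult_grade[OF b_mono_grade[of l], of p q]
      by (auto simp: D_pairing_b_mono R0_def Du.coord_ext_sum[OF finite_weight])
  qed
  have "D_pairing (R P Q) b = pair2 P Q (Dlower_comult b)" for P Q b
  proof (rule Du.additive_eqI[of "\<lambda>P. D_pairing (R P Q) b", OF _ additive_pair2_left])
    show "additive (\<lambda>P. D_pairing (R P Q) b)"
      unfolding R_def by (rule additive_comp[OF additive_D_pairing_left Du.additive_ext])
    show "D_pairing (R (D_basis p) Q) b = pair2 (D_basis p) Q (Dlower_comult b)" for p
    proof (rule Du.additive_eqI[of "\<lambda>Q. D_pairing (R (D_basis p) Q) b", OF _ additive_pair2_right])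
      show "additive (\<lambda>Q. D_pairing (R (D_basis p) Q) b)"
        unfolding R_def Du.ext_basis by (rule additive_comp[OF additive_D_pairing_left Du.additive_ext])
      show "D_pairing (R (D_basis p) (D_basis q)) b = pair2 (D_basis p) (D_basis q) (Dlower_comult b)" for q
        unfolding R_def Du.ext_basis by (rule R0)
    qed
  qed
  then show ?thesis by blast
qed

lemma operator_Dupper_comp: "operator (Dupper_comp P Q) = operator P \<circ> operator Q"
proof -
  obtain R where R: "operator R = operator P \<circ> operator Q" using ex_D_comp operator_comp_pairing by metis
  then show ?thesis unfolding Dupper_comp_def by (rule theI[of _ R]) (metis R operator_inject)
qed

lemma D_pairing_comp: "D_pairing (Dupper_comp P Q) b = pair2 P Q (Dlower_comult b)"
proof -
  obtain R where R: "\<And>b. D_pairing R b = pair2 P Q (Dlower_comult b)" using ex_D_comp by blast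
  then have "operator R = operator (Dupper_comp P Q)"
    by (simp add: operator_comp_pairing operator_Dupper_comp)
  then show ?thesis using R by (simp add: operator_inject)
qed

lemma biadditive_Dupper_comp: "biadditive Dupper_comp"
proof (rule biadditiveI)
  show "additive (Dupper_comp P)" for P
    unfolding additive_def
    by (simp add: operator_Dupper_comp fun_eq_iff plus_Dupper.rep_eq additive_add[OF additive_operator_arg]
        flip: operator_inject)
  show "additive (\<lambda>P. Dupper_comp P Q)" for Q
    unfolding additive_def
    by (simp add: operator_Dupper_comp fun_eq_iff plus_Dupper.rep_eq flip: operator_inject)
qed

lemma operator_D_basis_0: "operator (D_basis 0) = id"
proof (intro ext)
  fix f \<gamma>
  have "D_form 0 = diffop_id" by (simp add: D_form_def)
  then show "operator (D_basis 0) f \<gamma> = id f \<gamma>" by (simp add: D_basis.rep_eq diffop_apply_id)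
qed

lemma Dupper_comp_assoc: "Dupper_comp (Dupper_comp P Q) R = Dupper_comp P (Dupper_comp Q R)"
  by (simp add: operator_Dupper_comp comp_assoc flip: operator_inject)

lemma Dupper_comp_one: "Dupper_comp (D_basis 0) P = P" "Dupper_comp P (D_basis 0) = P"
  by (simp_all only: operator_Dupper_comp operator_D_basis_0 id_comp comp_id flip: operator_inject)

definition Dupper_grade :: "int \<Rightarrow> Dupper set" where
  "Dupper_grade n = zmod.span {D_basis l |l. - int (weight l) = n}"

lemma grading_Dupper: "grading Dupper_grade"
  unfolding Dupper_grade_def[abs_def] by (rule Du.grading_span)

lemma subspace_Dupper_grade: "zmod.subspace (Dupper_grade n)"
  unfolding Dupper_grade_def by (rule zmod.subspace_span)

lemma D_basis_grade: "D_basis l \<in> Dupper_grade (- int (weight l))"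
  unfolding Dupper_grade_def by (rule zmod.span_base) auto

lemma Dupper_comp_grade:
  assumes "P \<in> Dupper_grade i" "Q \<in> Dupper_grade j"
  shows "Dupper_comp P Q \<in> Dupper_grade (i + j)"
proof (rule additive_span_image[OF biadditive_left[OF biadditive_Dupper_comp] _ subspace_Dupper_grade assms(1)[unfolded Dupper_grade_def]])
  fix x assume "x \<in> {D_basis l |l. - int (weight l) = i}"
  then obtain p where p: "x = D_basis p" "- int (weight p) = i" by blast
  show "Dupper_comp x Q \<in> Dupper_grade (i + j)"
  proof (rule additive_span_image[OF biadditive_right[OF biadditive_Dupper_comp] _ subspace_Dupper_grade assms(2)[unfolded Dupper_grade_def]])
    fix y assume "y \<in> {D_basis l |l. - int (weight l) = j}"
    then obtain q where q: "y = D_basis q" "- int (weight q) = j" by blast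
    show "Dupper_comp x y \<in> Dupper_grade (i + j)"
      unfolding Dupper_grade_def Du.graded_part_iff
    proof (intro allI impI)
      fix l assume "D_coord l (Dupper_comp x y) \<noteq> 0"
      then have "pair2 (D_basis p) (D_basis q) (Dlower_comult (b_mono l)) \<noteq> 0"
        using p q by (simp add: D_pairing_comp flip: D_pairing_b_mono)
      then have "int (weight p) + int (weight q) = int (weight l)"
        using pair2_comult_grade[OF b_mono_grade] by blast
      then show "- int (weight l) = i + j" using p q by simp
    qed
  qed
qed

section \<open>Coalgebra structure of D^* and its duality with the ring D_*\<close>

lemma Dupper_comult_universal:
  "additive Dupper_comult \<and> (\<forall>l. Dupper_comult (D_basis l) = (\<Sum>(m, n) | m + n = l. D_basis m \<otimes> D_basis n))"
proof -
  let ?D = "Du.ext (\<lambda>l. \<Sum>(m, n) | m + n = l. D_basis m \<otimes> D_basis n)"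
  have D: "additive ?D \<and> (\<forall>l. ?D (D_basis l) = (\<Sum>(m, n) | m + n = l. D_basis m \<otimes> D_basis n))"
    by (simp add: Du.additive_ext Du.ext_basis)
  show ?thesis
    unfolding Dupper_comult_def
  proof (rule theI[of _ ?D], rule D)
    fix E :: "Dupper \<Rightarrow> (Dupper, Dupper) tensor"
    assume E: "additive E \<and> (\<forall>l. E (D_basis l) = (\<Sum>(m, n) | m + n = l. D_basis m \<otimes> D_basis n))"
    show "E = ?D"
      by (rule ext, rule Du.additive_eqI[OF conjunct1[OF E] conjunct1[OF D]]) (simp only: conjunct2[OF E, rule_format] conjunct2[OF D, rule_format])
  qed
qed

lemma additive_Dupper_comult: "additive Dupper_comult"
  using Dupper_comult_universal by blast

lemma Dupper_comult_basis:
  "Dupper_comult (D_basis l) = (\<Sum>x | fst x + snd x = l. D_basis (fst x) \<otimes> D_basis (snd x))"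
  using Dupper_comult_universal by (simp add: case_prod_unfold)

lemma Dupper_counit_universal:
  "additive Dupper_counit \<and> (\<forall>l. Dupper_counit (D_basis l) = (if l = 0 then 1 else 0))"
proof -
  let ?D = "D_coord 0"
  have D: "additive ?D \<and> (\<forall>l. ?D (D_basis l) = (if l = 0 then 1 else 0))"
    by (simp add: Du.additive_coord Du.coord_basis)
  show ?thesis
    unfolding Dupper_counit_def
  proof (rule theI[of _ ?D], rule D)
    fix E :: "Dupper \<Rightarrow> int" assume E: "additive E \<and> (\<forall>l. E (D_basis l) = (if l = 0 then 1 else 0))"
    show "E = ?D"
      by (rule ext, rule Du.additive_eqI[OF conjunct1[OF E] conjunct1[OF D]]) (simp only: conjunct2[OF E, rule_format] conjunct2[OF D, rule_format])
  qed
qed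

lemma additive_Dupper_counit: "additive Dupper_counit"
  using Dupper_counit_universal by blast

lemma Dupper_counit_basis: "Dupper_counit (D_basis l) = (if l = 0 then 1 else 0)"
  using Dupper_counit_universal by blast

lemma Dupper_counit_eq: "Dupper_counit P = D_pairing P 1"
  by (rule Du.additive_eqI[OF additive_Dupper_counit additive_D_pairing_left])
    (simp add: Dupper_counit_basis D_pairing_D_basis lookup_one when_def)

lemma D_pairing_one: "D_pairing (D_basis 0) b = Dlower_counit b"
  by (simp add: D_pairing_D_basis Dlower_counit_def)

lemma finite_partition_sum: "finite {x. fst x + snd x = (l :: partition)}"
  using finite_partition_pairs[of l] by (simp add: case_prod_unfold)

definition eval2 :: "Dlower \<Rightarrow> Dlower \<Rightarrow> (Dupper, Dupper) tensor \<Rightarrow> int" where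
  "eval2 a b = tpair (\<lambda>P. D_pairing P a) (\<lambda>P. D_pairing P b)"

lemma additive_eval2: "additive (eval2 a b)"
  unfolding eval2_def by (rule additive_tpair[OF additive_D_pairing_left additive_D_pairing_left])

lemma eval2_tens: "eval2 a b (P \<otimes> Q) = D_pairing P a * D_pairing Q b"
  unfolding eval2_def by (rule tpair_tens[OF additive_D_pairing_left additive_D_pairing_left])

lemma free_on_Dupper2: "free_on (\<lambda>(i, j). D_basis i \<otimes> D_basis j) (\<lambda>(i, j). eval2 (b_mono i) (b_mono j))"
proof -
  have "(\<lambda>(i, j). eval2 (b_mono i) (b_mono j)) = (\<lambda>(i, j). tlift (\<lambda>a b. D_coord i a * D_coord j b))"
    by (simp add: eval2_def tpair_def D_pairing_b_mono fun_eq_iff)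
  then show ?thesis using free_on_tensor[OF Du.free_on_axioms Du.free_on_axioms] by simp
qed

lemma eval2_eqI: "(\<And>a b. eval2 a b s = eval2 a b t) \<Longrightarrow> s = t"
  by (rule free_on.coord_eqI[OF free_on_Dupper2]) auto

text \<open>Splitting a partition is dual to multiplying monomials. Through this identity
  coassociativity and the counit laws of D^* become associativity and the unit laws of
  \<int>[b].\<close>

lemma eval2_Dupper_comult: "eval2 a b (Dupper_comult P) = D_pairing P (a * b)"
proof (rule Db.additive_eqI[of "\<lambda>a. eval2 a b (Dupper_comult P)"])
  show "additive (\<lambda>a. eval2 a b (Dupper_comult P))" for b P
    unfolding eval2_def tpair_def
    by (intro additive_intros additive_D_pairing_right additive_D_pairing_left)
  show "additive (\<lambda>a. D_pairing P (a * b))"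
    by (intro additive_comp[OF additive_D_pairing_right] additive_intros)
  fix m
  show "eval2 (b_mono m) b (Dupper_comult P) = D_pairing P (b_mono m * b)"
  proof (rule Db.additive_eqI[of "\<lambda>b. eval2 (b_mono m) b (Dupper_comult P)"])
    show "additive (\<lambda>b. eval2 (b_mono m) b (Dupper_comult P))"
      unfolding eval2_def tpair_def
      by (intro additive_intros additive_D_pairing_right additive_D_pairing_left)
    show "additive (\<lambda>b. D_pairing P (b_mono m * b))"
      by (intro additive_comp[OF additive_D_pairing_right] additive_intros)
    fix n
    show "eval2 (b_mono m) (b_mono n) (Dupper_comult P) = D_pairing P (b_mono m * b_mono n)"
    proof (rule Du.additive_eqI[of "\<lambda>P. eval2 (b_mono m) (b_mono n) (Dupper_comult P)"])
      fix l
      have "eval2 (b_mono m) (b_mono n) (Dupper_comult (D_basis l)) =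
          (\<Sum>x | fst x + snd x = l. if x = (m, n) then 1 else 0)"
        unfolding Dupper_comult_basis additive_sum[OF additive_eval2] eval2_tens D_pairing_b_mono Du.coord_basis
        by (rule sum.cong[OF refl]) auto
      also have "\<dots> = D_pairing (D_basis l) (b_mono m * b_mono n)"
        using finite_partition_sum[of l]
        by (auto simp: D_pairing_b_mono Du.coord_basis sum.delta simp flip: b_mono_plus)
      finally show "eval2 (b_mono m) (b_mono n) (Dupper_comult (D_basis l)) = D_pairing (D_basis l) (b_mono m * b_mono n)" .
    qed (intro additive_comp[OF additive_eval2 additive_Dupper_comult] additive_D_pairing_left)+
  qed
qed

text \<open>Tested against a \<otimes> b \<otimes> c the two sides are the values of P at (ab)c and
  a(bc).\<close>

lemma Dupper_coassoc:
  "tassoc (tmap Dupper_comult id (Dupper_comult P)) = tmap id Dupper_comult (Dupper_comult P)"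
proof -
  define eval3 where "eval3 a b c = tpair (\<lambda>P. D_pairing P a) (eval2 b c)" for a b c
  have a3: "additive (eval3 a b c)" for a b c
    unfolding eval3_def by (rule additive_tpair[OF additive_D_pairing_left additive_eval2])
  have t3: "eval3 a b c (Q \<otimes> t) = D_pairing Q a * eval2 b c t" for a b c Q t
    unfolding eval3_def by (rule tpair_tens[OF additive_D_pairing_left additive_eval2])
  have eq: "s = t" if "\<And>a b c. eval3 a b c s = eval3 a b c t" for s t
  proof (rule free_on.coord_eqI[OF free_on_tensor[OF Du.free_on_axioms free_on_Dupper2]])
    fix i :: "partition \<times> partition \<times> partition"
    obtain l m n where "i = (l, m, n)" by (cases i)
    then show "(case i of (i, j) \<Rightarrow> tlift (\<lambda>a b. D_coord i a * (case j of (i, j) \<Rightarrow> eval2 (b_mono i) (b_mono j)) b)) s =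
        (case i of (i, j) \<Rightarrow> tlift (\<lambda>a b. D_coord i a * (case j of (i, j) \<Rightarrow> eval2 (b_mono i) (b_mono j)) b)) t"
      using that[of "b_mono l" "b_mono m" "b_mono n"] by (simp add: eval3_def tpair_def D_pairing_b_mono)
  qed
  have 1: "eval3 a b c (tassoc (u \<otimes> Q)) = eval2 a b u * D_pairing Q c" for a b c u Q
    by (rule additive_eqI_tensor[of "\<lambda>u. eval3 a b c (tassoc (u \<otimes> Q))"])
      (intro additive_comp[OF a3] additive_comp[OF additive_tassoc] additive_intros additive_eval2
        | simp add: tassoc_tens t3 eval2_tens)+
  have "eval3 a b c (tassoc (tmap Dupper_comult id s)) = eval2 (a * b) c s" for a b c s
    by (rule additive_eqI_tensor[of "\<lambda>s. eval3 a b c (tassoc (tmap Dupper_comult id s))"])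
      (intro additive_comp[OF a3] additive_comp[OF additive_tassoc] additive_tmap additive_id additive_Dupper_comult additive_eval2
        | simp only: tmap_tens[OF additive_Dupper_comult additive_id] id_apply 1 eval2_tens eval2_Dupper_comult)+
  moreover have "eval3 a b c (tmap id Dupper_comult s) = eval2 a (b * c) s" for a b c s
    by (rule additive_eqI_tensor[of "\<lambda>s. eval3 a b c (tmap id Dupper_comult s)"])
      (intro additive_comp[OF a3] additive_tmap additive_id additive_Dupper_comult additive_eval2
        | simp only: tmap_tens[OF additive_id additive_Dupper_comult] id_apply t3 eval2_tens eval2_Dupper_comult)+
  ultimately show ?thesis
    by (intro eq) (simp only: eval2_Dupper_comult mult.assoc)
qed

lemma Dupper_counit_left: "tlift (\<lambda>a b. zmul (Dupper_counit a) b) (Dupper_comult P) = P"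
proof (rule D_pairing_eqI)
  fix b
  have bi: "biadditive (\<lambda>P Q. zmul (Dupper_counit P) (Q :: Dupper))"
    by (intro additive_intros additive_Dupper_counit)
  have "D_pairing (tlift (\<lambda>a b. zmul (Dupper_counit a) b) t) b = eval2 1 b t" for t
    by (rule additive_eqI_tensor[OF additive_comp[OF additive_D_pairing_left additive_tlift[OF bi]] additive_eval2])
      (simp add: tlift_tens[OF bi] eval2_tens additive_zmul[OF additive_D_pairing_left], simp add: Dupper_counit_eq)
  then show "D_pairing (tlift (\<lambda>a b. zmul (Dupper_counit a) b) (Dupper_comult P)) b = D_pairing P b"
    by (simp add: eval2_Dupper_comult)
qed

lemma Dupper_counit_right: "tlift (\<lambda>a b. zmul (Dupper_counit b) a) (Dupper_comult P) = P"
proof (rule D_pairing_eqI)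
  fix b
  have bi: "biadditive (\<lambda>(P :: Dupper) Q. zmul (Dupper_counit Q) P)"
    by (intro additive_intros additive_Dupper_counit)
  have "D_pairing (tlift (\<lambda>a b. zmul (Dupper_counit b) a) t) b = eval2 b 1 t" for t
    by (rule additive_eqI_tensor[OF additive_comp[OF additive_D_pairing_left additive_tlift[OF bi]] additive_eval2])
      (simp add: tlift_tens[OF bi] eval2_tens additive_zmul[OF additive_D_pairing_left], simp add: Dupper_counit_eq)
  then show "D_pairing (tlift (\<lambda>a b. zmul (Dupper_counit b) a) (Dupper_comult P)) b = D_pairing P b"
    by (simp add: eval2_Dupper_comult)
qed

lemma Dupper_comult_graded: "P \<in> Dupper_grade n \<Longrightarrow> Dupper_comult P \<in> tensor_grade Dupper_grade Dupper_grade n"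
  unfolding Dupper_grade_def[of n]
proof (erule additive_span_image[OF additive_Dupper_comult _ subspace_tensor_grade, rotated])
  fix x assume "x \<in> {D_basis l |l. - int (weight l) = n}"
  then obtain l where l: "x = D_basis l" "- int (weight l) = n" by blast
  show "Dupper_comult x \<in> tensor_grade Dupper_grade Dupper_grade n"
    unfolding l(1) Dupper_comult_basis
    by (intro tensor_grade_sum tens_in_tensor_grade[where G = Dupper_grade and G' = Dupper_grade, OF D_basis_grade D_basis_grade])
      (use l in auto)
qed

lemma Dupper_counit_graded: "P \<in> Dupper_grade n \<Longrightarrow> n \<noteq> 0 \<Longrightarrow> Dupper_counit P = 0"
  using Du.graded_part_iff[of P "\<lambda>l. - int (weight l)" n] D_pairing_b_mono[of P 0]
  by (auto simp: Dupper_grade_def Dupper_counit_eq b_mono_0)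

text \<open>The transpose of the fact that the comultiplication of D_* is multiplicative; the two
  expansions agree by \<open>sum_fourfold\<close>.\<close>

lemma Dupper_comult_comp:
  "Dupper_comult (Dupper_comp P Q) = tensor_mult Dupper_comp Dupper_comp (Dupper_comult P) (Dupper_comult Q)"
proof (rule eval2_eqI)
  fix a b
  note bm = biadditive_tensor_mult[OF biadditive_Dupper_comp biadditive_Dupper_comp]
  obtain n :: nat and x y where P: "Dupper_comult P = (\<Sum>i<n. x i \<otimes> y i)" using tensor_rep by blast
  obtain m :: nat and z w where Q: "Dupper_comult Q = (\<Sum>j<m. z j \<otimes> w j)" using tensor_rep by blast
  obtain r :: nat and c c' where a: "Dlower_comult a = (\<Sum>k<r. c k \<otimes> c' k)" using tensor_rep by blast
  obtain s :: nat and d d' where b: "Dlower_comult b = (\<Sum>l<s. d l \<otimes> d' l)" using tensor_rep by blast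
  have "eval2 a b (Dupper_comult (Dupper_comp P Q)) =
      (\<Sum>k<r. \<Sum>l<s. D_pairing P (c k * d l) * D_pairing Q (c' k * d' l))"
    unfolding eval2_Dupper_comult D_pairing_comp rhom_mult[OF rhom_Dlower_comult] a b sum_product tens_times
      additive_sum[OF additive_pair2] pair2_tens ..
  also have "\<dots> = (\<Sum>k<r. \<Sum>l<s. (\<Sum>i<n. D_pairing (x i) (c k) * D_pairing (y i) (d l)) *
      (\<Sum>j<m. D_pairing (z j) (c' k) * D_pairing (w j) (d' l)))"
    unfolding eval2_Dupper_comult[symmetric] P Q additive_sum[OF additive_eval2] eval2_tens ..
  also have "\<dots> = (\<Sum>i<n. \<Sum>j<m. (\<Sum>k<r. D_pairing (x i) (c k) * D_pairing (z j) (c' k)) *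
      (\<Sum>l<s. D_pairing (y i) (d l) * D_pairing (w j) (d' l)))"
    by (rule sum_fourfold)
  also have "\<dots> = (\<Sum>i<n. \<Sum>j<m. eval2 a b (Dupper_comp (x i) (z j) \<otimes> Dupper_comp (y i) (w j)))"
    unfolding eval2_tens D_pairing_comp a b additive_sum[OF additive_pair2] pair2_tens ..
  also have "\<dots> = eval2 a b (tensor_mult Dupper_comp Dupper_comp (Dupper_comult P) (Dupper_comult Q))"
    unfolding P Q additive_sum[OF biadditive_left[OF bm]] additive_sum[OF biadditive_right[OF bm]]
      additive_sum[OF additive_eval2] tensor_mult_tens[OF biadditive_Dupper_comp biadditive_Dupper_comp] by (rule sum.swap)
  finally show "eval2 a b (Dupper_comult (Dupper_comp P Q)) =
      eval2 a b (tensor_mult Dupper_comp Dupper_comp (Dupper_comult P) (Dupper_comult Q))" .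
qed

lemma Dupper_comult_one: "Dupper_comult (D_basis 0) = D_basis 0 \<otimes> D_basis 0"
  by (rule eval2_eqI) (simp add: eval2_Dupper_comult eval2_tens D_pairing_one rhom_mult rhom_Dlower_counit)

lemma Dupper_counit_comp: "Dupper_counit (Dupper_comp P Q) = Dupper_counit P * Dupper_counit Q"
  by (simp add: Dupper_counit_eq D_pairing_comp rhom_1[OF rhom_Dlower_comult] pair2_tens flip: tens_1)

lemma Dupper_hopf_simps [simp]:
  "hgrade Dupper_hopf = Dupper_grade" "hmult Dupper_hopf = Dupper_comp" "hone Dupper_hopf = D_basis 0"
  "hcomult Dupper_hopf = Dupper_comult" "hcounit Dupper_hopf = Dupper_counit"
  by (simp_all add: Dupper_hopf_def Dupper_grade_def fun_eq_iff)

lemma graded_bialgebra_Dupper: "graded_bialgebra Dupper_hopf"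
  unfolding graded_bialgebra_def graded_algebra_def graded_coalgebra_def Dupper_hopf_simps
  by (intro conjI allI ballI impI grading_Dupper biadditive_Dupper_comp Dupper_comp_assoc Dupper_comp_one
      Dupper_comp_grade additive_Dupper_comult additive_Dupper_counit Dupper_coassoc
      Dupper_counit_left Dupper_counit_right Dupper_comult_graded Dupper_counit_graded
      Dupper_comult_comp Dupper_comult_one Dupper_counit_comp)
    (use D_basis_grade[of 0] in \<open>simp_all add: Dupper_counit_basis\<close>)

text \<open>The transpose of the antipode of D_*. The bound on weights makes the sum finite and
  loses nothing, since \<open>Dlower_S\<close> preserves degrees.\<close>

definition D_S :: "Dupper \<Rightarrow> Dupper" where
  "D_S = Du.ext (\<lambda>l. \<Sum>m | weight m \<le> weight l. zmul (Poly_Mapping.lookup (Dlower_S (b_mono m)) l) (D_basis m))"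

lemma additive_D_S: "additive D_S"
  unfolding D_S_def by (rule Du.additive_ext)

lemma lookup_Dlower_S: "weight m \<noteq> weight l \<Longrightarrow> Poly_Mapping.lookup (Dlower_S (b_mono m)) l = 0"
  using D_pairing_grade[OF Dlower_S_grade[OF b_mono_grade[of m]], of l] by (simp add: D_pairing_D_basis)

lemma D_pairing_D_S: "D_pairing (D_S P) b = D_pairing P (Dlower_S b)"
proof (rule Du.additive_eqI[of "\<lambda>P. D_pairing (D_S P) b", OF additive_comp[OF additive_D_pairing_left additive_D_S] additive_D_pairing_left])
  show "D_pairing (D_S (D_basis l)) b = D_pairing (D_basis l) (Dlower_S b)" for l
  proof (rule Db.additive_eqI[OF additive_D_pairing_right additive_comp[OF additive_D_pairing_right rhom_additive[OF rhom_Dlower_S]]])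
    show "D_pairing (D_S (D_basis l)) (b_mono m) = D_pairing (D_basis l) (Dlower_S (b_mono m))" for m
      using lookup_Dlower_S[of m l]
      by (auto simp: D_pairing_b_mono D_pairing_D_basis D_S_def Du.ext_basis Du.coord_ext_sum[OF finite_weight])
  qed
qed

text \<open>Transposition turns convolution on D^* into convolution on D_*, so that the antipode
  identities carry over.\<close>

lemma D_pairing_conv:
  assumes "additive F" "additive G" and F: "\<And>P b. D_pairing (F P) b = D_pairing P (f b)"
    and G: "\<And>P b. D_pairing (G P) b = D_pairing P (g b)" and fg: "additive f" "additive g"
  shows "D_pairing (tlift (\<lambda>x y. Dupper_comp (F x) (G y)) (Dupper_comult P)) b =
    D_pairing P (tlift (\<lambda>a b. f a * g b) (Dlower_comult b))"
proof -
  have bi: "biadditive (\<lambda>x y. Dupper_comp (F x) (G y))"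
    by (intro biadditiveI additive_comp[OF biadditive_left[OF biadditive_Dupper_comp]]
        additive_comp[OF biadditive_right[OF biadditive_Dupper_comp]] assms)
  have bi': "biadditive (\<lambda>a b. f a * g b)" by (intro additive_intros fg)
  obtain r :: nat and c c' where b: "Dlower_comult b = (\<Sum>k<r. c k \<otimes> c' k)" using tensor_rep by blast
  have "D_pairing (tlift (\<lambda>x y. Dupper_comp (F x) (G y)) t) b = (\<Sum>k<r. eval2 (f (c k)) (g (c' k)) t)" for t
    by (rule additive_eqI_tensor[OF additive_comp[OF additive_D_pairing_left additive_tlift[OF bi]]])
      (intro additive_intros additive_eval2
        | simp add: tlift_tens[OF bi] D_pairing_comp b additive_sum[OF additive_pair2] pair2_tens F G eval2_tens)+
  then show ?thesis
    by (simp add: eval2_Dupper_comult b additive_sum[OF additive_tlift[OF bi']] tlift_tens[OF bi']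
        additive_sum[OF additive_D_pairing_right])
qed

lemma D_S_grade: "P \<in> Dupper_grade n \<Longrightarrow> D_S P \<in> Dupper_grade n"
  unfolding Dupper_grade_def[of n]
proof (erule additive_span_image[OF additive_D_S _ zmod.subspace_span, rotated])
  fix x assume "x \<in> {D_basis l |l. - int (weight l) = n}"
  then obtain l where l: "x = D_basis l" "- int (weight l) = n" by blast
  show "D_S x \<in> zmod.span {D_basis l |l. - int (weight l) = n}"
    unfolding Du.graded_part_iff l(1) D_pairing_b_mono[symmetric] D_pairing_D_S D_pairing_D_basis
    using lookup_Dlower_S[of _ l] l(2) by metis
qed

lemma hopf_algebra_Dupper: "hopf_algebra Dupper_hopf"
proof -
  have S: "tlift (\<lambda>a b. Dlower_S a * b) (Dlower_comult b) = zmul (Dlower_counit b) 1"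
      "tlift (\<lambda>a b. a * Dlower_S b) (Dlower_comult b) = zmul (Dlower_counit b) 1" for b
    using is_antipode_Dlower_S by (simp_all add: is_antipode_def)
  have u: "D_pairing P (zmul (Dlower_counit b) 1) = D_pairing (zmul (Dupper_counit P) (D_basis 0)) b" for P b
    by (simp add: additive_zmul[OF additive_D_pairing_right] additive_zmul[OF additive_D_pairing_left]
        D_pairing_one Dupper_counit_eq)
  have "tlift (\<lambda>x y. Dupper_comp (D_S x) y) (Dupper_comult P) = zmul (Dupper_counit P) (D_basis 0)" for P
    by (rule D_pairing_eqI)
      (simp only: D_pairing_conv[of D_S "\<lambda>x. x", OF additive_D_S additive_ident D_pairing_D_S refl
          rhom_additive[OF rhom_Dlower_S] additive_ident] S u)
  moreover have "tlift (\<lambda>x y. Dupper_comp x (D_S y)) (Dupper_comult P) = zmul (Dupper_counit P) (D_basis 0)" for P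
    by (rule D_pairing_eqI)
      (simp only: D_pairing_conv[of "\<lambda>x. x" D_S, OF additive_ident additive_D_S refl D_pairing_D_S
          additive_ident rhom_additive[OF rhom_Dlower_S]] S u)
  ultimately have "is_antipode Dupper_hopf D_S"
    by (auto simp: is_antipode_def additive_D_S D_S_grade)
  then show ?thesis using graded_bialgebra_Dupper by (auto simp: hopf_algebra_def)
qed

section \<open>The actions\<close>

text \<open>Contraction of the first tensor factor with P, which turns a left coaction of D_* into a
  right action of D^*.\<close>

definition contr :: "Dupper \<Rightarrow> (Dlower, 'a::ab_group_add) tensor \<Rightarrow> 'a" where
  "contr P = tlift (\<lambda>b a. zmul (D_pairing P b) a)"

lemma biadditive_contr: "biadditive (\<lambda>b a. zmul (D_pairing P b) a)"
  by (intro additive_intros additive_D_pairing_right)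

lemma additive_contr: "additive (contr P)"
  unfolding contr_def by (rule additive_tlift[OF biadditive_contr])

lemma contr_tens: "contr P (b \<otimes> a) = zmul (D_pairing P b) a"
  unfolding contr_def by (rule tlift_tens[OF biadditive_contr])

lemma additive_contr_left: "additive (\<lambda>P. contr P t)"
  unfolding contr_def by (intro additive_intros additive_D_pairing_right additive_D_pairing_left)

lemma contr_tmap:
  assumes "additive f"
  shows "contr P (tmap id f t) = f (contr P t)"
  by (rule additive_eqI_tensor[OF additive_comp[OF additive_contr additive_tmap[OF additive_id assms]]
        additive_comp[OF assms additive_contr]])
    (simp only: tmap_tens[OF additive_id assms] contr_tens id_apply additive_zmul[OF assms])

text \<open>P meets the outer leg of the comultiplied factor and is removed first; this is why the
  resulting action is a right one.\<close>

lemma contr_comp: "contr (Dupper_comp P Q) t = contr Q (contr P (tassoc (tmap Dlower_comult id t)))"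
proof -
  note a = rhom_additive[OF rhom_Dlower_comult]
  have 1: "contr Q (contr P (tassoc (u \<otimes> g))) = zmul (pair2 P Q u) g" for u and g :: 'a
    by (rule additive_eqI_tensor[of "\<lambda>u. contr Q (contr P (tassoc (u \<otimes> g)))"])
      (intro additive_comp[OF additive_contr] additive_comp[OF additive_tassoc] additive_intros additive_pair2
        | simp add: tassoc_tens contr_tens pair2_tens additive_zmul[OF additive_contr])+
  show ?thesis
    by (rule additive_eqI_tensor[OF additive_contr additive_comp[OF additive_contr additive_comp[OF additive_contr
          additive_comp[OF additive_tassoc additive_tmap[OF a additive_id]]]]])
      (simp only: tmap_tens[OF a additive_id] id_apply 1 contr_tens D_pairing_comp)
qed

definition perp :: "Dupper \<Rightarrow> sym \<Rightarrow> sym" where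
  "perp P g = contr P (\<rho> g)"

lemma additive_perp: "additive (perp P)"
  unfolding perp_def[abs_def] by (rule additive_comp[OF additive_contr rhom_additive[OF rhom_\<rho>]])

lemma additive_perp_left: "additive (\<lambda>P. perp P g)"
  unfolding perp_def by (rule additive_contr_left)

lemma perp_one: "perp (D_basis 0) g = g"
  using \<rho>_counit[of g] by (simp add: perp_def contr_def D_pairing_one)

lemma perp_comp: "perp (Dupper_comp P Q) g = perp Q (perp P g)"
  by (simp only: perp_def contr_comp \<rho>_coassoc contr_tmap[OF rhom_additive[OF rhom_\<rho>]])

lemma D_pairing_graded_neq_0:
  assumes "P \<in> Dupper_grade i" "b \<in> Dlower_grade a" "i + a \<noteq> 0"
  shows "D_pairing P b = 0"
proof -
  have "D_pairing P b \<in> {0}"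
  proof (rule additive_span_image[OF additive_D_pairing_left _ _ assms(1)[unfolded Dupper_grade_def]])
    show "zmod.subspace {0 :: int}" by (simp add: zmod.subspace_def)
    show "D_pairing x b \<in> {0}" if "x \<in> {D_basis l |l. - int (weight l) = i}" for x
      using that D_pairing_grade[OF assms(2)] assms(3) by auto
  qed
  then show ?thesis by simp
qed

lemma perp_grade:
  assumes "P \<in> Dupper_grade i" "g \<in> homogeneous j"
  shows "perp P g \<in> homogeneous (i + j)"
  unfolding perp_def
proof (rule additive_tensor_grade[OF additive_contr subspace_homogeneous \<rho>_graded[OF assms(2)]])
  fix b g' a c assume bg: "b \<in> Dlower_grade a" "g' \<in> homogeneous c" "a + c = j"
  show "contr P (b \<otimes> g') \<in> homogeneous (i + j)"
  proof (cases "i + a = 0")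
    case True
    then have "i + j = c" using bg(3) by simp
    then show ?thesis unfolding contr_tens using zmod.subspace_scale[OF subspace_homogeneous bg(2)] by simp
  next
    case False
    then show ?thesis
      using D_pairing_graded_neq_0[OF assms(1) bg(1)] zmod.subspace_0[OF subspace_homogeneous] by (simp add: contr_tens)
  qed
qed

text \<open>The tensor coaction multiplies in D_* and the tensor action comultiplies in D^*; on pure
  tensors the identity is the duality \<open>eval2_Dupper_comult\<close>. It converts each comodule
  map into a module map.\<close>

lemma contr_tensor_coact:
  "contr P (tensor_coact Dlower_hopf \<rho> \<rho> t) = tensor_act Dupper_hopf perp perp P t"
proof -
  note a\<rho> = rhom_additive[OF rhom_\<rho>]
  have t1: "additive (\<lambda>a :: sym. a \<otimes> (1 :: sym))" and t2: "additive (\<lambda>a :: sym. (1 :: sym) \<otimes> a)"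
    by (intro additive_intros)+
  have bi: "biadditive (\<lambda>P Q. contr P s \<otimes> contr Q t)" for s t :: "(Dlower, sym) tensor"
    by (intro additive_intros additive_contr_left)
  have mix: "contr P (tmap id (\<lambda>a. a \<otimes> 1) s * tmap id (\<lambda>a. 1 \<otimes> a) t) =
      tlift (\<lambda>P Q. contr P s \<otimes> contr Q t) (Dupper_comult P)" for s t :: "(Dlower, sym) tensor"
  proof (rule additive_eqI_tensor[of "\<lambda>s. contr P (tmap id (\<lambda>a. a \<otimes> 1) s * tmap id (\<lambda>a. 1 \<otimes> a) t)"])
    show "additive (\<lambda>s :: (Dlower, sym) tensor. contr P (tmap id (\<lambda>a. a \<otimes> 1) s * tmap id (\<lambda>a. 1 \<otimes> a) t))"
      by (intro additive_comp[OF additive_contr] additive_intros additive_tmap additive_id t1)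
    show "additive (\<lambda>s :: (Dlower, sym) tensor. tlift (\<lambda>P Q. contr P s \<otimes> contr Q t) (Dupper_comult P))"
      by (intro additive_tlift_param bi tens_left additive_contr)
    fix b and x :: sym
    show "contr P (tmap id (\<lambda>a. a \<otimes> 1) (b \<otimes> x) * tmap id (\<lambda>a. 1 \<otimes> a) t) =
      tlift (\<lambda>P Q. contr P (b \<otimes> x) \<otimes> contr Q t) (Dupper_comult P)"
    proof (rule additive_eqI_tensor[of "\<lambda>t. contr P (tmap id (\<lambda>a. a \<otimes> 1) (b \<otimes> x) * tmap id (\<lambda>a. 1 \<otimes> a) t)"])
      show "additive (\<lambda>t :: (Dlower, sym) tensor. contr P (tmap id (\<lambda>a. a \<otimes> 1) (b \<otimes> x) * tmap id (\<lambda>a. 1 \<otimes> a) t))"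
        by (intro additive_comp[OF additive_contr] additive_intros additive_tmap additive_id t2)
      show "additive (\<lambda>t :: (Dlower, sym) tensor. tlift (\<lambda>P Q. contr P (b \<otimes> x) \<otimes> contr Q t) (Dupper_comult P))"
        by (intro additive_tlift_param bi tens_right additive_contr)
      fix c and y :: sym
      have "tlift (\<lambda>P Q. contr P (b \<otimes> x) \<otimes> contr Q (c \<otimes> y)) u = zmul (eval2 b c u) (x \<otimes> y)" for u
        by (rule additive_eqI_tensor[OF additive_tlift[OF bi]])
          (intro additive_intros additive_eval2
            | (simp only: tlift_tens[OF bi] eval2_tens, simp add: contr_tens zmul_tens_left zmul_tens_right mult.commute))+
      then show "contr P (tmap id (\<lambda>a. a \<otimes> 1) (b \<otimes> x) * tmap id (\<lambda>a. 1 \<otimes> a) (c \<otimes> y)) =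
          tlift (\<lambda>P Q. contr P (b \<otimes> x) \<otimes> contr Q (c \<otimes> y)) (Dupper_comult P)"
        by (simp only: tmap_tens[OF additive_id t1] tmap_tens[OF additive_id t2] id_apply tens_times contr_tens
            eval2_Dupper_comult mult_1_left mult_1_right)
    qed
  qed
  have bt: "biadditive (\<lambda>P Q. tmap (perp P) (perp Q) t)" for t
    unfolding tmap_def
    by (intro additive_intros tens_left tens_right additive_perp additive_perp_left)
  show ?thesis
    unfolding tensor_act_def Dupper_hopf_simps
  proof (rule additive_eqI_tensor[OF additive_comp[OF additive_contr rhom_additive[OF rhom_tensor_coact[OF rhom_\<rho> rhom_\<rho>]]]])
    show "additive (\<lambda>t. tlift (\<lambda>P Q. tmap (perp P) (perp Q) t) (Dupper_comult P))"
      by (intro additive_tlift_param bt additive_tmap additive_perp)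
    show "contr P (tensor_coact Dlower_hopf \<rho> \<rho> (x \<otimes> y)) = tlift (\<lambda>P Q. tmap (perp P) (perp Q) (x \<otimes> y)) (Dupper_comult P)" for x y
      unfolding tensor_coact_tens[OF a\<rho> a\<rho>] mix tmap_tens[OF additive_perp additive_perp] perp_def ..
  qed
qed

lemma perp_mult: "perp P (tlift (*) t) = tlift (*) (tensor_act Dupper_hopf perp perp P t)"
proof -
  have m: "additive (tlift (*) :: (sym, sym) tensor \<Rightarrow> sym)" by (rule additive_tlift[OF biadditive_mult])
  have "\<rho> (tlift (*) t) = tmap id (tlift (*)) (tensor_coact Dlower_hopf \<rho> \<rho> t)"
    using \<rho>_mult by (simp only: comodule_map_def)
  then show ?thesis by (simp only: perp_def contr_tmap[OF m] contr_tensor_coact)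
qed

lemma perp_comult: "sym_comult (perp P g) = tensor_act Dupper_hopf perp perp P (sym_comult g)"
proof -
  have "tensor_coact Dlower_hopf \<rho> \<rho> (sym_comult g) = tmap id sym_comult (\<rho> g)"
    using \<rho>_comult by (simp only: comodule_map_def)
  then show ?thesis
    by (simp only: perp_def contr_tmap[OF rhom_additive[OF rhom_sym_comult], symmetric] contr_tensor_coact[symmetric])
qed

lemma perp_S: "perp P (sym_S g) = sym_S (perp P g)"
proof -
  have "\<rho> (sym_S g) = tmap id sym_S (\<rho> g)"
    using \<rho>_antipode by (simp only: comodule_map_def)
  then show ?thesis by (simp only: perp_def contr_tmap[OF rhom_additive[OF rhom_sym_S]])
qed

lemma perp_unit: "perp P (zmul n 1) = zmul (Dupper_counit P * n) 1"
  by (simp add: additive_zmul[OF additive_perp])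
    (simp add: perp_def rhom_1[OF rhom_\<rho>] contr_tens Dupper_counit_eq mult.commute flip: tens_1)

text \<open>The adjoint form of the unit axiom for \<open>D_act\<close>, for which it is used; it
  holds since \<rho> respects the counit of Sym.\<close>

lemma perp_counit: "sym_counit (perp P g) = Dupper_counit P * sym_counit g"
proof -
  note a = rhom_additive[OF rhom_sym_counit]
  have r: "rhom (tmap id sym_counit :: (Dlower, sym) tensor \<Rightarrow> (Dlower, int) tensor)"
    by (rule rhom_tmap[OF rhom_id rhom_sym_counit])
  have "rhom (\<lambda>n :: int. (1 :: Dlower) \<otimes> n)"
    by (simp add: rhom_def tens_1 tens_times additive_intros)
  then have r': "rhom (\<lambda>g. (1 :: Dlower) \<otimes> sym_counit g)"
    by (rule rhom_comp[OF _ rhom_sym_counit])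
  have "tmap id sym_counit (\<rho> g) = 1 \<otimes> sym_counit g"
  proof (rule rhom_sym_eqI[OF rhom_comp[OF r rhom_\<rho>] r'])
    fix n
    have "tmap id sym_counit (\<rho> (h_sym n)) = (\<Sum>m\<le>n. if m = 0 then M n 0 \<otimes> 1 else 0)"
      unfolding \<rho>_h additive_sum[OF additive_tmap[OF additive_id a]] tmap_tens[OF additive_id a] id_apply
      by (rule sum.cong[OF refl]) (simp add: sym_counit_h)
    then show "tmap id sym_counit (\<rho> (h_sym n)) = 1 \<otimes> sym_counit (h_sym n)"
      by (simp add: M_0_right sym_counit_h)
  qed
  then have "sym_counit (perp P g) = contr P ((1 :: Dlower) \<otimes> sym_counit g)"
    by (simp only: perp_def contr_tmap[OF a, symmetric])
  then show ?thesis by (simp add: contr_tens Dupper_counit_eq)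
qed

text \<open>The numbers \<open>\<langle>f, A h_l\<rangle>\<close> must be the coefficients of the
  adjoint image. They depend only on the exponents of a monomial, so they form a symmetric series,
  and \<open>bounded\<close> makes its degree finite.\<close>

lemma ex_adjoint:
  assumes A: "additive A" and bounded: "\<And>l. sym_pairing f (A (h_prod l)) \<noteq> 0 \<Longrightarrow> weight l \<le> d"
  shows "\<exists>f'. \<forall>g. sym_pairing f' g = sym_pairing f (A g)"
proof -
  let ?G = "\<lambda>\<gamma>. sym_pairing f (A (h_prod (mtype \<gamma>)))"
  have "?G (image_mset \<pi> \<gamma>) = ?G \<gamma>" if "bij \<pi>" for \<pi> \<gamma>
    using exponents_image[OF that] by (simp add: mtype_def)
  moreover have "size \<gamma> \<le> d" if "?G \<gamma> \<noteq> 0" for \<gamma>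
    using bounded[OF that] by (simp add: weight_mtype)
  ultimately have "?G \<in> symmetric_series" by (auto simp: symmetric_series_def)
  then have G: "sym_coeff (Abs_sym ?G) = ?G" by (rule Abs_sym_inverse)
  have "sym_pairing (Abs_sym ?G) g = sym_pairing f (A g)" for g
    by (rule Sh.additive_eqI[OF additive_pairing_right additive_comp[OF additive_pairing_right A]])
      (simp add: sym_pairing_h_prod G)
  then show ?thesis by blast
qed

text \<open>By \<open>operator_eq\<close> the right-hand side is the coefficient of P f at \<gamma>,
  which is the adjointness of \<open>perp\<close> and the differential action.\<close>

lemma sym_pairing_perp_h_prod:
  "sym_pairing f (perp P (h_prod (mtype \<gamma>))) = (\<Sum>\<delta> | \<delta> \<subseteq># \<gamma>. D_pairing P (K \<gamma> \<delta>) * sym_coeff f \<delta>)"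
  by (simp add: perp_def \<rho>_h_prod additive_sum[OF additive_contr] contr_tens additive_sum[OF additive_pairing_right]
      additive_zmul[OF additive_pairing_right] sym_pairing_h_prod sym_coeff_gam)

text \<open>The adjoint image of f has the series P f as its coefficients. Hence this series is
  symmetric with integer coefficients and bounded degree, and the description of
  \<open>D_act\<close> denotes.\<close>

lemma D_act_adjoint_aux:
  "(\<lambda>\<gamma>. of_int (sym_coeff (D_act P f) \<gamma>)) = operator P (\<lambda>\<gamma>. of_int (sym_coeff f \<gamma>)) \<and>
   (\<forall>g. sym_pairing (D_act P f) g = sym_pairing f (perp P g))"
proof -
  obtain d where d: "\<And>\<gamma>. sym_coeff f \<gamma> \<noteq> 0 \<Longrightarrow> size \<gamma> \<le> d" using sym_coeff_bounded by blast
  \<comment> \<open>The largest weight occurring in P. Entries of K have degree |\<gamma>| -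
    |\<delta>|, so P raises degrees by at most w.\<close>
  define w where "w = Max (weight ` {l. D_coord l P \<noteq> 0})"
  have w: "weight l \<le> w" if "D_coord l P \<noteq> 0" for l
    unfolding w_def by (rule Max_ge) (use that Du.finite_coords[of P] in auto)
  have bounded: "weight l \<le> w + d" if nz: "sym_pairing f (perp P (h_prod l)) \<noteq> 0" for l
  proof -
    have "(\<Sum>\<delta> | \<delta> \<subseteq># gam l. D_pairing P (K (gam l) \<delta>) * sym_coeff f \<delta>) \<noteq> 0"
      using nz sym_pairing_perp_h_prod[of f P "gam l"] by simp
    then obtain \<delta> where "\<delta> \<in> {\<delta>. \<delta> \<subseteq># gam l}" "D_pairing P (K (gam l) \<delta>) * sym_coeff f \<delta> \<noteq> 0"
      by (rule sum.not_neutral_contains_not_neutral)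
    then have \<delta>: "\<delta> \<subseteq># gam l" "D_pairing P (K (gam l) \<delta>) \<noteq> 0" "sym_coeff f \<delta> \<noteq> 0" by auto
    from \<delta>(2) obtain m where "zmul (Poly_Mapping.lookup (K (gam l) \<delta>) m) (D_coord m P) \<noteq> 0"
      unfolding D_pairing_eq Db.ext_def by (rule sum.not_neutral_contains_not_neutral)
    then have "\<exists>m. Poly_Mapping.lookup (K (gam l) \<delta>) m \<noteq> 0 \<and> D_coord m P \<noteq> 0" by auto
    then obtain m where m: "m \<in> Poly_Mapping.keys (K (gam l) \<delta>)" "weight m \<le> w"
      using w by (auto simp: in_keys_iff)
    then have "int (weight m) = int (weight l) - int (size \<delta>)"
      using K_grade[OF \<delta>(1)] by (simp add: Dlower_grade_def)
    then show ?thesis using m(2) d[OF \<delta>(3)] by linarith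
  qed
  obtain f' where f': "\<And>g. sym_pairing f' g = sym_pairing f (perp P g)"
    using ex_adjoint[OF additive_perp bounded] by blast
  have op: "(\<lambda>\<gamma>. of_int (sym_coeff f' \<gamma>)) = operator P (\<lambda>\<gamma>. of_int (sym_coeff f \<gamma>))"
  proof
    fix \<gamma>
    have "sym_coeff f' \<gamma> = sym_pairing f (perp P (h_prod (mtype \<gamma>)))"
      unfolding f'[symmetric] sym_pairing_h_prod sym_coeff_gam ..
    then show "of_int (sym_coeff f' \<gamma>) = operator P (\<lambda>\<gamma>. of_int (sym_coeff f \<gamma>)) \<gamma>"
      by (simp add: sym_pairing_perp_h_prod operator_eq)
  qed
  have "D_act P f = f'"
    unfolding D_act_def
  proof (rule the_equality, rule op)
    fix g assume "(\<lambda>\<gamma>. of_int (sym_coeff g \<gamma>)) = operator P (\<lambda>\<gamma>. of_int (sym_coeff f \<gamma>))"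
    then have "(\<lambda>\<gamma>. of_int (sym_coeff g \<gamma>) :: rat) = (\<lambda>\<gamma>. of_int (sym_coeff f' \<gamma>))" by (simp only: op)
    then show "g = f'" by (intro sym_eqI) (metis of_int_eq_iff)
  qed
  then show ?thesis using op f' by simp
qed

lemma D_act_adjoint: "sym_pairing (D_act P f) g = sym_pairing f (perp P g)"
  using D_act_adjoint_aux by blast

lemma D_perp_eq: "D_perp = perp"
proof (intro ext)
  fix P g
  show "D_perp P g = perp P g"
    unfolding D_perp_def D_act_adjoint
    by (rule the_equality) (auto intro: sym_pairing_eqI_right)
qed

lemma sym_pairing_contr: "sym_pairing f (contr P t) = tpair (D_pairing P) (sym_pairing f) t"
  by (rule additive_eqI_tensor[OF additive_comp[OF additive_pairing_right additive_contr]
        additive_tpair[OF additive_D_pairing_right additive_pairing_right]])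
    (simp add: contr_tens additive_zmul[OF additive_pairing_right] tpair_tens additive_D_pairing_right additive_pairing_right)

lemma sym_pairing_m_sym: "sym_pairing (m_sym l) g = Poly_Mapping.lookup (\<theta>' g) l"
  by (rule Sh.additive_eqI[OF additive_pairing_right Sh.additive_coord])
    (simp add: sym_pairing_h_prod Sm.coord_basis Db.coord_basis)

lemma D_coact_eq: "D_coact = \<rho>"
proof
  fix g
  have u: "tlift (\<lambda>b g'. D_pairing P b * sym_pairing f g') t = tpair (D_pairing P) (sym_pairing f) t" for P f t
    by (simp add: tpair_def)
  show "D_coact g = \<rho> g"
    unfolding D_coact_def u D_act_adjoint perp_def sym_pairing_contr
  proof (rule the_equality)
    fix t assume t: "\<forall>P f. tpair (D_pairing P) (sym_pairing f) t = tpair (D_pairing P) (sym_pairing f) (\<rho> g)"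
    show "t = \<rho> g"
    proof (rule free_on.coord_eqI[OF free_on_tensor[OF Db.free_on_axioms Sh.free_on_axioms]])
      fix i :: "partition \<times> partition"
      obtain l m where "i = (l, m)" by (cases i)
      then show "(case i of (i, j) \<Rightarrow> tlift (\<lambda>a b. Poly_Mapping.lookup a i * Poly_Mapping.lookup (\<theta>' b) j)) t =
          (case i of (i, j) \<Rightarrow> tlift (\<lambda>a b. Poly_Mapping.lookup a i * Poly_Mapping.lookup (\<theta>' b) j)) (\<rho> g)"
        \<comment> \<open>These two elements read off the coordinate at b_l \<otimes> h_m, so the
          defining property determines the tensor.\<close>
        using t[rule_format, of "D_basis l" "m_sym m"]
        by (simp add: tpair_def D_pairing_D_basis sym_pairing_m_sym)
    qed
  qed blast
qed

section \<open>Adjoints on Sym \<otimes> Sym and the left action\<close>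

definition spair2 :: "(sym, sym) tensor \<Rightarrow> (sym, sym) tensor \<Rightarrow> int" where
  "spair2 s t = tlift (\<lambda>f f'. tpair (sym_pairing f) (sym_pairing f') t) s"

lemma biadditive_spair: "biadditive (\<lambda>f f'. tpair (sym_pairing f) (sym_pairing f') t)"
  unfolding tpair_def by (intro additive_intros additive_pairing_right additive_pairing_left)

lemma additive_spair2_left: "additive (\<lambda>s. spair2 s t)"
  unfolding spair2_def by (rule additive_tlift[OF biadditive_spair])

lemma additive_spair2_right: "additive (spair2 s)"
  unfolding spair2_def[abs_def]
  by (intro additive_tlift_param biadditive_spair additive_tpair additive_pairing_right)

lemma spair2_tens: "spair2 (f \<otimes> f') t = tpair (sym_pairing f) (sym_pairing f') t"
  unfolding spair2_def by (rule tlift_tens[OF biadditive_spair])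

lemma spair2_tens_right: "spair2 s (g \<otimes> g') = tpair (\<lambda>f. sym_pairing f g) (\<lambda>f. sym_pairing f g') s"
  by (rule additive_eqI_tensor[OF additive_spair2_left additive_tpair[OF additive_pairing_left additive_pairing_left]])
    (simp add: spair2_tens tpair_tens additive_pairing_right additive_pairing_left)

lemma spair2_eqI:
  assumes "\<And>t. spair2 s t = spair2 s' t"
  shows "s = s'"
proof (rule free_on.coord_eqI[OF free_on_tensor[OF Sm.free_on_axioms Sm.free_on_axioms]])
  fix i :: "partition \<times> partition"
  obtain l m where "i = (l, m)" by (cases i)
  then show "(case i of (i, j) \<Rightarrow> tlift (\<lambda>a b. sym_coeff a (gam i) * sym_coeff b (gam j))) s =
      (case i of (i, j) \<Rightarrow> tlift (\<lambda>a b. sym_coeff a (gam i) * sym_coeff b (gam j))) s'"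
    using assms[of "h_prod l \<otimes> h_prod m"] by (simp add: spair2_tens_right tpair_def sym_pairing_h_prod)
qed

lemma sym_pairing_tlift_mult: "sym_pairing (tlift (*) s) g = spair2 s (sym_comult g)"
  by (rule additive_eqI_tensor[OF additive_comp[OF additive_pairing_left additive_tlift[OF biadditive_mult]] additive_spair2_left])
    (simp add: tlift_tens biadditive_mult spair2_tens sym_pairing_mult_left)

lemma sym_pairing_tlift_mult_right: "sym_pairing f (tlift (*) t) = spair2 (sym_comult f) t"
  by (rule additive_eqI_tensor[OF additive_comp[OF additive_pairing_right additive_tlift[OF biadditive_mult]] additive_spair2_right])
    (simp add: tlift_tens biadditive_mult spair2_tens_right sym_pairing_mult_right)

lemma spair2_tmap:
  assumes "additive A" "additive B" "additive A'" "additive B'"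
    and "\<And>f g. sym_pairing (A f) g = sym_pairing f (A' g)" "\<And>f g. sym_pairing (B f) g = sym_pairing f (B' g)"
  shows "spair2 (tmap A B s) t = spair2 s (tmap A' B' t)"
proof (rule additive_eqI_tensor[OF additive_comp[OF additive_spair2_left additive_tmap[OF assms(1,2)]] additive_spair2_left])
  fix f f'
  show "spair2 (tmap A B (f \<otimes> f')) t = spair2 (f \<otimes> f') (tmap A' B' t)"
    by (simp add: tmap_tens assms(1,2) spair2_tens tpair_tmap[OF additive_pairing_right additive_pairing_right assms(3,4)]
        flip: assms(5,6))
qed

lemma sym_pairing_one: "sym_pairing f 1 = sym_counit f"
proof -
  have "gam 0 = {#}" by (metis size_gam weight_0 size_eq_0_iff_empty)
  then show ?thesis
    using sym_pairing_h_prod[of f 0] by (simp add: h_prod_def sym_counit_def)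
qed

text \<open>The adjoint of the antipode is again an inverse of the identity under convolution.\<close>

lemma sym_S_adjoint: "sym_pairing (sym_S f) g = sym_pairing f (sym_S g)"
proof -
  note aS = rhom_additive[OF rhom_sym_S]
  have "\<exists>f'. \<forall>g. sym_pairing f' g = sym_pairing f (sym_S g)" for f
  proof -
    obtain d where d: "\<And>\<gamma>. sym_coeff f \<gamma> \<noteq> 0 \<Longrightarrow> size \<gamma> \<le> d" using sym_coeff_bounded by blast
    \<comment> \<open>The antipode preserves degrees, and f vanishes above degree d.\<close>
    have "weight l \<le> d" if nz: "sym_pairing f (sym_S (h_prod l)) \<noteq> 0" for l
    proof (rule ccontr)
      assume "\<not> weight l \<le> d"
      have "sym_pairing f (sym_S (h_prod l)) \<in> {0}"
      proof (rule additive_span_image[OF additive_pairing_right _ _ sym_S_homogeneous[OF h_prod_homogeneous, unfolded homogeneous_eq_h]])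
        show "zmod.subspace {0 :: int}" by (simp add: zmod.subspace_def)
        show "sym_pairing f x \<in> {0}" if "x \<in> {h_prod m |m. int (weight m) = int (weight l)}" for x
          using that \<open>\<not> weight l \<le> d\<close> by (auto simp: sym_pairing_h_prod) (metis d size_gam)
      qed
      with nz show False by simp
    qed
    then show ?thesis by (rule ex_adjoint[OF aS])
  qed
  then obtain S' where S': "\<And>f g. sym_pairing (S' f) g = sym_pairing f (sym_S g)" by metis
  have aS': "additive S'"
    by (rule additive.intro, rule sym_pairing_eqI)
      (simp add: S' additive_add[OF additive_pairing_left])
  have conv: "conv Sym_lower id sym_S = conv_unit Sym_lower" "conv Sym_lower sym_S id = conv_unit Sym_lower"
    using Sym_lower_hopf by (simp_all add: is_antipode_iff)
  have "conv Sym_lower S' id = conv_unit Sym_lower"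
  proof (rule ext, rule sym_pairing_eqI)
    fix f g
    have bi: "biadditive (\<lambda>a b. S' a * id b)" "biadditive (\<lambda>a b. sym_S a * id b)"
      by (intro additive_intros aS' aS additive_id)+
    have t1: "tlift (\<lambda>a b. S' a * id b) s = tlift (*) (tmap S' id s)" for s
      by (rule additive_eqI_tensor[OF additive_tlift[OF bi(1)] additive_comp[OF additive_tlift[OF biadditive_mult] additive_tmap[OF aS' additive_id]]])
        (simp only: tlift_tens[OF bi(1)] tmap_tens[OF aS' additive_id] tlift_tens[OF biadditive_mult])
    have t2: "tlift (\<lambda>a b. sym_S a * id b) s = tlift (*) (tmap sym_S id s)" for s
      by (rule additive_eqI_tensor[OF additive_tlift[OF bi(2)] additive_comp[OF additive_tlift[OF biadditive_mult] additive_tmap[OF aS additive_id]]])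
        (simp only: tlift_tens[OF bi(2)] tmap_tens[OF aS additive_id] tlift_tens[OF biadditive_mult])
    have adj: "sym_pairing (id f) g = sym_pairing f (id g)" for f g
      by simp
    \<comment> \<open>Multiplication and comultiplication change places under the pairing, so the
      convolution of S' with id is adjoint to that of \<open>sym_S\<close> with id.\<close>
    have "sym_pairing (conv Sym_lower S' id f) g = spair2 (tmap S' id (sym_comult f)) (sym_comult g)"
      unfolding conv_def Sym_lower_eq Sym_graded_simps t1 by (rule sym_pairing_tlift_mult)
    also have "\<dots> = spair2 (sym_comult f) (tmap sym_S id (sym_comult g))"
      by (rule spair2_tmap[OF aS' additive_id aS additive_id S' adj])
    also have "\<dots> = sym_pairing f (conv Sym_lower sym_S id g)"
      unfolding conv_def Sym_lower_eq Sym_graded_simps t2 by (rule sym_pairing_tlift_mult_right[symmetric])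
    also have "\<dots> = sym_pairing (conv_unit Sym_lower f) g"
      unfolding conv(2) using sym_pairing_one[of f] sym_pairing_one[of g]
      by (simp add: Sym_lower_eq additive_zmul[OF additive_pairing_right] additive_zmul[OF additive_pairing_left]
          sym_pairing_commute[of 1])
    finally show "sym_pairing (conv Sym_lower S' id f) g = sym_pairing (conv_unit Sym_lower f) g" .
  qed
  then have "S' = sym_S"
    by (rule conv_inverse_unique[OF Sym_lower_hopf(1) aS' additive_id aS _ conv(1)])
  then show ?thesis using S' by simp
qed

lemma additive_D_act: "additive (D_act P)"
  by (rule additive.intro, rule sym_pairing_eqI)
    (simp add: D_act_adjoint additive_add[OF additive_pairing_left])

lemma additive_D_act_left: "additive (\<lambda>P. D_act P f)"
  by (rule additive.intro, rule sym_pairing_eqI)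
    (simp add: D_act_adjoint additive_add[OF additive_pairing_left] additive_add[OF additive_pairing_right]
      additive_add[OF additive_perp_left])

lemma biadditive_tmap_act:
  assumes "\<And>P. additive (act P)" "\<And>f. additive (\<lambda>P. act P f)"
  shows "biadditive (\<lambda>P Q. tmap (act P) (act Q) t)"
  unfolding tmap_def by (intro additive_intros tens_left tens_right assms)

lemma spair2_act: "spair2 (tensor_act Dupper_hopf D_act D_act P s) t = spair2 s (tensor_act Dupper_hopf perp perp P t)"
proof -
  note b1 = biadditive_tmap_act[OF additive_D_act additive_D_act_left]
  note b2 = biadditive_tmap_act[OF additive_perp additive_perp_left]
  show ?thesis
    unfolding tensor_act_def Dupper_hopf_simps
    by (rule additive_eqI_tensor[OF additive_comp[OF additive_spair2_left additive_tlift[OF b1]]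
          additive_comp[OF additive_spair2_right additive_tlift[OF b2]]])
      (simp only: tlift_tens[OF b1] tlift_tens[OF b2]
        spair2_tmap[OF additive_D_act additive_D_act additive_perp additive_perp D_act_adjoint D_act_adjoint])
qed

lemma sym_pairing_homogeneous:
  assumes "f \<in> homogeneous i" "g \<in> homogeneous j" "i \<noteq> j"
  shows "sym_pairing f g = 0"
proof -
  have "sym_pairing f g \<in> {0}"
  proof (rule additive_span_image[OF additive_pairing_right _ _ assms(2)[unfolded homogeneous_eq_h]])
    show "zmod.subspace {0 :: int}" by (simp add: zmod.subspace_def)
    show "sym_pairing f x \<in> {0}" if "x \<in> {h_prod l |l. int (weight l) = j}" for x
      using that assms(1,3) by (auto simp: sym_pairing_h_prod homogeneous_def)
  qed
  then show ?thesis by simp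
qed

text \<open>By adjointness a nonzero coefficient at \<gamma> pairs f, of polynomial degree -j, with
  an element of degree i + |\<gamma>|; the two degrees must agree.\<close>

lemma D_act_grade:
  assumes "P \<in> Dupper_grade i" "f \<in> homogeneous (- j)"
  shows "D_act P f \<in> homogeneous (- (i + j))"
  unfolding homogeneous_def
proof (intro CollectI allI impI)
  fix \<gamma> assume "sym_coeff (D_act P f) \<gamma> \<noteq> 0"
  then have "sym_pairing f (perp P (h_prod (mtype \<gamma>))) \<noteq> 0"
    by (simp add: sym_pairing_h_prod sym_coeff_gam flip: D_act_adjoint)
  then have "- j = i + int (weight (mtype \<gamma>))"
    using sym_pairing_homogeneous[OF assms(2) perp_grade[OF assms(1) h_prod_homogeneous]] by blast
  then show "int (size \<gamma>) = - (i + j)" by (simp add: weight_mtype)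
qed

lemma module_hopf_perp: "right_module_hopf_algebra Dupper_hopf Sym_lower perp"
  unfolding right_module_hopf_algebra_def right_module_def module_hopf_maps_def module_algebra_maps_def
    module_map_def antipode_Sym
  using hopf_algebra_Dupper hopf_algebra_Sym biadditiveI[OF additive_perp additive_perp_left] perp_grade
    rhom_additive[OF rhom_sym_comult] rhom_additive[OF rhom_sym_S] additive_tlift[OF biadditive_mult[where 'a = sym]]
    additive_zmul_left[OF additive_ident, of "1 :: sym"]
  by (simp add: Sym_lower_eq perp_one perp_comp perp_mult perp_comult perp_S perp_unit trivial_act_def)

text \<open>Taking adjoints reverses the order of operators and exchanges multiplication with
  comultiplication and unit with counit, while the antipode is its own adjoint. Each axiom is thus
  the mirror image of a property of \<open>perp\<close>.\<close>

lemma module_hopf_D_act: "left_module_hopf_algebra Dupper_hopf Sym_upper D_act"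
proof -
  have one: "D_act (D_basis 0) f = f" for f
    by (rule sym_pairing_eqI) (simp add: D_act_adjoint perp_one)
  have comp: "D_act (Dupper_comp P Q) f = D_act P (D_act Q f)" for P Q f
    by (rule sym_pairing_eqI) (simp add: D_act_adjoint perp_comp)
  have mult: "tlift (*) (tensor_act Dupper_hopf D_act D_act P s) = D_act P (tlift (*) s)" for P s
    by (rule sym_pairing_eqI) (simp add: D_act_adjoint sym_pairing_tlift_mult spair2_act perp_comult)
  have comult: "sym_comult (D_act P f) = tensor_act Dupper_hopf D_act D_act P (sym_comult f)" for P f
    by (rule spair2_eqI) (simp add: sym_pairing_tlift_mult_right[symmetric] spair2_act D_act_adjoint perp_mult)
  have S: "sym_S (D_act P f) = D_act P (sym_S f)" for P f
    by (rule sym_pairing_eqI) (simp add: D_act_adjoint sym_S_adjoint perp_S)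
  have unit: "D_act P (zmul n 1) = zmul (Dupper_counit P * n) 1" for P n
  proof (rule sym_pairing_eqI)
    have 1: "sym_pairing 1 g = sym_counit g" for g using sym_pairing_one[of g] by (simp add: sym_pairing_commute)
    show "sym_pairing (D_act P (zmul n 1)) g = sym_pairing (zmul (Dupper_counit P * n) 1) g" for g
      by (simp add: D_act_adjoint additive_zmul[OF additive_pairing_left] 1 perp_counit)
  qed
  show ?thesis
    unfolding left_module_hopf_algebra_def left_module_def module_hopf_maps_def module_algebra_maps_def
      module_map_def antipode_Sym
    using hopf_algebra_Dupper hopf_algebra_Sym biadditiveI[OF additive_D_act additive_D_act_left] D_act_grade
      rhom_additive[OF rhom_sym_comult] rhom_additive[OF rhom_sym_S] additive_tlift[OF biadditive_mult[where 'a = sym]]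
      additive_zmul_left[OF additive_ident, of "1 :: sym"]
    by (simp add: Sym_upper_eq one comp mult comult S unit trivial_act_def)
qed

theorem theorem7:
  "left_module_hopf_algebra Dupper_hopf Sym_upper D_act \<and>
   right_module_hopf_algebra Dupper_hopf Sym_lower D_perp \<and>
   left_comodule_hopf_algebra Dlower_hopf Sym_lower D_coact"
  using module_hopf_D_act module_hopf_perp comodule_hopf_\<rho> by (simp add: D_perp_eq D_coact_eq)

end
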